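(* Let $\Omega\subset\mathbb{R}^N$ be a bounded open set with Lipschitz boundary. For each $(g,G)\in mSD=BV(\Omega;\mathbb{R}^d)\times\mathcal{M}(\Omega;\mathbb{R}^{d\times N})$ there exists a sequence $\{u_n\}\subset SBV(\Omega;\mathbb{R}^d)$ such that $$u_n\stackrel{*}{\rightharpoonup} g\ \text{ in } BV(\Omega;\mathbb{R}^d)\qquad\text{and}\qquad \nabla u_n\stackrel{*}{\rightharpoonup} G\ \text{ in }\mathcal{M}(\Omega;\mathbb{R}^{d\times N}).$$ In addition, $$\|Du_n\|_{\mathcal{M}(\Omega;\mathbb{R}^{d\times N})}\leq C_1\|(g,G)\|_{mSD}\qquad\text{and}\qquad \|u_n\|_{BV(\Omega;\mathbb{R}^d)}\leq C_2\|(g,G)\|_{mSD}$$ for constants $C_1=C_1(N)>0$ and $C_2=C_2(N,\Omega)>0$ independent of $\{u_n\}$ and $(g,G)$.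
   Context: $\mathcal{M}(\Omega;\mathbb{R}^{d\times N})$ is the space of finite $\mathbb{R}^{d\times N}$-valued Radon measures on $\Omega$, normed by the total variation $\|\mu\|_{\mathcal M}=|\mu|(\Omega)$; weak* convergence in it is in duality with $C_0(\Omega)$. For $u\in BV(\Omega;\mathbb{R}^d)$, $Du$ is the distributional derivative and $\nabla u$ denotes the density of the absolutely continuous part of $Du$ with respect to Lebesgue measure $\mathcal{L}^N$, identified with the measure $\nabla u\,\mathcal{L}^N$. Weak* convergence $u_n\stackrel{*}{\rightharpoonup}g$ in $BV$ means $u_n\to g$ in $L^1$ and $Du_n\stackrel{*}{\rightharpoonup}Dg$ in $\mathcal{M}$. The norm on the space $mSD$ of measure structured deformations is $\|(g,G)\|_{mSD}:=\|g\|_{BV(\Omega;\mathbb{R}^d)}+|G|(\Omega)$, where $|G|$ is the total variation measure of $G$. *)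

theory Defs
  imports "HOL-Analysis.Analysis"
begin

text \<open>
  The codomain dimension \<open>d\<close> is quantified inside the theorem (the constants must not
  depend on it), so it is a natural number: a vector of \<open>R^d\<close> is a function
  \<open>nat \<Rightarrow> real\<close>, and a \<open>d \<times> N\<close> matrix is a function \<open>nat \<Rightarrow> real ^ 'n\<close> giving its rows;
  only the indices \<open>i < d\<close> are ever inspected.
\<close>

abbreviation norm_vec :: "nat \<Rightarrow> (nat \<Rightarrow> real) \<Rightarrow> real" where
  "norm_vec d v \<equiv> L2_set v {..<d}"

text \<open>Frobenius norm.\<close>

abbreviation norm_mat :: "nat \<Rightarrow> (nat \<Rightarrow> real ^ 'n) \<Rightarrow> real" where
  "norm_mat d A \<equiv> L2_set (\<lambda>i. norm (A i)) {..<d}"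

subsection \<open>Domains\<close>

text \<open>
  Near each boundary point the set is the strict epigraph of a Lipschitz function over the
  hyperplane orthogonal to some unit vector \<open>e\<close>; the choice of \<open>e\<close> plays the role of
  the rotated coordinate system.
\<close>

definition lipschitz_boundary :: "(real ^ 'n) set \<Rightarrow> bool" where
  "lipschitz_boundary \<Omega> \<longleftrightarrow>
    (\<forall>x\<in>frontier \<Omega>. \<exists>r>0. \<exists>e \<gamma> L. norm e = 1 \<and>
       lipschitz_on L {v. v \<bullet> e = 0} (\<gamma> :: real ^ 'n \<Rightarrow> real) \<and>
       \<Omega> \<inter> ball x r = {y \<in> ball x r. \<gamma> (y - (y \<bullet> e) *\<^sub>R e) < y \<bullet> e})"

subsection \<open>Test functions\<close>

definition partial_deriv :: "'n \<Rightarrow> (real ^ 'n \<Rightarrow> real) \<Rightarrow> real ^ 'n \<Rightarrow> real" where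
  "partial_deriv j f x = frechet_derivative f (at x) (axis j 1)"

primrec C_k :: "nat \<Rightarrow> (real ^ 'n \<Rightarrow> real) \<Rightarrow> bool" where
  "C_k 0 f \<longleftrightarrow> continuous_on UNIV f"
| "C_k (Suc k) f \<longleftrightarrow> (\<forall>x. f differentiable (at x)) \<and> (\<forall>j. C_k k (partial_deriv j f))"

definition Cc_infinity :: "(real ^ 'n) set \<Rightarrow> (real ^ 'n \<Rightarrow> real) set" where
  "Cc_infinity \<Omega> =
    {\<phi>. (\<forall>k. C_k k \<phi>) \<and> (\<exists>K. compact K \<and> K \<subseteq> \<Omega> \<and> (\<forall>x. x \<notin> K \<longrightarrow> \<phi> x = 0))}"

definition C_0 :: "(real ^ 'n) set \<Rightarrow> (real ^ 'n \<Rightarrow> real) set" where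
  "C_0 \<Omega> =
    {\<phi>. continuous_on \<Omega> \<phi> \<and>
        (\<forall>\<epsilon>>0. \<exists>K. compact K \<and> K \<subseteq> \<Omega> \<and> (\<forall>x\<in>\<Omega> - K. \<bar>\<phi> x\<bar> < \<epsilon>))}"

subsection \<open>Finite signed and matrix-valued measures\<close>

text \<open>
  In this section \<open>M\<close> only supplies the underlying measurable space.  A vector-valued
  measure is a set function, of which only the values on \<open>sets M\<close> matter.
\<close>

definition vector_measure :: "'a measure \<Rightarrow> ('a set \<Rightarrow> 'b::real_normed_vector) \<Rightarrow> bool" where
  "vector_measure M \<mu> \<longleftrightarrow>
    (\<forall>A :: nat \<Rightarrow> 'a set. range A \<subseteq> sets M \<longrightarrow> disjoint_family A \<longrightarrow>
       (\<lambda>k. \<mu> (A k)) sums \<mu> (\<Union>k. A k))"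

definition total_variation ::
    "'a measure \<Rightarrow> nat \<Rightarrow> ('a set \<Rightarrow> nat \<Rightarrow> real ^ 'n) \<Rightarrow> 'a set \<Rightarrow> ennreal" where
  "total_variation M d \<mu> B =
    (SUP A \<in> {A :: nat \<Rightarrow> 'a set. range A \<subseteq> sets M \<and> disjoint_family A \<and> (\<Union>k. A k) = B}.
       \<Sum>k. ennreal (norm_mat d (\<mu> (A k))))"

text \<open>
  Jordan decomposition of a signed measure \<open>\<nu>\<close>.  As \<open>ennreal\<close> sends negative
  reals to \<open>0\<close>, the supremum is \<open>sup {\<nu> E | E \<subseteq> B}\<close>.
\<close>

definition pos_part :: "'a measure \<Rightarrow> ('a set \<Rightarrow> real) \<Rightarrow> 'a measure" where
  "pos_part M \<nu> =
    measure_of (space M) (sets M) (\<lambda>B. SUP E \<in> {E \<in> sets M. E \<subseteq> B}. ennreal (\<nu> E))"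

definition signed_integral :: "'a measure \<Rightarrow> ('a set \<Rightarrow> real) \<Rightarrow> ('a \<Rightarrow> real) \<Rightarrow> real" where
  "signed_integral M \<nu> f =
    (\<integral>x. f x \<partial>pos_part M \<nu>) - (\<integral>x. f x \<partial>pos_part M (\<lambda>B. - \<nu> B))"

subsection \<open>Matrix-valued Radon measures on an open set\<close>

abbreviation borel_on :: "(real ^ 'n) set \<Rightarrow> (real ^ 'n) measure" where
  "borel_on \<Omega> \<equiv> restrict_space borel \<Omega>"

text \<open>
  On an open subset of \<open>R^N\<close> every countably additive \<open>R^(d \<times> N)\<close>-valued Borel set
  function is a finite Radon measure.
\<close>

definition radon_measures ::
    "(real ^ 'n) set \<Rightarrow> nat \<Rightarrow> ((real ^ 'n) set \<Rightarrow> nat \<Rightarrow> real ^ 'n) set" where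
  "radon_measures \<Omega> d = {\<mu>. \<forall>i<d. vector_measure (borel_on \<Omega>) (\<lambda>B. \<mu> B i)}"

definition measure_norm ::
    "(real ^ 'n) set \<Rightarrow> nat \<Rightarrow> ((real ^ 'n) set \<Rightarrow> nat \<Rightarrow> real ^ 'n) \<Rightarrow> ennreal" where
  "measure_norm \<Omega> d \<mu> = total_variation (borel_on \<Omega>) d \<mu> \<Omega>"

definition weak_star_measures ::
    "(real ^ 'n) set \<Rightarrow> nat \<Rightarrow> (nat \<Rightarrow> (real ^ 'n) set \<Rightarrow> nat \<Rightarrow> real ^ 'n)
      \<Rightarrow> ((real ^ 'n) set \<Rightarrow> nat \<Rightarrow> real ^ 'n) \<Rightarrow> bool" where
  "weak_star_measures \<Omega> d \<mu>s \<mu> \<longleftrightarrow>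
    (\<forall>\<phi>\<in>C_0 \<Omega>. \<forall>i<d. \<forall>j.
       (\<lambda>n. signed_integral (borel_on \<Omega>) (\<lambda>B. \<mu>s n B i $ j) \<phi>)
         \<longlonglongrightarrow> signed_integral (borel_on \<Omega>) (\<lambda>B. \<mu> B i $ j) \<phi>)"

text \<open>The measure \<open>F L^N\<close>.\<close>

definition lebesgue_density ::
    "(real ^ 'n \<Rightarrow> nat \<Rightarrow> real ^ 'n) \<Rightarrow> (real ^ 'n) set \<Rightarrow> nat \<Rightarrow> real ^ 'n" where
  "lebesgue_density F B i = (LINT x:B|lebesgue. F x i)"

definition lebesgue_singular ::
    "(real ^ 'n) set \<Rightarrow> nat \<Rightarrow> ((real ^ 'n) set \<Rightarrow> nat \<Rightarrow> real ^ 'n) \<Rightarrow> bool" where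
  "lebesgue_singular \<Omega> d \<mu> \<longleftrightarrow>
    (\<exists>S \<in> sets (borel_on \<Omega>). S \<in> null_sets lebesgue \<and>
       total_variation (borel_on \<Omega>) d \<mu> (\<Omega> - S) = 0)"

subsection \<open>Functions of bounded variation\<close>

definition has_distr_deriv ::
    "(real ^ 'n) set \<Rightarrow> nat \<Rightarrow> (real ^ 'n \<Rightarrow> nat \<Rightarrow> real)
      \<Rightarrow> ((real ^ 'n) set \<Rightarrow> nat \<Rightarrow> real ^ 'n) \<Rightarrow> bool" where
  "has_distr_deriv \<Omega> d u \<mu> \<longleftrightarrow>
    \<mu> \<in> radon_measures \<Omega> d \<and>
    (\<forall>\<phi>\<in>Cc_infinity \<Omega>. \<forall>i<d. \<forall>j.
       (LINT x:\<Omega>|lebesgue. u x i * partial_deriv j \<phi> x)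
         = - signed_integral (borel_on \<Omega>) (\<lambda>B. \<mu> B i $ j) \<phi>)"

definition BV :: "(real ^ 'n) set \<Rightarrow> nat \<Rightarrow> (real ^ 'n \<Rightarrow> nat \<Rightarrow> real) set" where
  "BV \<Omega> d =
    {u. (\<forall>i<d. set_integrable lebesgue \<Omega> (\<lambda>x. u x i)) \<and> (\<exists>\<mu>. has_distr_deriv \<Omega> d u \<mu>)}"

text \<open>
  For \<open>u \<in> BV \<Omega> d\<close> the measure below is determined on Borel subsets of \<open>\<Omega>\<close> and the
  density that follows is determined almost everywhere, so the choices are immaterial.
\<close>

definition D :: "(real ^ 'n) set \<Rightarrow> nat \<Rightarrow> (real ^ 'n \<Rightarrow> nat \<Rightarrow> real)
    \<Rightarrow> (real ^ 'n) set \<Rightarrow> nat \<Rightarrow> real ^ 'n" where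
  "D \<Omega> d u = (SOME \<mu>. has_distr_deriv \<Omega> d u \<mu>)"

definition ac_grad :: "(real ^ 'n) set \<Rightarrow> nat \<Rightarrow> (real ^ 'n \<Rightarrow> nat \<Rightarrow> real)
    \<Rightarrow> real ^ 'n \<Rightarrow> nat \<Rightarrow> real ^ 'n" where
  "ac_grad \<Omega> d u =
    (SOME F. (\<forall>i<d. set_integrable lebesgue \<Omega> (\<lambda>x. F x i)) \<and>
       lebesgue_singular \<Omega> d (\<lambda>B i. D \<Omega> d u B i - lebesgue_density F B i))"

definition D_sing :: "(real ^ 'n) set \<Rightarrow> nat \<Rightarrow> (real ^ 'n \<Rightarrow> nat \<Rightarrow> real)
    \<Rightarrow> (real ^ 'n) set \<Rightarrow> nat \<Rightarrow> real ^ 'n" where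
  "D_sing \<Omega> d u B i = D \<Omega> d u B i - lebesgue_density (ac_grad \<Omega> d u) B i"

text \<open>
  The approximate discontinuity set \<open>S_u\<close>: the points of \<open>\<Omega>\<close> without approximate limit.
\<close>

definition approx_discont ::
    "(real ^ 'n) set \<Rightarrow> nat \<Rightarrow> (real ^ 'n \<Rightarrow> nat \<Rightarrow> real) \<Rightarrow> (real ^ 'n) set" where
  "approx_discont \<Omega> d u =
    {x \<in> \<Omega>. \<nexists>z. ((\<lambda>r. (LINT y:ball x r|lebesgue. norm_vec d (\<lambda>i. u y i - z i))
                        / measure lebesgue (ball x r)) \<longlongrightarrow> 0) (at_right 0)}"

text \<open>
  The Cantor part is the restriction of the singular part to \<open>\<Omega> - S_u\<close> (Ambrosio, Fusco
  and Pallara), where \<open>S_u\<close> is a Borel set.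
\<close>

definition D_cantor :: "(real ^ 'n) set \<Rightarrow> nat \<Rightarrow> (real ^ 'n \<Rightarrow> nat \<Rightarrow> real)
    \<Rightarrow> (real ^ 'n) set \<Rightarrow> nat \<Rightarrow> real ^ 'n" where
  "D_cantor \<Omega> d u B = D_sing \<Omega> d u (B - approx_discont \<Omega> d u)"

definition SBV :: "(real ^ 'n) set \<Rightarrow> nat \<Rightarrow> (real ^ 'n \<Rightarrow> nat \<Rightarrow> real) set" where
  "SBV \<Omega> d =
    {u \<in> BV \<Omega> d. \<forall>B \<in> sets (borel_on \<Omega>). \<forall>i<d. D_cantor \<Omega> d u B i = 0}"

definition L1_norm :: "(real ^ 'n) set \<Rightarrow> nat \<Rightarrow> (real ^ 'n \<Rightarrow> nat \<Rightarrow> real) \<Rightarrow> ennreal" where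
  "L1_norm \<Omega> d u = (\<integral>\<^sup>+x\<in>\<Omega>. ennreal (norm_vec d (u x)) \<partial>lebesgue)"

definition BV_norm :: "(real ^ 'n) set \<Rightarrow> nat \<Rightarrow> (real ^ 'n \<Rightarrow> nat \<Rightarrow> real) \<Rightarrow> ennreal" where
  "BV_norm \<Omega> d u = L1_norm \<Omega> d u + measure_norm \<Omega> d (D \<Omega> d u)"

definition weak_star_BV ::
    "(real ^ 'n) set \<Rightarrow> nat \<Rightarrow> (nat \<Rightarrow> real ^ 'n \<Rightarrow> nat \<Rightarrow> real)
      \<Rightarrow> (real ^ 'n \<Rightarrow> nat \<Rightarrow> real) \<Rightarrow> bool" where
  "weak_star_BV \<Omega> d us g \<longleftrightarrow>
    (\<lambda>n. L1_norm \<Omega> d (\<lambda>x i. us n x i - g x i)) \<longlonglongrightarrow> 0 \<and>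
    weak_star_measures \<Omega> d (\<lambda>n. D \<Omega> d (us n)) (D \<Omega> d g)"

subsection \<open>Measure structured deformations\<close>

definition mSD :: "(real ^ 'n) set \<Rightarrow> nat
    \<Rightarrow> ((real ^ 'n \<Rightarrow> nat \<Rightarrow> real) \<times> ((real ^ 'n) set \<Rightarrow> nat \<Rightarrow> real ^ 'n)) set" where
  "mSD \<Omega> d = BV \<Omega> d \<times> radon_measures \<Omega> d"

definition mSD_norm :: "(real ^ 'n) set \<Rightarrow> nat
    \<Rightarrow> (real ^ 'n \<Rightarrow> nat \<Rightarrow> real) \<times> ((real ^ 'n) set \<Rightarrow> nat \<Rightarrow> real ^ 'n) \<Rightarrow> ennreal" where
  "mSD_norm \<Omega> d = (\<lambda>(g, G). BV_norm \<Omega> d g + measure_norm \<Omega> d G)"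

end

theory Submission imports Defs begin

text \<open>
  Approximate \<open>g\<close> by functions \<open>v\<close> that are continuous inside \<open>\<Omega>\<close> and have integrable gradients
  \<open>V\<close> (Meyers and Serrin), and \<open>G\<close> by its mollification \<open>W\<close>.  Let \<open>F\<close> be a mollification of
  \<open>W - V\<close> and put \<open>u x = v x + (\<Sum>l. F l x * saw n (x $ l))\<close>, where \<open>saw n t = frac (n t) / n\<close>.
  As \<open>0 \<le> saw n \<le> 1 / n\<close>, the function \<open>u\<close> is close to \<open>v\<close>, but away from the hyperplanes
  \<open>x $ l \<in> \<int> / n\<close> its gradient is \<open>V + F + O(1 / n)\<close>, which is close to \<open>W\<close>.  The rest of \<open>Du\<close>
  sits on these hyperplanes, where \<open>u\<close> jumps by \<open>F l / n\<close>; it is the image of the density \<open>F l\<close>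
  under the projection along the axis \<open>l\<close> to the hyperplane below, so that its mass is a Riemann sum
  of the integral of \<open>\<bar>F l\<bar>\<close>.  That integral is at most the total variation of \<open>Dg\<close> plus that of
  \<open>G\<close>.  At the points of the hyperplanes where \<open>F\<close> vanishes \<open>u\<close> is continuous, whence there is no
  Cantor part.
\<close>

subsection \<open>Partial derivatives and smooth functions\<close>

text \<open>Membership in SBV is decided through the set of points without approximate limit, so
  that set has to be known exactly. This shapes the construction. \<open>v\<close> must be
  continuous at every point of the domain in order to add nothing to the set, whereas
  \<open>g\<close> may have a Cantor part of its own. \<open>F\<close> must be smooth, so that its
  values on the hyperplanes make sense and the jump at a point there can be read off. The order of
  the choices is forced: the derivatives of \<open>F\<close> are not controlled by (g, G), so n is
  fixed last, after \<open>F\<close>, and beats them by the factor 1 / n. The first constant may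
  depend on N only. Masses are therefore measured with Frobenius norms of whole matrices, or with
  norms of columns, one for each family of hyperplanes; sums over the d rows occur only in error
  terms, which the choice of the mollifiers and of n makes small. The error must also be a fixed
  fraction of the norm of (g, G), because the inequalities are demanded for every member of the
  sequence and not in the limit; when that norm is 0 the tolerance is 0, and the function u = 0
  takes over.\<close>

lemma partial_deriv_eq:
  "(f has_derivative f') (at x) \<Longrightarrow> partial_deriv j f x = f' (axis j 1)"
  unfolding partial_deriv_def using frechet_derivative_at by metis

lemma has_derivative_partial_deriv:
  fixes f :: "real ^ 'n \<Rightarrow> real"
  assumes "f differentiable (at x)"
  shows "(f has_derivative (\<lambda>h. \<Sum>j\<in>UNIV. h $ j * partial_deriv j f x)) (at x)"
proof -
  have d: "(f has_derivative frechet_derivative f (at x)) (at x)"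
    using assms frechet_derivative_works by blast
  then have lin: "linear (frechet_derivative f (at x))"
    by (rule has_derivative_linear)
  have "frechet_derivative f (at x) h = (\<Sum>j\<in>UNIV. h $ j * partial_deriv j f x)" for h
  proof -
    have "frechet_derivative f (at x) h
        = frechet_derivative f (at x) (\<Sum>j\<in>UNIV. (h $ j) *\<^sub>R axis j 1)"
      using basis_expansion[of h] by (simp add: scalar_mult_eq_scaleR)
    then show ?thesis
      by (simp add: linear_sum[OF lin] linear_cmul[OF lin] partial_deriv_def)
  qed
  then show ?thesis using d by presburger
qed

lemma partial_deriv_zero_open:
  fixes f :: "real ^ 'n \<Rightarrow> real"
  assumes "open S" "x \<in> S" "\<And>y. y \<in> S \<Longrightarrow> f y = c"
  shows "partial_deriv j f x = 0"
proof -
  have "(f has_derivative (\<lambda>h. 0)) (at x)"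
    by (rule has_derivative_transform_within_open[of "\<lambda>y. c"]) (use assms in auto)
  then show ?thesis by (rule partial_deriv_eq)
qed

text \<open>\<open>C_k (Suc k)\<close> asks for differentiability and for the partial derivatives to
  be \<open>C_k k\<close>, but not for continuity, so the inclusion has to be pushed down by
  induction until it reaches the continuity of differentiable functions.\<close>

lemma C_k_Suc_imp: "C_k (Suc k) f \<Longrightarrow> C_k k f"
proof (induction k arbitrary: f)
  case 0
  then show ?case
    by (auto intro!: differentiable_imp_continuous_on simp: differentiable_on_def
        differentiable_at_withinI)
next
  case (Suc k)
  then show ?case by (metis C_k.simps(2))
qed

lemma C_k_imp_continuous: "C_k k f \<Longrightarrow> continuous_on UNIV f"
  by (induction k arbitrary: f) (simp, metis C_k_Suc_imp)

lemma partial_deriv_const [simp]: "partial_deriv j (\<lambda>x. c) = (\<lambda>x. 0)"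
  by (rule ext, rule partial_deriv_eq[where f'="\<lambda>x. 0"]) auto

lemma C_k_const: "C_k k (\<lambda>x. c)"
  by (induction k arbitrary: c) auto

lemma partial_deriv_add:
  assumes "f differentiable (at x)" "g differentiable (at x)"
  shows "partial_deriv j (\<lambda>x. f x + g x) x = partial_deriv j f x + partial_deriv j g x"
  using partial_deriv_eq[OF has_derivative_add[OF assms[THEN frechet_derivative_works[THEN iffD1]]]]
  by (simp add: partial_deriv_def)

lemma partial_deriv_mult:
  fixes f g :: "real ^ 'n \<Rightarrow> real"
  assumes "f differentiable (at x)" "g differentiable (at x)"
  shows "partial_deriv j (\<lambda>x. f x * g x) x = f x * partial_deriv j g x + partial_deriv j f x * g x"
  using partial_deriv_eq[OF has_derivative_mult[OF assms[THEN frechet_derivative_works[THEN iffD1]]]]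
  by (simp add: partial_deriv_def)

lemma C_k_add: "C_k k f \<Longrightarrow> C_k k g \<Longrightarrow> C_k k (\<lambda>x. f x + g x)"
proof (induction k arbitrary: f g)
  case 0 then show ?case by (auto intro: continuous_intros)
next
  case (Suc k)
  have "partial_deriv j (\<lambda>x. f x + g x) = (\<lambda>x. partial_deriv j f x + partial_deriv j g x)" for j
    using Suc.prems by (auto simp: partial_deriv_add)
  then show ?case using Suc by auto
qed

lemma C_k_mult: "C_k k f \<Longrightarrow> C_k k g \<Longrightarrow> C_k k (\<lambda>x. f x * g x)"
proof (induction k arbitrary: f g)
  case 0 then show ?case by (auto intro: continuous_intros)
next
  case (Suc k)
  have "partial_deriv j (\<lambda>x. f x * g x)
      = (\<lambda>x. f x * partial_deriv j g x + partial_deriv j f x * g x)" for j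
    using Suc.prems by (auto simp: partial_deriv_mult)
  moreover have "C_k k f" "C_k k g" using Suc.prems by (metis C_k_Suc_imp)+
  ultimately show ?case using Suc by (auto intro!: C_k_add)
qed

lemma C_k_cmult: "C_k k f \<Longrightarrow> C_k k (\<lambda>x. c * f x)"
  by (intro C_k_mult C_k_const)

lemma C_k_diff: "C_k k f \<Longrightarrow> C_k k g \<Longrightarrow> C_k k (\<lambda>x. f x - g x)"
  using C_k_add[of k f "\<lambda>x. -1 * g x"] C_k_cmult[of k g "-1"] by simp

lemma partial_deriv_diff:
  fixes f g :: "real ^ 'n \<Rightarrow> real"
  assumes "f differentiable (at x)" "g differentiable (at x)"
  shows "partial_deriv j (\<lambda>x. f x - g x) x = partial_deriv j f x - partial_deriv j g x"
  using partial_deriv_eq[OF has_derivative_diff[OF assms[THEN frechet_derivative_works[THEN iffD1]]]]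
  by (simp add: partial_deriv_def)

text \<open>A mollifier enters a convolution as the function \<open>y\<close> to
  \<open>\<rho> (x - y)\<close>. The sign found here is what lets a weak derivative identity, tested
  with such a function, yield the gradient of a mollification.\<close>

lemma partial_deriv_reflect:
  fixes f :: "real ^ 'n \<Rightarrow> real"
  assumes "f differentiable (at (x - y))"
  shows "((\<lambda>y. f (x - y)) differentiable (at y))"
    and "partial_deriv j (\<lambda>y. f (x - y)) y = - partial_deriv j f (x - y)"
proof -
  let ?f' = "frechet_derivative f (at (x - y))"
  have d: "(f has_derivative ?f') (at (x - y))"
    using assms frechet_derivative_works by blast
  have "((\<lambda>y. f (x - y)) has_derivative (\<lambda>h. ?f' (- h))) (at y)"
    by (rule has_derivative_compose[of "\<lambda>y. x - y" "\<lambda>h. - h" y UNIV f ?f'])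
      (auto intro!: derivative_eq_intros d)
  then show "((\<lambda>y. f (x - y)) differentiable (at y))"
    and "partial_deriv j (\<lambda>y. f (x - y)) y = - partial_deriv j f (x - y)"
    using partial_deriv_eq[of "\<lambda>y. f (x - y)" "\<lambda>h. ?f' (- h)" y j]
      linear_neg[OF has_derivative_linear[OF d]]
    by (auto simp: differentiable_def partial_deriv_def)
qed

lemma C_k_reflect:
  fixes f :: "real ^ 'n \<Rightarrow> real"
  shows "C_k k f \<Longrightarrow> C_k k (\<lambda>y. f (x - y))"
proof (induction k arbitrary: f)
  case 0
  then have "continuous_on UNIV f" by simp
  then have "continuous_on UNIV (\<lambda>y. f (x - y))"
    by (rule continuous_on_compose2) (auto intro: continuous_intros)
  then show ?case by simp
next
  case (Suc k)
  have "partial_deriv j (\<lambda>y. f (x - y)) = (\<lambda>y. - 1 * partial_deriv j f (x - y))" for j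
    using Suc.prems partial_deriv_reflect(2)[of f x] by auto
  moreover have "\<forall>y. (\<lambda>y. f (x - y)) differentiable (at y)"
    using Suc.prems partial_deriv_reflect(1)[of f x] by auto
  moreover have "C_k k (\<lambda>y. - 1 * partial_deriv j f (x - y))" for j
    by (rule C_k_cmult, rule Suc.IH) (use Suc.prems in auto)
  ultimately show ?case by (metis C_k.simps(2))
qed

definition smooth :: "(real ^ 'n \<Rightarrow> real) \<Rightarrow> bool" where
  "smooth f \<longleftrightarrow> (\<forall>k. C_k k f)"

lemma smooth_partial_deriv: "smooth f \<Longrightarrow> smooth (partial_deriv j f)"
  unfolding smooth_def by (metis C_k.simps(2))

lemma smooth_differentiable: "smooth f \<Longrightarrow> f differentiable (at x)"
  unfolding smooth_def by (metis C_k.simps(2))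

lemma smooth_continuous: "smooth f \<Longrightarrow> continuous_on UNIV f"
  unfolding smooth_def using C_k_imp_continuous by blast

text \<open>Refers to the whole space and not to a domain. This is enough for integrability and
  uniform continuity, and it also covers the mollified coefficients \<open>F\<close>, whose supports
  may reach beyond \<Omega>.\<close>

definition bounded_support :: "('a::real_normed_vector \<Rightarrow> real) \<Rightarrow> bool" where
  "bounded_support f \<longleftrightarrow> (\<exists>R. \<forall>x. f x \<noteq> 0 \<longrightarrow> norm x \<le> R)"

lemma bounded_support_partial_deriv:
  fixes f :: "real ^ 'n \<Rightarrow> real"
  assumes "bounded_support f"
  shows "bounded_support (partial_deriv j f)"
proof -
  obtain R where R: "\<And>x. f x \<noteq> 0 \<Longrightarrow> norm x \<le> R" using assms bounded_support_def by blast
  have "partial_deriv j f x = 0" if "\<not> norm x \<le> R" for x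
    by (rule partial_deriv_zero_open[where S="- cball 0 R" and c=0])
      (use that R in \<open>auto simp: open_Compl\<close>)
  then show ?thesis unfolding bounded_support_def by blast
qed

lemma bounded_support_mult_left: "bounded_support f \<Longrightarrow> bounded_support (\<lambda>x. f x * g x)"
  and bounded_support_mult_right: "bounded_support g \<Longrightarrow> bounded_support (\<lambda>x. f x * g x)"
  unfolding bounded_support_def by fastforce+

lemma bounded_support_bounded:
  fixes f :: "'a::euclidean_space \<Rightarrow> real"
  assumes "continuous_on UNIV f" "bounded_support f"
  obtains B where "B > 0" "\<And>x. \<bar>f x\<bar> \<le> B"
proof -
  obtain R where R: "\<And>x. f x \<noteq> 0 \<Longrightarrow> norm x \<le> R" using assms bounded_support_def by blast
  have "bounded (f ` cball 0 R)"
    by (intro compact_imp_bounded compact_continuous_image continuous_on_subset[OF assms(1)]) auto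
  then obtain B where B: "B > 0" "\<And>x. norm x \<le> R \<Longrightarrow> \<bar>f x\<bar> \<le> B"
    unfolding bounded_pos by auto
  show ?thesis
    by (rule that[of B]) (use B R in \<open>force+\<close>)
qed

lemma bounded_support_uniformly_continuous:
  fixes f :: "'a::euclidean_space \<Rightarrow> real"
  assumes "continuous_on UNIV f" "bounded_support f" "e > 0"
  obtains d where "d > 0" "\<And>x y. norm (x - y) < d \<Longrightarrow> \<bar>f x - f y\<bar> < e"
proof -
  obtain R where R: "\<And>x. f x \<noteq> 0 \<Longrightarrow> norm x \<le> R" using assms bounded_support_def by blast
  have "uniformly_continuous_on (cball 0 (R + 1)) f"
    by (intro compact_uniformly_continuous continuous_on_subset[OF assms(1)]) auto
  then obtain d where d: "d > 0"
    "\<And>x y. x \<in> cball 0 (R + 1) \<Longrightarrow> y \<in> cball 0 (R + 1) \<Longrightarrow> dist y x < d \<Longrightarrow> dist (f y) (f x) < e"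
    unfolding uniformly_continuous_on_def using assms(3) by metis
  have "\<bar>f x - f y\<bar> < e" if "norm (x - y) < min d 1" for x y
  proof (cases "norm x \<le> R \<or> norm y \<le> R")
    case True
    then have "norm x \<le> R + 1" "norm y \<le> R + 1"
      using that norm_triangle_ineq2[of x y] norm_triangle_ineq3[of x y] by auto
    then show ?thesis using d(2)[of y x] that by (simp add: dist_norm)
  next
    case False
    then have "f x = 0" "f y = 0" using R by blast+
    then show ?thesis using assms(3) by simp
  qed
  then show ?thesis using d(1) that[of "min d 1"] by auto
qed

text \<open>The partial derivatives are uniformly continuous, so the mean value inequality along the
  segment from x to x + h has an error independent of x. This uniformity later permits
  differentiation under an integral with respect to an arbitrary measure, and limits of difference
  quotients against weights that are merely bounded.\<close>

lemma C1_uniform_differentiability: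
  fixes f :: "real ^ 'n \<Rightarrow> real"
  assumes f: "C_k (Suc 0) f" "bounded_support f" and e: "e > 0"
  obtains d where "d > 0" "\<And>x h. norm h < d \<Longrightarrow>
    \<bar>f (x + h) - f x - (\<Sum>j\<in>UNIV. h $ j * partial_deriv j f x)\<bar> \<le> e * norm h"
proof -
  let ?N = "real CARD('n)"
  \<comment> \<open>Each of the N partial derivatives receives an equal share of the
    tolerance.\<close>
  have e': "e / ?N > 0" using e by simp
  have "\<exists>d>0. \<forall>x y. norm (x - y) < d \<longrightarrow> \<bar>partial_deriv j f x - partial_deriv j f y\<bar> < e / ?N" for j
    by (rule bounded_support_uniformly_continuous[of "partial_deriv j f", OF _ _ e'])
      (use f bounded_support_partial_deriv in auto)
  then obtain d where d: "\<And>j. d j > 0"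
    "\<And>j x y. norm (x - y) < d j \<Longrightarrow> \<bar>partial_deriv j f x - partial_deriv j f y\<bar> < e / ?N"
    by metis
  define \<delta> where "\<delta> = Min (range d)"
  have \<delta>: "\<delta> > 0" "\<And>j. \<delta> \<le> d j" unfolding \<delta>_def using d(1) by auto
  have "\<bar>f (x + h) - f x - (\<Sum>j\<in>UNIV. h $ j * partial_deriv j f x)\<bar> \<le> e * norm h"
    if h: "norm h < \<delta>" for x h
  proof -
    let ?L = "\<lambda>y h. \<Sum>j\<in>UNIV. h $ j * partial_deriv j f y"
    have "norm (f (x + h) - f x - ?L x (x + h - x)) \<le> norm (x + h - x) * e"
    proof (rule differentiable_bound_linearization[where S="closed_segment x (x + h)"
            and f'="?L", unfolded fun_diff_def])
      show "x + t *\<^sub>R (x + h - x) \<in> closed_segment x (x + h)" if "t \<in> {0..1}" for t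
        using that by (auto simp: closed_segment_def algebra_simps intro!: exI[of _ t])
      show "(f has_derivative ?L y) (at y within closed_segment x (x + h))" for y
        by (rule has_derivative_at_withinI, rule has_derivative_partial_deriv) (use f(1) in auto)
      show "onorm (\<lambda>k. ?L y k - ?L x k) \<le> e" if y: "y \<in> closed_segment x (x + h)" for y
      proof (rule onorm_le)
        fix k
        have yx: "norm (y - x) < \<delta>"
          using segment_bound(1)[OF y] h by simp
        have "norm (?L y k - ?L x k)
            = \<bar>\<Sum>j\<in>UNIV. k $ j * (partial_deriv j f y - partial_deriv j f x)\<bar>"
          by (simp add: sum_subtractf algebra_simps)
        also have "\<dots> \<le> (\<Sum>j\<in>(UNIV::'n set). norm k * (e / ?N))"
        proof (rule order_trans[OF sum_abs], rule sum_mono)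
          fix j :: 'n
          have "\<bar>partial_deriv j f y - partial_deriv j f x\<bar> \<le> e / ?N"
            using d(2)[of y x j] less_le_trans[OF yx \<delta>(2)] by (simp add: less_imp_le)
          then show "\<bar>k $ j * (partial_deriv j f y - partial_deriv j f x)\<bar> \<le> norm k * (e / ?N)"
            unfolding abs_mult using component_le_norm_cart[of k j] by (intro mult_mono) auto
        qed
        also have "\<dots> = e * norm k" by simp
        finally show "norm (?L y k - ?L x k) \<le> e * norm k" .
      qed
    qed auto
    then show ?thesis by (simp add: mult.commute)
  qed
  then show ?thesis using that \<delta>(1) by blast
qed

subsection \<open>A smooth bump function\<close>

text \<open>The derivative is quantified existentially, unlike in \<open>C_k\<close>, so that an
  induction step may simply exhibit one, for instance another member of the family
  \<open>flat_exp\<close>.\<close>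

primrec C_real :: "nat \<Rightarrow> (real \<Rightarrow> real) \<Rightarrow> bool" where
  "C_real 0 f \<longleftrightarrow> continuous_on UNIV f"
| "C_real (Suc k) f \<longleftrightarrow> (\<exists>f'. (\<forall>x. (f has_real_derivative f' x) (at x)) \<and> C_real k f')"

lemma C_real_Suc_imp: "C_real (Suc k) f \<Longrightarrow> C_real k f"
proof (induction k arbitrary: f)
  case 0
  then show ?case
    by (auto intro: DERIV_continuous_on has_field_derivative_at_within)
next
  case (Suc k)
  then show ?case by (metis C_real.simps(2))
qed

lemma C_real_add: "C_real k f \<Longrightarrow> C_real k g \<Longrightarrow> C_real k (\<lambda>x. f x + g x)"
proof (induction k arbitrary: f g)
  case 0 then show ?case by (auto intro: continuous_intros)
next
  case (Suc k)
  then obtain f' g' where "\<And>x. (f has_real_derivative f' x) (at x)" "C_real k f'"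
    "\<And>x. (g has_real_derivative g' x) (at x)" "C_real k g'"
    by auto
  then show ?case using Suc.IH[of f' g']
    by (auto intro!: exI[of _ "\<lambda>x. f' x + g' x"] DERIV_add)
qed

lemma C_real_mult: "C_real k f \<Longrightarrow> C_real k g \<Longrightarrow> C_real k (\<lambda>x. f x * g x)"
proof (induction k arbitrary: f g)
  case 0 then show ?case by (auto intro: continuous_intros)
next
  case (Suc k)
  obtain f' g' where d: "\<And>x. (f has_real_derivative f' x) (at x)" "C_real k f'"
    "\<And>x. (g has_real_derivative g' x) (at x)" "C_real k g'"
    using Suc.prems by auto
  have "C_real k f" "C_real k g" using Suc.prems by (metis C_real_Suc_imp)+
  then have "C_real k (\<lambda>x. f' x * g x + f x * g' x)"
    using d Suc.IH by (intro C_real_add) auto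
  moreover have "((\<lambda>x. f x * g x) has_real_derivative f' x * g x + f x * g' x) (at x)" for x
    using DERIV_mult[OF d(1) d(3), of x] by (simp add: algebra_simps)
  ultimately show ?case by (auto intro!: exI[of _ "\<lambda>x. f' x * g x + f x * g' x"])
qed

lemma C_real_affine: "C_real k f \<Longrightarrow> C_real k (\<lambda>x. f (a + c * x))"
proof (induction k arbitrary: f)
  case 0
  then have "continuous_on UNIV f" by simp
  then have "continuous_on UNIV (\<lambda>x. f (a + c * x))"
    by (rule continuous_on_compose2) (auto intro: continuous_intros)
  then show ?case by simp
next
  case (Suc k)
  then obtain f' where d: "\<And>x. (f has_real_derivative f' x) (at x)" "C_real k f'" by auto
  have "((\<lambda>x. f (a + c * x)) has_real_derivative c * f' (a + c * x)) (at x)" for x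
  proof -
    have "((\<lambda>x. a + c * x) has_real_derivative c) (at x)"
      by (auto intro!: derivative_eq_intros)
    from DERIV_chain2[OF d(1) this] show ?thesis by (simp add: mult.commute)
  qed
  moreover have "C_real k (\<lambda>x. c)" by (induction k arbitrary: c) (auto intro!: exI[of _ "\<lambda>x. 0"])
  then have "C_real k (\<lambda>x. c * f' (a + c * x))" using Suc.IH d(2) by (intro C_real_mult) auto
  ultimately show ?case by (auto intro!: exI[of _ "\<lambda>x. c * f' (a + c * x)"])
qed

text \<open>The classical flat function \<open>exp (- 1 / t)\<close> with a polynomial in 1 / t in
  front of it. With this factor the family is closed under differentiation, which turns the proof of
  smoothness into an induction.\<close>

definition flat_exp :: "real poly \<Rightarrow> real \<Rightarrow> real" where
  "flat_exp p t = (if t \<le> 0 then 0 else poly p (1 / t) * exp (- (1 / t)))"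

lemma flat_exp_tendsto_0: "((\<lambda>t. poly p (1 / t) * exp (- (1 / t))) \<longlongrightarrow> 0) (at_right (0::real))"
proof -
  have "((\<lambda>s. \<Sum>i\<le>degree p. coeff p i * (s ^ i / exp s)) \<longlongrightarrow> 0) (at_top :: real filter)"
    by (rule tendsto_null_sum) (intro tendsto_mult_right_zero tendsto_power_div_exp_0)
  also have "(\<lambda>s. \<Sum>i\<le>degree p. coeff p i * (s ^ i / exp s)) = (\<lambda>s. poly p s * exp (- s))"
    by (auto simp: poly_altdef exp_minus field_simps sum_divide_distrib sum_distrib_right)
  finally show ?thesis
    by (subst (asm) filterlim_at_top_to_right) (simp add: inverse_eq_divide)
qed

text \<open>With s = 1 / t the derivative of s is minus its square, so differentiating p(s) exp(-s)
  produces the square of s times (p - p')(s) times exp(-s). The factor \<open>[:0, 0, 1:]\<close> is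
  that square.\<close>

lemma DERIV_flat_exp:
  "(flat_exp p has_real_derivative flat_exp ([:0, 0, 1:] * (p - pderiv p)) t) (at t)"
proof -
  consider "t < 0" | "t > 0" | "t = 0" by linarith
  then show ?thesis
  proof cases
    case 1
    have "(flat_exp p has_real_derivative 0) (at t)"
      by (rule has_field_derivative_transform_within_open[of "\<lambda>t. 0" 0 t "{..<0}"])
        (use 1 in \<open>auto simp: flat_exp_def\<close>)
    then show ?thesis using 1 by (simp add: flat_exp_def)
  next
    case 2
    have "((\<lambda>t. poly p (1 / t) * exp (- (1 / t))) has_real_derivative
        poly ([:0, 0, 1:] * (p - pderiv p)) (1 / t) * exp (- (1 / t))) (at t)"
      using 2 by (auto intro!: derivative_eq_intros DERIV_chain2[OF poly_DERIV]
          simp: field_simps power2_eq_square)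
    then have "(flat_exp p has_real_derivative
        poly ([:0, 0, 1:] * (p - pderiv p)) (1 / t) * exp (- (1 / t))) (at t)"
      by (rule has_field_derivative_transform_within_open[of _ _ t "{0<..}"])
        (use 2 in \<open>auto simp: flat_exp_def\<close>)
    then show ?thesis using 2 by (simp add: flat_exp_def)
  next
    case 3
    have "((\<lambda>h. (flat_exp p h - flat_exp p 0) / h) \<longlongrightarrow> 0) (at 0)"
    proof (subst filterlim_at_split, intro conjI)
      show "((\<lambda>h. (flat_exp p h - flat_exp p 0) / h) \<longlongrightarrow> 0) (at_left 0)"
        by (rule tendsto_eventually) (auto simp: flat_exp_def eventually_at_filter)
      \<comment> \<open>The quotient by h is a product of the same kind: the extra factor 1 / h is
        absorbed into the polynomial.\<close>
      have "((\<lambda>t. poly ([:0, 1:] * p) (1 / t) * exp (- (1 / t))) \<longlongrightarrow> 0) (at_right (0::real))"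
        by (rule flat_exp_tendsto_0)
      then show "((\<lambda>h. (flat_exp p h - flat_exp p 0) / h) \<longlongrightarrow> 0) (at_right 0)"
        by (rule tendsto_cong[THEN iffD1, rotated])
          (auto simp: flat_exp_def eventually_at_filter)
    qed
    then have "(flat_exp p has_real_derivative 0) (at 0)"
      by (simp add: DERIV_def)
    then show ?thesis using 3 by (simp add: flat_exp_def)
  qed
qed

lemma C_real_flat_exp: "C_real k (flat_exp p)"
proof (induction k arbitrary: p)
  case 0
  show ?case using DERIV_flat_exp[of p]
    by (auto intro: DERIV_continuous_on has_field_derivative_at_within)
next
  case (Suc k)
  then show ?case using DERIV_flat_exp by auto
qed

text \<open>Differentiating in direction j replaces the j-th factor by its derivative and leaves a
  product of the same shape. The induction therefore runs over all families of factors at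
  once.\<close>

lemma C_k_prod:
  fixes b :: "'n::finite \<Rightarrow> real \<Rightarrow> real"
  assumes "\<And>i. C_real k (b i)"
  shows "C_k k (\<lambda>x::real ^ 'n. \<Prod>i\<in>UNIV. b i (x $ i))"
  using assms
proof (induction k arbitrary: b)
  case 0
  have "continuous_on UNIV (\<lambda>x::real ^ 'n. b i (x $ i))" for i
    by (rule continuous_on_compose2[of UNIV "b i"]) (use 0 in \<open>auto intro: continuous_intros\<close>)
  then show ?case by (simp add: continuous_on_prod)
next
  case (Suc k)
  then have "\<forall>i. \<exists>f'. (\<forall>x. (b i has_real_derivative f' x) (at x)) \<and> C_real k f'" by simp
  from choice[OF this] obtain b' where
    b': "\<And>i x. (b i has_real_derivative b' i x) (at x)" "\<And>i. C_real k (b' i)" by blast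
  let ?f = "\<lambda>x::real ^ 'n. \<Prod>i\<in>UNIV. b i (x $ i)"
  have comp: "((\<lambda>x. b i (x $ i)) has_derivative (\<lambda>y. b' i (x $ i) * y $ i)) (at x)" for i and x :: "real ^ 'n"
    by (rule has_derivative_compose[of "\<lambda>x. x $ i" "\<lambda>y. y $ i" x UNIV "b i"])
      (use b'(1) in \<open>auto simp: has_field_derivative_def
        intro!: bounded_linear_imp_has_derivative bounded_linear_vec_nth\<close>)
  have der: "(?f has_derivative
      (\<lambda>y. \<Sum>i\<in>UNIV. b' i (x $ i) * y $ i * (\<Prod>j\<in>UNIV - {i}. b j (x $ j)))) (at x)" for x
    by (rule has_derivative_prod) (use comp in auto)
  have pd: "partial_deriv j ?f = (\<lambda>x. \<Prod>i\<in>UNIV. (if i = j then b' i else b i) (x $ i))" for j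
  proof
    fix x
    have "partial_deriv j ?f x
        = (\<Sum>i\<in>UNIV. b' i (x $ i) * axis j 1 $ i * (\<Prod>j\<in>UNIV - {i}. b j (x $ j)))"
      by (rule partial_deriv_eq[OF der])
    also have "\<dots> = (\<Sum>i\<in>UNIV. if i = j then b' i (x $ i) * (\<Prod>j\<in>UNIV - {i}. b j (x $ j)) else 0)"
      by (intro sum.cong) (auto simp: axis_def)
    also have "\<dots> = b' j (x $ j) * (\<Prod>i\<in>UNIV - {j}. b i (x $ i))"
      by simp
    also have "\<dots> = (\<Prod>i\<in>UNIV. (if i = j then b' i else b i) (x $ i))"
      by (subst prod.remove[of UNIV j]) (auto intro!: prod.cong)
    finally show "partial_deriv j ?f x = \<dots>" .
  qed
  have "C_k k (partial_deriv j ?f)" for j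
    unfolding pd by (rule Suc.IH) (use Suc.prems b'(2) C_real_Suc_imp in auto)
  moreover have "\<forall>x. ?f differentiable (at x)" using der differentiable_def by blast
  ultimately show ?case by simp
qed

section \<open>Mollifiers\<close>

definition is_mollifier :: "real \<Rightarrow> (real ^ 'n \<Rightarrow> real) \<Rightarrow> bool" where
  "is_mollifier r \<rho> \<longleftrightarrow> smooth \<rho> \<and> (\<forall>x. \<rho> x \<ge> 0) \<and> (\<forall>x. r < norm x \<longrightarrow> \<rho> x = 0) \<and>
     has_bochner_integral lborel \<rho> 1"

lemma integrable_bounded_support:
  fixes f :: "'a::euclidean_space \<Rightarrow> real"
  assumes "continuous_on UNIV f" "bounded_support f"
  shows "integrable lborel f"
proof -
  obtain R where R: "\<And>x. f x \<noteq> 0 \<Longrightarrow> norm x \<le> R" using assms bounded_support_def by blast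
  have "set_integrable lborel (cball 0 R) f"
    unfolding set_integrable_def using assms(1)
    by (intro borel_integrable_compact) (auto intro: continuous_on_subset)
  moreover have "(\<lambda>x. indicator (cball 0 R) x *\<^sub>R f x) = f"
    using R by (force simp: indicator_def)
  ultimately show ?thesis unfolding set_integrable_def by simp
qed

lemma mollifier_exists:
  assumes "r > 0"
  shows "\<exists>\<rho> :: real ^ 'n \<Rightarrow> real. is_mollifier r \<rho>"
proof -
  \<comment> \<open>The Euclidean norm is at most the sum of the absolute coordinates, so the cube
    of half-width r / N lies in the ball of radius r.\<close>
  define \<delta> where "\<delta> = r / real CARD('n)"
  have \<delta>: "\<delta> > 0" using assms by (simp add: \<delta>_def)
  define b where "b t = flat_exp 1 (\<delta> - t) * flat_exp 1 (\<delta> + t)" for t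
  define f where "f = (\<lambda>x::real ^ 'n. \<Prod>i\<in>UNIV. b (x $ i))"
  have "C_real k b" for k
    unfolding b_def using C_real_mult C_real_affine[OF C_real_flat_exp, of k 1 \<delta> "-1"]
      C_real_affine[OF C_real_flat_exp, of k 1 \<delta> "1"] by simp
  then have sm: "smooth f" unfolding smooth_def f_def by (intro allI C_k_prod)
  have b0: "b t \<ge> 0" for t by (auto simp: b_def flat_exp_def)
  have b1: "b t = 0" if "\<bar>t\<bar> \<ge> \<delta>" for t using that by (auto simp: b_def flat_exp_def)
  have f0: "f x \<ge> 0" for x unfolding f_def by (intro prod_nonneg) (auto simp: b0)
  have f1: "f x = 0" if "r < norm x" for x
  proof -
    have "\<exists>i. \<bar>x $ i\<bar> \<ge> \<delta>"
    proof (rule ccontr)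
      assume "\<not> ?thesis"
      then have "(\<Sum>i\<in>UNIV. \<bar>x $ i\<bar>) \<le> (\<Sum>i\<in>(UNIV::'n set). \<delta>)" by (intro sum_mono) (auto simp: not_le less_imp_le)
      also have "\<dots> = r" by (simp add: \<delta>_def)
      finally show False using norm_le_l1_cart[of x] that by simp
    qed
    then show ?thesis unfolding f_def using b1 by (metis UNIV_I finite prod_zero)
  qed
  have bs: "bounded_support f" unfolding bounded_support_def using f1 by (meson not_le)
  have int: "integrable lborel f" by (rule integrable_bounded_support[OF smooth_continuous[OF sm] bs])
  have pos: "f 0 > 0" unfolding f_def using \<delta> by (intro prod_pos) (auto simp: b_def flat_exp_def)
  \<comment> \<open>A vanishing integral would make the open set where f is positive negligible,
    although it contains 0.\<close>
  have "integral\<^sup>L lborel f \<noteq> 0"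
  proof
    assume "integral\<^sup>L lborel f = 0"
    then have "AE x in lborel. f x = 0" using integral_nonneg_eq_0_iff_AE[OF int] f0 by simp
    then have ae: "AE x in lborel. x \<notin> {x. f x > 0}" by eventually_elim auto
    have op: "open {x. f x > 0}"
      using smooth_continuous[OF sm] open_Collect_less[of "\<lambda>x. 0" f] by (auto intro: continuous_intros)
    then have "{x. f x > 0} \<in> null_sets lborel"
      using ae by (subst AE_iff_null_sets) auto
    then have "negligible {x. f x > 0}"
      using negligible_iff_null_sets null_sets_completionI by blast
    then show False using open_not_negligible[OF op] pos by auto
  qed
  then have Ipos: "integral\<^sup>L lborel f > 0"
    using integral_nonneg_AE[of f lborel] f0 by (simp add: less_le)
  let ?c = "inverse (integral\<^sup>L lborel f)"
  have "is_mollifier r (\<lambda>x. ?c * f x)"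
    unfolding is_mollifier_def
  proof (intro conjI allI impI)
    show "smooth (\<lambda>x. ?c * f x)" using sm C_k_cmult unfolding smooth_def by blast
    show "has_bochner_integral lborel (\<lambda>x. ?c * f x) 1"
      using int Ipos by (simp add: has_bochner_integral_iff)
  qed (use f0 f1 Ipos in auto)
  then show ?thesis by blast
qed

definition mollifier :: "nat \<Rightarrow> real ^ 'n \<Rightarrow> real" where
  "mollifier m = (SOME \<rho>. is_mollifier (1 / real (Suc m)) \<rho>)"

lemma mollifier: "is_mollifier (1 / real (Suc m)) (mollifier m :: real ^ 'n \<Rightarrow> real)"
  unfolding mollifier_def
  using someI_ex[OF mollifier_exists[of "1 / real (Suc m)"]] by simp

subsection \<open>The Hahn decomposition of a signed measure\<close>

lemma vector_measure_empty:
  assumes "vector_measure M \<nu>" shows "\<nu> {} = 0"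
proof -
  have "(\<lambda>k::nat. \<nu> {}) sums \<nu> (\<Union>k::nat. {})"
    using assms unfolding vector_measure_def by (auto simp: disjoint_family_on_def dest!: spec[of _ "\<lambda>k. {}"])
  then show ?thesis using sums_summable summable_const_iff by blast
qed

lemma vector_measure_sums:
  "vector_measure M \<nu> \<Longrightarrow> (\<And>k. A k \<in> sets M) \<Longrightarrow> disjoint_family A \<Longrightarrow>
    (\<lambda>k. \<nu> (A k)) sums \<nu> (\<Union>k. A k)"
  unfolding vector_measure_def by blast

lemma vector_measure_Un:
  assumes v: "vector_measure M \<nu>" and A: "A \<in> sets M" "B \<in> sets M" "A \<inter> B = {}"
  shows "\<nu> (A \<union> B) = \<nu> A + \<nu> B"
proof -
  have "(\<lambda>k. \<nu> (binaryset A B k)) sums \<nu> (\<Union>k. binaryset A B k)"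
    using A by (intro vector_measure_sums[OF v]) (auto simp: disjoint_family_on_def binaryset_def)
  moreover have "(\<lambda>k. \<nu> (binaryset A B k)) sums (\<nu> A + \<nu> B)"
    by (rule binaryset_sums[of \<nu>, OF vector_measure_empty[OF v]])
  ultimately show ?thesis by (simp add: UN_binaryset_eq sums_iff)
qed

lemma vector_measure_Diff:
  assumes v: "vector_measure M \<nu>" and A: "A \<in> sets M" "B \<in> sets M" "B \<subseteq> A"
  shows "\<nu> (A - B) = \<nu> A - \<nu> B"
  using vector_measure_Un[OF v, of B "A - B"] A by (simp add: Un_absorb1)

lemma vector_measure_split:
  assumes v: "vector_measure M \<nu>" and A: "A \<in> sets M" "Y \<in> sets M"
  shows "\<nu> A = \<nu> (A \<inter> Y) + \<nu> (A - Y)"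
  using vector_measure_Un[OF v, of "A \<inter> Y" "A - Y"] A
  by (metis Diff_disjoint Int_Diff Int_Diff_Un inf_le2 Int_Diff_disjoint sets.Diff sets.Int)

lemma vector_measure_uminus:
  "vector_measure M \<nu> \<Longrightarrow> vector_measure M (\<lambda>B. - \<nu> B)"
  unfolding vector_measure_def using sums_minus by blast

text \<open>Removing repeatedly a subset of nearly minimal measure leaves a positive set.\<close>

lemma positive_subset:
  fixes \<nu> :: "'a set \<Rightarrow> real"
  assumes v: "vector_measure M \<nu>" and A: "A \<in> sets M"
  shows "\<exists>P\<in>sets M. P \<subseteq> A \<and> (\<forall>E\<in>sets M. E \<subseteq> P \<longrightarrow> \<nu> E \<ge> 0) \<and> \<nu> P \<ge> \<nu> A"
proof -
  \<comment> \<open>Nothing is known yet about lower bounds of \<nu>. Truncating by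
    \<open>min 1\<close> keeps the supremum finite, and E realises at least half of it, whence the
    factor 2.\<close>
  have step: "\<exists>E\<in>sets M. E \<subseteq> B \<and> \<nu> E \<le> 0 \<and> (\<forall>F\<in>sets M. F \<subseteq> B \<longrightarrow> min 1 (- \<nu> F) \<le> - 2 * \<nu> E)"
    if "B \<in> sets M" for B
  proof -
    let ?S = "(\<lambda>F. min 1 (- \<nu> F)) ` {F \<in> sets M. F \<subseteq> B}"
    have bdd: "bdd_above ?S" by (auto intro: bdd_aboveI[of _ 1])
    have empty: "{} \<in> {F \<in> sets M. F \<subseteq> B}" by auto
    have s0: "Sup ?S \<ge> 0"
      using cSUP_upper[OF empty bdd] vector_measure_empty[OF v] by simp
    have up: "min 1 (- \<nu> F) \<le> Sup ?S" if "F \<in> sets M" "F \<subseteq> B" for F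
      using that by (intro cSUP_upper[OF _ bdd]) auto
    show ?thesis
    proof (cases "Sup ?S = 0")
      case True
      then show ?thesis using up vector_measure_empty[OF v] by (intro bexI[of _ "{}"]) auto
    next
      case False
      then have "Sup ?S / 2 < Sup ?S" using s0 by auto
      then obtain E where E: "E \<in> sets M" "E \<subseteq> B" "Sup ?S / 2 < min 1 (- \<nu> E)"
        using less_cSUP_iff[OF _ bdd, of "Sup ?S / 2"] empty by auto
      show ?thesis
        using E s0 up by (intro bexI[of _ E]) fastforce+
    qed
  qed
  then obtain e where e: "\<And>B. B \<in> sets M \<Longrightarrow> e B \<in> sets M \<and> e B \<subseteq> B \<and> \<nu> (e B) \<le> 0"
      "\<And>B F. B \<in> sets M \<Longrightarrow> F \<in> sets M \<Longrightarrow> F \<subseteq> B \<Longrightarrow> min 1 (- \<nu> F) \<le> - 2 * \<nu> (e B)"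
    by metis
  define B where "B = rec_nat A (\<lambda>_ B. B - e B)"
  have B: "B 0 = A" "\<And>n. B (Suc n) = B n - e (B n)" by (simp_all add: B_def)
  have Bs: "B n \<in> sets M" for n by (induction n) (use A e B in auto)
  have dec: "m \<le> n \<Longrightarrow> B n \<subseteq> B m" for m n
    using lift_Suc_antimono_le[of B m n] B(2) by blast
  have eB: "e (B n) \<in> sets M" "e (B n) \<subseteq> B n" "\<nu> (e (B n)) \<le> 0" for n using e(1)[OF Bs] by auto
  have disj: "e (B m) \<inter> e (B n) = {}" if "m < n" for m n
    using dec[of "Suc m" n] that eB(2)[of n] B(2)[of m] by auto
  have disj': "disjoint_family (\<lambda>n. e (B n))"
    unfolding disjoint_family_on_def using disj by (metis inf_commute linorder_neqE_nat)
  define P where "P = (\<Inter>n. B n)"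
  have P: "P \<in> sets M" "P \<subseteq> A" unfolding P_def using Bs B(1) by auto
  have "x \<in> (\<Union>n. e (B n))" if "x \<in> A" "x \<notin> B n" for x n
    using that by (induction n) (use B in auto)
  moreover have "e (B n) \<subseteq> A - P" for n
    using eB(2)[of n] dec[of 0 n] B P_def by blast
  ultimately have AP: "A - P = (\<Union>n. e (B n))" unfolding P_def by blast
  have sums: "(\<lambda>n. \<nu> (e (B n))) sums \<nu> (A - P)"
    unfolding AP by (intro vector_measure_sums[OF v]) (use eB disj' in auto)
  \<comment> \<open>The removed pieces are disjoint, so their measures are summable and tend to 0. A
    subset of \<open>P\<close> was available for removal at every stage and hence cannot have
    negative measure.\<close>
  have lim: "(\<lambda>n. - 2 * \<nu> (e (B n))) \<longlonglongrightarrow> - 2 * 0"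
    using sums sums_summable summable_LIMSEQ_zero by (intro tendsto_intros) blast
  have "\<nu> F \<ge> 0" if F: "F \<in> sets M" "F \<subseteq> P" for F
  proof -
    have "min 1 (- \<nu> F) \<le> - 2 * 0"
    proof (rule LIMSEQ_le_const[OF lim], intro exI allI impI)
      fix n :: nat
      show "min 1 (- \<nu> F) \<le> - 2 * \<nu> (e (B n))" by (rule e(2)[OF Bs F(1)]) (use F(2) P_def in auto)
    qed
    then show ?thesis by auto
  qed
  moreover have "\<nu> (A - P) \<le> 0"
    using sums_le[OF _ sums sums_zero] eB(3) by blast
  then have "\<nu> P \<ge> \<nu> A" using vector_measure_Diff[OF v A P] by simp
  ultimately show ?thesis using P by blast
qed

text \<open>Positive sets are closed under countable unions, so sets of nearly maximal measure unite
  to a positive set \<open>Y\<close> of maximal measure. A set of positive measure disjoint from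
  \<open>Y\<close> would contain a positive set by \<open>positive_subset\<close>, and adding that
  to \<open>Y\<close> would exceed the maximum.\<close>

lemma Hahn_decomposition:
  fixes \<nu> :: "'a set \<Rightarrow> real"
  assumes v: "vector_measure M \<nu>"
  obtains Y where "Y \<in> sets M" "\<And>E. E \<in> sets M \<Longrightarrow> E \<subseteq> Y \<Longrightarrow> \<nu> E \<ge> 0"
    "\<And>E. E \<in> sets M \<Longrightarrow> E \<inter> Y = {} \<Longrightarrow> \<nu> E \<le> 0"
proof -
  define pos where "pos P \<longleftrightarrow> P \<in> sets M \<and> (\<forall>E\<in>sets M. E \<subseteq> P \<longrightarrow> \<nu> E \<ge> 0)" for P
  have pos1: "pos P \<Longrightarrow> P \<in> sets M" and pos2: "pos P \<Longrightarrow> E \<in> sets M \<Longrightarrow> E \<subseteq> P \<Longrightarrow> \<nu> E \<ge> 0" for P E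
    by (auto simp: pos_def)
  have pos_UN: "pos (\<Union>n. P n)" if P: "\<And>n::nat. pos (P n)" for P
    unfolding pos_def
  proof (intro conjI ballI impI)
    have Ps: "range P \<subseteq> sets M" using pos1[OF P] by auto
    then show "(\<Union>n. P n) \<in> sets M" by blast
    fix E assume E: "E \<in> sets M" "E \<subseteq> (\<Union>n. P n)"
    have ds: "range (disjointed P) \<subseteq> sets M" by (rule sets.range_disjointed_sets[OF Ps])
    have "(\<lambda>n. \<nu> (E \<inter> disjointed P n)) sums \<nu> (\<Union>n. E \<inter> disjointed P n)"
      using disjoint_family_disjointed[of P] ds E
      by (intro vector_measure_sums[OF v]) (auto simp: disjoint_family_on_def)
    moreover have "(\<Union>n. E \<inter> disjointed P n) = E"
      using E(2) UN_disjointed_eq[of P] by (simp add: Int_absorb2 flip: Int_UN_distrib)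
    moreover have pn: "\<nu> (E \<inter> disjointed P n) \<ge> 0" for n
      by (rule pos2[OF P[of n]]) (use disjointed_subset[of P n] E(1) ds in auto)
    ultimately show "\<nu> E \<ge> 0" using sums_le[OF pn sums_zero] by auto
  qed
  have pos_mono: "\<nu> P \<le> \<nu> Q" if "pos P" "pos Q" "P \<subseteq> Q" for P Q
    using vector_measure_Diff[OF v, of Q P] pos2[OF that(2), of "Q - P"] pos1 that by auto
  have pos_empty: "pos {}" using vector_measure_empty[OF v] by (simp add: pos_def)
  \<comment> \<open>A real-valued \<nu> cannot be unbounded on positive sets: a sequence of them has
    a positive union, whose finite measure dominates every term.\<close>
  have bdd: "bdd_above (\<nu> ` {P. pos P})"
  proof (rule ccontr)
    assume "\<not> ?thesis"
    then have "\<forall>n::nat. \<exists>P. pos P \<and> \<nu> P > real n" unfolding bdd_above_def by (force simp: not_le)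
    then obtain P where P: "\<And>n::nat. pos (P n)" "\<And>n. \<nu> (P n) > real n" by metis
    obtain n where "real n > \<nu> (\<Union>n. P n)" using reals_Archimedean2 by blast
    moreover have "\<nu> (P n) \<le> \<nu> (\<Union>n. P n)" by (rule pos_mono[OF P(1) pos_UN[OF P(1)]]) auto
    ultimately show False using P(2)[of n] by simp
  qed
  define s where "s = Sup (\<nu> ` {P. pos P})"
  have "\<exists>P. pos P \<and> \<nu> P > s - 1 / real (Suc n)" for n
    using less_cSUP_iff[OF _ bdd, of "s - 1 / real (Suc n)"] pos_empty unfolding s_def by auto
  then obtain P where P: "\<And>n. pos (P n)" "\<And>n. \<nu> (P n) > s - 1 / real (Suc n)" by metis
  define Y where "Y = (\<Union>n. P n)"
  have Y: "pos Y" unfolding Y_def by (rule pos_UN[OF P(1)])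
  have "s \<le> \<nu> Y"
  proof (rule LIMSEQ_le_const2)
    show "(\<lambda>n. s - 1 / real (Suc n)) \<longlonglongrightarrow> s" using tendsto_diff[OF tendsto_const LIMSEQ_Suc[OF lim_1_over_n]] by simp
    have "\<nu> (P n) \<le> \<nu> Y" for n by (rule pos_mono[OF P(1) Y]) (auto simp: Y_def)
    then have "s - 1 / real (Suc n) \<le> \<nu> Y" for n
      using P(2)[of n] by (meson less_le_trans less_imp_le)
    then show "\<exists>N. \<forall>n\<ge>N. s - 1 / real (Suc n) \<le> \<nu> Y" by blast
  qed
  show thesis
  proof (rule that)
    show "Y \<in> sets M" "\<And>E. E \<in> sets M \<Longrightarrow> E \<subseteq> Y \<Longrightarrow> \<nu> E \<ge> 0" using pos1[OF Y] pos2[OF Y] by auto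
    fix E assume E: "E \<in> sets M" "E \<inter> Y = {}"
    show "\<nu> E \<le> 0"
    proof (rule ccontr)
      assume n: "\<not> \<nu> E \<le> 0"
      obtain Q where Q: "Q \<subseteq> E" "pos Q" "\<nu> Q \<ge> \<nu> E"
        using positive_subset[OF v E(1)] unfolding pos_def by blast
      have "pos (\<Union>n::nat. if n = 0 then Y else Q)" by (rule pos_UN) (use Y Q in auto)
      also have "(\<Union>n::nat. if n = 0 then Y else Q) = Y \<union> Q" by (auto split: if_splits)
      finally have "\<nu> (Y \<union> Q) \<le> s" unfolding s_def by (intro cSUP_upper bdd) auto
      moreover have "\<nu> (Y \<union> Q) = \<nu> Y + \<nu> Q"
        using Q(1) E(2) by (intro vector_measure_Un[OF v] pos1 Y Q(2)) auto
      ultimately show False using \<open>s \<le> \<nu> Y\<close> Q n by simp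
    qed
  qed
qed

lemma sets_pos_part [simp, measurable_cong]: "sets (pos_part M \<nu>) = sets M"
  and space_pos_part [simp]: "space (pos_part M \<nu>) = space M"
  unfolding pos_part_def by simp_all

text \<open>Among the subsets of B the best one is \<open>B \<inter> Y\<close>: points outside Y
  only lower \<nu>, and omitted points of Y could only raise it. This closed form inherits countable
  additivity from \<nu>, without which \<open>measure_of\<close> would say nothing.\<close>

lemma emeasure_pos_part_aux:
  fixes \<nu> :: "'a set \<Rightarrow> real"
  assumes v: "vector_measure M \<nu>" and Y: "Y \<in> sets M"
    and p: "\<And>E. E \<in> sets M \<Longrightarrow> E \<subseteq> Y \<Longrightarrow> \<nu> E \<ge> 0"
    and n: "\<And>E. E \<in> sets M \<Longrightarrow> E \<inter> Y = {} \<Longrightarrow> \<nu> E \<le> 0"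
    and B: "B \<in> sets M"
  shows "emeasure (pos_part M \<nu>) B = ennreal (\<nu> (B \<inter> Y))"
proof -
  let ?m = "\<lambda>B. SUP E \<in> {E \<in> sets M. E \<subseteq> B}. ennreal (\<nu> E)"
  have m: "?m B = ennreal (\<nu> (B \<inter> Y))" if B: "B \<in> sets M" for B
  proof (rule antisym)
    show "?m B \<le> ennreal (\<nu> (B \<inter> Y))"
    proof (rule SUP_least)
      fix E assume "E \<in> {E \<in> sets M. E \<subseteq> B}"
      then have E: "E \<in> sets M" "E \<subseteq> B" by auto
      have "\<nu> E = \<nu> (E \<inter> Y) + \<nu> (E - Y)" by (rule vector_measure_split[OF v E(1) Y])
      moreover have "\<nu> (E - Y) \<le> 0" by (rule n) (use E Y in auto)
      moreover have "\<nu> (B \<inter> Y - E \<inter> Y) \<ge> 0" by (rule p) (use E B Y in auto)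
      moreover have "\<nu> (B \<inter> Y - E \<inter> Y) = \<nu> (B \<inter> Y) - \<nu> (E \<inter> Y)"
        by (rule vector_measure_Diff[OF v]) (use E B Y in auto)
      ultimately show "ennreal (\<nu> E) \<le> ennreal (\<nu> (B \<inter> Y))" by (intro ennreal_leI) linarith
    qed
    show "ennreal (\<nu> (B \<inter> Y)) \<le> ?m B" by (rule SUP_upper) (use B Y in auto)
  qed
  show ?thesis
    unfolding m[OF B, symmetric]
  proof (rule emeasure_measure_of[OF pos_part_def])
    show "positive (sets (pos_part M \<nu>)) ?m"
      using m[of "{}"] vector_measure_empty[OF v] by (simp add: positive_def)
    show "countably_additive (sets (pos_part M \<nu>)) ?m"
    proof (rule countably_additiveI)
      fix A :: "nat \<Rightarrow> 'a set"
      assume A: "range A \<subseteq> sets (pos_part M \<nu>)" "disjoint_family A" "(\<Union>i. A i) \<in> sets (pos_part M \<nu>)"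
      have "(\<lambda>i. \<nu> (A i \<inter> Y)) sums \<nu> (\<Union>i. A i \<inter> Y)"
        using A Y by (intro vector_measure_sums[OF v]) (auto simp: disjoint_family_on_def)
      then have s: "(\<lambda>i. \<nu> (A i \<inter> Y)) sums \<nu> ((\<Union>i. A i) \<inter> Y)" by (simp add: UN_simps)
      have "(\<Sum>i. ?m (A i)) = (\<Sum>i. ennreal (\<nu> (A i \<inter> Y)))"
        using A(1) by (intro arg_cong[where f=suminf] ext m) auto
      also have "\<dots> = ennreal (\<Sum>i. \<nu> (A i \<inter> Y))"
        using s A(1) Y by (intro suminf_ennreal2 p) (auto simp: sums_iff)
      also have "\<dots> = ?m (\<Union>i. A i)" using s m A(3) by (simp add: sums_iff)
      finally show "(\<Sum>i. ?m (A i)) = ?m (\<Union>i. A i)" .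
    qed
  qed (use B sets.sets_into_space in auto)
qed

text \<open>The complement of \<open>Y\<close> is a positive set for the negated measure, so a
  single set describes both parts.\<close>

lemma Jordan_decomposition:
  fixes \<nu> :: "'a set \<Rightarrow> real"
  assumes v: "vector_measure M \<nu>"
  obtains Y where "Y \<in> sets M"
    "\<And>B. B \<in> sets M \<Longrightarrow> \<nu> (B \<inter> Y) \<ge> 0"
    "\<And>B. B \<in> sets M \<Longrightarrow> \<nu> (B - Y) \<le> 0"
    "\<And>B. B \<in> sets M \<Longrightarrow> emeasure (pos_part M \<nu>) B = ennreal (\<nu> (B \<inter> Y))"
    "\<And>B. B \<in> sets M \<Longrightarrow> emeasure (pos_part M (\<lambda>B. - \<nu> B)) B = ennreal (- \<nu> (B - Y))"
proof -
  obtain Y where Y: "Y \<in> sets M" "\<And>E. E \<in> sets M \<Longrightarrow> E \<subseteq> Y \<Longrightarrow> \<nu> E \<ge> 0"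
    "\<And>E. E \<in> sets M \<Longrightarrow> E \<inter> Y = {} \<Longrightarrow> \<nu> E \<le> 0"
    using Hahn_decomposition[OF v] by blast
  have neg: "emeasure (pos_part M (\<lambda>B. - \<nu> B)) B = ennreal (- \<nu> (B \<inter> (space M - Y)))"
    if "B \<in> sets M" for B
  proof (rule emeasure_pos_part_aux[OF vector_measure_uminus[OF v]])
    show "- \<nu> E \<ge> 0" if "E \<in> sets M" "E \<subseteq> space M - Y" for E using Y(3)[of E] that by auto
    show "- \<nu> E \<le> 0" if "E \<in> sets M" "E \<inter> (space M - Y) = {}" for E
      using Y(2)[of E] that sets.sets_into_space by auto
  qed (use Y that in auto)
  have "B \<inter> (space M - Y) = B - Y" if "B \<in> sets M" for B
    using sets.sets_into_space[OF that] by auto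
  then have neg': "emeasure (pos_part M (\<lambda>B. - \<nu> B)) B = ennreal (- \<nu> (B - Y))"
    if "B \<in> sets M" for B
    using neg that by simp
  show thesis
    by (rule that[OF Y(1) _ _ emeasure_pos_part_aux[OF v Y] neg']) (use Y(1) in \<open>auto intro!: Y(2,3)\<close>)
qed

lemma finite_measure_pos_part:
  fixes \<nu> :: "'a set \<Rightarrow> real"
  assumes v: "vector_measure M \<nu>"
  shows "finite_measure (pos_part M \<nu>)"
  by (rule Jordan_decomposition[OF v]) (auto intro!: finite_measureI)

lemma vector_measure_eq_pos_part:
  fixes \<nu> :: "'a set \<Rightarrow> real"
  assumes v: "vector_measure M \<nu>" and B: "B \<in> sets M"
  shows "\<nu> B = measure (pos_part M \<nu>) B - measure (pos_part M (\<lambda>B. - \<nu> B)) B"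
proof -
  obtain Y where Y: "Y \<in> sets M"
    "\<And>B. B \<in> sets M \<Longrightarrow> \<nu> (B \<inter> Y) \<ge> 0"
    "\<And>B. B \<in> sets M \<Longrightarrow> \<nu> (B - Y) \<le> 0"
    "\<And>B. B \<in> sets M \<Longrightarrow> emeasure (pos_part M \<nu>) B = ennreal (\<nu> (B \<inter> Y))"
    "\<And>B. B \<in> sets M \<Longrightarrow> emeasure (pos_part M (\<lambda>B. - \<nu> B)) B = ennreal (- \<nu> (B - Y))"
    using Jordan_decomposition[OF v] by blast
  show ?thesis
    using vector_measure_split[OF v B Y(1)] Y B by (simp add: measure_def)
qed

subsection \<open>Finite sums of measures\<close>

text \<open>Made for comparing signed combinations of measures: once the negative terms are moved to
  the other side, both sides are honest measures of this form.\<close>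

definition sum_measure :: "'a measure \<Rightarrow> 'i set \<Rightarrow> ('i \<Rightarrow> 'a measure) \<Rightarrow> 'a measure" where
  "sum_measure M I m = measure_of (space M) (sets M) (\<lambda>B. \<Sum>i\<in>I. emeasure (m i) B)"

lemma sets_sum_measure [simp, measurable_cong]: "sets (sum_measure M I m) = sets M"
  and space_sum_measure [simp]: "space (sum_measure M I m) = space M"
  unfolding sum_measure_def by simp_all

lemma emeasure_sum_measure:
  fixes M :: "'a measure"
  assumes s: "\<And>i. i \<in> I \<Longrightarrow> sets (m i) = sets M" and B: "B \<in> sets M"
  shows "emeasure (sum_measure M I m) B = (\<Sum>i\<in>I. emeasure (m i) B)"
proof (rule emeasure_measure_of[OF sum_measure_def])
  show "positive (sets (sum_measure M I m)) (\<lambda>B. \<Sum>i\<in>I. emeasure (m i) B)"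
    by (simp add: positive_def)
  show "countably_additive (sets (sum_measure M I m)) (\<lambda>B. \<Sum>i\<in>I. emeasure (m i) B)"
  proof (rule countably_additiveI)
    fix A :: "nat \<Rightarrow> 'a set"
    assume A: "range A \<subseteq> sets (sum_measure M I m)" "disjoint_family A"
    have "(\<Sum>k. \<Sum>i\<in>I. emeasure (m i) (A k)) = (\<Sum>i\<in>I. \<Sum>k. emeasure (m i) (A k))"
      by (rule suminf_sum) simp
    also have "\<dots> = (\<Sum>i\<in>I. emeasure (m i) (\<Union>k. A k))"
      using A s by (intro sum.cong suminf_emeasure) auto
    finally show "(\<Sum>k. \<Sum>i\<in>I. emeasure (m i) (A k)) = (\<Sum>i\<in>I. emeasure (m i) (\<Union>k. A k))" .
  qed
qed (use B sets.sets_into_space in auto)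

lemma finite_measure_sum_measure:
  assumes s: "\<And>i. i \<in> I \<Longrightarrow> sets (m i) = sets M" and f: "finite I" "\<And>i. i \<in> I \<Longrightarrow> finite_measure (m i)"
  shows "finite_measure (sum_measure M I m)"
proof (rule finite_measureI)
  show "emeasure (sum_measure M I m) (space (sum_measure M I m)) \<noteq> \<infinity>"
    using f finite_measure.emeasure_finite by (subst emeasure_sum_measure[OF s]) (auto)
qed

lemma nn_integral_sum_measure:
  assumes s: "\<And>i. i \<in> I \<Longrightarrow> sets (m i) = sets M" and f: "f \<in> borel_measurable M"
  shows "(\<integral>\<^sup>+x. f x \<partial>sum_measure M I m) = (\<Sum>i\<in>I. \<integral>\<^sup>+x. f x \<partial>m i)"
  using f
proof (induction rule: borel_measurable_induct)
  case (cong f g)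
  have "(\<integral>\<^sup>+x. f x \<partial>m i) = (\<integral>\<^sup>+x. g x \<partial>m i)" if "i \<in> I" for i
    using cong(3) sets_eq_imp_space_eq[OF s[OF that]] by (intro nn_integral_cong) auto
  moreover have "(\<integral>\<^sup>+x. f x \<partial>sum_measure M I m) = (\<integral>\<^sup>+x. g x \<partial>sum_measure M I m)"
    using cong(3) by (intro nn_integral_cong) auto
  ultimately show ?case using cong(4) by simp
next
  case (set A)
  then show ?case using emeasure_sum_measure[OF s set] s by simp
next
  case (mult u c)
  have "u \<in> borel_measurable (m i)" if "i \<in> I" for i using mult s[OF that] measurable_cong_sets by blast
  then show ?case
    using mult measurable_cong_sets[OF sets_sum_measure refl, of M I m]
    by (simp add: nn_integral_cmult sum_distrib_left)
next
  case (add u v)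
  have "u \<in> borel_measurable (m i)" "v \<in> borel_measurable (m i)" if "i \<in> I" for i
    using add s[OF that] measurable_cong_sets by blast+
  then show ?case using add
    by (simp add: nn_integral_add sum.distrib measurable_cong_sets[OF sets_sum_measure refl, of M I m])
next
  case (seq U)
  have U: "U n \<in> borel_measurable (m i)" if "i \<in> I" for i n
    using seq(1) s[OF that] measurable_cong_sets by blast
  have mono: "i \<in> I \<Longrightarrow> incseq (\<lambda>n. \<integral>\<^sup>+x. U n x \<partial>m i)" for i
    using seq(3) by (auto simp: incseq_def le_fun_def intro!: nn_integral_mono)
  have "(\<integral>\<^sup>+x. (SUP n. U n) x \<partial>sum_measure M I m) = (SUP n. \<integral>\<^sup>+x. U n x \<partial>sum_measure M I m)"
    unfolding SUP_apply
    by (rule nn_integral_monotone_convergence_SUP[OF seq(3)]) (use seq(1) in auto)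
  also have "\<dots> = (SUP n. \<Sum>i\<in>I. \<integral>\<^sup>+x. U n x \<partial>m i)" using seq by simp
  also have "\<dots> = (\<Sum>i\<in>I. SUP n. \<integral>\<^sup>+x. U n x \<partial>m i)"
    by (rule ennreal_SUP_sum[OF mono])
  also have "\<dots> = (\<Sum>i\<in>I. \<integral>\<^sup>+x. (SUP n. U n) x \<partial>m i)"
    unfolding SUP_apply
    by (intro sum.cong refl nn_integral_monotone_convergence_SUP[symmetric, OF seq(3)]) (use U in auto)
  finally show ?case .
qed

lemma integrable_bounded_finite_measure:
  fixes f :: "'a \<Rightarrow> real"
  assumes "finite_measure m" "f \<in> borel_measurable m" "\<And>x. x \<in> space m \<Longrightarrow> \<bar>f x\<bar> \<le> C"
  shows "integrable m f"
  by (rule finite_measure.integrable_const_bound[OF assms(1), of _ C]) (use assms in auto)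

lemma integral_sum_measure:
  fixes f :: "'a \<Rightarrow> real"
  assumes s: "\<And>i. i \<in> I \<Longrightarrow> sets (m i) = sets M" and I: "finite I" "\<And>i. i \<in> I \<Longrightarrow> finite_measure (m i)"
    and f: "f \<in> borel_measurable M" "\<And>x. x \<in> space M \<Longrightarrow> \<bar>f x\<bar> \<le> C"
  shows "(\<integral>x. f x \<partial>sum_measure M I m) = (\<Sum>i\<in>I. \<integral>x. f x \<partial>m i)"
proof -
  note fin = finite_measure_sum_measure[of I m M, OF s I]
  have nn: "(\<integral>x. g x \<partial>sum_measure M I m) = (\<Sum>i\<in>I. \<integral>x. g x \<partial>m i)"
    if g: "g \<in> borel_measurable M" "\<And>x. 0 \<le> g x" "\<And>x. x \<in> space M \<Longrightarrow> \<bar>g x\<bar> \<le> C" for g :: "'a \<Rightarrow> real"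
  proof -
    have "integrable (sum_measure M I m) g"
      by (rule integrable_bounded_finite_measure[OF fin]) (use g in auto)
    then have "ennreal (\<integral>x. g x \<partial>sum_measure M I m) = (\<integral>\<^sup>+x. g x \<partial>sum_measure M I m)"
      using g by (subst nn_integral_eq_integral) auto
    also have "\<dots> = (\<Sum>i\<in>I. \<integral>\<^sup>+x. g x \<partial>m i)"
      using g by (intro nn_integral_sum_measure s) auto
    also have "\<dots> = (\<Sum>i\<in>I. ennreal (\<integral>x. g x \<partial>m i))"
    proof (rule sum.cong[OF refl])
      fix i assume i: "i \<in> I"
      have "integrable (m i) g"
        using g s[OF i] sets_eq_imp_space_eq[OF s[OF i]] measurable_cong_sets[OF s[OF i] refl]
        by (intro integrable_bounded_finite_measure[OF I(2)[OF i], of _ C]) auto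
      then show "(\<integral>\<^sup>+x. g x \<partial>m i) = ennreal (\<integral>x. g x \<partial>m i)"
        using g by (intro nn_integral_eq_integral) auto
    qed
    also have "\<dots> = ennreal (\<Sum>i\<in>I. \<integral>x. g x \<partial>m i)"
      using g by (intro sum_ennreal integral_nonneg_AE) auto
    finally show ?thesis
      using g by (subst (asm) ennreal_inj) (auto intro!: sum_nonneg integral_nonneg_AE)
  qed
  let ?p = "\<lambda>x. max 0 (f x)" and ?n = "\<lambda>x. max 0 (- f x)"
  have split: "(\<integral>x. f x \<partial>k) = (\<integral>x. ?p x \<partial>k) - (\<integral>x. ?n x \<partial>k)"
    if "finite_measure k" "sets k = sets M" for k
  proof -
    have "integrable k ?p" "integrable k ?n"
      using that f sets_eq_imp_space_eq[OF that(2)] measurable_cong_sets[OF that(2) refl]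
      by (auto intro!: integrable_bounded_finite_measure[OF that(1), of _ "\<bar>C\<bar>"]) fastforce+
    then have "(\<integral>x. ?p x \<partial>k) - (\<integral>x. ?n x \<partial>k) = (\<integral>x. ?p x - ?n x \<partial>k)" by simp
    also have "\<dots> = (\<integral>x. f x \<partial>k)" by (intro Bochner_Integration.integral_cong) auto
    finally show ?thesis by simp
  qed
  have "\<bar>?p x\<bar> \<le> C" "\<bar>?n x\<bar> \<le> C" if "x \<in> space M" for x using f(2)[OF that] by auto
  then show ?thesis
    using split[OF fin] split[OF I(2) s] nn[of ?p] nn[of ?n] f(1)
    by (simp add: sum_subtractf)
qed

text \<open>\<open>signed_integral\<close> is defined by the Jordan decomposition, but any
  presentation as a difference of finite measures serves to compute it: with the subtracted measures
  moved across, the identity becomes an equality of two positive measures, and equal measures have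
  equal integrals.\<close>

lemma signed_integral_eq_sum:
  fixes \<nu> :: "'a set \<Rightarrow> real"
  assumes v: "vector_measure M \<nu>" and I: "finite I"
    and a: "\<And>i. i \<in> I \<Longrightarrow> finite_measure (a i) \<and> sets (a i) = sets M"
    and b: "\<And>i. i \<in> I \<Longrightarrow> finite_measure (b i) \<and> sets (b i) = sets M"
    and eq: "\<And>B. B \<in> sets M \<Longrightarrow> \<nu> B = (\<Sum>i\<in>I. measure (a i) B - measure (b i) B)"
    and f: "f \<in> borel_measurable M" "\<And>x. x \<in> space M \<Longrightarrow> \<bar>f x\<bar> \<le> C"
  shows "signed_integral M \<nu> f = (\<Sum>i\<in>I. (\<integral>x. f x \<partial>a i) - (\<integral>x. f x \<partial>b i))"
proof -
  define p where "p = pos_part M \<nu>"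
  define q where "q = pos_part M (\<lambda>B. - \<nu> B)"
  have pq: "finite_measure p" "finite_measure q" "sets p = sets M" "sets q = sets M"
    unfolding p_def q_def using finite_measure_pos_part v vector_measure_uminus by auto
  \<comment> \<open>The index \<open>None\<close> carries the Jordan parts. As \<open>p - q\<close>
    equals the sum of the differences \<open>a i - b i\<close>, the positive part joins the
    \<open>b i\<close> and the negative part joins the \<open>a i\<close>.\<close>
  let ?J = "insert None (Some ` I)"
  define m1 where "m1 = case_option p b"
  define m2 where "m2 = case_option q a"
  have m: "finite_measure (m1 i)" "sets (m1 i) = sets M" "finite_measure (m2 i)" "sets (m2 i) = sets M"
    if "i \<in> ?J" for i
    using that a b pq by (auto simp: m1_def m2_def)
  have sumJ: "(\<Sum>i\<in>?J. g i) = g None + (\<Sum>i\<in>I. g (Some i))" for g :: "_ \<Rightarrow> real"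
    using I by (subst sum.insert) (auto simp: sum.reindex)
  have "sum_measure M ?J m1 = sum_measure M ?J m2"
  proof (rule measure_eqI)
    fix B assume "B \<in> sets (sum_measure M ?J m1)"
    then have B: "B \<in> sets M" by simp
    have "(\<Sum>i\<in>?J. measure (m1 i) B) = (\<Sum>i\<in>?J. measure (m2 i) B)"
      unfolding sumJ using eq[OF B] vector_measure_eq_pos_part[OF v B]
      by (simp add: m1_def m2_def p_def q_def sum_subtractf)
    moreover have "emeasure (sum_measure M ?J m1) B = ennreal (\<Sum>i\<in>?J. measure (m1 i) B)"
      using m by (simp add: emeasure_sum_measure[OF m(2) B] finite_measure.emeasure_eq_measure
          del: sum.insert_remove sum.insert insert_iff)
    moreover have "emeasure (sum_measure M ?J m2) B = ennreal (\<Sum>i\<in>?J. measure (m2 i) B)"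
      using m by (simp add: emeasure_sum_measure[OF m(4) B] finite_measure.emeasure_eq_measure
          del: sum.insert_remove sum.insert insert_iff)
    ultimately show "emeasure (sum_measure M ?J m1) B = emeasure (sum_measure M ?J m2) B" by simp
  qed simp
  moreover have "(\<integral>x. f x \<partial>sum_measure M ?J m1) = (\<Sum>i\<in>?J. \<integral>x. f x \<partial>m1 i)"
    by (rule integral_sum_measure[OF m(2) _ m(1) f]) (use I in auto)
  moreover have "(\<integral>x. f x \<partial>sum_measure M ?J m2) = (\<Sum>i\<in>?J. \<integral>x. f x \<partial>m2 i)"
    by (rule integral_sum_measure[OF m(4) _ m(3) f]) (use I in auto)
  ultimately have "(\<Sum>i\<in>?J. \<integral>x. f x \<partial>m1 i) = (\<Sum>i\<in>?J. \<integral>x. f x \<partial>m2 i)" by simp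
  then show ?thesis
    unfolding sumJ signed_integral_def m1_def m2_def p_def[symmetric] q_def[symmetric]
    by (simp add: sum_subtractf)
qed

subsection \<open>Measures with densities\<close>

lemma integrable_imp_set_integrable:
  fixes f :: "'a \<Rightarrow> 'b::{banach, second_countable_topology}"
  assumes "integrable M f" "B \<in> sets M"
  shows "set_integrable M B f"
  unfolding set_integrable_def by (rule integrable_mult_indicator[OF assms(2,1)])

lemma integrable_mult_bounded:
  fixes f g :: "'a \<Rightarrow> real"
  assumes f: "integrable M f" and g: "g \<in> borel_measurable M" "AE x in M. norm (g x) \<le> C"
  shows "integrable M (\<lambda>x. f x * g x)"
proof (rule Bochner_Integration.integrable_bound)
  show "integrable M (\<lambda>x. f x * C)" using f by simp
  show "AE x in M. norm (f x * g x) \<le> norm (f x * C)"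
    using g(2) by eventually_elim (auto simp: abs_mult intro!: mult_left_mono)
qed (use f g in measurable)

lemma vector_measure_eq_sum:
  fixes \<nu> :: "'a set \<Rightarrow> real"
  assumes a: "\<And>i. i \<in> I \<Longrightarrow> finite_measure (a i) \<and> sets (a i) = sets M"
    and b: "\<And>i. i \<in> I \<Longrightarrow> finite_measure (b i) \<and> sets (b i) = sets M"
    and eq: "\<And>B. B \<in> sets M \<Longrightarrow> \<nu> B = (\<Sum>i\<in>I. measure (a i) B - measure (b i) B)"
  shows "vector_measure M \<nu>"
  unfolding vector_measure_def
proof (intro allI impI)
  fix A :: "nat \<Rightarrow> 'a set"
  assume A: "range A \<subseteq> sets M" "disjoint_family A"
  have "(\<lambda>k. \<Sum>i\<in>I. measure (a i) (A k) - measure (b i) (A k)) sums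
      (\<Sum>i\<in>I. measure (a i) (\<Union>k. A k) - measure (b i) (\<Union>k. A k))"
    using A a b by (intro sums_sum sums_diff finite_measure.finite_measure_UNION) auto
  moreover have "A k \<in> sets M" for k using A by auto
  moreover have "(\<Union>k. A k) \<in> sets M" using A by auto
  ultimately show "(\<lambda>k. \<nu> (A k)) sums \<nu> (\<Union>k. A k)" using eq by simp
qed

lemma density_pos_part:
  fixes h :: "'a \<Rightarrow> real"
  assumes h: "integrable \<kappa> h"
  defines "m \<equiv> density \<kappa> (\<lambda>x. ennreal (max 0 (h x)))"
  shows "finite_measure m" "sets m = sets \<kappa>"
    "B \<in> sets \<kappa> \<Longrightarrow> measure m B = (LINT x:B|\<kappa>. max 0 (h x))"
    "f \<in> borel_measurable \<kappa> \<Longrightarrow> (\<integral>x. f x \<partial>m) = (\<integral>x. max 0 (h x) * f x \<partial>\<kappa>)"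
proof -
  have hm: "(\<lambda>x. max 0 (h x)) \<in> borel_measurable \<kappa>" using h by simp
  have i: "integrable \<kappa> (\<lambda>x. max 0 (h x))" using h by (intro integrable_max) auto
  have em: "emeasure m B = ennreal (LINT x:B|\<kappa>. max 0 (h x))" if B: "B \<in> sets \<kappa>" for B
  proof -
    have "emeasure m B = (\<integral>\<^sup>+x. ennreal (indicator B x * max 0 (h x)) \<partial>\<kappa>)"
      unfolding m_def using B hm
      by (simp add: emeasure_density) (auto intro!: nn_integral_cong simp: indicator_def)
    also have "\<dots> = ennreal (\<integral>x. indicator B x * max 0 (h x) \<partial>\<kappa>)"
      using integrable_mult_indicator[OF B i] by (intro nn_integral_eq_integral) auto
    finally show ?thesis by (simp add: set_lebesgue_integral_def)
  qed
  have nonneg: "(LINT x:B|\<kappa>. max 0 (h x)) \<ge> 0" for B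
    unfolding set_lebesgue_integral_def by (intro integral_nonneg_AE) auto
  show s: "sets m = sets \<kappa>" by (simp add: m_def)
  show "finite_measure m"
    by (rule finite_measureI) (simp add: em s sets_eq_imp_space_eq[OF s])
  show "B \<in> sets \<kappa> \<Longrightarrow> measure m B = (LINT x:B|\<kappa>. max 0 (h x))"
    using em[of B] nonneg[of B] by (simp add: measure_def)
  show "f \<in> borel_measurable \<kappa> \<Longrightarrow> (\<integral>x. f x \<partial>m) = (\<integral>x. max 0 (h x) * f x \<partial>\<kappa>)"
    unfolding m_def using hm by (subst integral_density) auto
qed

text \<open>The reference measures may vary with i. For a sawtooth function one is Lebesgue measure
  and the other is its image under a projection. Splitting each density into
  \<open>max 0 (h i x)\<close> and \<open>max 0 (- h i x)\<close> presents \<nu> as a difference of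
  positive measures.\<close>

lemma signed_measure_densities:
  fixes \<nu> :: "'a set \<Rightarrow> real"
  assumes I: "finite I" and l: "\<And>i. i \<in> I \<Longrightarrow> sets (\<kappa> i) = sets M"
    and h: "\<And>i. i \<in> I \<Longrightarrow> integrable (\<kappa> i) (h i)"
    and eq: "\<And>B. B \<in> sets M \<Longrightarrow> \<nu> B = (\<Sum>i\<in>I. LINT x:B|\<kappa> i. h i x)"
  shows "vector_measure M \<nu>"
    and "f \<in> borel_measurable M \<Longrightarrow> (\<And>x. x \<in> space M \<Longrightarrow> \<bar>f x\<bar> \<le> C) \<Longrightarrow>
      signed_integral M \<nu> f = (\<Sum>i\<in>I. \<integral>x. f x * h i x \<partial>\<kappa> i)"
proof -
  define a where "a i = density (\<kappa> i) (\<lambda>x. ennreal (max 0 (h i x)))" for i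
  define b where "b i = density (\<kappa> i) (\<lambda>x. ennreal (max 0 (- h i x)))" for i
  have a: "finite_measure (a i) \<and> sets (a i) = sets M" if "i \<in> I" for i
    unfolding a_def using density_pos_part(1,2)[OF h[OF that]] l[OF that] by simp
  have b: "finite_measure (b i) \<and> sets (b i) = sets M" if "i \<in> I" for i
    unfolding b_def using density_pos_part(1,2)[of "\<kappa> i" "\<lambda>x. - h i x"] h[OF that] l[OF that] by simp
  have int: "integrable (\<kappa> i) (\<lambda>x. max 0 (h i x))" "integrable (\<kappa> i) (\<lambda>x. max 0 (- h i x))" if "i \<in> I" for i
    using h[OF that] by (auto intro!: integrable_max)
  have eq2: "\<nu> B = (\<Sum>i\<in>I. measure (a i) B - measure (b i) B)" if B: "B \<in> sets M" for B
    unfolding eq[OF B]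
  proof (rule sum.cong[OF refl])
    fix i assume i: "i \<in> I"
    then have Bi: "B \<in> sets (\<kappa> i)" using B l by simp
    have "measure (a i) B - measure (b i) B
        = (LINT x:B|\<kappa> i. max 0 (h i x)) - (LINT x:B|\<kappa> i. max 0 (- h i x))"
      unfolding a_def b_def
      using density_pos_part(3)[OF h[OF i] Bi] density_pos_part(3)[of "\<kappa> i" "\<lambda>x. - h i x", OF _ Bi] h[OF i]
      by simp
    also have "\<dots> = (LINT x:B|\<kappa> i. max 0 (h i x) - max 0 (- h i x))"
      by (intro set_integral_diff(2)[symmetric] integrable_imp_set_integrable int[OF i] Bi)
    also have "\<dots> = (LINT x:B|\<kappa> i. h i x)"
      unfolding set_lebesgue_integral_def by (intro Bochner_Integration.integral_cong) auto
    finally show "(LINT x:B|\<kappa> i. h i x) = measure (a i) B - measure (b i) B" by simp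
  qed
  show v: "vector_measure M \<nu>" by (rule vector_measure_eq_sum[OF a b eq2])
  assume f: "f \<in> borel_measurable M" "\<And>x. x \<in> space M \<Longrightarrow> \<bar>f x\<bar> \<le> C"
  have "signed_integral M \<nu> f = (\<Sum>i\<in>I. (\<integral>x. f x \<partial>a i) - (\<integral>x. f x \<partial>b i))"
    by (rule signed_integral_eq_sum[OF v I a b eq2 f])
  also have "\<dots> = (\<Sum>i\<in>I. \<integral>x. f x * h i x \<partial>\<kappa> i)"
  proof (rule sum.cong[OF refl])
    fix i assume i: "i \<in> I"
    have fm: "f \<in> borel_measurable (\<kappa> i)" using f(1) measurable_cong_sets[OF l[OF i] refl] by blast
    have fb: "AE x in \<kappa> i. norm (f x) \<le> C" using f(2) sets_eq_imp_space_eq[OF l[OF i]] by auto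
    have i2: "integrable (\<kappa> i) (\<lambda>x. max 0 (h i x) * f x)" "integrable (\<kappa> i) (\<lambda>x. max 0 (- h i x) * f x)"
      by (rule integrable_mult_bounded[OF int(1)[OF i] fm fb],
          rule integrable_mult_bounded[OF int(2)[OF i] fm fb])
    have "(\<integral>x. f x \<partial>a i) - (\<integral>x. f x \<partial>b i)
        = (\<integral>x. max 0 (h i x) * f x \<partial>\<kappa> i) - (\<integral>x. max 0 (- h i x) * f x \<partial>\<kappa> i)"
      unfolding a_def b_def using density_pos_part(4)[OF h[OF i] fm]
        density_pos_part(4)[of "\<kappa> i" "\<lambda>x. - h i x", OF _ fm] h[OF i] by simp
    also have "\<dots> = (\<integral>x. max 0 (h i x) * f x - max 0 (- h i x) * f x \<partial>\<kappa> i)"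
      using i2 by simp
    also have "\<dots> = (\<integral>x. f x * h i x \<partial>\<kappa> i)"
      by (intro Bochner_Integration.integral_cong) (auto simp: max_def)
    finally show "(\<integral>x. f x \<partial>a i) - (\<integral>x. f x \<partial>b i) = (\<integral>x. f x * h i x \<partial>\<kappa> i)" .
  qed
  finally show "signed_integral M \<nu> f = (\<Sum>i\<in>I. \<integral>x. f x * h i x \<partial>\<kappa> i)" .
qed

text \<open>The total mass of either Jordan part is, up to sign, a value of \<nu> and hence at most
  K. The two parts account for the factor 2, which does no harm in density arguments.\<close>

lemma abs_signed_integral_le:
  fixes \<nu> :: "'a set \<Rightarrow> real"
  assumes v: "vector_measure M \<nu>" and K: "\<And>B. B \<in> sets M \<Longrightarrow> \<bar>\<nu> B\<bar> \<le> K"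
    and f: "f \<in> borel_measurable M" "\<And>x. x \<in> space M \<Longrightarrow> \<bar>f x\<bar> \<le> C"
  shows "\<bar>signed_integral M \<nu> f\<bar> \<le> 2 * \<bar>C\<bar> * K"
proof -
  have main: "\<bar>\<integral>x. f x \<partial>pos_part M \<nu>\<bar> \<le> \<bar>C\<bar> * K"
    if v: "vector_measure M \<nu>" and K: "\<And>B. B \<in> sets M \<Longrightarrow> \<bar>\<nu> B\<bar> \<le> K" for \<nu> :: "'a set \<Rightarrow> real"
  proof -
    obtain Y where Y: "Y \<in> sets M"
      "\<And>B. B \<in> sets M \<Longrightarrow> \<nu> (B \<inter> Y) \<ge> 0"
      "\<And>B. B \<in> sets M \<Longrightarrow> emeasure (pos_part M \<nu>) B = ennreal (\<nu> (B \<inter> Y))"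
      using Jordan_decomposition[OF v] by metis
    interpret finite_measure "pos_part M \<nu>" by (rule finite_measure_pos_part[OF v])
    have "measure (pos_part M \<nu>) (space M) = \<nu> (space M \<inter> Y)"
      using Y(2,3)[of "space M"] by (simp add: measure_def)
    also have "\<dots> \<le> K" using K[of "space M \<inter> Y"] Y(1) by auto
    finally have le: "measure (pos_part M \<nu>) (space M) \<le> K" .
    have "\<bar>\<integral>x. f x \<partial>pos_part M \<nu>\<bar> \<le> (\<integral>x. \<bar>f x\<bar> \<partial>pos_part M \<nu>)" by (rule integral_abs_bound)
    also have "\<dots> \<le> (\<integral>x. \<bar>C\<bar> \<partial>pos_part M \<nu>)"
      using f by (intro integral_mono integrable_abs integrable_bounded_finite_measure[of _ f C] finite_measure_axioms) fastforce+
    also have "\<dots> \<le> \<bar>C\<bar> * K"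
      using mult_left_mono[OF le, of "\<bar>C\<bar>"] by (simp add: mult.commute)
    finally show ?thesis .
  qed
  have "\<bar>\<integral>x. f x \<partial>pos_part M (\<lambda>B. - \<nu> B)\<bar> \<le> \<bar>C\<bar> * K"
    by (rule main[OF vector_measure_uminus[OF v]]) (use K in auto)
  then show ?thesis using main[OF v K] unfolding signed_integral_def by linarith
qed

text \<open>The sum of all Jordan parts dominates every component. Having one reference measure for
  all entries is what allows the Frobenius norm of a matrix-valued measure to be taken
  pointwise.\<close>

lemma Radon_Nikodym_family:
  fixes \<nu> :: "'k \<Rightarrow> 'a set \<Rightarrow> real"
  assumes I: "finite I" and v: "\<And>k. k \<in> I \<Longrightarrow> vector_measure M (\<nu> k)"
  obtains \<kappa> h where "finite_measure \<kappa>" "sets \<kappa> = sets M"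
    "\<And>k. k \<in> I \<Longrightarrow> integrable \<kappa> (h k)"
    "\<And>k B. k \<in> I \<Longrightarrow> B \<in> sets M \<Longrightarrow> \<nu> k B = (LINT x:B|\<kappa>. h k x)"
proof -
  define m where "m = (\<lambda>(k, b). pos_part M (if b then \<nu> k else (\<lambda>B. - \<nu> k B)))"
  define \<kappa> where "\<kappa> = sum_measure M (I \<times> (UNIV :: bool set)) m"
  have m: "sets (m k) = sets M" "k \<in> I \<times> UNIV \<Longrightarrow> finite_measure (m k)" for k
    using v vector_measure_uminus
    by (auto simp: m_def split: prod.splits intro!: finite_measure_pos_part)
  have fin: "finite_measure \<kappa>" unfolding \<kappa>_def using I m by (intro finite_measure_sum_measure) auto
  have "\<exists>f. integrable \<kappa> f \<and> (\<forall>B\<in>sets M. measure (m k) B = (LINT x:B|\<kappa>. f x))" if k: "k \<in> I \<times> UNIV" for k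
  proof -
    have "absolutely_continuous \<kappa> (m k)"
      unfolding absolutely_continuous_def
    proof
      fix B assume B: "B \<in> null_sets \<kappa>"
      then have "B \<in> sets M" "(\<Sum>k\<in>I \<times> UNIV. emeasure (m k) B) = 0"
        using emeasure_sum_measure[of "I \<times> UNIV" m M B] m(1) by (auto simp: \<kappa>_def null_sets_def)
      then show "B \<in> null_sets (m k)" using k I m(1) by (auto simp: null_sets_def sum_eq_0_iff)
    qed
    then obtain f where f: "f \<in> borel_measurable \<kappa>" "density \<kappa> f = m k"
      using finite_measure.Radon_Nikodym_finite_measure[OF fin m(2)[OF k]] m(1) \<kappa>_def by auto
    have "(\<integral>\<^sup>+x. f x \<partial>\<kappa>) = emeasure (density \<kappa> f) (space \<kappa>)"
      using f(1) by (subst emeasure_density) (auto intro!: nn_integral_cong)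
    then have nn: "(\<integral>\<^sup>+x. f x \<partial>\<kappa>) \<noteq> \<infinity>"
      using f(2) finite_measure.emeasure_finite[OF m(2)[OF k], of "space \<kappa>"] by simp
    then have ae: "AE x in \<kappa>. f x = ennreal (enn2real (f x))"
      using nn_integral_PInf_AE[OF f(1)] by (auto simp: ennreal_enn2real_if elim!: eventually_mono)
    let ?g = "\<lambda>x. enn2real (f x)"
    have int: "integrable \<kappa> ?g"
      using nn f(1) ae by (intro integrableI_nonneg) (auto simp: less_top[symmetric] cong: nn_integral_cong_AE)
    have "measure (m k) B = (LINT x:B|\<kappa>. ?g x)" if B: "B \<in> sets M" for B
    proof -
      have B': "B \<in> sets \<kappa>" using B by (simp add: \<kappa>_def)
      have "emeasure (m k) B = (\<integral>\<^sup>+x. f x * indicator B x \<partial>\<kappa>)"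
        using f B' by (metis emeasure_density)
      also have "\<dots> = (\<integral>\<^sup>+x. ennreal (indicator B x * ?g x) \<partial>\<kappa>)"
        using ae by (intro nn_integral_cong_AE) (auto simp: indicator_def elim!: eventually_mono)
      also have "\<dots> = ennreal (\<integral>x. indicator B x * ?g x \<partial>\<kappa>)"
        using integrable_mult_indicator[OF B' int] by (intro nn_integral_eq_integral) auto
      finally show ?thesis
        by (simp add: measure_def set_lebesgue_integral_def)
    qed
    then show ?thesis using int by blast
  qed
  then obtain f where f: "\<And>k. k \<in> I \<times> UNIV \<Longrightarrow> integrable \<kappa> (f k)"
    "\<And>k B. k \<in> I \<times> UNIV \<Longrightarrow> B \<in> sets M \<Longrightarrow> measure (m k) B = (LINT x:B|\<kappa>. f k x)" by metis
  show thesis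
  proof (rule that[OF fin])
    show "sets \<kappa> = sets M" by (simp add: \<kappa>_def)
    show "integrable \<kappa> (\<lambda>x. f (k, True) x - f (k, False) x)" if "k \<in> I" for k
      using f(1) that by auto
    fix k B assume kB: "k \<in> I" "B \<in> sets M"
    then have "\<nu> k B = (LINT x:B|\<kappa>. f (k, True) x) - (LINT x:B|\<kappa>. f (k, False) x)"
      using vector_measure_eq_pos_part[OF v[OF kB(1)] kB(2)] f(2)[of "(k, True)" B] f(2)[of "(k, False)" B]
      by (simp add: m_def)
    also have "\<dots> = (LINT x:B|\<kappa>. f (k, True) x - f (k, False) x)"
      using f(1) kB by (intro set_integral_diff(2)[symmetric] integrable_imp_set_integrable) (auto simp: \<kappa>_def)
    finally show "\<nu> k B = (LINT x:B|\<kappa>. f (k, True) x - f (k, False) x)" .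
  qed
qed

subsection \<open>The Frobenius norm and total variation\<close>

lemma borel_measurable_L2_set [measurable]:
  assumes "\<And>k. k \<in> I \<Longrightarrow> f k \<in> borel_measurable M"
  shows "(\<lambda>x. L2_set (\<lambda>k. f k x) I) \<in> borel_measurable M"
  unfolding L2_set_def using assms by measurable

lemma integrable_L2_set:
  assumes "finite I" "\<And>k. k \<in> I \<Longrightarrow> integrable M (f k)"
  shows "integrable M (\<lambda>x. L2_set (\<lambda>k. f k x) I)"
proof (rule Bochner_Integration.integrable_bound)
  show "integrable M (\<lambda>x. \<Sum>k\<in>I. \<bar>f k x\<bar>)" using assms by auto
  show "AE x in M. norm (L2_set (\<lambda>k. f k x) I) \<le> norm (\<Sum>k\<in>I. \<bar>f k x\<bar>)"
    using L2_set_le_sum_abs[of "\<lambda>k. f k _" I] by (intro AE_I2) (simp add: sum_nonneg)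
qed (use assms in measurable)

text \<open>Minkowski's inequality for integrals: the vector of integrals is paired with itself,
  Cauchy-Schwarz is applied under the integral sign, and one factor of the norm is
  cancelled.\<close>

lemma L2_set_integral_le:
  fixes f :: "'k \<Rightarrow> 'a \<Rightarrow> real"
  assumes I: "finite I" "\<And>k. k \<in> I \<Longrightarrow> integrable M (f k)"
  shows "L2_set (\<lambda>k. \<integral>x. f k x \<partial>M) I \<le> (\<integral>x. L2_set (\<lambda>k. f k x) I \<partial>M)"
proof -
  let ?v = "\<lambda>k. \<integral>x. f k x \<partial>M" and ?J = "\<integral>x. L2_set (\<lambda>k. f k x) I \<partial>M"
  let ?V = "L2_set ?v I"
  have "?V * ?V = (\<Sum>k\<in>I. ?v k * ?v k)"
    unfolding L2_set_def by (simp add: sum_nonneg power2_eq_square flip: real_sqrt_mult)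
  also have "\<dots> = (\<integral>x. (\<Sum>k\<in>I. ?v k * f k x) \<partial>M)" using I by simp
  also have "\<dots> \<le> (\<integral>x. ?V * L2_set (\<lambda>k. f k x) I \<partial>M)"
  proof (rule integral_mono)
    fix x
    have "(\<Sum>k\<in>I. ?v k * f k x) \<le> (\<Sum>k\<in>I. \<bar>?v k\<bar> * \<bar>f k x\<bar>)"
      by (intro sum_mono) (metis abs_ge_self abs_mult)
    also have "\<dots> \<le> ?V * L2_set (\<lambda>k. f k x) I" by (rule L2_set_mult_ineq)
    finally show "(\<Sum>k\<in>I. ?v k * f k x) \<le> ?V * L2_set (\<lambda>k. f k x) I" .
  qed (use I integrable_L2_set[OF I] in auto)
  also have "\<dots> = ?V * ?J" by simp
  finally have *: "?V * ?V \<le> ?V * ?J" .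
  have "?J \<ge> 0" by (intro integral_nonneg_AE) auto
  then show ?thesis
    using * by (cases "?V = 0") (auto simp: mult_le_cancel_left less_le)
qed

text \<open>Indexing the entries by pairs makes the Frobenius norm a single \<open>L2_set\<close>,
  to which Cauchy-Schwarz, the triangle inequality and Minkowski's inequality apply
  directly.\<close>

abbreviation frob :: "nat \<Rightarrow> (nat \<Rightarrow> 'n \<Rightarrow> real) \<Rightarrow> real" where
  "frob d H \<equiv> L2_set (\<lambda>k. H (fst k) (snd k)) ({..<d} \<times> UNIV)"

lemma norm_mat_eq_frob: "norm_mat d A = frob d (\<lambda>i j. A i $ j)"
proof -
  have "(\<Sum>i<d. (norm (A i))\<^sup>2) = (\<Sum>i<d. \<Sum>j\<in>UNIV. (A i $ j)\<^sup>2)"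
    by (simp add: norm_vec_def L2_set_def sum_nonneg)
  also have "\<dots> = (\<Sum>k\<in>{..<d} \<times> UNIV. (A (fst k) $ snd k)\<^sup>2)"
    by (simp add: sum.cartesian_product case_prod_beta)
  finally show ?thesis unfolding L2_set_def by simp
qed

lemma total_variation_le:
  assumes s: "sets \<kappa> = sets M" and le: "\<And>A. A \<in> sets M \<Longrightarrow> ennreal (norm_mat d (\<mu> A)) \<le> emeasure \<kappa> A"
  shows "total_variation M d \<mu> B \<le> emeasure \<kappa> B"
  unfolding total_variation_def
proof (rule SUP_least, clarify)
  fix A :: "nat \<Rightarrow> 'a set"
  assume A: "range A \<subseteq> sets M" "disjoint_family A"
  have "(\<Sum>k. ennreal (norm_mat d (\<mu> (A k)))) \<le> (\<Sum>k. emeasure \<kappa> (A k))"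
    using A le by (intro suminf_le) auto
  also have "\<dots> = emeasure \<kappa> (\<Union>k. A k)" using A s by (intro suminf_emeasure) auto
  finally show "(\<Sum>k. ennreal (norm_mat d (\<mu> (A k)))) \<le> emeasure \<kappa> (\<Union>k. A k)" .
qed

lemma norm_mat_le_total_variation:
  assumes "B \<in> sets M" "A \<in> sets M" "A \<subseteq> B"
  shows "ennreal (norm_mat d (\<mu> A)) \<le> total_variation M d \<mu> B"
proof -
  let ?A = "binaryset A (B - A)"
  have "ennreal (norm_mat d (\<mu> A)) = (\<Sum>k\<in>{0::nat}. ennreal (norm_mat d (\<mu> (?A k))))"
    by (simp add: binaryset_def)
  also have "\<dots> \<le> (\<Sum>k. ennreal (norm_mat d (\<mu> (?A k))))" by (intro sum_le_suminf) auto
  also have "\<dots> \<le> total_variation M d \<mu> B"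
    unfolding total_variation_def
    using assms by (intro SUP_upper) (auto simp: disjoint_family_on_def binaryset_def split: if_splits)
  finally show ?thesis .
qed

lemma total_variation_cong:
  assumes "\<And>A i. A \<in> sets M \<Longrightarrow> i < d \<Longrightarrow> \<mu> A i = \<mu>' A i"
  shows "total_variation M d \<mu> B = total_variation M d \<mu>' B"
proof -
  have "(\<Sum>k. ennreal (norm_mat d (\<mu> (A k)))) = (\<Sum>k. ennreal (norm_mat d (\<mu>' (A k))))"
    if "range A \<subseteq> sets M" for A :: "nat \<Rightarrow> _"
    using assms that by (intro arg_cong[where f=suminf] ext arg_cong[where f=ennreal] L2_set_cong) auto
  then show ?thesis unfolding total_variation_def by (intro SUP_cong) auto
qed

text \<open>Both sides are compared with the value of h at one point of A. This costs e for each of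
  the \<open>card I\<close> components, once for the norm under the integral and once for the norm
  of the integrals, whence the factor 2.\<close>

lemma almost_constant_piece:
  fixes h :: "'k \<Rightarrow> 'a \<Rightarrow> real"
  assumes \<kappa>: "finite_measure \<kappa>" and I: "finite I" "\<And>k. k \<in> I \<Longrightarrow> integrable \<kappa> (h k)" and e: "e \<ge> 0"
    and A: "A \<in> sets \<kappa>" "\<And>x y k. x \<in> A \<Longrightarrow> y \<in> A \<Longrightarrow> k \<in> I \<Longrightarrow> \<bar>h k x - h k y\<bar> \<le> e"
  shows "(LINT x:A|\<kappa>. L2_set (\<lambda>k. h k x) I)
    \<le> L2_set (\<lambda>k. LINT x:A|\<kappa>. h k x) I + 2 * e * card I * measure \<kappa> A"
proof (cases "A = {}")
  case False
  then obtain y where y: "y \<in> A" by blast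
  interpret finite_measure \<kappa> by fact
  let ?N = "L2_set (\<lambda>k. h k y) I" and ?c = "e * card I"
  have L2: "L2_set f I \<le> L2_set g I + r * card I" if "\<And>k. k \<in> I \<Longrightarrow> \<bar>f k - g k\<bar> \<le> r" for f g r
  proof -
    have "L2_set f I = L2_set (\<lambda>k. g k + (f k - g k)) I" by simp
    also have "\<dots> \<le> L2_set g I + L2_set (\<lambda>k. f k - g k) I" by (rule L2_set_triangle_ineq)
    also have "L2_set (\<lambda>k. f k - g k) I \<le> (\<Sum>k\<in>I. r)"
    proof (rule order_trans[OF L2_set_le_sum_abs])
      show "(\<Sum>k\<in>I. \<bar>f k - g k\<bar>) \<le> (\<Sum>k\<in>I. r)" by (rule sum_mono) (rule that)
    qed
    finally show ?thesis by (simp add: mult.commute)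
  qed
  have si: "set_integrable \<kappa> A f" if "integrable \<kappa> f" for f :: "'a \<Rightarrow> real"
    unfolding set_integrable_def using integrable_mult_indicator[OF A(1) that] .
  have sc: "set_integrable \<kappa> A (\<lambda>x. c)" for c :: real by (rule si) simp
  have const: "(LINT x:A|\<kappa>. c) = c * measure \<kappa> A" for c :: real
    using A(1) by (simp add: set_lebesgue_integral_def)
  have "(LINT x:A|\<kappa>. L2_set (\<lambda>k. h k x) I) \<le> (LINT x:A|\<kappa>. ?N + ?c)"
    by (rule set_integral_mono[OF si[OF integrable_L2_set[OF I]] sc]) (use L2 A(2) y in auto)
  also have "\<dots> = ?N * measure \<kappa> A + ?c * measure \<kappa> A" by (simp add: const distrib_right)
  also have "?N * measure \<kappa> A = L2_set (\<lambda>k. h k y * measure \<kappa> A) I"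
    by (simp add: L2_set_left_distrib)
  also have "\<dots> \<le> L2_set (\<lambda>k. LINT x:A|\<kappa>. h k x) I + (e * measure \<kappa> A) * card I"
  proof (rule L2)
    fix k assume k: "k \<in> I"
    have "h k y * measure \<kappa> A - (LINT x:A|\<kappa>. h k x) = (LINT x:A|\<kappa>. h k y - h k x)"
      by (subst set_integral_diff(2)[OF sc si[OF I(2)[OF k]]]) (simp add: const)
    also have "\<bar>\<dots>\<bar> \<le> (LINT x:A|\<kappa>. e)"
    proof -
      have "\<bar>LINT x:A|\<kappa>. h k y - h k x\<bar> \<le> (LINT x:A|\<kappa>. \<bar>h k y - h k x\<bar>)"
        using set_integral_norm_bound[OF si[of "\<lambda>x. h k y - h k x"]] I(2)[OF k] by simp
      also have "\<dots> \<le> (LINT x:A|\<kappa>. e)"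
        by (rule set_integral_mono[OF si sc]) (use I(2)[OF k] A(2) y k in auto)
      finally show ?thesis .
    qed
    finally show "\<bar>h k y * measure \<kappa> A - (LINT x:A|\<kappa>. h k x)\<bar> \<le> e * measure \<kappa> A" by (simp add: const)
  qed
  finally show ?thesis by (simp add: algebra_simps)
qed (simp add: set_lebesgue_integral_def)

text \<open>The sets on which all the components of \<open>h / e\<close> have given integer parts form a countable
  partition on whose pieces \<open>h\<close> is almost constant.\<close>

lemma total_variation_ge:
  fixes \<mu> :: "'a set \<Rightarrow> nat \<Rightarrow> real ^ 'n" and h :: "nat \<Rightarrow> 'n \<Rightarrow> 'a \<Rightarrow> real"
  assumes \<kappa>: "finite_measure \<kappa>" and s: "sets \<kappa> = sets M"
    and h: "\<And>i j. i < d \<Longrightarrow> integrable \<kappa> (h i j)"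
    and eq: "\<And>i j B. i < d \<Longrightarrow> B \<in> sets M \<Longrightarrow> \<mu> B i $ j = (LINT x:B|\<kappa>. h i j x)"
  shows "(\<integral>\<^sup>+x. ennreal (frob d (\<lambda>i j. h i j x)) \<partial>\<kappa>) \<le> total_variation M d \<mu> (space M)"
proof (rule ennreal_le_epsilon)
  fix \<epsilon> :: real assume \<epsilon>: "\<epsilon> > 0"
  interpret finite_measure \<kappa> by fact
  define I where "I = {..<d} \<times> (UNIV :: 'n set)"
  have I: "finite I" by (simp add: I_def)
  define hk where "hk k = h (fst k) (snd k)" for k
  have hk: "k \<in> I \<Longrightarrow> integrable \<kappa> (hk k)" for k using h by (auto simp: hk_def I_def)
  \<comment> \<open>Chosen so that the error \<open>2 * e * card I\<close> per unit of mass adds up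
    to at most \<epsilon> over all pieces; the added ones keep the denominator positive.\<close>
  define e where "e = \<epsilon> / (2 * (card I + 1) * (measure \<kappa> (space M) + 1))"
  have pos: "2 * (real (card I) + 1) * (measure \<kappa> (space M) + 1) > 0"
    by (intro mult_pos_pos add_nonneg_pos) auto
  have e: "e > 0" unfolding e_def using \<epsilon> pos by (simp add: add.commute)
  define c where "c = 2 * e * card I"
  have "c * measure \<kappa> (space M) \<le> 2 * e * (card I + 1) * (measure \<kappa> (space M) + 1)"
    unfolding c_def using e by (intro mult_mono) auto
  also have "\<dots> = \<epsilon>" unfolding e_def using pos by (simp add: field_simps)
  finally have c\<epsilon>: "c * measure \<kappa> (space M) \<le> \<epsilon>" .
  have c: "c \<ge> 0" using e by (simp add: c_def)
  define q where "q x = restrict (\<lambda>k. \<lfloor>hk k x / e\<rfloor>) I" for x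
  define C where "C = (I \<rightarrow>\<^sub>E (UNIV :: int set))"
  have C: "countable C" unfolding C_def using I by (intro countable_PiE) auto
  have qC: "q x \<in> C" for x by (auto simp: q_def C_def)
  define A where "A n = {x \<in> space M. to_nat_on C (q x) = n}" for n
  have Am: "A n \<in> sets M" for n
  proof -
    have "A n = (\<Union>c\<in>{c \<in> C. to_nat_on C c = n}. {x \<in> space \<kappa>. \<forall>k\<in>I. \<lfloor>hk k x / e\<rfloor> = c k})"
    proof -
      have qc: "(\<forall>k\<in>I. \<lfloor>hk k x / e\<rfloor> = c k) \<longleftrightarrow> q x = c" if "c \<in> C" for c x
        using that unfolding C_def q_def by (auto simp: fun_eq_iff PiE_def extensional_def)
      have "x \<in> (\<Union>c\<in>{c \<in> C. to_nat_on C c = n}. {x \<in> space \<kappa>. \<forall>k\<in>I. \<lfloor>hk k x / e\<rfloor> = c k})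
          \<longleftrightarrow> x \<in> space M \<and> (\<exists>c\<in>C. to_nat_on C c = n \<and> q x = c)" for x
        unfolding sets_eq_imp_space_eq[OF s] using qc by blast
      then show ?thesis using qC by (auto simp: A_def)
    qed
    also have "\<dots> \<in> sets \<kappa>"
    proof (rule sets.countable_UN'')
      show "countable {c \<in> C. to_nat_on C c = n}" using C by (rule countable_subset[rotated]) auto
      fix c
      have [measurable]: "k \<in> I \<Longrightarrow> hk k \<in> borel_measurable \<kappa>" for k using hk by auto
      show "{x \<in> space \<kappa>. \<forall>k\<in>I. \<lfloor>hk k x / e\<rfloor> = c k} \<in> sets \<kappa>"
        by (intro sets.sets_Collect_finite_All I) measurable
    qed
    finally show ?thesis using s by simp
  qed
  have disj: "disjoint_family A" by (auto simp: disjoint_family_on_def A_def)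
  have UN: "(\<Union>n. A n) = space M" by (auto simp: A_def)
  have osc: "\<bar>hk k x - hk k y\<bar> \<le> e" if "x \<in> A n" "y \<in> A n" "k \<in> I" for x y k n
  proof -
    have "q x = q y" using that(1,2) inj_on_to_nat_on[OF C] qC by (auto simp: A_def inj_on_def)
    then have "\<lfloor>hk k x / e\<rfloor> = \<lfloor>hk k y / e\<rfloor>" using that(3) unfolding q_def by (metis restrict_apply')
    then have "\<bar>hk k x / e - hk k y / e\<bar> \<le> 1" by linarith
    then show ?thesis using e by (simp add: field_simps flip: diff_divide_distrib)
  qed
  let ?n = "\<lambda>x. L2_set (\<lambda>k. hk k x) I"
  have nm: "norm_mat d (\<mu> B) = L2_set (\<lambda>k. LINT x:B|\<kappa>. hk k x) I" if "B \<in> sets M" for B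
    unfolding norm_mat_eq_frob I_def hk_def using eq that by (intro L2_set_cong) auto
  have int: "integrable \<kappa> ?n" by (rule integrable_L2_set[OF I hk])
  have "(\<integral>\<^sup>+x. ennreal (?n x) \<partial>\<kappa>) = (\<integral>\<^sup>+x\<in>(\<Union>n. A n). ennreal (?n x) \<partial>\<kappa>)"
    unfolding UN sets_eq_imp_space_eq[OF s, symmetric] by (intro nn_integral_cong) auto
  also have "\<dots> = (\<Sum>n. \<integral>\<^sup>+x\<in>A n. ennreal (?n x) \<partial>\<kappa>)"
    using Am s int by (intro nn_integral_disjoint_family disj) auto
  also have "\<dots> \<le> (\<Sum>n. ennreal (norm_mat d (\<mu> (A n))) + ennreal c * emeasure \<kappa> (A n))"
  proof (intro suminf_le summableI)
    fix n
    have An: "A n \<in> sets \<kappa>" using Am s by simp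
    have "(\<integral>\<^sup>+x\<in>A n. ennreal (?n x) \<partial>\<kappa>) = (\<integral>\<^sup>+x. ennreal (indicator (A n) x * ?n x) \<partial>\<kappa>)"
      by (intro nn_integral_cong) (auto simp: indicator_def)
    also have "\<dots> = ennreal (LINT x:A n|\<kappa>. ?n x)"
      unfolding set_lebesgue_integral_def real_scaleR_def
      using integrable_mult_indicator[OF An int] by (intro nn_integral_eq_integral) auto
    also have "\<dots> \<le> ennreal (norm_mat d (\<mu> (A n)) + c * measure \<kappa> (A n))"
      unfolding nm[OF Am] c_def
      by (intro ennreal_leI almost_constant_piece \<kappa> I hk An osc) (use e in auto)
    also have "\<dots> = ennreal (norm_mat d (\<mu> (A n))) + ennreal c * emeasure \<kappa> (A n)"
      using c by (simp add: emeasure_eq_measure ennreal_mult)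
    finally show "(\<integral>\<^sup>+x\<in>A n. ennreal (?n x) \<partial>\<kappa>) \<le> ennreal (norm_mat d (\<mu> (A n))) + ennreal c * emeasure \<kappa> (A n)" .
  qed
  also have "\<dots> = (\<Sum>n. ennreal (norm_mat d (\<mu> (A n)))) + ennreal c * emeasure \<kappa> (space M)"
  proof -
    have "(\<Sum>n. emeasure \<kappa> (A n)) = emeasure \<kappa> (space M)"
      unfolding UN[symmetric] using Am s disj by (intro suminf_emeasure) auto
    then have "(\<Sum>n. ennreal c * emeasure \<kappa> (A n)) = ennreal c * emeasure \<kappa> (space M)"
      by (simp only: ennreal_suminf_cmult)
    then show ?thesis by (subst suminf_add[symmetric]) (rule summableI, rule summableI, simp only:)
  qed
  also have "\<dots> \<le> total_variation M d \<mu> (space M) + ennreal \<epsilon>"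
  proof (rule add_mono)
    show "(\<Sum>n. ennreal (norm_mat d (\<mu> (A n)))) \<le> total_variation M d \<mu> (space M)"
      unfolding total_variation_def using Am disj UN by (intro SUP_upper) auto
    show "ennreal c * emeasure \<kappa> (space M) \<le> ennreal \<epsilon>"
      using ennreal_leI[OF c\<epsilon>] c by (simp add: emeasure_eq_measure flip: ennreal_mult)
  qed
  finally show "(\<integral>\<^sup>+x. ennreal (frob d (\<lambda>i j. h i j x)) \<partial>\<kappa>) \<le> total_variation M d \<mu> (space M) + ennreal \<epsilon>"
    by (simp add: hk_def I_def)
qed

lemma vector_measure_component:
  fixes \<mu> :: "'a set \<Rightarrow> real ^ 'n"
  assumes "vector_measure M \<mu>"
  shows "vector_measure M (\<lambda>B. \<mu> B $ j)"
  using assms unfolding vector_measure_def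
  using bounded_linear.sums[OF bounded_linear_vec_nth] by blast

text \<open>The final inequality is the direction that converts a bound on the mass of \<mu> into an
  L1 bound on its density. Setting \<open>h\<close> to 0 for rows beyond d makes integrability hold
  for all indices without a side condition.\<close>

lemma polar_decomposition:
  fixes \<mu> :: "'a set \<Rightarrow> nat \<Rightarrow> real ^ 'n"
  assumes v: "\<And>i. i < d \<Longrightarrow> vector_measure M (\<lambda>B. \<mu> B i)"
  obtains \<kappa> h where "finite_measure \<kappa>" "sets \<kappa> = sets M" "\<And>i j. integrable \<kappa> (h i j)"
    "\<And>i j B. i < d \<Longrightarrow> B \<in> sets M \<Longrightarrow> \<mu> B i $ j = (LINT x:B|\<kappa>. h i j x)"
    "(\<integral>\<^sup>+x. ennreal (frob d (\<lambda>i j. h i j x)) \<partial>\<kappa>) \<le> total_variation M d \<mu> (space M)"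
proof -
  obtain \<kappa> h where \<kappa>: "finite_measure \<kappa>" "sets \<kappa> = sets M"
    and h: "\<And>k. k \<in> {..<d} \<times> UNIV \<Longrightarrow> integrable \<kappa> (h k)"
    "\<And>k B. k \<in> {..<d} \<times> UNIV \<Longrightarrow> B \<in> sets M \<Longrightarrow> \<mu> B (fst k) $ snd k = (LINT x:B|\<kappa>. h k x)"
    by (rule Radon_Nikodym_family[of "{..<d} \<times> (UNIV :: 'n set)" M "\<lambda>k B. \<mu> B (fst k) $ snd k"])
      (auto intro!: vector_measure_component v)
  define h' where "h' i j = (if i < d then h (i, j) else (\<lambda>x. 0))" for i j
  have eq: "\<mu> B i $ j = (LINT x:B|\<kappa>. h' i j x)" if "i < d" "B \<in> sets M" for i j B
    using h(2)[of "(i, j)" B] that by (simp add: h'_def)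
  have int: "integrable \<kappa> (h' i j)" for i j using h(1) by (auto simp: h'_def)
  show thesis by (rule that[OF \<kappa> int eq total_variation_ge[OF \<kappa> int eq]])
qed

text \<open>By Minkowski's inequality the norm of \<open>\<mu> A\<close> is at most the integral
  over A of the Frobenius norm of the density, and this bound is itself a finite measure in
  A.\<close>

lemma total_variation_finite:
  fixes \<mu> :: "'a set \<Rightarrow> nat \<Rightarrow> real ^ 'n"
  assumes v: "\<And>i. i < d \<Longrightarrow> vector_measure M (\<lambda>B. \<mu> B i)"
  shows "total_variation M d \<mu> (space M) < \<infinity>"
proof (rule polar_decomposition[of d M \<mu>, OF v], assumption)
  fix \<kappa> h assume \<kappa>: "finite_measure \<kappa>" "sets \<kappa> = sets M" and h: "\<And>i j. integrable \<kappa> (h i j)"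
    and eq: "\<And>i j B. i < d \<Longrightarrow> B \<in> sets M \<Longrightarrow> \<mu> B i $ j = (LINT x:B|\<kappa>. h i j x)"
  let ?n = "\<lambda>x. frob d (\<lambda>i j. h i j x)"
  have int: "integrable \<kappa> ?n" by (rule integrable_L2_set) (use h in auto)
  have "total_variation M d \<mu> (space M) \<le> emeasure (density \<kappa> (\<lambda>x. ennreal (?n x))) (space M)"
  proof (rule total_variation_le)
    fix A assume A: "A \<in> sets M"
    then have A': "A \<in> sets \<kappa>" using \<kappa>(2) by simp
    have "norm_mat d (\<mu> A) = L2_set (\<lambda>k. \<integral>x. indicator A x * h (fst k) (snd k) x \<partial>\<kappa>) ({..<d} \<times> UNIV)"
      unfolding norm_mat_eq_frob using eq A by (intro L2_set_cong) (auto simp: set_lebesgue_integral_def)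
    also have "\<dots> \<le> (\<integral>x. L2_set (\<lambda>k. indicator A x * h (fst k) (snd k) x) ({..<d} \<times> UNIV) \<partial>\<kappa>)"
      using integrable_mult_indicator[OF A' h] by (intro L2_set_integral_le) auto
    also have "\<dots> = (\<integral>x. indicator A x * ?n x \<partial>\<kappa>)"
      by (intro Bochner_Integration.integral_cong) (auto simp: L2_set_right_distrib)
    finally have "ennreal (norm_mat d (\<mu> A)) \<le> ennreal (\<integral>x. indicator A x * ?n x \<partial>\<kappa>)"
      by (rule ennreal_leI)
    also have "\<dots> = (\<integral>\<^sup>+x. ennreal (indicator A x * ?n x) \<partial>\<kappa>)"
      using integrable_mult_indicator[OF A' int] by (intro nn_integral_eq_integral[symmetric]) auto
    also have "\<dots> = emeasure (density \<kappa> (\<lambda>x. ennreal (?n x))) A"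
      using int A' by (subst emeasure_density) (auto intro!: nn_integral_cong simp: indicator_def)
    finally show "ennreal (norm_mat d (\<mu> A)) \<le> emeasure (density \<kappa> (\<lambda>x. ennreal (?n x))) A" .
  qed (simp add: \<kappa>(2))
  also have "\<dots> = (\<integral>\<^sup>+x. ennreal (?n x) \<partial>\<kappa>)"
    unfolding sets_eq_imp_space_eq[OF \<kappa>(2), symmetric] using int
    by (subst emeasure_density) (auto intro!: nn_integral_cong)
  also have "\<dots> < \<infinity>" using int by (simp add: nn_integral_eq_integral)
  finally show ?thesis .
qed

subsection \<open>Convolution with a density\<close>

lemma lborel_distr_translate: "distr lborel borel (\<lambda>x::'a::euclidean_space. x + c) = lborel"
  using lborel_distr_plus[of c] by (subst add.commute)

lemma lborel_distr_reflect: "distr lborel borel (\<lambda>x::'a::euclidean_space. c - x) = lborel"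
  using lborel_affine[of "-1" c] by (simp add: density_1)

lemma nn_integral_lborel_translate:
  fixes f :: "'a::euclidean_space \<Rightarrow> ennreal"
  assumes "f \<in> borel_measurable borel"
  shows "(\<integral>\<^sup>+x. f (x + c) \<partial>lborel) = (\<integral>\<^sup>+x. f x \<partial>lborel)"
  using assms nn_integral_distr[of "\<lambda>x. x + c" lborel borel f] by (simp add: lborel_distr_translate)

lemma integral_lborel_translate:
  fixes f :: "'a::euclidean_space \<Rightarrow> real"
  assumes "f \<in> borel_measurable borel"
  shows "(\<integral>x. f (x + c) \<partial>lborel) = (\<integral>x. f x \<partial>lborel)"
  using assms integral_distr[of "\<lambda>x. x + c" lborel borel f] by (simp add: lborel_distr_translate)

lemma integral_lborel_reflect:
  fixes f :: "'a::euclidean_space \<Rightarrow> real"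
  assumes "f \<in> borel_measurable borel"
  shows "(\<integral>x. f (c - x) \<partial>lborel) = (\<integral>x. f x \<partial>lborel)"
  using assms integral_distr[of "\<lambda>x. c - x" lborel borel f] by (simp add: lborel_distr_reflect)

lemma mollifierD:
  assumes "is_mollifier r \<rho>"
  shows "smooth \<rho>" "\<rho> x \<ge> 0" "r < norm x \<Longrightarrow> \<rho> x = 0" "bounded_support \<rho>"
    "continuous_on UNIV \<rho>" "\<rho> \<in> borel_measurable borel" "integrable lborel \<rho>"
    "(\<integral>x. \<rho> x \<partial>lborel) = 1" "(\<integral>\<^sup>+x. ennreal (\<rho> x) \<partial>lborel) = 1"
proof -
  show s: "smooth \<rho>" and n: "\<And>x. \<rho> x \<ge> 0" and z: "\<And>x. r < norm x \<Longrightarrow> \<rho> x = 0"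
    using assms by (auto simp: is_mollifier_def)
  show "bounded_support \<rho>" unfolding bounded_support_def using z by (meson not_le)
  show c: "continuous_on UNIV \<rho>" by (rule smooth_continuous[OF s])
  show "\<rho> \<in> borel_measurable borel" by (rule borel_measurable_continuous_onI[OF c])
  show i: "integrable lborel \<rho>" and 1: "(\<integral>x. \<rho> x \<partial>lborel) = 1"
    using assms by (auto simp: is_mollifier_def has_bochner_integral_iff)
  show "(\<integral>\<^sup>+x. ennreal (\<rho> x) \<partial>lborel) = 1"
    using nn_integral_eq_integral[OF i] n 1 by simp
qed

text \<open>Tolerances are divided by H + 1 and not by H, since the norms H to which this is applied
  may vanish.\<close>

lemma divide_mult_less:
  fixes e H :: real
  assumes "e > 0" "H \<ge> 0"
  shows "e / (H + 1) * H < e"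
  using assms by (simp add: field_simps)

text \<open>The convolution of \<rho> with the measure of density \<open>h\<close> against \<kappa>.
  The measure is a parameter because functions are mollified against Lebesgue measure, but
  \<open>D \<Omega> d g\<close> and \<open>G\<close> against the measures from their polar
  decompositions.\<close>

definition conv :: "('a \<Rightarrow> real) \<Rightarrow> 'a measure \<Rightarrow> ('a \<Rightarrow> real) \<Rightarrow> 'a::euclidean_space \<Rightarrow> real" where
  "conv \<rho> \<kappa> h x = (\<integral>y. \<rho> (x - y) * h y \<partial>\<kappa>)"

text \<open>Asking only that the identity be measurable covers Lebesgue measure as well as measures
  whose space is just \<Omega>: functions on the whole space then remain measurable
  integrands.\<close>

locale euclidean_measure = sigma_finite_measure \<kappa> for \<kappa> :: "(real ^ 'n) measure" +
  assumes id_measurable [measurable]: "(\<lambda>y. y) \<in> measurable \<kappa> borel"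
begin

lemma conv_integrable:
  assumes \<rho>: "continuous_on UNIV \<rho>" "bounded_support \<rho>" and h: "integrable \<kappa> h"
  shows "integrable \<kappa> (\<lambda>y. \<rho> (x - y) * h y)"
proof -
  obtain B where B: "\<And>x. \<bar>\<rho> x\<bar> \<le> B" using bounded_support_bounded[OF \<rho>] by blast
  have [measurable]: "\<rho> \<in> borel_measurable borel" by (rule borel_measurable_continuous_onI[OF \<rho>(1)])
  have "integrable \<kappa> (\<lambda>y. h y * \<rho> (x - y))"
    by (rule integrable_mult_bounded[OF h, of _ B]) (use B in auto)
  then show ?thesis by (simp add: mult.commute)
qed

lemma conv_continuous:
  assumes \<rho>: "continuous_on UNIV \<rho>" "bounded_support \<rho>" and h: "integrable \<kappa> h"
  shows "continuous_on UNIV (conv \<rho> \<kappa> h)"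
  unfolding continuous_on_iff
proof (intro ballI allI impI)
  fix x :: "real ^ 'n" and e :: real assume e: "e > 0"
  let ?H = "\<integral>y. \<bar>h y\<bar> \<partial>\<kappa>"
  have H: "?H \<ge> 0" by (intro integral_nonneg_AE) auto
  then have "e / (?H + 1) > 0" using e by (intro divide_pos_pos) linarith+
  from bounded_support_uniformly_continuous[OF \<rho> this]
  obtain d where d: "d > 0" "\<And>x y. norm (x - y) < d \<Longrightarrow> \<bar>\<rho> x - \<rho> y\<bar> < e / (?H + 1)" by blast
  have "dist (conv \<rho> \<kappa> h x') (conv \<rho> \<kappa> h x) < e" if "dist x' x < d" for x'
  proof -
    have "conv \<rho> \<kappa> h x' - conv \<rho> \<kappa> h x = (\<integral>y. (\<rho> (x' - y) - \<rho> (x - y)) * h y \<partial>\<kappa>)"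
      unfolding conv_def using conv_integrable[OF \<rho> h] by (simp add: left_diff_distrib)
    also have "\<bar>\<dots>\<bar> \<le> (\<integral>y. \<bar>(\<rho> (x' - y) - \<rho> (x - y)) * h y\<bar> \<partial>\<kappa>)" by (rule integral_abs_bound)
    also have "\<dots> \<le> (\<integral>y. e / (?H + 1) * \<bar>h y\<bar> \<partial>\<kappa>)"
    proof (rule integral_mono)
      show "integrable \<kappa> (\<lambda>y. \<bar>(\<rho> (x' - y) - \<rho> (x - y)) * h y\<bar>)"
        using conv_integrable[OF \<rho> h] by (simp add: left_diff_distrib)
      fix y
      have "\<bar>\<rho> (x' - y) - \<rho> (x - y)\<bar> \<le> e / (?H + 1)"
        by (rule less_imp_le, rule d(2)) (use that in \<open>simp add: dist_norm\<close>)
      then show "\<bar>(\<rho> (x' - y) - \<rho> (x - y)) * h y\<bar> \<le> e / (?H + 1) * \<bar>h y\<bar>"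
        unfolding abs_mult by (rule mult_right_mono) simp
    qed (use h in auto)
    also have "\<dots> = e / (?H + 1) * ?H" by simp
    also have "\<dots> < e" by (rule divide_mult_less[OF e H])
    finally show ?thesis by (simp add: dist_norm)
  qed
  then show "\<exists>d>0. \<forall>x'\<in>UNIV. dist x' x < d \<longrightarrow> dist (conv \<rho> \<kappa> h x') (conv \<rho> \<kappa> h x) < e"
    using d(1) by blast
qed

text \<open>By \<open>C1_uniform_differentiability\<close> the remainder in the expansion of \<rho>
  is small uniformly in the base point, so it can be integrated against the absolute value of h
  directly.\<close>

lemma conv_has_derivative:
  assumes \<rho>: "C_k (Suc 0) \<rho>" "bounded_support \<rho>" and h: "integrable \<kappa> h"
  shows "(conv \<rho> \<kappa> h has_derivative (\<lambda>k. \<Sum>j\<in>UNIV. k $ j * conv (partial_deriv j \<rho>) \<kappa> h x)) (at x)"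
  unfolding has_derivative_at_alt
proof (intro conjI allI impI)
  let ?L = "\<lambda>k. \<Sum>j\<in>UNIV. k $ j * conv (partial_deriv j \<rho>) \<kappa> h x"
  show "bounded_linear ?L"
    by (intro bounded_linear_sum bounded_linear_mult_const bounded_linear_vec_nth)
  fix e :: real assume e: "e > 0"
  let ?H = "\<integral>y. \<bar>h y\<bar> \<partial>\<kappa>"
  have H: "?H \<ge> 0" by (intro integral_nonneg_AE) auto
  then have e': "e / (?H + 1) > 0" using e by (intro divide_pos_pos) linarith+
  obtain d where d: "d > 0" "\<And>x k. norm k < d \<Longrightarrow>
      \<bar>\<rho> (x + k) - \<rho> x - (\<Sum>j\<in>UNIV. k $ j * partial_deriv j \<rho> x)\<bar> \<le> e / (?H + 1) * norm k"
    using C1_uniform_differentiability[OF \<rho> e'] by blast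
  have c: "continuous_on UNIV \<rho>" by (rule C_k_imp_continuous[OF \<rho>(1)])
  have pd: "continuous_on UNIV (partial_deriv j \<rho>)" "bounded_support (partial_deriv j \<rho>)" for j
    using \<rho> bounded_support_partial_deriv by auto
  note int = conv_integrable[OF c \<rho>(2) h] conv_integrable[OF pd h]
  have "norm (conv \<rho> \<kappa> h x' - conv \<rho> \<kappa> h x - ?L (x' - x)) \<le> e * norm (x' - x)"
    if "norm (x' - x) < d" for x'
  proof -
    define k where "k = x' - x"
    let ?R = "\<lambda>y. \<rho> (x - y + k) - \<rho> (x - y) - (\<Sum>j\<in>UNIV. k $ j * partial_deriv j \<rho> (x - y))"
    have eq: "\<rho> (x' - y) * h y - \<rho> (x - y) * h y
        - (\<Sum>j\<in>UNIV. k $ j * (partial_deriv j \<rho> (x - y) * h y)) = ?R y * h y" for y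
      by (simp add: k_def algebra_simps sum_distrib_right sum_distrib_left)
    have intR: "integrable \<kappa> (\<lambda>y. ?R y * h y)"
      unfolding eq[symmetric]
      by (intro Bochner_Integration.integrable_diff Bochner_Integration.integrable_sum integrable_mult_right int)
    have "conv \<rho> \<kappa> h x' - conv \<rho> \<kappa> h x - ?L k = (\<integral>y. ?R y * h y \<partial>\<kappa>)"
      unfolding eq[symmetric] conv_def using int by simp
    also have "\<bar>\<dots>\<bar> \<le> (\<integral>y. \<bar>?R y * h y\<bar> \<partial>\<kappa>)" by (rule integral_abs_bound)
    also have "\<dots> \<le> (\<integral>y. e / (?H + 1) * norm k * \<bar>h y\<bar> \<partial>\<kappa>)"
    proof (rule integral_mono)
      fix y
      show "\<bar>?R y * h y\<bar> \<le> e / (?H + 1) * norm k * \<bar>h y\<bar>"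
        unfolding abs_mult by (rule mult_right_mono[OF d(2)]) (use that k_def in auto)
    qed (use intR h in auto)
    also have "\<dots> = (e / (?H + 1) * ?H) * norm k" by simp
    also have "\<dots> \<le> e * norm k" using divide_mult_less[OF e H] by (intro mult_right_mono) auto
    finally show ?thesis by (simp add: k_def)
  qed
  then show "\<exists>d>0. \<forall>x'. norm (x' - x) < d \<longrightarrow>
      norm (conv \<rho> \<kappa> h x' - conv \<rho> \<kappa> h x - ?L (x' - x)) \<le> e * norm (x' - x)"
    using d(1) by blast
qed

lemma partial_deriv_conv:
  assumes \<rho>: "C_k (Suc 0) \<rho>" "bounded_support \<rho>" and h: "integrable \<kappa> h"
  shows "partial_deriv j (conv \<rho> \<kappa> h) = conv (partial_deriv j \<rho>) \<kappa> h"
proof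
  fix x
  have "(\<Sum>i\<in>UNIV. axis j 1 $ i * conv (partial_deriv i \<rho>) \<kappa> h x)
      = (\<Sum>i\<in>UNIV. if i = j then conv (partial_deriv i \<rho>) \<kappa> h x else 0)"
    by (intro sum.cong) (auto simp: axis_def)
  then show "partial_deriv j (conv \<rho> \<kappa> h) x = conv (partial_deriv j \<rho>) \<kappa> h x"
    using partial_deriv_eq[OF conv_has_derivative[OF assms], of j x] by simp
qed

lemma C_k_conv:
  assumes "C_k k \<rho>" "bounded_support \<rho>" and h: "integrable \<kappa> h"
  shows "C_k k (conv \<rho> \<kappa> h)"
  using assms(1,2)
proof (induction k arbitrary: \<rho>)
  case 0
  then show ?case using conv_continuous h by simp
next
  case (Suc k)
  have 1: "C_k (Suc 0) \<rho>"
    using Suc.prems(1) C_k_imp_continuous by auto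
  have "\<forall>x. conv \<rho> \<kappa> h differentiable (at x)"
    using conv_has_derivative[OF 1 Suc.prems(2) h] differentiable_def by blast
  moreover have "C_k k (conv (partial_deriv j \<rho>) \<kappa> h)" for j
    by (rule Suc.IH) (use Suc.prems bounded_support_partial_deriv in auto)
  ultimately show ?case using partial_deriv_conv[OF 1 Suc.prems(2) h] by simp
qed

lemma smooth_conv:
  assumes "smooth \<rho>" "bounded_support \<rho>" "integrable \<kappa> h"
  shows "smooth (conv \<rho> \<kappa> h)" "partial_deriv j (conv \<rho> \<kappa> h) = conv (partial_deriv j \<rho>) \<kappa> h"
  using assms C_k_conv partial_deriv_conv unfolding smooth_def by blast+

lemma measurable_conv:
  assumes "continuous_on UNIV \<rho>" "bounded_support \<rho>" "integrable \<kappa> h"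
  shows "conv \<rho> \<kappa> h \<in> borel_measurable borel"
  by (rule borel_measurable_continuous_onI[OF conv_continuous[OF assms]])

text \<open>Mollification does not increase mass, by Minkowski's inequality and Tonelli's theorem.
  Treating the whole family under one norm, and not each component separately, is what keeps the
  later constants free of d.\<close>

lemma nn_integral_conv_L2:
  fixes h :: "'k \<Rightarrow> real ^ 'n \<Rightarrow> real"
  assumes \<rho>: "is_mollifier r \<rho>" and I: "finite I" and h: "\<And>k. k \<in> I \<Longrightarrow> integrable \<kappa> (h k)"
  shows "(\<integral>\<^sup>+x. ennreal (L2_set (\<lambda>k. conv \<rho> \<kappa> (h k) x) I) \<partial>lborel)
    \<le> (\<integral>\<^sup>+y. ennreal (L2_set (\<lambda>k. h k y) I) \<partial>\<kappa>)"
proof -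
  note [measurable] = mollifierD(6)[OF \<rho>]
  have [measurable]: "k \<in> I \<Longrightarrow> h k \<in> borel_measurable \<kappa>" for k using h by auto
  let ?n = "\<lambda>y. L2_set (\<lambda>k. h k y) I"
  have [measurable]: "?n \<in> borel_measurable \<kappa>" by (rule borel_measurable_L2_set) measurable
  interpret pair_sigma_finite lborel \<kappa> by unfold_locales
  have int: "integrable \<kappa> (\<lambda>y. \<rho> (x - y) * ?n y)" for x
    by (rule conv_integrable[OF mollifierD(5,4)[OF \<rho>] integrable_L2_set[OF I h]])
  have "ennreal (L2_set (\<lambda>k. conv \<rho> \<kappa> (h k) x) I) \<le> (\<integral>\<^sup>+y. ennreal (\<rho> (x - y) * ?n y) \<partial>\<kappa>)" for x
  proof -
    have "L2_set (\<lambda>k. conv \<rho> \<kappa> (h k) x) I \<le> (\<integral>y. L2_set (\<lambda>k. \<rho> (x - y) * h k y) I \<partial>\<kappa>)"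
      unfolding conv_def
      by (rule L2_set_integral_le[OF I]) (rule conv_integrable[OF mollifierD(5,4)[OF \<rho>] h])
    also have "\<dots> = (\<integral>y. \<rho> (x - y) * ?n y \<partial>\<kappa>)"
      using mollifierD(2)[OF \<rho>] by (intro Bochner_Integration.integral_cong) (auto simp: L2_set_right_distrib)
    finally have "ennreal (L2_set (\<lambda>k. conv \<rho> \<kappa> (h k) x) I) \<le> ennreal (\<integral>y. \<rho> (x - y) * ?n y \<partial>\<kappa>)"
      by (rule ennreal_leI)
    also have "\<dots> = (\<integral>\<^sup>+y. ennreal (\<rho> (x - y) * ?n y) \<partial>\<kappa>)"
      using int mollifierD(2)[OF \<rho>] by (intro nn_integral_eq_integral[symmetric]) auto
    finally show ?thesis .
  qed
  then have "(\<integral>\<^sup>+x. ennreal (L2_set (\<lambda>k. conv \<rho> \<kappa> (h k) x) I) \<partial>lborel)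
      \<le> (\<integral>\<^sup>+x. \<integral>\<^sup>+y. ennreal (\<rho> (x - y) * ?n y) \<partial>\<kappa> \<partial>lborel)"
    by (intro nn_integral_mono)
  also have "\<dots> = (\<integral>\<^sup>+y. \<integral>\<^sup>+x. ennreal (\<rho> (x - y) * ?n y) \<partial>lborel \<partial>\<kappa>)"
    by (rule Fubini'[symmetric]) measurable
  also have "\<dots> = (\<integral>\<^sup>+y. ennreal (?n y) \<partial>\<kappa>)"
  proof (rule nn_integral_cong)
    fix y
    have "(\<integral>\<^sup>+x. ennreal (\<rho> (x - y) * ?n y) \<partial>lborel) = (\<integral>\<^sup>+x. ennreal (\<rho> (x - y)) * ennreal (?n y) \<partial>lborel)"
      using mollifierD(2)[OF \<rho>] by (intro nn_integral_cong) (simp add: ennreal_mult)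
    also have "\<dots> = (\<integral>\<^sup>+x. ennreal (\<rho> (x + (- y))) \<partial>lborel) * ennreal (?n y)"
      by (subst nn_integral_multc) auto
    also have "(\<integral>\<^sup>+x. ennreal (\<rho> (x + (- y))) \<partial>lborel) = 1"
      using nn_integral_lborel_translate[of "\<lambda>x. ennreal (\<rho> x)" "- y"] mollifierD(9)[OF \<rho>] by simp
    finally show "(\<integral>\<^sup>+x. ennreal (\<rho> (x - y) * ?n y) \<partial>lborel) = ennreal (?n y)" by simp
  qed
  finally show ?thesis .
qed

lemma nn_integral_conv_abs:
  assumes \<rho>: "is_mollifier r \<rho>" and h: "integrable \<kappa> h"
  shows "(\<integral>\<^sup>+x. ennreal \<bar>conv \<rho> \<kappa> h x\<bar> \<partial>lborel) \<le> (\<integral>\<^sup>+y. ennreal \<bar>h y\<bar> \<partial>\<kappa>)"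
  using nn_integral_conv_L2[OF \<rho>, of "{()}" "\<lambda>_. h"] h by simp

lemma integrable_conv:
  assumes \<rho>: "is_mollifier r \<rho>" and h: "integrable \<kappa> h"
  shows "integrable lborel (conv \<rho> \<kappa> h)"
proof (rule integrableI_bounded)
  show "conv \<rho> \<kappa> h \<in> borel_measurable lborel"
    using measurable_conv[OF mollifierD(5,4)[OF \<rho>] h] by simp
  have "(\<integral>\<^sup>+y. ennreal \<bar>h y\<bar> \<partial>\<kappa>) < \<infinity>" using h by (simp add: nn_integral_eq_integral)
  then show "(\<integral>\<^sup>+x. ennreal (norm (conv \<rho> \<kappa> h x)) \<partial>lborel) < \<infinity>"
    using nn_integral_conv_abs[OF assms] by (simp add: le_less_trans)
qed

lemma integral_conv_abs:
  assumes \<rho>: "is_mollifier r \<rho>" and h: "integrable \<kappa> h"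
  shows "(\<integral>x. \<bar>conv \<rho> \<kappa> h x\<bar> \<partial>lborel) \<le> (\<integral>y. \<bar>h y\<bar> \<partial>\<kappa>)"
proof -
  have "ennreal (\<integral>x. \<bar>conv \<rho> \<kappa> h x\<bar> \<partial>lborel) \<le> ennreal (\<integral>y. \<bar>h y\<bar> \<partial>\<kappa>)"
    using nn_integral_conv_abs[OF assms] integrable_conv[OF assms] h by (simp add: nn_integral_eq_integral)
  then show ?thesis by (subst (asm) ennreal_le_iff) (auto intro: integral_nonneg_AE)
qed

text \<open>Fubini's theorem moves the mollifier to the bounded function \<phi>. Integrability on
  the product comes from the convolution of the absolute value of h, since mollifiers are
  nonnegative.\<close>

lemma integral_mult_conv:
  assumes \<rho>: "is_mollifier r \<rho>" and h: "integrable \<kappa> h"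
    and \<phi>: "\<phi> \<in> borel_measurable borel" "\<And>x. \<bar>\<phi> x\<bar> \<le> C"
  shows "(\<integral>x. \<phi> x * conv \<rho> \<kappa> h x \<partial>lborel) = (\<integral>y. (\<integral>x. \<phi> x * \<rho> (x - y) \<partial>lborel) * h y \<partial>\<kappa>)"
proof -
  note [measurable] = mollifierD(6)[OF \<rho>] \<phi>(1)
  have [measurable]: "h \<in> borel_measurable \<kappa>" using h by auto
  interpret pair_sigma_finite lborel \<kappa> by unfold_locales
  have "integrable (lborel \<Otimes>\<^sub>M \<kappa>) (\<lambda>(x, y). \<phi> x * (\<rho> (x - y) * h y))"
  proof (rule Fubini_integrable)
    have "integrable lborel (\<lambda>x. conv \<rho> \<kappa> (\<lambda>y. \<bar>h y\<bar>) x * \<bar>\<phi> x\<bar>)"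
      by (rule integrable_mult_bounded[OF integrable_conv[OF \<rho>], of _ _ C]) (use h \<phi> in auto)
    also have "(\<lambda>x. conv \<rho> \<kappa> (\<lambda>y. \<bar>h y\<bar>) x * \<bar>\<phi> x\<bar>)
        = (\<lambda>x. \<integral>y. norm (case (x, y) of (x, y) \<Rightarrow> \<phi> x * (\<rho> (x - y) * h y)) \<partial>\<kappa>)"
      using mollifierD(2)[OF \<rho>] by (simp add: conv_def abs_mult mult.commute fun_eq_iff)
    finally show "integrable lborel (\<lambda>x. \<integral>y. norm (case (x, y) of (x, y) \<Rightarrow> \<phi> x * (\<rho> (x - y) * h y)) \<partial>\<kappa>)" .
    show "AE x in lborel. integrable \<kappa> (\<lambda>y. case (x, y) of (x, y) \<Rightarrow> \<phi> x * (\<rho> (x - y) * h y))"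
      using conv_integrable[OF mollifierD(5,4)[OF \<rho>] h] by simp
  qed measurable
  from Fubini_integral[OF this]
  have "(\<integral>y. (\<integral>x. \<phi> x * (\<rho> (x - y) * h y) \<partial>lborel) \<partial>\<kappa>) = (\<integral>x. (\<integral>y. \<phi> x * (\<rho> (x - y) * h y) \<partial>\<kappa>) \<partial>lborel)" .
  then show ?thesis
    by (simp add: conv_def mult.assoc[symmetric] del: integral_mult_right_zero)
       (simp add: mult.assoc)
qed

lemma conv_eq_0:
  assumes \<rho>: "is_mollifier r \<rho>" and z: "\<And>y. y \<in> space \<kappa> \<Longrightarrow> dist x y \<le> r \<Longrightarrow> h y = 0"
  shows "conv \<rho> \<kappa> h x = 0"
proof -
  have "conv \<rho> \<kappa> h x = (\<integral>y. 0 \<partial>\<kappa>)"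
    unfolding conv_def using z mollifierD(3)[OF \<rho>]
    by (intro Bochner_Integration.integral_cong) (auto simp: dist_norm not_le, meson not_le)
  then show ?thesis by simp
qed

lemma conv_diff:
  assumes "is_mollifier r \<rho>" "integrable \<kappa> f" "integrable \<kappa> g"
  shows "conv \<rho> \<kappa> (\<lambda>y. f y - g y) x = conv \<rho> \<kappa> f x - conv \<rho> \<kappa> g x"
  unfolding conv_def
  using conv_integrable[OF mollifierD(5,4)[OF assms(1)] assms(2)]
    conv_integrable[OF mollifierD(5,4)[OF assms(1)] assms(3)]
  by (simp add: right_diff_distrib)

end

lemma euclidean_measure_lborel: "euclidean_measure lborel"
  by (intro euclidean_measure.intro euclidean_measure_axioms.intro sigma_finite_lborel) simp

interpretation lborel: euclidean_measure "lborel :: (real ^ 'n) measure"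
  by (rule euclidean_measure_lborel)

lemma euclidean_measure_borel_on:
  assumes "finite_measure \<kappa>" "sets \<kappa> = sets (borel_on \<Omega>)"
  shows "euclidean_measure \<kappa>"
proof (intro euclidean_measure.intro euclidean_measure_axioms.intro)
  show "sigma_finite_measure \<kappa>" using assms(1) finite_measure_def by blast
  have "(\<lambda>y. y) \<in> measurable (borel_on \<Omega>) borel" by (rule measurable_restrict_space1) simp
  then show "(\<lambda>y. y) \<in> measurable \<kappa> borel" using measurable_cong_sets[OF assms(2) refl] by blast
qed

lemma mollifier_integral:
  assumes \<rho>: "is_mollifier r \<rho>"
  shows "(\<integral>y. \<rho> (x - y) \<partial>lborel) = 1" "(\<integral>y. \<rho> (y - x) \<partial>lborel) = 1"
  using integral_lborel_reflect[OF mollifierD(6)[OF \<rho>], of x]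
    integral_lborel_translate[OF mollifierD(6)[OF \<rho>], of "- x"] mollifierD(8)[OF \<rho>] by simp_all

lemma mollifier_integrable:
  assumes \<rho>: "is_mollifier r \<rho>"
  shows "integrable lborel (\<lambda>y. \<rho> (x - y))" "integrable lborel (\<lambda>y. \<rho> (y - x))"
  using mollifier_integral[OF \<rho>, of x] not_integrable_integral_eq by fastforce+

text \<open>Mollifiers are not assumed to be even, hence two versions: a convolution contains
  \<open>\<rho> (x - y)\<close>, whereas its adjoint, which appears when a measure is mollified,
  contains \<open>\<rho> (y - x)\<close>.\<close>

lemma mollified_value_close:
  assumes \<rho>: "is_mollifier r \<rho>" and f: "f \<in> borel_measurable borel"
    and b: "\<And>y. dist x y \<le> r \<Longrightarrow> \<bar>f y - c\<bar> \<le> e"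
  shows "\<bar>(\<integral>y. f y * \<rho> (x - y) \<partial>lborel) - c\<bar> \<le> e" "\<bar>(\<integral>y. f y * \<rho> (y - x) \<partial>lborel) - c\<bar> \<le> e"
proof -
  have main: "\<bar>(\<integral>y. f y * k y \<partial>lborel) - c\<bar> \<le> e"
    if k: "integrable lborel k" "(\<integral>y. k y \<partial>lborel) = 1" "\<And>y. k y \<ge> 0" "\<And>y. r < dist x y \<Longrightarrow> k y = 0" for k
  proof -
    have le: "\<bar>(f y - c) * k y\<bar> \<le> e * k y" for y
      using b[of y] k(3)[of y] k(4)[of y]
      by (cases "dist x y \<le> r") (auto simp: abs_mult intro!: mult_right_mono)
    have [measurable]: "k \<in> borel_measurable borel" using borel_measurable_integrable[OF k(1)] by simp
    have int: "integrable lborel (\<lambda>y. (f y - c) * k y)"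
      by (rule Bochner_Integration.integrable_bound[OF integrable_mult_right[OF k(1), of e]])
        (use f le in \<open>auto intro: order_trans[OF _ abs_ge_self]\<close>)
    then have "integrable lborel (\<lambda>y. (f y - c) * k y + c * k y)" using k(1) by simp
    then have "integrable lborel (\<lambda>y. f y * k y)" by (simp add: algebra_simps)
    then have "(\<integral>y. f y * k y \<partial>lborel) - c = (\<integral>y. (f y - c) * k y \<partial>lborel)"
      using k(1,2) by (simp add: left_diff_distrib)
    also have "\<bar>\<dots>\<bar> \<le> (\<integral>y. \<bar>(f y - c) * k y\<bar> \<partial>lborel)" by (rule integral_abs_bound)
    also have "\<dots> \<le> (\<integral>y. e * k y \<partial>lborel)" by (rule integral_mono) (use int k le in auto)
    finally show ?thesis using k(2) by simp
  qed
  show "\<bar>(\<integral>y. f y * \<rho> (x - y) \<partial>lborel) - c\<bar> \<le> e"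
    by (rule main) (use mollifier_integrable[OF \<rho>] mollifier_integral[OF \<rho>] mollifierD(2,3)[OF \<rho>] in
        \<open>auto simp: dist_norm\<close>)
  show "\<bar>(\<integral>y. f y * \<rho> (y - x) \<partial>lborel) - c\<bar> \<le> e"
    by (rule main) (use mollifier_integrable[OF \<rho>] mollifier_integral[OF \<rho>] mollifierD(2,3)[OF \<rho>] in
        \<open>auto simp: dist_norm norm_minus_commute\<close>)
qed

lemma conv_close:
  assumes "is_mollifier r \<rho>" "f \<in> borel_measurable borel" "\<And>y. dist x y \<le> r \<Longrightarrow> \<bar>f y - c\<bar> \<le> e"
  shows "\<bar>conv \<rho> lborel f x - c\<bar> \<le> e"
  using mollified_value_close(1)[OF assms] by (simp add: conv_def mult.commute)

subsection \<open>Mollification converges in L1\<close>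

definition mollifies :: "(real ^ 'n \<Rightarrow> real) \<Rightarrow> bool" where
  "mollifies f \<longleftrightarrow> (\<lambda>m. \<integral>x. \<bar>conv (mollifier m) lborel f x - f x\<bar> \<partial>lborel) \<longlonglongrightarrow> 0"

text \<open>Mollification is a contraction of L1, so replacing f by a nearby g costs the distance
  twice; the convergence for g supplies the remaining third of the tolerance.\<close>

lemma mollifies_limit:
  fixes f :: "real ^ 'n \<Rightarrow> real"
  assumes f: "integrable lborel f"
    and g: "\<And>e. e > 0 \<Longrightarrow> \<exists>g. integrable lborel g \<and> mollifies g \<and> (\<integral>x. \<bar>f x - g x\<bar> \<partial>lborel) < e"
  shows "mollifies f"
  unfolding mollifies_def
proof (rule LIMSEQ_I)
  fix e :: real assume "e > 0"
  then have e: "e / 3 > 0" by simp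
  then obtain g where g: "integrable lborel g" "mollifies g" "(\<integral>x. \<bar>f x - g x\<bar> \<partial>lborel) < e / 3"
    using g by blast
  obtain M where M: "\<And>m. m \<ge> M \<Longrightarrow> \<bar>\<integral>x. \<bar>conv (mollifier m) lborel g x - g x\<bar> \<partial>lborel\<bar> < e / 3"
    using LIMSEQ_D[OF g(2)[unfolded mollifies_def] e] by auto
  have "\<bar>\<integral>x. \<bar>conv (mollifier m) lborel f x - f x\<bar> \<partial>lborel\<bar> < e" if m: "m \<ge> M" for m
  proof -
    let ?c = "\<lambda>f. conv (mollifier m :: real ^ 'n \<Rightarrow> real) lborel f"
    have int: "integrable lborel (?c f)" "integrable lborel (?c g)"
      using f g lborel.integrable_conv[OF mollifier] by auto
    have i1: "integrable lborel (\<lambda>x. f x - g x)" using f g by simp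
    have "(\<integral>x. \<bar>?c f x - f x\<bar> \<partial>lborel)
        \<le> (\<integral>x. \<bar>?c (\<lambda>y. f y - g y) x\<bar> + \<bar>?c g x - g x\<bar> + \<bar>f x - g x\<bar> \<partial>lborel)"
      using int f g lborel.integrable_conv[OF mollifier i1]
      by (intro integral_mono) (auto simp: lborel.conv_diff[OF mollifier f g(1)])
    also have "\<dots> = (\<integral>x. \<bar>?c (\<lambda>y. f y - g y) x\<bar> \<partial>lborel) + (\<integral>x. \<bar>?c g x - g x\<bar> \<partial>lborel)
        + (\<integral>x. \<bar>f x - g x\<bar> \<partial>lborel)"
      using int f g lborel.integrable_conv[OF mollifier i1] by simp
    also have "(\<integral>x. \<bar>?c (\<lambda>y. f y - g y) x\<bar> \<partial>lborel) \<le> (\<integral>x. \<bar>f x - g x\<bar> \<partial>lborel)"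
      by (rule lborel.integral_conv_abs[OF mollifier i1])
    finally have "(\<integral>x. \<bar>?c f x - f x\<bar> \<partial>lborel) < e" using g(3) M[OF m] by linarith
    moreover have "(\<integral>x. \<bar>?c f x - f x\<bar> \<partial>lborel) \<ge> 0" by (intro integral_nonneg_AE) auto
    ultimately show ?thesis by simp
  qed
  then show "\<exists>no. \<forall>m\<ge>no. norm ((\<integral>x. \<bar>conv (mollifier m) lborel f x - f x\<bar> \<partial>lborel) - 0) < e" by auto
qed

text \<open>Scheffe's argument: the mollification and the indicator have the same integral, so their
  L1 distance is twice the integral of the positive part of the indicator minus the mollification.
  That part is dominated by the indicator and tends to 0 everywhere; at points of U this is where
  openness enters.\<close>

lemma mollifies_open:
  fixes U :: "(real ^ 'n) set"
  assumes U: "open U" "emeasure lborel U < \<infinity>"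
  shows "mollifies (indicator U)"
proof -
  let ?u = "indicator U :: real ^ 'n \<Rightarrow> real"
  let ?c = "\<lambda>m. conv (mollifier m :: real ^ 'n \<Rightarrow> real) lborel ?u"
  have [measurable]: "U \<in> sets borel" using U by simp
  have u: "integrable lborel ?u" using U by simp
  have cint: "integrable lborel (?c m)" for m by (rule lborel.integrable_conv[OF mollifier u])
  have c0: "?c m x \<ge> 0" for m x
    unfolding conv_def using mollifierD(2)[OF mollifier] by (intro integral_nonneg_AE AE_I2 mult_nonneg_nonneg) auto
  have int: "(\<integral>x. ?c m x \<partial>lborel) = (\<integral>x. ?u x \<partial>lborel)" for m
    using lborel.integral_mult_conv[OF mollifier u, of "\<lambda>x. 1" 1 m] by (simp add: mollifier_integral(2)[OF mollifier])
  have lim: "(\<lambda>m. \<integral>x. max 0 (?u x - ?c m x) \<partial>lborel) \<longlonglongrightarrow> integral\<^sup>L lborel (\<lambda>x::real ^ 'n. 0)"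
  proof (rule integral_dominated_convergence[where w="?u"])
    show "AE x in lborel. (\<lambda>m. max 0 (?u x - ?c m x)) \<longlonglongrightarrow> 0"
    proof (rule AE_I2)
      fix x :: "real ^ 'n"
      show "(\<lambda>m. max 0 (?u x - ?c m x)) \<longlonglongrightarrow> 0"
      proof (cases "x \<in> U")
        case True
        then obtain e where e: "e > 0" "ball x e \<subseteq> U" using U(1) open_contains_ball by blast
        obtain M where M: "1 / real (Suc M) < e" using e(1) nat_approx_posE by blast
        have "?c m x = 1" if "m \<ge> M" for m
        proof -
          have "1 / real (Suc m) \<le> 1 / real (Suc M)" using that by (simp add: frac_le)
          then have "dist x y \<le> 1 / real (Suc m) \<Longrightarrow> y \<in> U" for y using e(2) M by auto
          then have "\<bar>?c m x - 1\<bar> \<le> 0" by (intro conv_close[OF mollifier]) auto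
          then show ?thesis by simp
        qed
        then show ?thesis using True
          by (intro tendsto_eventually) (auto simp: eventually_sequentially intro!: exI[of _ M])
      next
        case False
        then have "max 0 (?u x - ?c m x) = 0" for m using c0[of m x] by simp
        then show ?thesis by simp
      qed
    qed
    show "AE x in lborel. norm (max 0 (?u x - ?c m x)) \<le> ?u x" for m
      using c0 by (intro AE_I2) (auto simp: max_def)
  qed (use u borel_measurable_integrable[OF cint] in auto)
  have "(\<integral>x. \<bar>?c m x - ?u x\<bar> \<partial>lborel) = 2 * (\<integral>x. max 0 (?u x - ?c m x) \<partial>lborel)" for m
  proof -
    have "(\<integral>x. \<bar>?c m x - ?u x\<bar> \<partial>lborel) = (\<integral>x. (?c m x - ?u x) + 2 * max 0 (?u x - ?c m x) \<partial>lborel)"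
      by (intro Bochner_Integration.integral_cong) (simp_all add: max_def abs_if)
    also have "\<dots> = 2 * (\<integral>x. max 0 (?u x - ?c m x) \<partial>lborel)"
      using u cint int by (subst Bochner_Integration.integral_add) (auto intro!: integrable_max)
    finally show ?thesis .
  qed
  then show ?thesis unfolding mollifies_def using tendsto_mult[OF tendsto_const lim, of 2] by simp
qed

lemma mollifies_add:
  assumes "integrable lborel f" "integrable lborel g" "mollifies f" "mollifies g"
  shows "mollifies (\<lambda>x. f x + g x)"
proof -
  have lim: "(\<lambda>m. (\<integral>x. \<bar>conv (mollifier m) lborel f x - f x\<bar> \<partial>lborel)
      + (\<integral>x. \<bar>conv (mollifier m) lborel g x - g x\<bar> \<partial>lborel)) \<longlonglongrightarrow> 0 + 0"
    using assms(3,4) unfolding mollifies_def by (rule tendsto_add)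
  show ?thesis
    unfolding mollifies_def
  proof (rule tendsto_sandwich[OF _ _ tendsto_const])
    show "(\<lambda>m. (\<integral>x. \<bar>conv (mollifier m) lborel f x - f x\<bar> \<partial>lborel)
      + (\<integral>x. \<bar>conv (mollifier m) lborel g x - g x\<bar> \<partial>lborel)) \<longlonglongrightarrow> 0" using lim by simp
    show "\<forall>\<^sub>F m in sequentially. (\<integral>x. \<bar>conv (mollifier m) lborel (\<lambda>x. f x + g x) x - (f x + g x)\<bar> \<partial>lborel)
        \<le> (\<integral>x. \<bar>conv (mollifier m) lborel f x - f x\<bar> \<partial>lborel)
          + (\<integral>x. \<bar>conv (mollifier m) lborel g x - g x\<bar> \<partial>lborel)"
    proof (rule always_eventually, rule allI)
      fix m
      note i = lborel.integrable_conv[OF mollifier[of m] assms(1)] lborel.integrable_conv[OF mollifier[of m] assms(2)]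
      have c: "conv (mollifier m) lborel (\<lambda>x. f x + g x) x = conv (mollifier m) lborel f x + conv (mollifier m) lborel g x" for x
        unfolding conv_def
        using lborel.conv_integrable[OF mollifierD(5,4)[OF mollifier[of m]] assms(1), of x]
          lborel.conv_integrable[OF mollifierD(5,4)[OF mollifier[of m]] assms(2), of x]
        by (simp add: distrib_left)
      have "(\<integral>x. \<bar>conv (mollifier m) lborel (\<lambda>x. f x + g x) x - (f x + g x)\<bar> \<partial>lborel)
          \<le> (\<integral>x. \<bar>conv (mollifier m) lborel f x - f x\<bar> + \<bar>conv (mollifier m) lborel g x - g x\<bar> \<partial>lborel)"
        unfolding c using i assms by (intro integral_mono) auto
      then show "(\<integral>x. \<bar>conv (mollifier m) lborel (\<lambda>x. f x + g x) x - (f x + g x)\<bar> \<partial>lborel)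
        \<le> (\<integral>x. \<bar>conv (mollifier m) lborel f x - f x\<bar> \<partial>lborel)
          + (\<integral>x. \<bar>conv (mollifier m) lborel g x - g x\<bar> \<partial>lborel)" using i assms by simp
    qed
  qed (auto intro!: always_eventually integral_nonneg_AE)
qed

lemma mollifies_cmult:
  assumes "mollifies f"
  shows "mollifies (\<lambda>x. f x * c)"
proof -
  have "conv (mollifier m) lborel (\<lambda>x. f x * c) x = conv (mollifier m) lborel f x * c" for m x
    by (simp add: conv_def flip: mult.assoc)
  then have "(\<integral>x. \<bar>conv (mollifier m) lborel (\<lambda>x. f x * c) x - f x * c\<bar> \<partial>lborel)
      = (\<integral>x. \<bar>conv (mollifier m) lborel f x - f x\<bar> \<partial>lborel) * \<bar>c\<bar>" for m
    by (simp add: abs_mult flip: left_diff_distrib)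
  then show ?thesis using tendsto_mult_left_zero[OF assms[unfolded mollifies_def], of "\<bar>c\<bar>"]
    unfolding mollifies_def by simp
qed

text \<open>The functions with this property are closed under sums, multiples and L1 limits, so an
  induction on integrable functions reduces everything to indicators of sets of finite measure.
  Outer regularity approximates these by open sets.\<close>

theorem mollification_tendsto_L1:
  fixes f :: "real ^ 'n \<Rightarrow> real"
  assumes "integrable lborel f"
  shows "(\<lambda>m. \<integral>x. \<bar>conv (mollifier m) lborel f x - f x\<bar> \<partial>lborel) \<longlonglongrightarrow> 0"
proof -
  have "mollifies f"
    using assms
  proof (induction rule: integrable_induct)
    case (base A c)
    then have A: "A \<in> sets borel" "emeasure lborel A < \<infinity>" by auto
    have "mollifies (indicator A)"
    proof (rule mollifies_limit)
      show "integrable lborel (indicator A :: real ^ 'n \<Rightarrow> real)" using A by simp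
      fix e :: real assume e: "e > 0"
      obtain U where U: "open U" "A \<subseteq> U" "emeasure lborel (U - A) < ennreal e"
        using outer_regular_lborel[OF A(1) e] by blast
      have [measurable]: "U \<in> sets borel" using U by simp
      have "emeasure lborel U = emeasure lborel (U - A) + emeasure lborel A"
        using U A by (subst plus_emeasure) (auto simp: Un_absorb2 Un_commute intro!: arg_cong[where f="emeasure lborel"])
      also have "\<dots> < \<infinity>" using U A less_trans[OF U(3) ennreal_less_top] by (simp add: less_top)
      finally have fin: "emeasure lborel U < \<infinity>" .
      have "(\<integral>x. \<bar>indicator A x - indicator U x :: real\<bar> \<partial>lborel) = (\<integral>x. indicator (U - A) x \<partial>lborel)"
        using U(2) by (intro Bochner_Integration.integral_cong) (auto simp: indicator_def)
      also have "\<dots> = measure lborel (U - A)" using A by simp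
      also have "\<dots> < e" using U(3) e unfolding measure_def
        by (metis enn2real_less_iff ennreal_less_top less_top order_less_trans)
      finally show "\<exists>g. integrable lborel g \<and> mollifies g \<and> (\<integral>x. \<bar>indicator A x - g x\<bar> \<partial>lborel) < e"
        using mollifies_open[OF U(1) fin] fin by (intro exI[of _ "indicator U"]) auto
    qed
    then show ?case using mollifies_cmult by simp
  next
    case (add f g)
    then show ?case by (intro mollifies_add)
  next
    case (lim f s)
    show ?case
    proof (rule mollifies_limit[OF lim.hyps(4)])
      fix e :: real assume e: "e > 0"
      \<comment> \<open>The approximating functions satisfy a bound by twice the absolute value of
        f, whence the dominating function with factor 3.\<close>
      have "(\<lambda>i. \<integral>x. \<bar>f x - s i x\<bar> \<partial>lborel) \<longlonglongrightarrow> integral\<^sup>L lborel (\<lambda>x::real ^ 'n. 0)"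
      proof (rule integral_dominated_convergence[where w="\<lambda>x. 3 * \<bar>f x\<bar>"])
        show "AE x in lborel. (\<lambda>i. \<bar>f x - s i x\<bar>) \<longlonglongrightarrow> 0"
          using lim.hyps(2) by (intro AE_I2 tendsto_rabs_zero) (auto intro!: tendsto_eq_intros)
        show "AE x in lborel. norm \<bar>f x - s i x\<bar> \<le> 3 * \<bar>f x\<bar>" for i
        proof (rule AE_I2)
          fix x show "norm \<bar>f x - s i x\<bar> \<le> 3 * \<bar>f x\<bar>" using lim.hyps(3)[of x i] by simp
        qed
      qed (use lim.hyps(1,4) in auto)
      then have "\<forall>\<^sub>F i in sequentially. (\<integral>x. \<bar>f x - s i x\<bar> \<partial>lborel) < e"
        using e by (intro order_tendstoD) auto
      then obtain i where "(\<integral>x. \<bar>f x - s i x\<bar> \<partial>lborel) < e" by (auto simp: eventually_sequentially)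
      then show "\<exists>g. integrable lborel g \<and> mollifies g \<and> (\<integral>x. \<bar>f x - g x\<bar> \<partial>lborel) < e"
        using lim.hyps(1) lim.IH by blast
    qed
  qed
  then show ?thesis by (simp add: mollifies_def)
qed

subsection \<open>Test functions and uniqueness of the distributional derivative\<close>

definition thicken :: "'a::metric_space set \<Rightarrow> real \<Rightarrow> 'a set" where
  "thicken K r = (\<Union>x\<in>K. cball x r)"

lemma compact_thicken:
  fixes K :: "'a::euclidean_space set"
  assumes "compact K" shows "compact (thicken K r)"
proof -
  have cb: "cball x r = (\<Union>y\<in>cball 0 r. {x + y})" for x :: 'a
  proof (intro set_eqI iffI)
    fix z assume "z \<in> cball x r"
    then have "z - x \<in> cball 0 r" by (simp add: dist_norm norm_minus_commute)
    then show "z \<in> (\<Union>y\<in>cball 0 r. {x + y})" by (intro UN_I[of "z - x"]) auto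
  qed (auto simp: dist_norm)
  have "thicken K r = (\<Union>x\<in>K. \<Union>y\<in>cball 0 r. {x + y})"
    unfolding thicken_def by (rule SUP_cong[OF refl cb])
  then show ?thesis using compact_sums'[OF assms compact_cball] by simp
qed

lemma mem_thicken: "x \<in> thicken K r \<longleftrightarrow> (\<exists>k\<in>K. dist k x \<le> r)"
  by (auto simp: thicken_def)

text \<open>The factor 3 leaves room for a cutoff: the indicator of the thickening by two radii,
  mollified with one radius, is 1 within one radius of the set and vanishes beyond three.\<close>

lemma thicken_subset_open:
  fixes K :: "'a::euclidean_space set"
  assumes "compact K" "open U" "K \<subseteq> U"
  obtains m :: nat where "thicken K (3 / real (Suc m)) \<subseteq> U"
proof -
  obtain e where e: "e > 0" "(\<Union>x\<in>K. ball x e) \<subseteq> U"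
    using compact_subset_open_imp_ball_epsilon_subset[OF assms] by blast
  then obtain m where "1 / real (Suc m) < e / 3" using nat_approx_posE[of "e / 3"] by auto
  then have "3 / real (Suc m) < e" by simp
  then show thesis using e(2) that[of m] by (force simp: thicken_def)
qed

lemma Cc_infinityD:
  assumes "\<phi> \<in> Cc_infinity \<Omega>"
  shows "smooth \<phi>" "bounded_support \<phi>" "continuous_on UNIV \<phi>" "\<phi> \<in> borel_measurable borel"
    "x \<notin> \<Omega> \<Longrightarrow> \<phi> x = 0"
proof -
  obtain K where K: "compact K" "K \<subseteq> \<Omega>" "\<And>x. x \<notin> K \<Longrightarrow> \<phi> x = 0" and s: "\<forall>k. C_k k \<phi>"
    using assms unfolding Cc_infinity_def by auto
  show sm: "smooth \<phi>" using s by (simp add: smooth_def)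
  obtain B where "\<And>x. x \<in> K \<Longrightarrow> norm x \<le> B" using compact_imp_bounded[OF K(1)] bounded_iff by blast
  then show "bounded_support \<phi>" unfolding bounded_support_def using K(3) by blast
  show "continuous_on UNIV \<phi>" by (rule smooth_continuous[OF sm])
  then show "\<phi> \<in> borel_measurable borel" by (rule borel_measurable_continuous_onI)
  show "x \<notin> \<Omega> \<Longrightarrow> \<phi> x = 0" using K by blast
qed

lemma Cc_infinity_mono: "\<phi> \<in> Cc_infinity U \<Longrightarrow> U \<subseteq> \<Omega> \<Longrightarrow> \<phi> \<in> Cc_infinity \<Omega>"
  unfolding Cc_infinity_def by blast

lemma Cc_infinityI:
  assumes "smooth \<phi>" "compact K" "K \<subseteq> \<Omega>" "\<And>x. x \<notin> K \<Longrightarrow> \<phi> x = 0"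
  shows "\<phi> \<in> Cc_infinity \<Omega>"
  using assms unfolding Cc_infinity_def smooth_def by blast

lemma Cc_infinity_mult:
  assumes "\<phi> \<in> Cc_infinity \<Omega>" "smooth \<psi>"
  shows "(\<lambda>x. \<phi> x * \<psi> x) \<in> Cc_infinity \<Omega>"
proof -
  obtain K where K: "compact K" "K \<subseteq> \<Omega>" "\<And>x. x \<notin> K \<Longrightarrow> \<phi> x = 0" and s: "\<forall>k. C_k k \<phi>"
    using assms(1) unfolding Cc_infinity_def by auto
  show ?thesis
    by (rule Cc_infinityI[OF _ K(1,2)]) (use assms(2) s K(3) in \<open>auto simp: smooth_def intro!: C_k_mult\<close>)
qed

lemma Cc_infinity_partial_deriv:
  assumes "\<phi> \<in> Cc_infinity \<Omega>"
  shows "continuous_on UNIV (partial_deriv j \<phi>)" "bounded_support (partial_deriv j \<phi>)"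
    "partial_deriv j \<phi> \<in> borel_measurable borel"
proof -
  show c: "continuous_on UNIV (partial_deriv j \<phi>)"
    by (rule smooth_continuous[OF smooth_partial_deriv[OF Cc_infinityD(1)[OF assms]]])
  then show "partial_deriv j \<phi> \<in> borel_measurable borel" by (rule borel_measurable_continuous_onI)
  show "bounded_support (partial_deriv j \<phi>)"
    by (rule bounded_support_partial_deriv[OF Cc_infinityD(2)[OF assms]])
qed

text \<open>The open set \<open>W\<close> is part of the conclusion because the partial derivatives
  of the cutoff are to vanish on \<open>K\<close> as well, and for that \<eta> must be constant on a
  neighbourhood.\<close>

lemma smooth_cutoff:
  fixes K :: "(real ^ 'n) set"
  assumes K: "compact K" "open U" "K \<subseteq> U"
  obtains \<eta> W where "\<eta> \<in> Cc_infinity U" "\<And>x. 0 \<le> \<eta> x \<and> \<eta> x \<le> 1"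
    "open W" "K \<subseteq> W" "\<And>x. x \<in> W \<Longrightarrow> \<eta> x = 1"
proof -
  obtain m where m: "thicken K (3 / real (Suc m)) \<subseteq> U" using thicken_subset_open[OF K] by blast
  let ?r = "1 / real (Suc m)"
  let ?C = "thicken K (2 * ?r)" and ?\<rho> = "mollifier m :: real ^ 'n \<Rightarrow> real"
  let ?h = "indicator ?C :: real ^ 'n \<Rightarrow> real"
  define \<eta> where "\<eta> = conv ?\<rho> lborel ?h"
  define W where "W = (\<Union>x\<in>K. ball x ?r)"
  have C: "compact ?C" by (rule compact_thicken[OF K(1)])
  have Cm [measurable]: "?C \<in> sets borel" using C by (simp add: compact_imp_closed)
  have int: "integrable lborel ?h"
    by (intro integrable_real_indicator emeasure_bounded_finite compact_imp_bounded[OF C]) (use Cm in simp)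
  have sm: "smooth \<eta>" unfolding \<eta>_def
    by (rule lborel.smooth_conv(1)[OF mollifierD(1,4)[OF mollifier] int])
  have "\<eta> x = 0" if x: "x \<notin> thicken K (3 * ?r)" for x
    unfolding \<eta>_def
  proof (rule lborel.conv_eq_0[OF mollifier])
    fix y assume y: "dist x y \<le> ?r"
    have "y \<notin> ?C"
    proof
      assume "y \<in> ?C"
      then obtain k where k: "k \<in> K" "dist k y \<le> 2 * ?r" by (auto simp: mem_thicken)
      have "dist k x \<le> 3 * ?r" using dist_triangle[of k x y] k(2) y by (simp add: dist_commute)
      then show False using x k(1) by (auto simp: mem_thicken)
    qed
    then show "?h y = 0" by simp
  qed
  then have "\<eta> \<in> Cc_infinity U"
    using m by (intro Cc_infinityI[OF sm compact_thicken[OF K(1)]]) auto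
  moreover have "0 \<le> \<eta> x \<and> \<eta> x \<le> 1" for x
  proof -
    have "\<bar>\<eta> x - 1 / 2\<bar> \<le> 1 / 2"
      unfolding \<eta>_def
      by (rule conv_close[OF mollifier borel_measurable_indicator[OF Cm]]) (simp split: split_indicator)
    then show ?thesis by linarith
  qed
  moreover have "open W" unfolding W_def by auto
  moreover have "K \<subseteq> W"
  proof
    fix x assume "x \<in> K"
    moreover have "x \<in> ball x ?r" by simp
    ultimately show "x \<in> W" unfolding W_def by blast
  qed
  moreover have "\<eta> x = 1" if "x \<in> W" for x
  proof -
    obtain k where k: "k \<in> K" "dist k x < ?r" using \<open>x \<in> W\<close> by (auto simp: W_def)
    have "\<bar>\<eta> x - 1\<bar> \<le> 0"
      unfolding \<eta>_def
    proof (rule conv_close[OF mollifier borel_measurable_indicator[OF Cm]])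
      fix y assume "dist x y \<le> ?r"
      then have "dist k y \<le> 2 * ?r" using dist_triangle[of k y x] k(2) by simp
      then have "y \<in> ?C" using k(1) by (auto simp: mem_thicken)
      then show "\<bar>?h y - 1\<bar> \<le> 0" by simp
    qed
    then show ?thesis by simp
  qed
  ultimately show thesis by (rule that)
qed

section \<open>Test functions against \<open>C_0\<close> and against signed measures\<close>

lemma C_0_bounded:
  assumes "\<phi> \<in> C_0 \<Omega>"
  obtains C where "\<And>x. x \<in> \<Omega> \<Longrightarrow> \<bar>\<phi> x\<bar> \<le> C"
proof -
  obtain K where K: "compact K" "K \<subseteq> \<Omega>" "\<And>x. x \<in> \<Omega> - K \<Longrightarrow> \<bar>\<phi> x\<bar> < 1"
    using assms unfolding C_0_def by (auto dest!: spec[of _ 1])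
  have "compact (\<phi> ` K)"
    using assms K unfolding C_0_def by (intro compact_continuous_image) (auto intro: continuous_on_subset)
  then obtain B where B: "\<And>x. x \<in> K \<Longrightarrow> \<bar>\<phi> x\<bar> \<le> B"
    using compact_imp_bounded[of "\<phi> ` K"] by (auto simp: bounded_iff)
  have "\<bar>\<phi> x\<bar> \<le> max B 1" if "x \<in> \<Omega>" for x
    using that B[of x] K(3)[of x] by (cases "x \<in> K") auto
  then show thesis using that by blast
qed

text \<open>Soft thresholding: subtracting from \<phi> its truncation at level e / 2 leaves a
  continuous function that vanishes off a compact set, at the cost of half the tolerance. Mollifying
  this function costs the other half.\<close>

lemma Cc_infinity_dense_C_0:
  fixes \<Omega> :: "(real ^ 'n) set"
  assumes \<Omega>: "open \<Omega>" and \<phi>: "\<phi> \<in> C_0 \<Omega>" and e: "e > 0"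
  obtains \<psi> where "\<psi> \<in> Cc_infinity \<Omega>" "\<And>x. x \<in> \<Omega> \<Longrightarrow> \<bar>\<phi> x - \<psi> x\<bar> \<le> e"
proof -
  have "e / 2 > 0" using e by simp
  then obtain K where K: "compact K" "K \<subseteq> \<Omega>" "\<And>x. x \<in> \<Omega> - K \<Longrightarrow> \<bar>\<phi> x\<bar> < e / 2"
    using \<phi>[unfolded C_0_def, THEN CollectD, THEN conjunct2, rule_format, OF \<open>e / 2 > 0\<close>] by auto
  define \<tau> where "\<tau> t = t - max (- (e / 2)) (min (e / 2) t)" for t :: real
  have \<tau>: "\<bar>t - \<tau> t\<bar> \<le> e / 2" "\<bar>t\<bar> < e / 2 \<Longrightarrow> \<tau> t = 0" for t using e by (auto simp: \<tau>_def)
  have \<tau>c: "continuous_on S \<tau>" for S unfolding \<tau>_def by (intro continuous_intros)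
  define f where "f x = (if x \<in> \<Omega> then \<tau> (\<phi> x) else 0)" for x
  have f0: "f x = 0" if "x \<notin> K" for x using that K(3)[of x] \<tau>(2) by (auto simp: f_def)
  have "continuous_on \<Omega> (\<lambda>x. \<tau> (\<phi> x))"
    using \<phi> unfolding C_0_def by (intro continuous_on_compose2[OF \<tau>c[of UNIV]]) auto
  then have "continuous_on \<Omega> f" by (rule continuous_on_cong[THEN iffD1, rotated 2]) (auto simp: f_def)
  moreover have "continuous_on (- K) f"
    by (rule continuous_on_cong[THEN iffD1, rotated 2, OF continuous_on_const]) (auto simp: f0)
  ultimately have "continuous_on (\<Omega> \<union> - K) f"
    using \<Omega> K(1) by (intro continuous_on_open_Un) (auto simp: compact_imp_closed)
  moreover have "\<Omega> \<union> - K = UNIV" using K(2) by blast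
  ultimately have fc: "continuous_on UNIV f" by simp
  obtain B where "\<And>x. x \<in> K \<Longrightarrow> norm x \<le> B" using compact_imp_bounded[OF K(1)] bounded_iff by blast
  then have fb: "bounded_support f" unfolding bounded_support_def using f0 by blast
  obtain d where d: "d > 0" "\<And>x y. norm (x - y) < d \<Longrightarrow> \<bar>f x - f y\<bar> < e / 2"
    using bounded_support_uniformly_continuous[OF fc fb \<open>e / 2 > 0\<close>] by blast
  obtain m0 where m0: "thicken K (3 / real (Suc m0)) \<subseteq> \<Omega>" using thicken_subset_open[OF K(1) \<Omega> K(2)] by blast
  obtain m1 where m1: "1 / real (Suc m1) < d" using nat_approx_posE[OF d(1)] by blast
  define m where "m = max m0 m1"
  have m: "1 / real (Suc m) < d" "1 / real (Suc m) \<le> 3 / real (Suc m0)"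
  proof -
    have "1 / real (Suc m) \<le> 1 / real (Suc m1)" by (simp add: m_def frac_le)
    then show "1 / real (Suc m) < d" using m1 by simp
    show "1 / real (Suc m) \<le> 3 / real (Suc m0)" by (rule frac_le) (auto simp: m_def)
  qed
  define \<psi> where "\<psi> = conv (mollifier m :: real ^ 'n \<Rightarrow> real) lborel f"
  have sm: "smooth \<psi>" unfolding \<psi>_def
    by (rule lborel.smooth_conv(1)[OF mollifierD(1,4)[OF mollifier] integrable_bounded_support[OF fc fb]])
  have "\<psi> x = 0" if x: "x \<notin> thicken K (3 / real (Suc m0))" for x
    unfolding \<psi>_def
  proof (rule lborel.conv_eq_0[OF mollifier])
    fix y assume y: "dist x y \<le> 1 / real (Suc m)"
    have "y \<notin> K" using x y m(2) by (force simp: mem_thicken dist_commute)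
    then show "f y = 0" by (rule f0)
  qed
  then have "\<psi> \<in> Cc_infinity \<Omega>" by (intro Cc_infinityI[OF sm compact_thicken[OF K(1)] m0])
  moreover have "\<bar>\<phi> x - \<psi> x\<bar> \<le> e" if x: "x \<in> \<Omega>" for x
  proof -
    have "\<bar>\<psi> x - f x\<bar> \<le> e / 2"
      unfolding \<psi>_def
    proof (rule conv_close[OF mollifier])
      show "f \<in> borel_measurable borel" by (rule borel_measurable_continuous_onI[OF fc])
      fix y assume "dist x y \<le> 1 / real (Suc m)"
      then have "norm (y - x) < d" using m(1) by (simp add: dist_norm norm_minus_commute)
      then show "\<bar>f y - f x\<bar> \<le> e / 2" using d(2) by (simp add: less_imp_le)
    qed
    moreover have "\<bar>\<phi> x - f x\<bar> \<le> e / 2" using \<tau>(1) x by (simp add: f_def)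
    ultimately show ?thesis by linarith
  qed
  ultimately show thesis by (rule that)
qed

lemma borel_measurable_borel_on: "f \<in> borel_measurable borel \<Longrightarrow> f \<in> borel_measurable (borel_on \<Omega>)"
  by (rule measurable_restrict_space1)

lemma C_0_measurable: "\<phi> \<in> C_0 \<Omega> \<Longrightarrow> \<phi> \<in> borel_measurable (borel_on \<Omega>)"
  unfolding C_0_def by (auto intro: borel_measurable_continuous_on_restrict)

text \<open>The cutoffs of a compact exhaustion converge pointwise to the indicator of an open set,
  so dominated convergence under each Jordan part gives agreement on open sets. These form an
  intersection-stable generator; complements are harmless because all values are finite.\<close>

lemma signed_measures_eqI:
  fixes \<Omega> :: "(real ^ 'n) set" and \<nu> \<nu>' :: "(real ^ 'n) set \<Rightarrow> real"
  assumes \<Omega>: "open \<Omega>" and v: "vector_measure (borel_on \<Omega>) \<nu>" "vector_measure (borel_on \<Omega>) \<nu>'"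
    and eq: "\<And>\<phi>. \<phi> \<in> Cc_infinity \<Omega> \<Longrightarrow>
      signed_integral (borel_on \<Omega>) \<nu> \<phi> = signed_integral (borel_on \<Omega>) \<nu>' \<phi>"
    and B: "B \<in> sets (borel_on \<Omega>)"
  shows "\<nu> B = \<nu>' B"
proof -
  let ?M = "borel_on \<Omega>"
  have sp: "space ?M = \<Omega>" by (simp add: space_restrict_space)
  have setsI: "X \<inter> \<Omega> \<in> sets ?M" if "X \<in> sets borel" for X
    using that by (auto simp: sets_restrict_space)
  have op: "\<nu> U = \<nu>' U" if U: "open U" "U \<subseteq> \<Omega>" for U
  proof -
    obtain C where C: "\<And>n::nat. compact (C n)" "\<And>n. C n \<subseteq> U" "\<Union>(range C) = U"
      "\<And>K. compact K \<Longrightarrow> K \<subseteq> U \<Longrightarrow> \<exists>N. \<forall>n\<ge>N. K \<subseteq> C n"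
      using open_Union_compact_subsets[OF U(1)] by metis
    have "\<exists>\<eta>. \<eta> \<in> Cc_infinity U \<and> (\<forall>x. 0 \<le> \<eta> x \<and> \<eta> x \<le> 1) \<and> (\<forall>x\<in>C n. \<eta> x = 1)" for n
      using smooth_cutoff[OF C(1)[of n] U(1) C(2)[of n]] by (metis subsetD)
    then obtain \<eta> where \<eta>: "\<And>n. \<eta> n \<in> Cc_infinity U" "\<And>n x. 0 \<le> \<eta> n x \<and> \<eta> n x \<le> 1"
      "\<And>n x. x \<in> C n \<Longrightarrow> \<eta> n x = 1" by metis
    have \<eta>lim: "(\<lambda>n. \<eta> n x) \<longlonglongrightarrow> indicator U x" for x
    proof (cases "x \<in> U")
      case True
      then obtain N where "\<forall>n\<ge>N. {x} \<subseteq> C n" using C(4)[of "{x}"] by auto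
      then show ?thesis using True \<eta>(3)
        by (intro tendsto_eventually) (auto simp: eventually_sequentially intro!: exI[of _ N])
    next
      case False
      then show ?thesis using Cc_infinityD(5)[OF \<eta>(1)] by simp
    qed
    have Um: "U \<in> sets ?M" using setsI[of U] U by (simp add: Int_absorb2)
    have lim: "(\<lambda>n. signed_integral ?M \<nu> (\<eta> n)) \<longlonglongrightarrow> \<nu> U"
      if v: "vector_measure ?M \<nu>" for \<nu> :: "(real ^ 'n) set \<Rightarrow> real"
    proof -
      have l: "(\<lambda>n. \<integral>x. \<eta> n x \<partial>p) \<longlonglongrightarrow> measure p U"
        if p: "finite_measure p" "sets p = sets ?M" for p
      proof -
        have "(\<lambda>n. \<integral>x. \<eta> n x \<partial>p) \<longlonglongrightarrow> (\<integral>x. indicator U x \<partial>p)"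
        proof (rule integral_dominated_convergence[where w="\<lambda>x. 1"])
          show "\<eta> n \<in> borel_measurable p" for n
            using borel_measurable_borel_on[OF Cc_infinityD(4)[OF \<eta>(1)]] measurable_cong_sets[OF p(2) refl] by blast
          show "integrable p (\<lambda>x. 1)" using p(1) by (simp add: finite_measure.integrable_const)
        qed (use \<eta>(2) \<eta>lim Um p(2) in auto)
        then show ?thesis using Um p(2) by simp
      qed
      have "(\<lambda>n. signed_integral ?M \<nu> (\<eta> n)) \<longlonglongrightarrow>
          measure (pos_part ?M \<nu>) U - measure (pos_part ?M (\<lambda>B. - \<nu> B)) U"
        unfolding signed_integral_def
        by (intro tendsto_diff l finite_measure_pos_part v vector_measure_uminus) auto
      then show ?thesis using vector_measure_eq_pos_part[OF v Um] by simp
    qed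
    have "(\<lambda>n. signed_integral ?M \<nu> (\<eta> n)) = (\<lambda>n. signed_integral ?M \<nu>' (\<eta> n))"
      using eq Cc_infinity_mono[OF \<eta>(1) U(2)] by auto
    then show ?thesis using lim[OF v(1)] lim[OF v(2)] LIMSEQ_unique by metis
  qed
  have "\<nu> (X \<inter> \<Omega>) = \<nu>' (X \<inter> \<Omega>)" if "X \<in> sigma_sets UNIV {S :: (real ^ 'n) set. open S}" for X
  proof -
    have b: "Y \<in> sets borel" if "Y \<in> sigma_sets UNIV {S :: (real ^ 'n) set. open S}" for Y
      using that by (simp add: borel_def)
    show ?thesis
      using _ _ that
    proof (rule sigma_sets_induct_disjoint[of "{S. open S}" UNIV X "\<lambda>X. \<nu> (X \<inter> \<Omega>) = \<nu>' (X \<inter> \<Omega>)"])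
      show "Int_stable {S :: (real ^ 'n) set. open S}" by (auto simp: Int_stable_def)
      show "\<nu> (Y \<inter> \<Omega>) = \<nu>' (Y \<inter> \<Omega>)" if "Y \<in> {S. open S}" for Y
        using that \<Omega> by (intro op) auto
      show "\<nu> ({} \<inter> \<Omega>) = \<nu>' ({} \<inter> \<Omega>)" using v[THEN vector_measure_empty] by simp
      show "\<nu> ((UNIV - Y) \<inter> \<Omega>) = \<nu>' ((UNIV - Y) \<inter> \<Omega>)"
        if Y: "Y \<in> sigma_sets UNIV {S. open S}" "\<nu> (Y \<inter> \<Omega>) = \<nu>' (Y \<inter> \<Omega>)" for Y
      proof -
        have "(UNIV - Y) \<inter> \<Omega> = \<Omega> - Y \<inter> \<Omega>" by auto
        moreover have "\<Omega> \<in> sets ?M" using setsI[of UNIV] by simp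
        ultimately show ?thesis
          using vector_measure_Diff[OF v(1), of \<Omega> "Y \<inter> \<Omega>"] vector_measure_Diff[OF v(2), of \<Omega> "Y \<inter> \<Omega>"]
            setsI[OF b[OF Y(1)]] Y(2) op[OF \<Omega> order_refl] by simp
      qed
      show "\<nu> (\<Union>(range A) \<inter> \<Omega>) = \<nu>' (\<Union>(range A) \<inter> \<Omega>)"
        if A: "disjoint_family A" "range A \<subseteq> sigma_sets UNIV {S. open S}"
          "\<And>i. \<nu> (A i \<inter> \<Omega>) = \<nu>' (A i \<inter> \<Omega>)" for A :: "nat \<Rightarrow> _"
      proof -
        have Ai: "A i \<inter> \<Omega> \<in> sets ?M" for i using A(2) by (intro setsI b) auto
        have d: "disjoint_family (\<lambda>i. A i \<inter> \<Omega>)" using A(1) by (auto simp: disjoint_family_on_def)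
        have u: "(\<Union>i. A i \<inter> \<Omega>) = \<Union>(range A) \<inter> \<Omega>" by auto
        show ?thesis
          using vector_measure_sums[OF v(1) Ai d] vector_measure_sums[OF v(2) Ai d] A(3)
          unfolding u by (simp add: sums_unique2)
      qed
    qed auto
  qed
  moreover obtain X where "X \<in> sets borel" "B = X \<inter> \<Omega>"
    using B by (auto simp: sets_restrict_space)
  ultimately show ?thesis by (simp add: borel_def)
qed

lemma radon_measures_component:
  assumes "\<mu> \<in> radon_measures \<Omega> d" "i < d"
  shows "vector_measure (borel_on \<Omega>) (\<lambda>B. \<mu> B i $ j)"
  by (rule vector_measure_component) (use assms in \<open>simp add: radon_measures_def\<close>)

text \<open>\<open>D\<close> is introduced by choice. By uniqueness it agrees on Borel sets with any
  measure that has been exhibited as a distributional derivative, and this is how \<open>D\<close>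
  is computed for a concrete function.\<close>

lemma D_eq:
  assumes \<Omega>: "open \<Omega>" and u: "has_distr_deriv \<Omega> d u \<mu>" and B: "B \<in> sets (borel_on \<Omega>)" and i: "i < d"
  shows "D \<Omega> d u B i = \<mu> B i"
proof -
  have "has_distr_deriv \<Omega> d u (D \<Omega> d u)" unfolding D_def by (rule someI[of "has_distr_deriv \<Omega> d u", OF u])
  note h = this[unfolded has_distr_deriv_def] u[unfolded has_distr_deriv_def]
  have "D \<Omega> d u B i $ j = \<mu> B i $ j" for j
  proof (rule signed_measures_eqI[OF \<Omega> _ _ _ B])
    show "vector_measure (borel_on \<Omega>) (\<lambda>B. D \<Omega> d u B i $ j)"
      by (rule radon_measures_component[OF h(1)[THEN conjunct1] i])
    show "vector_measure (borel_on \<Omega>) (\<lambda>B. \<mu> B i $ j)"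
      by (rule radon_measures_component[OF h(2)[THEN conjunct1] i])
    fix \<phi> assume \<phi>: "\<phi> \<in> Cc_infinity \<Omega>"
    show "signed_integral (borel_on \<Omega>) (\<lambda>B. D \<Omega> d u B i $ j) \<phi>
        = signed_integral (borel_on \<Omega>) (\<lambda>B. \<mu> B i $ j) \<phi>"
      using h(1)[THEN conjunct2, rule_format, OF \<phi> i, of j] h(2)[THEN conjunct2, rule_format, OF \<phi> i, of j]
      by linarith
  qed
  then show ?thesis by (simp add: vec_eq_iff)
qed

lemma has_distr_deriv_D: "u \<in> BV \<Omega> d \<Longrightarrow> has_distr_deriv \<Omega> d u (D \<Omega> d u)"
  unfolding BV_def D_def using someI_ex[of "has_distr_deriv \<Omega> d u"] by simp

lemma signed_integral_diff:
  fixes \<nu> :: "'a set \<Rightarrow> real"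
  assumes v: "vector_measure M \<nu>"
    and f: "f \<in> borel_measurable M" "\<And>x. x \<in> space M \<Longrightarrow> \<bar>f x\<bar> \<le> C"
    and g: "g \<in> borel_measurable M" "\<And>x. x \<in> space M \<Longrightarrow> \<bar>g x\<bar> \<le> C'"
  shows "signed_integral M \<nu> (\<lambda>x. f x - g x) = signed_integral M \<nu> f - signed_integral M \<nu> g"
proof -
  have i: "integrable (pos_part M \<nu>) h" if "vector_measure M \<nu>" "h \<in> borel_measurable M"
    "\<And>x. x \<in> space M \<Longrightarrow> \<bar>h x\<bar> \<le> C" for \<nu> :: "'a set \<Rightarrow> real" and h :: "'a \<Rightarrow> real" and C
    by (rule integrable_bounded_finite_measure[OF finite_measure_pos_part[OF that(1)], of _ C])
      (use that in auto)
  show ?thesis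
    unfolding signed_integral_def
    using i[OF v f] i[OF v g] i[OF vector_measure_uminus[OF v] f] i[OF vector_measure_uminus[OF v] g]
    by simp
qed

text \<open>A common bound on all values of the measures makes the integrals equicontinuous in the
  uniform norm, so convergence extends from smooth test functions to their uniform limits in
  \<open>C_0\<close>.\<close>

lemma weak_star_measuresI:
  fixes \<Omega> :: "(real ^ 'n) set"
  assumes \<Omega>: "open \<Omega>" and v: "\<And>n. \<mu>s n \<in> radon_measures \<Omega> d" "\<mu> \<in> radon_measures \<Omega> d"
    and K: "\<And>n B i j. B \<in> sets (borel_on \<Omega>) \<Longrightarrow> i < d \<Longrightarrow> \<bar>\<mu>s n B i $ j\<bar> \<le> K"
      "\<And>B i j. B \<in> sets (borel_on \<Omega>) \<Longrightarrow> i < d \<Longrightarrow> \<bar>\<mu> B i $ j\<bar> \<le> K"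
    and lim: "\<And>\<psi> i j. \<psi> \<in> Cc_infinity \<Omega> \<Longrightarrow> i < d \<Longrightarrow>
      (\<lambda>n. signed_integral (borel_on \<Omega>) (\<lambda>B. \<mu>s n B i $ j) \<psi>)
        \<longlonglongrightarrow> signed_integral (borel_on \<Omega>) (\<lambda>B. \<mu> B i $ j) \<psi>"
  shows "weak_star_measures \<Omega> d \<mu>s \<mu>"
  unfolding weak_star_measures_def
proof (intro ballI allI impI)
  fix \<phi> i j assume \<phi>: "\<phi> \<in> C_0 \<Omega>" and i: "i < d"
  let ?M = "borel_on \<Omega>"
  let ?a = "\<lambda>n. signed_integral ?M (\<lambda>B. \<mu>s n B i $ j)" and ?b = "signed_integral ?M (\<lambda>B. \<mu> B i $ j)"
  have sp: "space ?M = \<Omega>" by (simp add: space_restrict_space)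
  have K0: "K \<ge> 0" using K(2)[OF sets.empty_sets i] by (meson abs_ge_zero order_trans)
  have vm: "vector_measure ?M (\<lambda>B. \<mu>s n B i $ j)" "vector_measure ?M (\<lambda>B. \<mu> B i $ j)" for n
    using radon_measures_component v i by blast+
  obtain C where C: "\<And>x. x \<in> \<Omega> \<Longrightarrow> \<bar>\<phi> x\<bar> \<le> C" using C_0_bounded[OF \<phi>] by blast
  show "(\<lambda>n. ?a n \<phi>) \<longlonglongrightarrow> ?b \<phi>"
  proof (rule LIMSEQ_I)
    fix r :: real assume r: "r > 0"
    \<comment> \<open>By \<open>abs_signed_integral_le\<close> a uniform distance e changes an
      integral by at most 2 e K, here at most r / 4. Two such changes and a third quarter for the
      test function itself stay below r.\<close>
    define e where "e = r / (8 * (K + 1))"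
    have e: "e > 0" using r K0 by (simp add: e_def)
    have eK: "2 * \<bar>e\<bar> * K \<le> r / 4"
      using r K0 by (simp add: e_def field_simps)
    obtain \<psi> where \<psi>: "\<psi> \<in> Cc_infinity \<Omega>" "\<And>x. x \<in> \<Omega> \<Longrightarrow> \<bar>\<phi> x - \<psi> x\<bar> \<le> e"
      using Cc_infinity_dense_C_0[OF \<Omega> \<phi> e] by blast
    obtain B where B: "\<And>x. \<bar>\<psi> x\<bar> \<le> B"
      using bounded_support_bounded[OF Cc_infinityD(3,2)[OF \<psi>(1)]] by blast
    have m: "\<phi> \<in> borel_measurable ?M" "\<psi> \<in> borel_measurable ?M"
      using C_0_measurable[OF \<phi>] borel_measurable_borel_on[OF Cc_infinityD(4)[OF \<psi>(1)]] by auto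
    have close: "\<bar>signed_integral ?M \<nu> \<phi> - signed_integral ?M \<nu> \<psi>\<bar> \<le> r / 4"
      if v: "vector_measure ?M \<nu>" "\<And>B. B \<in> sets ?M \<Longrightarrow> \<bar>\<nu> B\<bar> \<le> K" for \<nu> :: "(real ^ 'n) set \<Rightarrow> real"
    proof -
      have "\<bar>signed_integral ?M \<nu> (\<lambda>x. \<phi> x - \<psi> x)\<bar> \<le> 2 * \<bar>e\<bar> * K"
        by (rule abs_signed_integral_le[OF v]) (use m \<psi>(2) sp in auto)
      then show ?thesis using signed_integral_diff[OF v(1) m(1) _ m(2), of C B] C B eK sp by simp
    qed
    obtain N where N: "\<And>n. n \<ge> N \<Longrightarrow> \<bar>?a n \<psi> - ?b \<psi>\<bar> < r / 4"
      using LIMSEQ_D[OF lim[OF \<psi>(1) i], of "r / 4" j] r by auto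
    have "\<bar>?a n \<phi> - ?b \<phi>\<bar> < r" if "n \<ge> N" for n
      using N[OF that] close[OF vm(1) K(1)[OF _ i], of n] close[OF vm(2) K(2)[OF _ i]] r by linarith
    then show "\<exists>no. \<forall>n\<ge>no. norm (?a n \<phi> - ?b \<phi>) < r" by auto
  qed
qed

subsection \<open>Integration by parts against a sawtooth\<close>

text \<open>Slope 1 and period 1 / n, with a downward jump of 1 / n at each multiple of 1 / n, where
  the value is 0. For n = 0 it is the zero function, as division by 0 gives 0.\<close>

definition saw :: "nat \<Rightarrow> real \<Rightarrow> real" where
  "saw n t = frac (real n * t) / real n"

text \<open>The image of Lebesgue measure under this map is 1 / n times the surface measure of the
  hyperplanes. Working with images of measures takes the place of any surface measure.\<close>

definition proj :: "nat \<Rightarrow> 'n \<Rightarrow> real ^ 'n \<Rightarrow> real ^ 'n" where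
  "proj n j x = x - saw n (x $ j) *\<^sub>R axis j 1"

lemma borel_measurable_frac [measurable]: "(frac :: real \<Rightarrow> real) \<in> borel_measurable borel"
  unfolding frac_def[abs_def] by measurable

lemma borel_measurable_saw [measurable]: "saw n \<in> borel_measurable borel"
  unfolding saw_def[abs_def] by measurable

lemma borel_measurable_proj [measurable]: "proj n j \<in> borel_measurable borel"
  unfolding proj_def[abs_def] by measurable

lemma saw_nonneg: "saw n t \<ge> 0"
  by (simp add: saw_def)

lemma saw_less: "n > 0 \<Longrightarrow> saw n t < 1 / real n"
  using frac_lt_1[of "real n * t"] by (simp add: saw_def divide_strict_right_mono)

lemma saw_le_1: "saw n t \<le> 1"
proof (cases "n = 0")
  case False
  then have "1 / real n \<le> 1" by simp
  then show ?thesis using saw_less[of n t] False by linarith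
qed (simp add: saw_def)

lemma norm_proj: "norm (x - proj n j x) = saw n (x $ j)"
  by (simp add: proj_def norm_axis_1 saw_nonneg)

lemma axis_component: "(x + c *\<^sub>R axis i 1 :: real ^ 'n) $ j = x $ j + (if i = j then c else 0)"
  by (simp add: axis_def)

lemma integral_bounded_on_ball:
  fixes f :: "'a::euclidean_space \<Rightarrow> real"
  assumes f: "f \<in> borel_measurable borel" and B: "\<And>x. \<bar>f x\<bar> \<le> B" and z: "\<And>x. R < norm x \<Longrightarrow> f x = 0"
  shows "integrable lborel f" "\<bar>\<integral>x. f x \<partial>lborel\<bar> \<le> B * measure lborel (cball 0 R :: 'a set)"
proof -
  have fin: "emeasure lborel (cball 0 R :: 'a set) < \<infinity>" by (intro emeasure_bounded_finite) simp
  then have i: "integrable lborel (\<lambda>x. indicator (cball 0 R :: 'a set) x * B)" by simp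
  have le: "\<bar>f x\<bar> \<le> indicator (cball 0 R) x * B" for x
    using B[of x] z[of x] by (cases "norm x \<le> R") auto
  show int: "integrable lborel f"
    by (rule Bochner_Integration.integrable_bound[OF i]) (use f le in \<open>auto intro: order_trans[OF _ abs_ge_self]\<close>)
  have "\<bar>\<integral>x. f x \<partial>lborel\<bar> \<le> (\<integral>x. \<bar>f x\<bar> \<partial>lborel)" by (rule integral_abs_bound)
  also have "\<dots> \<le> (\<integral>x. indicator (cball 0 R :: 'a set) x * B \<partial>lborel)"
    by (rule integral_mono) (use int i le in auto)
  finally show "\<bar>\<integral>x. f x \<partial>lborel\<bar> \<le> B * measure lborel (cball 0 R :: 'a set)" by (simp add: mult.commute)
qed

text \<open>The weight \<open>w\<close> has no derivative, so the derivative of \<psi> is replaced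
  by difference quotients: translation invariance of Lebesgue measure can then transfer the
  difference to \<open>w\<close>. The convergence is uniform, and for steps below 1 everything lives
  in the ball of radius R + 1.\<close>

lemma difference_quotient_tendsto:
  fixes \<psi> :: "real ^ 'n \<Rightarrow> real"
  assumes \<psi>: "C_k (Suc 0) \<psi>" "bounded_support \<psi>"
    and w: "w \<in> borel_measurable borel" "\<And>x. \<bar>w x\<bar> \<le> 1"
    and h: "h \<longlonglongrightarrow> 0" "\<And>k::nat. h k \<noteq> 0"
  shows "(\<lambda>k. \<integral>x. w x * ((\<psi> (x + h k *\<^sub>R axis i 1) - \<psi> x) / h k) \<partial>lborel)
    \<longlonglongrightarrow> (\<integral>x. w x * partial_deriv i \<psi> x \<partial>lborel)"
proof (rule LIMSEQ_I)
  fix e :: real assume e: "e > 0"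
  obtain R where R: "\<And>x. \<psi> x \<noteq> 0 \<Longrightarrow> norm x \<le> R" using \<psi>(2) bounded_support_def by blast
  have c: "continuous_on UNIV \<psi>" by (rule C_k_imp_continuous[OF \<psi>(1)])
  have pc: "continuous_on UNIV (partial_deriv i \<psi>)" using \<psi>(1) by simp
  have pd0: "partial_deriv i \<psi> x = 0" if "R < norm x" for x
  proof (rule partial_deriv_zero_open[where S="- cball 0 R" and c=0])
    show "\<psi> y = 0" if "y \<in> - cball 0 R" for y using R[of y] that by force
  qed (use that in auto)
  note [measurable] = borel_measurable_continuous_onI[OF c] borel_measurable_continuous_onI[OF pc] w(1)
  let ?m = "measure lborel (cball 0 (R + 1) :: (real ^ 'n) set)"
  define e' where "e' = e / (?m + 1)"
  have e': "e' > 0" unfolding e'_def using e by (intro divide_pos_pos add_nonneg_pos) auto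
  obtain d where d: "d > 0" "\<And>x k. norm k < d \<Longrightarrow>
      \<bar>\<psi> (x + k) - \<psi> x - (\<Sum>j\<in>UNIV. k $ j * partial_deriv j \<psi> x)\<bar> \<le> e' * norm k"
    using C1_uniform_differentiability[OF \<psi> e'] by blast
  have "\<forall>\<^sub>F k in sequentially. \<bar>h k\<bar> < min d 1"
    using tendsto_rabs_zero[OF h(1)] d(1) by (intro order_tendstoD(2)[of _ 0]) auto
  then obtain N where N: "\<And>k. k \<ge> N \<Longrightarrow> \<bar>h k\<bar> < min d 1" by (auto simp: eventually_sequentially)
  have "\<bar>(\<integral>x. w x * ((\<psi> (x + h k *\<^sub>R axis i 1) - \<psi> x) / h k) \<partial>lborel) - (\<integral>x. w x * partial_deriv i \<psi> x \<partial>lborel)\<bar> < e"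
    if k: "k \<ge> N" for k
  proof -
    let ?q = "\<lambda>x. (\<psi> (x + h k *\<^sub>R axis i 1) - \<psi> x) / h k"
    have hk: "\<bar>h k\<bar> < d" "\<bar>h k\<bar> < 1" using N[OF k] by auto
    have z: "?q x = 0 \<and> partial_deriv i \<psi> x = 0" if x: "R + 1 < norm x" for x
    proof -
      have "norm x \<le> norm (x + h k *\<^sub>R axis i 1) + norm (h k *\<^sub>R (axis i 1 :: real ^ 'n))"
        using norm_triangle_ineq4[of "x + h k *\<^sub>R axis i 1" "h k *\<^sub>R axis i 1"] by simp
      then have "R < norm (x + h k *\<^sub>R axis i 1)" using x hk(2) by simp
      then have "\<psi> (x + h k *\<^sub>R axis i 1) = 0" "\<psi> x = 0" using R x by fastforce+
      then show ?thesis using pd0[of x] x by simp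
    qed
    have close: "\<bar>?q x - partial_deriv i \<psi> x\<bar> \<le> e'" for x
    proof -
      have "(\<Sum>j\<in>UNIV. (h k *\<^sub>R axis i 1 :: real ^ 'n) $ j * partial_deriv j \<psi> x) = h k * partial_deriv i \<psi> x"
      proof -
        have "(\<Sum>j\<in>UNIV. (h k *\<^sub>R axis i 1 :: real ^ 'n) $ j * partial_deriv j \<psi> x)
            = (\<Sum>j\<in>UNIV. if j = i then h k * partial_deriv j \<psi> x else 0)"
          by (intro sum.cong) (auto simp: axis_def)
        then show ?thesis by simp
      qed
      then have "\<bar>\<psi> (x + h k *\<^sub>R axis i 1) - \<psi> x - h k * partial_deriv i \<psi> x\<bar> \<le> e' * \<bar>h k\<bar>"
        using d(2)[of "h k *\<^sub>R axis i 1" x] hk(1) by simp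
      moreover have "?q x - partial_deriv i \<psi> x
          = (\<psi> (x + h k *\<^sub>R axis i 1) - \<psi> x - h k * partial_deriv i \<psi> x) / h k"
        using h(2)[of k] by (simp add: field_simps)
      ultimately show ?thesis using h(2)[of k] by (simp add: divide_le_eq)
    qed
    obtain B where B: "\<And>x. \<bar>partial_deriv i \<psi> x\<bar> \<le> B"
      using bounded_support_bounded[OF pc bounded_support_partial_deriv[OF \<psi>(2)]] by blast
    have wB: "\<bar>w x * r\<bar> \<le> \<bar>r\<bar>" for x r using mult_right_mono[OF w(2)[of x], of "\<bar>r\<bar>"] by (simp add: abs_mult)
    have qB: "\<bar>?q x\<bar> \<le> B + e'" for x using close[of x] B[of x] by linarith
    have i1: "integrable lborel (\<lambda>x. w x * ?q x)"
    proof (rule integral_bounded_on_ball(1)[where B="B + e'" and R="R + 1"])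
      show "\<bar>w x * ?q x\<bar> \<le> B + e'" for x by (rule order_trans[OF wB qB])
      show "w x * ?q x = 0" if "R + 1 < norm x" for x using z[OF that] by simp
    qed measurable
    have i2: "integrable lborel (\<lambda>x. w x * partial_deriv i \<psi> x)"
      by (intro integral_bounded_on_ball(1)[where B=B and R="R + 1"])
        (use z B in \<open>auto intro: order_trans[OF wB]\<close>)
    have "(\<integral>x. w x * ?q x \<partial>lborel) - (\<integral>x. w x * partial_deriv i \<psi> x \<partial>lborel)
        = (\<integral>x. w x * (?q x - partial_deriv i \<psi> x) \<partial>lborel)"
      using i1 i2 by (simp add: right_diff_distrib)
    also have "\<bar>\<dots>\<bar> \<le> e' * ?m"
      by (intro integral_bounded_on_ball(2)) (use z close in \<open>auto intro: order_trans[OF wB]\<close>)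
    also have "\<dots> < e" unfolding e'_def by (rule divide_mult_less[OF e]) simp
    finally show ?thesis .
  qed
  then show "\<exists>no. \<forall>k\<ge>no. norm ((\<integral>x. w x * ((\<psi> (x + h k *\<^sub>R axis i 1) - \<psi> x) / h k) \<partial>lborel)
      - (\<integral>x. w x * partial_deriv i \<psi> x \<partial>lborel)) < e" by auto
qed

lemma integrable_weighted:
  fixes \<psi> :: "'a::euclidean_space \<Rightarrow> real"
  assumes "continuous_on UNIV \<psi>" "bounded_support \<psi>" "w \<in> borel_measurable borel" "\<And>x. \<bar>w x\<bar> \<le> C"
  shows "integrable lborel (\<lambda>x. w x * \<psi> x)"
proof -
  have "integrable lborel (\<lambda>x. \<psi> x * w x)"
    by (rule integrable_mult_bounded[OF integrable_bounded_support[OF assms(1,2)], of _ C]) (use assms in auto)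
  then show ?thesis by (simp add: mult.commute)
qed

lemma integral_difference_quotient_zero:
  fixes \<psi> :: "real ^ 'n \<Rightarrow> real"
  assumes \<psi>: "continuous_on UNIV \<psi>" "bounded_support \<psi>"
    and w: "w \<in> borel_measurable borel" "\<And>x. \<bar>w x\<bar> \<le> 1"
    and inv: "\<And>x. w (x + h *\<^sub>R axis i 1) = w x"
  shows "(\<integral>x. w x * ((\<psi> (x + h *\<^sub>R axis i 1) - \<psi> x) / h) \<partial>lborel) = 0"
proof -
  note [measurable] = borel_measurable_continuous_onI[OF \<psi>(1)] w(1)
  let ?f = "\<lambda>x. w x * \<psi> x"
  have i: "integrable lborel ?f" by (rule integrable_weighted[OF \<psi> w])
  have m: "?f \<in> borel_measurable borel" by measurable
  have e: "(\<integral>x. ?f (x + h *\<^sub>R axis i 1) \<partial>lborel) = (\<integral>x. ?f x \<partial>lborel)"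
    by (rule integral_lborel_translate[OF m])
  have "integrable (distr lborel borel (\<lambda>x. x + h *\<^sub>R axis i 1)) ?f"
    unfolding lborel_distr_translate by (rule i)
  then have i': "integrable lborel (\<lambda>x. ?f (x + h *\<^sub>R axis i 1))" by (subst (asm) integrable_distr_eq) auto
  have "(\<integral>x. w x * ((\<psi> (x + h *\<^sub>R axis i 1) - \<psi> x) / h) \<partial>lborel)
      = (\<integral>x. (?f (x + h *\<^sub>R axis i 1) - ?f x) / h \<partial>lborel)"
    by (intro Bochner_Integration.integral_cong) (simp_all add: inv algebra_simps diff_divide_distrib)
  also have "\<dots> = 0" using i i' e by simp
  finally show ?thesis .
qed

text \<open>Meant for a sawtooth in a coordinate other than i, which is constant along the axis i,
  and for the weight 1.\<close>

lemma integral_partial_deriv_weighted_zero: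
  fixes \<psi> :: "real ^ 'n \<Rightarrow> real"
  assumes \<psi>: "C_k (Suc 0) \<psi>" "bounded_support \<psi>"
    and w: "w \<in> borel_measurable borel" "\<And>x. \<bar>w x\<bar> \<le> 1"
    and inv: "\<And>x h. w (x + h *\<^sub>R axis i 1) = w x"
  shows "(\<integral>x. w x * partial_deriv i \<psi> x \<partial>lborel) = 0"
proof -
  have "(\<lambda>k. \<integral>x. w x * ((\<psi> (x + (1 / real (Suc k)) *\<^sub>R axis i 1) - \<psi> x) / (1 / real (Suc k))) \<partial>lborel)
      \<longlonglongrightarrow> (\<integral>x. w x * partial_deriv i \<psi> x \<partial>lborel)"
    by (rule difference_quotient_tendsto[OF \<psi> w LIMSEQ_Suc[OF lim_1_over_n]]) simp
  then show ?thesis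
    by (simp only: integral_difference_quotient_zero[OF C_k_imp_continuous[OF \<psi>(1)] \<psi>(2) w inv] LIMSEQ_const_iff)
qed

lemma integral_partial_deriv_zero:
  fixes \<psi> :: "real ^ 'n \<Rightarrow> real"
  assumes "C_k (Suc 0) \<psi>" "bounded_support \<psi>"
  shows "(\<integral>x. partial_deriv i \<psi> x \<partial>lborel) = 0"
  using integral_partial_deriv_weighted_zero[OF assms, of "\<lambda>x. 1" i] by simp

lemma saw_add:
  assumes n: "n > 0" and c: "0 \<le> c" "c < 1 / real n"
  shows "saw n (t + c) = (if saw n t + c < 1 / real n then saw n t + c else saw n t + c - 1 / real n)"
proof -
  have "real n * c < 1" using c(2) n by (simp add: field_simps)
  then have fc: "frac (real n * c) = real n * c" using c n by (subst frac_eq) auto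
  have "frac (real n * (t + c)) = frac (real n * t + real n * c)" by (simp add: algebra_simps)
  then have f: "saw n (t + c) = (if frac (real n * t) + real n * c < 1
      then (frac (real n * t) + real n * c) / real n else (frac (real n * t) + real n * c) / real n - 1 / real n)"
    unfolding frac_add fc saw_def by (simp add: diff_divide_distrib)
  have e: "saw n t + c = (frac (real n * t) + real n * c) / real n"
    using n by (simp add: saw_def add_divide_distrib)
  show ?thesis unfolding f e using n by (simp add: divide_less_cancel)
qed

text \<open>A shift to the left by less than one period crosses a jump exactly when the sawtooth at
  t is still below h, and then it gains 1 / n.\<close>

lemma saw_diff:
  assumes n: "n > 0" and h: "0 < h" "h < 1 / real n"
  shows "saw n (t - h) = saw n t - h + (if saw n t < h then 1 / real n else 0)"
  using saw_add[OF n less_imp_le[OF h(1)] h(2), of "t - h"] saw_nonneg[of n "t - h"] saw_less[OF n, of "t - h"]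
  by (auto split: if_splits)

lemma proj_translate:
  assumes n: "n > 0" and c: "0 \<le> c" "c < 1 / real n" and s: "saw n (x $ j) + c < 1 / real n"
  shows "proj n j (x + c *\<^sub>R axis j 1) = proj n j x"
  using saw_add[OF n c, of "x $ j"] s by (simp add: proj_def axis_component scaleR_left_distrib)

lemma integrable_proj:
  fixes f :: "real ^ 'n \<Rightarrow> real"
  assumes n: "n > 0" and f: "f \<in> borel_measurable borel" "\<And>x. \<bar>f x\<bar> \<le> B" "\<And>x. R < norm x \<Longrightarrow> f x = 0"
    and w: "w \<in> borel_measurable borel" "\<And>x. \<bar>w x\<bar> \<le> 1"
  shows "integrable lborel (\<lambda>x. w x * f (proj n j x))"
proof (rule integral_bounded_on_ball(1)[where B=B and R="R + 1"])
  show "(\<lambda>x. w x * f (proj n j x)) \<in> borel_measurable borel"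
    by (rule borel_measurable_times[OF w(1) measurable_compose[OF borel_measurable_proj f(1)]])
  show "\<bar>w x * f (proj n j x)\<bar> \<le> B" for x
  proof -
    have "\<bar>w x\<bar> * \<bar>f (proj n j x)\<bar> \<le> 1 * B" by (rule mult_mono[OF w(2) f(2)]) auto
    then show ?thesis by (simp add: abs_mult)
  qed
  fix x :: "real ^ 'n" assume x: "R + 1 < norm x"
  have "norm x \<le> norm (x - proj n j x) + norm (proj n j x)"
    using norm_triangle_ineq[of "x - proj n j x" "proj n j x"] by simp
  then have "R < norm (proj n j x)" using x saw_le_1[of n "x $ j"] by (simp add: norm_proj)
  then show "w x * f (proj n j x) = 0" using f(3) by simp
qed

text \<open>The slabs \<open>k h \<le> saw n (x $ j) < (k + 1) h\<close> with \<open>h = 1 / (n K)\<close> are translates of each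
  other along the axis \<open>j\<close>, and \<open>proj n j\<close> does not notice these translations.\<close>

lemma integral_proj_slab:
  fixes f :: "real ^ 'n \<Rightarrow> real"
  assumes n: "n > 0" and K: "K > 0"
    and f: "f \<in> borel_measurable borel" "\<And>x. \<bar>f x\<bar> \<le> B" "\<And>x. R < norm x \<Longrightarrow> f x = 0"
  shows "real K * (\<integral>x. of_bool (saw n (x $ j) < 1 / (real n * real K)) * f (proj n j x) \<partial>lborel)
    = (\<integral>x. f (proj n j x) \<partial>lborel)"
proof -
  define h where "h = 1 / (real n * real K)"
  have h: "h > 0" "real K * h = 1 / real n" using n K by (simp_all add: h_def)
  define A where "A k x \<longleftrightarrow> real k * h \<le> saw n (x $ j) \<and> saw n (x $ j) < real (Suc k) * h" for k and x :: "real ^ 'n"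
  have Am [measurable]: "Measurable.pred borel (A k)" for k unfolding A_def by measurable
  have int: "integrable lborel (\<lambda>x. of_bool (A k x) * f (proj n j x))" for k
    by (rule integrable_proj[OF n f]) auto
  have shift: "(\<integral>x. of_bool (A k x) * f (proj n j x) \<partial>lborel) = (\<integral>x. of_bool (A 0 x) * f (proj n j x) \<partial>lborel)"
    if k: "k < K" for k
  proof -
    let ?c = "real k * h"
    have "(real k + 1) * h \<le> real K * h" by (rule mult_right_mono) (use k h(1) in auto)
    then have "?c + h \<le> real K * h" by (simp add: distrib_right)
    then have c: "0 \<le> ?c" "?c < 1 / real n" "?c + h \<le> 1 / real n" using h by auto
    have "(\<lambda>x. of_bool (A k x) :: real) \<in> borel_measurable borel" by measurable
    then have m: "(\<lambda>x. of_bool (A k x) * f (proj n j x)) \<in> borel_measurable borel"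
      by (rule borel_measurable_times[OF _ measurable_compose[OF borel_measurable_proj f(1)]])
    have "of_bool (A k (x + ?c *\<^sub>R axis j 1)) * f (proj n j (x + ?c *\<^sub>R axis j 1))
        = of_bool (A 0 x) * f (proj n j x)" for x
    proof -
      have e: "real (Suc k) * h = ?c + h" "real 0 * h = 0" "real (Suc 0) * h = h" by (simp_all add: distrib_right)
      have "saw n ((x + ?c *\<^sub>R axis j 1) $ j) = saw n (x $ j + ?c)" by (simp add: axis_component)
      then have "A k (x + ?c *\<^sub>R axis j 1) \<longleftrightarrow> A 0 x"
        unfolding A_def e
        using saw_add[OF n c(1,2), of "x $ j"] saw_nonneg[of n "x $ j"] c(3) saw_less[OF n, of "x $ j"]
        by (simp split: if_splits)
      moreover have "proj n j (x + ?c *\<^sub>R axis j 1) = proj n j x" if "A 0 x"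
        using that c(3) by (intro proj_translate[OF n c(1,2)]) (simp add: A_def)
      ultimately show ?thesis by auto
    qed
    then show ?thesis using integral_lborel_translate[OF m, of "?c *\<^sub>R axis j 1"] by simp
  qed
  have one: "(\<Sum>k<K. of_bool (A k x) * y) = y" for x and y :: real
  proof -
    define k0 where "k0 = nat \<lfloor>saw n (x $ j) / h\<rfloor>"
    have s: "saw n (x $ j) / h \<ge> 0" using saw_nonneg h(1) by simp
    then have k0: "real k0 \<le> saw n (x $ j) / h" "saw n (x $ j) / h < real k0 + 1"
      unfolding k0_def by linarith+
    have iff: "A k x \<longleftrightarrow> k = k0" for k
    proof -
      have "A k x \<longleftrightarrow> real k \<le> saw n (x $ j) / h \<and> saw n (x $ j) / h < real k + 1"
        unfolding A_def using h(1) by (simp add: field_simps del: of_nat_Suc) (simp add: algebra_simps)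
      also have "\<dots> \<longleftrightarrow> k = k0" using k0 by linarith
      finally show ?thesis .
    qed
    have "saw n (x $ j) / h < real K" using saw_less[OF n, of "x $ j"] h by (simp add: field_simps)
    then have "k0 < K" using k0(1) by linarith
    have "(\<Sum>k<K. of_bool (A k x) * y) = (\<Sum>k<K. if k = k0 then y else 0)"
      by (intro sum.cong) (auto simp: iff)
    then show ?thesis using \<open>k0 < K\<close> by simp
  qed
  have "(\<integral>x. f (proj n j x) \<partial>lborel) = (\<integral>x. (\<Sum>k<K. of_bool (A k x) * f (proj n j x)) \<partial>lborel)"
    by (simp add: one)
  also have "\<dots> = (\<Sum>k<K. \<integral>x. of_bool (A k x) * f (proj n j x) \<partial>lborel)"
    by (rule Bochner_Integration.integral_sum) (rule int)
  also have "\<dots> = (\<Sum>k<K. \<integral>x. of_bool (A 0 x) * f (proj n j x) \<partial>lborel)"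
    by (intro sum.cong refl shift) simp
  also have "\<dots> = real K * (\<integral>x. of_bool (A 0 x) * f (proj n j x) \<partial>lborel)" by simp
  finally show ?thesis by (simp add: A_def h_def saw_nonneg)
qed

text \<open>On a slab of width h a point and its projection are less than h apart, so \<psi> may be
  replaced by its value at the projection. After that \<open>integral_proj_slab\<close> evaluates
  the rescaled integral exactly, for every k.\<close>

lemma slab_limit:
  fixes \<psi> :: "real ^ 'n \<Rightarrow> real"
  assumes n: "n > 0" and \<psi>: "continuous_on UNIV \<psi>" "bounded_support \<psi>"
  shows "(\<lambda>k. real (k + 2) * (\<integral>x. of_bool (saw n (x $ j) < 1 / (real n * real (k + 2))) * \<psi> x \<partial>lborel))
    \<longlonglongrightarrow> (\<integral>x. \<psi> (proj n j x) \<partial>lborel)"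
proof (rule LIMSEQ_I)
  fix e :: real assume e: "e > 0"
  obtain R where R: "\<And>x. \<psi> x \<noteq> 0 \<Longrightarrow> norm x \<le> R" using \<psi>(2) bounded_support_def by blast
  obtain B where B: "\<And>x. \<bar>\<psi> x\<bar> \<le> B" using bounded_support_bounded[OF \<psi>] by blast
  have \<psi>0: "\<psi> x = 0" if "R < norm x" for x using R[of x] that by fastforce
  note [measurable] = borel_measurable_continuous_onI[OF \<psi>(1)]
  \<comment> \<open>The error is a small multiple of the rescaled mass of the slab over a ball, and
    this mass equals \<open>m\<close> for every k. The margin 2 ensures that on the slab, wherever
    \<zeta> vanishes at the projection, \<psi> vanishes both there and at the point itself.\<close>
  define \<zeta> where "\<zeta> = (indicator (cball 0 (R + 2)) :: real ^ 'n \<Rightarrow> real)"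
  have \<zeta>1: "\<zeta> \<in> borel_measurable borel"
    unfolding \<zeta>_def by (rule borel_measurable_indicator) simp
  have \<zeta>2: "\<bar>\<zeta> x\<bar> \<le> 1" for x by (simp add: \<zeta>_def indicator_def)
  have \<zeta>3: "\<zeta> x = 0" if "R + 2 < norm x" for x using that by (simp add: \<zeta>_def)
  note \<zeta> = \<zeta>1 \<zeta>2 \<zeta>3
  define m where "m = (\<integral>x. \<zeta> (proj n j x) \<partial>lborel)"
  have m0: "m \<ge> 0" unfolding m_def by (intro integral_nonneg_AE) (simp add: \<zeta>_def)
  then have e': "e / (m + 1) > 0" using e by (intro divide_pos_pos) linarith+
  obtain d where d: "d > 0" "\<And>x y. norm (x - y) < d \<Longrightarrow> \<bar>\<psi> x - \<psi> y\<bar> < e / (m + 1)"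
    using bounded_support_uniformly_continuous[OF \<psi> e'] by blast
  obtain N where N: "1 / real (Suc N) < d" using nat_approx_posE[OF d(1)] by blast
  have "\<bar>real (k + 2) * (\<integral>x. of_bool (saw n (x $ j) < 1 / (real n * real (k + 2))) * \<psi> x \<partial>lborel)
      - (\<integral>x. \<psi> (proj n j x) \<partial>lborel)\<bar> < e" if k: "k \<ge> N" for k
  proof -
    let ?K = "k + 2"
    define h where "h = 1 / (real n * real ?K)"
    have "h \<le> 1 / real (Suc N)" unfolding h_def
    proof (rule frac_le)
      have "real (Suc N) \<le> 1 * real ?K" using k by simp
      also have "\<dots> \<le> real n * real ?K" using n by (intro mult_right_mono) auto
      finally show "real (Suc N) \<le> real n * real ?K" .
    qed auto
    then have h: "h < d" "h \<le> 1" using N by (auto intro: order_trans)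
    let ?b = "\<lambda>x::real ^ 'n. of_bool (saw n (x $ j) < h) :: real"
    have bm [measurable]: "?b \<in> borel_measurable borel" by measurable
    have b1: "\<bar>?b x\<bar> \<le> 1" for x by simp
    have slab: "real ?K * (\<integral>x. ?b x * \<psi> (proj n j x) \<partial>lborel) = (\<integral>x. \<psi> (proj n j x) \<partial>lborel)"
      unfolding h_def by (rule integral_proj_slab[OF n _ _ B \<psi>0]) auto
    have slab\<zeta>: "real ?K * (\<integral>x. ?b x * \<zeta> (proj n j x) \<partial>lborel) = m"
      unfolding h_def m_def by (rule integral_proj_slab[OF n _ \<zeta>]) auto
    have i1: "integrable lborel (\<lambda>x. ?b x * \<psi> x)" by (rule integrable_weighted[OF \<psi> bm b1])
    have i2: "integrable lborel (\<lambda>x. ?b x * \<psi> (proj n j x))"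
      by (rule integrable_proj[OF n _ B \<psi>0 bm b1]) auto
    have i3: "integrable lborel (\<lambda>x. ?b x * \<zeta> (proj n j x))" by (rule integrable_proj[OF n \<zeta> bm b1])
    have le: "\<bar>?b x * (\<psi> x - \<psi> (proj n j x))\<bar> \<le> e / (m + 1) * (?b x * \<zeta> (proj n j x))" for x
    proof (cases "saw n (x $ j) < h")
      case True
      then have p: "norm (x - proj n j x) < h" by (simp add: norm_proj)
      show ?thesis
      proof (cases "norm (proj n j x) \<le> R + 2")
        case True
        then show ?thesis using d(2)[of x "proj n j x"] p h(1) by (auto simp: \<zeta>_def less_imp_le)
      next
        case False
        then have "R < norm x" "R < norm (proj n j x)"
          using norm_triangle_ineq2[of "proj n j x" x] p h(2) by (auto simp: norm_minus_commute)
        then have "\<psi> x = 0" "\<psi> (proj n j x) = 0" by (auto intro: \<psi>0)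
        moreover have "0 \<le> e / (m + 1) * (?b x * \<zeta> (proj n j x))"
          using e' by (intro mult_nonneg_nonneg) (auto simp: \<zeta>_def)
        ultimately show ?thesis by simp
      qed
    qed simp
    have "real ?K * (\<integral>x. ?b x * \<psi> x \<partial>lborel) - (\<integral>x. \<psi> (proj n j x) \<partial>lborel)
        = real ?K * (\<integral>x. ?b x * (\<psi> x - \<psi> (proj n j x)) \<partial>lborel)"
      unfolding slab[symmetric] using i1 i2 by (simp add: right_diff_distrib)
    also have "\<bar>\<dots>\<bar> \<le> real ?K * (\<integral>x. \<bar>?b x * (\<psi> x - \<psi> (proj n j x))\<bar> \<partial>lborel)"
      unfolding abs_mult[of "real ?K"] by (intro mult_mono integral_abs_bound) auto
    also have "\<dots> \<le> real ?K * (\<integral>x. e / (m + 1) * (?b x * \<zeta> (proj n j x)) \<partial>lborel)"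
    proof (intro mult_left_mono integral_mono le)
      show "integrable lborel (\<lambda>x. \<bar>?b x * (\<psi> x - \<psi> (proj n j x))\<bar>)"
        using i1 i2 by (simp add: right_diff_distrib)
      show "integrable lborel (\<lambda>x. e / (m + 1) * (?b x * \<zeta> (proj n j x)))" using i3 by simp
    qed auto
    also have "\<dots> = e / (m + 1) * (real ?K * (\<integral>x. ?b x * \<zeta> (proj n j x) \<partial>lborel))" by simp
    also have "\<dots> = e / (m + 1) * m" unfolding slab\<zeta> ..
    also have "\<dots> < e" by (rule divide_mult_less[OF e m0])
    finally show ?thesis unfolding h_def .
  qed
  then show "\<exists>no. \<forall>k\<ge>no. norm (real (k + 2) * (\<integral>x. of_bool (saw n (x $ j) < 1 / (real n * real (k + 2))) * \<psi> x \<partial>lborel)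
      - (\<integral>x. \<psi> (proj n j x) \<partial>lborel)) < e" by auto
qed

text \<open>Transferred to the sawtooth, the difference quotient with step h is -1 plus a term of
  height 1 / (n h) on the slab of width h just above each hyperplane. In the limit the first part
  gives minus the integral of \<psi>, and the second concentrates on the hyperplanes.\<close>

theorem saw_integration_by_parts:
  fixes \<psi> :: "real ^ 'n \<Rightarrow> real"
  assumes n: "n > 0" and \<psi>: "C_k (Suc 0) \<psi>" "bounded_support \<psi>"
  shows "(\<integral>x. saw n (x $ j) * partial_deriv i \<psi> x \<partial>lborel)
    = (if i = j then (\<integral>x. \<psi> (proj n j x) \<partial>lborel) - (\<integral>x. \<psi> x \<partial>lborel) else 0)"
proof (cases "i = j")
  case False
  then show ?thesis
    using integral_partial_deriv_weighted_zero[OF \<psi>, of "\<lambda>x. saw n (x $ j)" i]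
    by (simp add: axis_def saw_le_1 saw_nonneg)
next
  case True
  have c: "continuous_on UNIV \<psi>" by (rule C_k_imp_continuous[OF \<psi>(1)])
  note [measurable] = borel_measurable_continuous_onI[OF c]
  let ?s = "\<lambda>x::real ^ 'n. saw n (x $ j)"
  \<comment> \<open>With k + 2 in place of k + 1 every step is strictly shorter than the period 1 /
    n, as \<open>saw_diff\<close> requires.\<close>
  define h where "h k = 1 / (real n * real (k + 2))" for k :: nat
  have h: "h k > 0" "h k < 1 / real n" for k using n by (simp_all add: h_def frac_less2)
  have "(\<lambda>k. inverse (real n) * inverse (real (k + 2))) \<longlonglongrightarrow> inverse (real n) * 0"
    by (intro tendsto_mult tendsto_const LIMSEQ_ignore_initial_segment lim_inverse_n)
  then have h0: "h \<longlonglongrightarrow> 0" by (simp add: h_def[abs_def] divide_inverse del: of_nat_add)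
  have lim1: "(\<lambda>k. \<integral>x. ?s x * ((\<psi> (x + h k *\<^sub>R axis j 1) - \<psi> x) / h k) \<partial>lborel)
      \<longlonglongrightarrow> (\<integral>x. ?s x * partial_deriv j \<psi> x \<partial>lborel)"
    by (rule difference_quotient_tendsto[OF \<psi> _ _ h0]) (use h(1) saw_le_1 saw_nonneg in \<open>auto simp: less_imp_neq[symmetric]\<close>)
  have eq: "(\<integral>x. ?s x * ((\<psi> (x + h k *\<^sub>R axis j 1) - \<psi> x) / h k) \<partial>lborel)
      = real (k + 2) * (\<integral>x. of_bool (?s x < h k) * \<psi> x \<partial>lborel) - (\<integral>x. \<psi> x \<partial>lborel)" for k
  proof -
    let ?f = "\<lambda>x. saw n (x $ j - h k) * \<psi> x"
    have m: "?f \<in> borel_measurable borel" by measurable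
    have ib: "integrable lborel (\<lambda>x. of_bool (?s x < h k) * \<psi> x)"
      by (rule integrable_weighted[OF c \<psi>(2), of _ 1]) auto
    have i\<psi>: "integrable lborel \<psi>" by (rule integrable_bounded_support[OF c \<psi>(2)])
    have i1: "integrable lborel ?f" by (rule integrable_weighted[OF c \<psi>(2), of _ 1]) (auto simp: saw_le_1 saw_nonneg)
    have i2: "integrable lborel (\<lambda>x. ?s x * \<psi> x)"
      by (rule integrable_weighted[OF c \<psi>(2), of _ 1]) (auto simp: saw_le_1 saw_nonneg)
    have t: "(\<integral>x. ?f (x + h k *\<^sub>R axis j 1) \<partial>lborel) = (\<integral>x. ?f x \<partial>lborel)"
      by (rule integral_lborel_translate[OF m])
    have "integrable (distr lborel borel (\<lambda>x. x + h k *\<^sub>R axis j 1)) ?f"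
      unfolding lborel_distr_translate by (rule i1)
    then have i3: "integrable lborel (\<lambda>x. ?f (x + h k *\<^sub>R axis j 1))" by (subst (asm) integrable_distr_eq) auto
    have "(\<integral>x. ?s x * ((\<psi> (x + h k *\<^sub>R axis j 1) - \<psi> x) / h k) \<partial>lborel)
        = (\<integral>x. (?f (x + h k *\<^sub>R axis j 1) - ?s x * \<psi> x) / h k \<partial>lborel)"
      by (intro Bochner_Integration.integral_cong) (simp_all add: axis_component algebra_simps diff_divide_distrib)
    also have "\<dots> = ((\<integral>x. ?f x \<partial>lborel) - (\<integral>x. ?s x * \<psi> x \<partial>lborel)) / h k"
      using i2 i3 t by simp
    also have "\<dots> = (\<integral>x. (?f x - ?s x * \<psi> x) / h k \<partial>lborel)" using i1 i2 by simp
    also have "\<dots> = (\<integral>x. real (k + 2) * (of_bool (?s x < h k) * \<psi> x) - \<psi> x \<partial>lborel)"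
    proof (intro Bochner_Integration.integral_cong refl)
      fix x
      have "?f x - ?s x * \<psi> x = (of_bool (?s x < h k) / real n - h k) * \<psi> x"
      proof -
        have "saw n (x $ j - h k) - ?s x = of_bool (?s x < h k) / real n - h k"
          using saw_diff[OF n h, of "x $ j" k] by auto
        then show ?thesis by (metis left_diff_distrib)
      qed
      also have "\<dots> / h k = (of_bool (?s x < h k) / (real n * h k) - 1) * \<psi> x"
        using h(1)[of k] by (simp add: field_simps)
      also have "real n * h k = 1 / real (k + 2)" using n by (simp add: h_def)
      finally show "(?f x - ?s x * \<psi> x) / h k = real (k + 2) * (of_bool (?s x < h k) * \<psi> x) - \<psi> x"
        by (simp add: algebra_simps)
    qed
    also have "\<dots> = real (k + 2) * (\<integral>x. of_bool (?s x < h k) * \<psi> x \<partial>lborel) - (\<integral>x. \<psi> x \<partial>lborel)"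
      using ib i\<psi> by (subst Bochner_Integration.integral_diff) auto
    finally show ?thesis .
  qed
  have "(\<lambda>k. real (k + 2) * (\<integral>x. of_bool (?s x < h k) * \<psi> x \<partial>lborel) - (\<integral>x. \<psi> x \<partial>lborel))
      \<longlonglongrightarrow> (\<integral>x. \<psi> (proj n j x) \<partial>lborel) - (\<integral>x. \<psi> x \<partial>lborel)"
    unfolding h_def by (intro tendsto_diff tendsto_const slab_limit[OF n c \<psi>(2)])
  then show ?thesis using LIMSEQ_unique[OF lim1[unfolded eq]] True by simp
qed

text \<open>The projection moves points by less than 1 / n, so dominated convergence applies. This
  bounds the mass on the hyperplanes by an ordinary integral once n is large.\<close>

lemma integral_proj_tendsto:
  fixes f :: "real ^ 'n \<Rightarrow> real"
  assumes f: "continuous_on UNIV f" "bounded_support f"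
  shows "(\<lambda>n. \<integral>x. f (proj (Suc n) j x) \<partial>lborel) \<longlonglongrightarrow> (\<integral>x. f x \<partial>lborel)"
proof -
  obtain R where R: "\<And>x. f x \<noteq> 0 \<Longrightarrow> norm x \<le> R" using f(2) bounded_support_def by blast
  obtain B where B: "B > 0" "\<And>x. \<bar>f x\<bar> \<le> B" using bounded_support_bounded[OF f] by blast
  note fm = borel_measurable_continuous_onI[OF f(1)]
  show ?thesis
  proof (rule integral_dominated_convergence[where w="\<lambda>x. indicator (cball 0 (R + 1)) x * B"])
    have "emeasure lborel (cball 0 (R + 1) :: (real ^ 'n) set) < \<infinity>" by (intro emeasure_bounded_finite) simp
    then show "integrable lborel (\<lambda>x. indicator (cball 0 (R + 1) :: (real ^ 'n) set) x * B)" by simp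
    show "AE x in lborel. (\<lambda>n. f (proj (Suc n) j x)) \<longlonglongrightarrow> f x"
    proof (rule AE_I2)
      fix x :: "real ^ 'n"
      have "(\<lambda>n. norm (x - proj (Suc n) j x)) \<longlonglongrightarrow> 0"
      proof (rule tendsto_sandwich[OF _ _ tendsto_const LIMSEQ_Suc[OF lim_1_over_n]])
        show "\<forall>\<^sub>F n in sequentially. norm (x - proj (Suc n) j x) \<le> 1 / real (Suc n)"
          using saw_less[of "Suc _" "x $ j"] by (simp add: norm_proj less_imp_le)
      qed auto
      then have "(\<lambda>n. x - (x - proj (Suc n) j x)) \<longlonglongrightarrow> x - 0"
        by (intro tendsto_diff tendsto_const) (simp add: tendsto_norm_zero_iff)
      then have "(\<lambda>n. proj (Suc n) j x) \<longlonglongrightarrow> x" by simp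
      moreover have "isCont f x" using f(1) by (simp add: continuous_on_eq_continuous_at)
      ultimately show "(\<lambda>n. f (proj (Suc n) j x)) \<longlonglongrightarrow> f x" by (rule isCont_tendsto_compose[rotated])
    qed
    show "AE x in lborel. norm (f (proj (Suc n) j x)) \<le> indicator (cball 0 (R + 1)) x * B" for n
    proof (rule AE_I2)
      fix x :: "real ^ 'n"
      have "norm x \<le> norm (x - proj (Suc n) j x) + norm (proj (Suc n) j x)"
        using norm_triangle_ineq[of "x - proj (Suc n) j x" "proj (Suc n) j x"] by simp
      then have "norm x \<le> R + 1" if "f (proj (Suc n) j x) \<noteq> 0"
        using R[OF that] saw_le_1[of "Suc n" "x $ j"] by (simp add: norm_proj)
      then show "norm (f (proj (Suc n) j x)) \<le> indicator (cball 0 (R + 1)) x * B"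
        using B by (cases "f (proj (Suc n) j x) = 0") auto
    qed
    show "f \<in> borel_measurable lborel" using fm by simp
    show "(\<lambda>x. f (proj (Suc n) j x)) \<in> borel_measurable lborel" for n
      using measurable_compose[OF borel_measurable_proj fm] by simp
  qed
qed

subsection \<open>Approximation by Sobolev functions that are continuous inside the domain\<close>

text \<open>BV functions are only Lebesgue measurable, and only their values on \<Omega> count,
  whereas Fubini's theorem and images of measures work with Borel functions on the whole space.
  Passing to a Borel representative that vanishes off \<Omega> settles both points.\<close>

lemma lebesgue_borel_representative:
  fixes f :: "real ^ 'n \<Rightarrow> real"
  assumes f: "set_integrable lebesgue \<Omega> f" and \<Omega>: "\<Omega> \<in> sets borel"
  obtains f' where "f' \<in> borel_measurable borel" "integrable lborel f'" "\<And>x. x \<notin> \<Omega> \<Longrightarrow> f' x = 0"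
    "AE x in lebesgue. x \<in> \<Omega> \<longrightarrow> f' x = f x"
    "\<And>k. k \<in> borel_measurable borel \<Longrightarrow> (LINT x:\<Omega>|lebesgue. f x * k x) = (\<integral>x. f' x * k x \<partial>lborel)"
proof -
  let ?F = "\<lambda>x. indicator \<Omega> x *\<^sub>R f x"
  have F: "integrable lebesgue ?F" using f by (simp add: set_integrable_def)
  obtain F' where F': "F' \<in> borel_measurable lborel" "AE x in lborel. ?F x = F' x"
    using completion_ex_borel_measurable_real[OF borel_measurable_integrable[OF F]] by blast
  define f' where "f' x = indicator \<Omega> x * F' x" for x
  have m: "f' \<in> borel_measurable borel" unfolding f'_def using F'(1) \<Omega> by simp
  have ae: "AE x in lebesgue. f' x = ?F x"
    using AE_completion[OF F'(2)] by eventually_elim (auto simp: f'_def indicator_def)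
  have i: "integrable lborel f'"
  proof -
    have "integrable lebesgue f'"
    proof (rule integrable_cong_AE_imp[OF F])
      show "f' \<in> borel_measurable lebesgue" using m by (simp add: measurable_completion)
      show "AE x in lebesgue. ?F x = f' x" using ae by eventually_elim simp
    qed
    then show ?thesis using m by (simp add: integrable_completion)
  qed
  show thesis
  proof (rule that[OF m i])
    show "AE x in lebesgue. x \<in> \<Omega> \<longrightarrow> f' x = f x" using ae by eventually_elim auto
    fix k :: "real ^ 'n \<Rightarrow> real" assume k: "k \<in> borel_measurable borel"
    have mk: "(\<lambda>x. f' x * k x) \<in> borel_measurable lborel" using m k by simp
    have "(LINT x:\<Omega>|lebesgue. f x * k x) = (\<integral>x. ?F x * k x \<partial>lebesgue)"
      unfolding set_lebesgue_integral_def by (intro Bochner_Integration.integral_cong) auto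
    also have "\<dots> = (\<integral>x. f' x * k x \<partial>lebesgue)"
    proof (rule integral_cong_AE)
      have "k \<in> borel_measurable lebesgue" using k by (simp add: measurable_completion)
      then show "(\<lambda>x. ?F x * k x) \<in> borel_measurable lebesgue"
        using borel_measurable_integrable[OF F] by (rule borel_measurable_times[rotated])
      show "(\<lambda>x. f' x * k x) \<in> borel_measurable lebesgue" by (rule measurable_completion[OF mk])
      show "AE x in lebesgue. ?F x * k x = f' x * k x" using ae by eventually_elim simp
    qed
    also have "\<dots> = (\<integral>x. f' x * k x \<partial>lborel)" by (rule integral_completion[OF mk])
    finally show "(LINT x:\<Omega>|lebesgue. f x * k x) = (\<integral>x. f' x * k x \<partial>lborel)" .
  qed (simp add: f'_def)
qed

text \<open>Differences of successive cutoffs, which telescope. The cutoffs are 1 on neighbourhoods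
  of the exhausting sets, so near \<open>C n\<close> the later differences vanish and the partial
  sum is constant; this yields the statements about derivatives.\<close>

lemma smooth_partition_of_unity:
  fixes \<Omega> :: "(real ^ 'n) set"
  assumes \<Omega>: "open \<Omega>"
  obtains C :: "nat \<Rightarrow> (real ^ 'n) set" and p :: "nat \<Rightarrow> real ^ 'n \<Rightarrow> real" where
    "\<And>n. compact (C n)" "\<And>n. C n \<subseteq> \<Omega>" "\<And>n. C n \<subseteq> interior (C (Suc n))"
    "\<And>K. compact K \<Longrightarrow> K \<subseteq> \<Omega> \<Longrightarrow> \<exists>n. K \<subseteq> C n"
    "\<And>i. p i \<in> Cc_infinity \<Omega>" "\<And>i x. 0 \<le> p i x"
    "\<And>n x. x \<in> C n \<Longrightarrow> (\<Sum>i<Suc n. p i x) = 1"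
    "\<And>n x j. x \<in> C n \<Longrightarrow> (\<Sum>i<Suc n. partial_deriv j (p i) x) = 0"
    "\<And>n i x. x \<in> C n \<Longrightarrow> n < i \<Longrightarrow> p i x = 0"
    "\<And>n i x j. x \<in> C n \<Longrightarrow> n < i \<Longrightarrow> partial_deriv j (p i) x = 0"
proof -
  obtain C where C: "\<And>n::nat. compact (C n)" "\<And>n. C n \<subseteq> \<Omega>" "\<And>n. C n \<subseteq> interior (C (Suc n))"
    "\<And>K. compact K \<Longrightarrow> K \<subseteq> \<Omega> \<Longrightarrow> \<exists>N. \<forall>n\<ge>N. K \<subseteq> C n"
    using open_Union_compact_subsets[OF \<Omega>] by metis
  have Cmono: "m \<le> n \<Longrightarrow> C m \<subseteq> C n" for m n
    by (rule lift_Suc_mono_le[of C]) (use C(3) interior_subset in blast)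
  have "\<exists>\<eta> W. \<eta> \<in> Cc_infinity (interior (C (Suc n))) \<and> (\<forall>x. 0 \<le> \<eta> x \<and> \<eta> x \<le> 1) \<and>
      open W \<and> C n \<subseteq> W \<and> (\<forall>x\<in>W. \<eta> x = 1)" for n
    by (rule smooth_cutoff[OF C(1)[of n] open_interior C(3)[of n]]) blast
  then obtain \<eta> W where \<eta>: "\<And>n. \<eta> n \<in> Cc_infinity (interior (C (Suc n)))"
    "\<And>n x. 0 \<le> \<eta> n x \<and> \<eta> n x \<le> 1" "\<And>n. open (W n)" "\<And>n. C n \<subseteq> W n" "\<And>n x. x \<in> W n \<Longrightarrow> \<eta> n x = 1"
    by metis
  have sub: "interior (C (Suc n)) \<subseteq> \<Omega>" for n using C(2) interior_subset by blast
  have \<eta>\<Omega>: "\<eta> n \<in> Cc_infinity \<Omega>" for n by (rule Cc_infinity_mono[OF \<eta>(1) sub])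
  have diff: "\<eta> n differentiable (at x)" for n x by (rule smooth_differentiable[OF Cc_infinityD(1)[OF \<eta>\<Omega>]])
  define p where "p i = (case i of 0 \<Rightarrow> \<eta> 0 | Suc k \<Rightarrow> (\<lambda>x. \<eta> (Suc k) x - \<eta> k x))" for i
  have p0: "p 0 = \<eta> 0" and pS: "p (Suc k) = (\<lambda>x. \<eta> (Suc k) x - \<eta> k x)" for k by (simp_all add: p_def)
  have psum: "(\<Sum>i<Suc n. p i x) = \<eta> n x" for n x
    by (induction n) (simp_all add: p0 pS)
  have dsum: "(\<Sum>i<Suc n. partial_deriv j (p i) x) = partial_deriv j (\<eta> n) x" for n x j
    by (induction n) (simp_all add: p0 pS partial_deriv_diff[OF diff diff])
  \<comment> \<open>The later cutoffs are 1 near \<open>C n\<close> too: for m > n the set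
    \<open>C m\<close>, on which \<eta> m is 1, contains \<open>C (Suc n)\<close>.\<close>
  have one: "\<eta> m y = 1" if "n \<le> m" "y \<in> W n" "y \<in> interior (C (Suc n))" for n m y
  proof (cases "m = n")
    case True then show ?thesis using \<eta>(5) that by simp
  next
    case False
    then have "C (Suc n) \<subseteq> C m" using that(1) by (intro Cmono) simp
    then show ?thesis using \<eta>(4)[of m] \<eta>(5)[of y m] interior_subset that(3) by blast
  qed
  have pz: "p i y = 0" if "n < i" "y \<in> W n \<inter> interior (C (Suc n))" for n i y
  proof -
    obtain k where k: "i = Suc k" "n \<le> k" using \<open>n < i\<close> by (cases i) auto
    then show ?thesis using one[of n k y] one[of n "Suc k" y] that(2) by (simp add: pS)
  qed
  have op: "open (W n \<inter> interior (C (Suc n)))" for n using \<eta>(3) by auto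
  have mem: "x \<in> W n \<inter> interior (C (Suc n))" if "x \<in> C n" for n x using \<eta>(4) C(3) that by blast
  show thesis
  proof (rule that[of C p])
    show "compact (C n)" "C n \<subseteq> \<Omega>" "C n \<subseteq> interior (C (Suc n))" for n by (rule C)+
    show "\<exists>n. K \<subseteq> C n" if "compact K" "K \<subseteq> \<Omega>" for K using C(4)[OF that] by blast
    show "p i \<in> Cc_infinity \<Omega>" for i
    proof (cases i)
      case 0 then show ?thesis using \<eta>\<Omega> by (simp add: p0)
    next
      case (Suc k)
      obtain K1 where K1: "compact K1" "K1 \<subseteq> \<Omega>" "\<And>x. x \<notin> K1 \<Longrightarrow> \<eta> k x = 0"
        using \<eta>\<Omega>[of k] unfolding Cc_infinity_def by auto
      obtain K2 where K2: "compact K2" "K2 \<subseteq> \<Omega>" "\<And>x. x \<notin> K2 \<Longrightarrow> \<eta> (Suc k) x = 0"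
        using \<eta>\<Omega>[of "Suc k"] unfolding Cc_infinity_def by auto
      have "smooth (p i)" unfolding Suc pS
        using Cc_infinityD(1)[OF \<eta>\<Omega>] C_k_diff unfolding smooth_def by blast
      then show ?thesis
        by (rule Cc_infinityI[of _ "K1 \<union> K2"]) (use K1 K2 in \<open>auto simp: Suc pS\<close>)
    qed
    show "0 \<le> p i x" for i x
    proof (cases i)
      case 0 then show ?thesis using \<eta>(2) by (simp add: p0)
    next
      case (Suc k)
      show ?thesis
      proof (cases "x \<in> C (Suc k)")
        case True
        then have "\<eta> (Suc k) x = 1" using \<eta>(4,5) by blast
        then show ?thesis using \<eta>(2)[of k x] by (simp add: Suc pS)
      next
        case False
        then have "x \<notin> interior (C (Suc k))" using interior_subset by blast
        then have "\<eta> k x = 0" by (rule Cc_infinityD(5)[OF \<eta>(1)])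
        then show ?thesis using \<eta>(2)[of "Suc k" x] by (simp add: Suc pS)
      qed
    qed
    show "(\<Sum>i<Suc n. p i x) = 1" if "x \<in> C n" for n x
      using \<eta>(5)[of x n] \<eta>(4)[of n] that unfolding psum by blast
    show "(\<Sum>i<Suc n. partial_deriv j (p i) x) = 0" if "x \<in> C n" for n x j
      unfolding dsum using \<eta>(4)[of n] that by (intro partial_deriv_zero_open[OF \<eta>(3) _ \<eta>(5)]) auto
    show "p i x = 0" if "x \<in> C n" "n < i" for n i x by (rule pz[OF that(2) mem[OF that(1)]])
    show "partial_deriv j (p i) x = 0" if "x \<in> C n" "n < i" for n i x j
      by (rule partial_deriv_zero_open[OF op mem[OF that(1)] pz[OF that(2)]])
  qed
qed

lemma L2_set_sum_le:
  assumes "finite S"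
  shows "L2_set (\<lambda>k. \<Sum>i\<in>S. f i k) I \<le> (\<Sum>i\<in>S. L2_set (f i) I)"
  using assms
proof (induction rule: finite_induct)
  case (insert s S)
  then show ?case using L2_set_triangle_ineq[of "f s" "\<lambda>k. \<Sum>i\<in>S. f i k" I] by simp
qed (simp add: L2_set_def)

lemma mollification_eventually:
  fixes f :: "real ^ 'n \<Rightarrow> real"
  assumes "integrable lborel f" "e > 0"
  shows "\<forall>\<^sub>F m in sequentially. (\<integral>\<^sup>+x. ennreal \<bar>conv (mollifier m) lborel f x - f x\<bar> \<partial>lborel) \<le> ennreal e"
proof -
  have "\<forall>\<^sub>F m in sequentially. (\<integral>x. \<bar>conv (mollifier m) lborel f x - f x\<bar> \<partial>lborel) < e"
    using order_tendstoD(2)[OF mollification_tendsto_L1[OF assms(1)] assms(2)] .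
  then show ?thesis
  proof eventually_elim
    case (elim m)
    have "integrable lborel (\<lambda>x. \<bar>conv (mollifier m) lborel f x - f x\<bar>)"
      using lborel.integrable_conv[OF mollifier assms(1)] assms(1) by simp
    then show ?case using elim by (simp add: nn_integral_eq_integral ennreal_leI)
  qed
qed

lemma suminf_half_ennreal: "e \<ge> 0 \<Longrightarrow> (\<Sum>i. ennreal (e * (1 / 2) ^ Suc i)) = ennreal e"
  by (rule suminf_ennreal_eq) (use sums_mult[OF power_half_series, of e] in auto)

lemma integration_by_parts_smooth:
  fixes u :: "real ^ 'n \<Rightarrow> real"
  assumes u: "smooth u" and \<phi>: "smooth \<phi>" "bounded_support \<phi>"
  shows "(\<integral>x. u x * partial_deriv j \<phi> x \<partial>lborel) = - (\<integral>x. partial_deriv j u x * \<phi> x \<partial>lborel)"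
proof -
  have pd: "partial_deriv j (\<lambda>x. u x * \<phi> x) = (\<lambda>x. u x * partial_deriv j \<phi> x + partial_deriv j u x * \<phi> x)"
    using partial_deriv_mult[OF smooth_differentiable[OF u] smooth_differentiable[OF \<phi>(1)]] by auto
  have "C_k (Suc 0) (\<lambda>x. u x * \<phi> x)" using u \<phi>(1) C_k_mult unfolding smooth_def by blast
  from integral_partial_deriv_zero[OF this bounded_support_mult_right[OF \<phi>(2)], of j]
  have 0: "(\<integral>x. u x * partial_deriv j \<phi> x + partial_deriv j u x * \<phi> x \<partial>lborel) = 0" by (simp add: pd)
  have c: "continuous_on UNIV (\<lambda>x. f x * g x)" if "smooth f" "smooth g" for f g :: "real ^ 'n \<Rightarrow> real"
    using that[THEN smooth_continuous] by (rule continuous_on_mult)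
  have "integrable lborel (\<lambda>x. u x * partial_deriv j \<phi> x)" "integrable lborel (\<lambda>x. partial_deriv j u x * \<phi> x)"
    by (intro integrable_bounded_support c u \<phi> smooth_partial_deriv bounded_support_mult_right
        bounded_support_partial_deriv)+
  then show ?thesis using 0 by simp
qed

text \<open>The function built here is \<open>\<Sum>i. \<rho>\<^sub>i * (p i g)\<close> for a smooth partition of unity \<open>p\<close> and
  mollifiers \<open>\<rho>\<^sub>i\<close> whose radii shrink so fast that the sum is locally finite.\<close>

lemma Meyers_Serrin_measure:
  fixes \<Omega> :: "(real ^ 'n) set" and g :: "nat \<Rightarrow> real ^ 'n \<Rightarrow> real"
  assumes \<Omega>: "open \<Omega>" and \<delta>: "\<delta> > 0"
    and \<kappa>: "finite_measure \<kappa>" "sets \<kappa> = sets (borel_on \<Omega>)" and h: "\<And>k j. integrable \<kappa> (h k j)"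
    and g: "\<And>k. integrable lborel (g k)" "\<And>k. g k \<in> borel_measurable borel" "\<And>k x. x \<notin> \<Omega> \<Longrightarrow> g k x = 0"
    and weak: "\<And>\<phi> k j. \<phi> \<in> Cc_infinity \<Omega> \<Longrightarrow> k < d \<Longrightarrow>
      (\<integral>x. g k x * partial_deriv j \<phi> x \<partial>lborel) = - (\<integral>y. \<phi> y * h k j y \<partial>\<kappa>)"
  obtains v V where
    "\<And>k. continuous_on \<Omega> (v k)" "\<And>k. k < d \<Longrightarrow> integrable lborel (v k)" "\<And>k x. x \<notin> \<Omega> \<Longrightarrow> v k x = 0"
    "\<And>k j. k < d \<Longrightarrow> integrable lborel (V k j)" "\<And>k j x. x \<notin> \<Omega> \<Longrightarrow> V k j x = 0"
    "(\<integral>\<^sup>+x. ennreal (norm_vec d (\<lambda>k. v k x - g k x)) \<partial>lborel) \<le> ennreal \<delta>"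
    "(\<integral>\<^sup>+x. ennreal (frob d (\<lambda>k j. V k j x)) \<partial>lborel)
      \<le> (\<integral>\<^sup>+y. ennreal (frob d (\<lambda>k j. h k j y)) \<partial>\<kappa>) + ennreal \<delta>"
    "\<And>\<phi> k j. \<phi> \<in> Cc_infinity \<Omega> \<Longrightarrow> k < d \<Longrightarrow>
      (\<integral>x. v k x * partial_deriv j \<phi> x \<partial>lborel) = - (\<integral>x. V k j x * \<phi> x \<partial>lborel)"
proof -
  note [simp del] = sum.lessThan_Suc
  interpret \<kappa>: euclidean_measure \<kappa> by (rule euclidean_measure_borel_on[OF \<kappa>])
  have spk: "space \<kappa> = \<Omega>" using sets_eq_imp_space_eq[OF \<kappa>(2)] by (simp add: space_restrict_space)
  have \<Omega>b: "\<Omega> \<in> sets borel" using \<Omega> by simp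
  obtain C :: "nat \<Rightarrow> (real ^ 'n) set" and p where
    C: "\<And>n. compact (C n)" "\<And>n. C n \<subseteq> \<Omega>" "\<And>n. C n \<subseteq> interior (C (Suc n))"
      "\<And>K. compact K \<Longrightarrow> K \<subseteq> \<Omega> \<Longrightarrow> \<exists>n. K \<subseteq> C n"
    and p: "\<And>i. p i \<in> Cc_infinity \<Omega>" "\<And>i x. 0 \<le> p i x"
    and psum: "\<And>n x. x \<in> C n \<Longrightarrow> (\<Sum>i<Suc n. p i x) = 1"
      "\<And>n x j. x \<in> C n \<Longrightarrow> (\<Sum>i<Suc n. partial_deriv j (p i) x) = 0"
    and pz: "\<And>n i x. x \<in> C n \<Longrightarrow> n < i \<Longrightarrow> p i x = 0"
      "\<And>n i x j. x \<in> C n \<Longrightarrow> n < i \<Longrightarrow> partial_deriv j (p i) x = 0"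
    by (rule smooth_partition_of_unity[OF \<Omega>]) (rule that; assumption)
  have Cmono: "m \<le> n \<Longrightarrow> C m \<subseteq> C n" for m n
    by (rule lift_Suc_mono_le[of C]) (use C(3) interior_subset in blast)
  have ex: "\<exists>n. x \<in> C n" if "x \<in> \<Omega>" for x using C(4)[of "{x}"] that by auto
  note ps = Cc_infinityD(1)[OF p(1)] and pc = Cc_infinityD(3)[OF p(1)]
    and pm = Cc_infinityD(4)[OF p(1)] and dp = Cc_infinity_partial_deriv[OF p(1)]
  have pg: "integrable lborel (\<lambda>y. p i y * g k y)" for i k
  proof -
    obtain B where B: "\<And>x. \<bar>p i x\<bar> \<le> B" using bounded_support_bounded[OF pc Cc_infinityD(2)[OF p(1)]] by blast
    have "integrable lborel (\<lambda>y. g k y * p i y)"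
      by (rule integrable_mult_bounded[OF g(1), of _ B]) (use pm B in auto)
    then show ?thesis by (simp add: mult.commute)
  qed
  have pdg: "integrable lborel (\<lambda>y. g k y * partial_deriv j (p i) y)" for i k j
  proof -
    obtain B where B: "\<And>x. \<bar>partial_deriv j (p i) x\<bar> \<le> B" using bounded_support_bounded[OF dp(1,2)] by blast
    show ?thesis by (rule integrable_mult_bounded[OF g(1), of _ B]) (use dp(3) B in auto)
  qed
  have pmk: "p i \<in> borel_measurable \<kappa>" for i
    using borel_measurable_borel_on[OF pm] measurable_cong_sets[OF \<kappa>(2) refl] by blast
  have ph: "integrable \<kappa> (\<lambda>y. p i y * h k j y)" for i k j
  proof -
    obtain B where B: "\<And>x. \<bar>p i x\<bar> \<le> B" using bounded_support_bounded[OF pc Cc_infinityD(2)[OF p(1)]] by blast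
    have "integrable \<kappa> (\<lambda>y. h k j y * p i y)"
      by (rule integrable_mult_bounded[OF h, of _ B]) (use pmk B in auto)
    then show ?thesis by (simp add: mult.commute)
  qed
  \<comment> \<open>The tolerance is shared among the d N entries of the gradient and, for each of
    them, among the pieces i by a geometric series. Adding 1 keeps L positive when d = 0.\<close>
  define L where "L = real d * real CARD('n) + 1"
  have L: "L \<ge> 1" by (simp add: L_def)
  define \<epsilon> where "\<epsilon> i = \<delta> / L * (1 / 2) ^ Suc i" for i
  have \<epsilon>: "\<epsilon> i > 0" for i using \<delta> L by (simp add: \<epsilon>_def)
  \<comment> \<open>The first condition makes the i-th mollified piece vanish on
    \<open>C (i - 2)\<close>, because \<open>p i\<close> vanishes on \<open>C (i - 1)\<close>; this
    gives local finiteness. The others control the L1 errors in the function and in the terms that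
    contain a derivative of \<open>p i\<close>.\<close>
  define Q where "Q i m \<longleftrightarrow> (2 \<le> i \<longrightarrow> thicken (C (i - 2)) (1 / real (Suc m)) \<subseteq> C (i - 1)) \<and>
      (\<forall>k<d. (\<integral>\<^sup>+x. ennreal \<bar>conv (mollifier m) lborel (\<lambda>y. p i y * g k y) x - p i x * g k x\<bar> \<partial>lborel) \<le> ennreal (\<epsilon> i)) \<and>
      (\<forall>k<d. \<forall>j. (\<integral>\<^sup>+x. ennreal \<bar>conv (mollifier m) lborel (\<lambda>y. g k y * partial_deriv j (p i) y) x
        - g k x * partial_deriv j (p i) x\<bar> \<partial>lborel) \<le> ennreal (\<epsilon> i))" for i m
  have Qex: "\<exists>m. Q i m" for i
  proof -
    have e1: "\<forall>\<^sub>F m in sequentially. 2 \<le> i \<longrightarrow> thicken (C (i - 2)) (1 / real (Suc m)) \<subseteq> C (i - 1)"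
    proof (cases "2 \<le> i")
      case True
      then have "Suc (i - 2) = i - 1" by simp
      then have "C (i - 2) \<subseteq> interior (C (i - 1))" using C(3)[of "i - 2"] by simp
      then obtain m0 where m0: "thicken (C (i - 2)) (3 / real (Suc m0)) \<subseteq> interior (C (i - 1))"
        using thicken_subset_open[OF C(1) open_interior] by blast
      have "thicken (C (i - 2)) (1 / real (Suc m)) \<subseteq> C (i - 1)" if "m \<ge> m0" for m
      proof -
        have "1 / real (Suc m) \<le> 3 / real (Suc m0)" using that by (intro frac_le) auto
        then have "thicken (C (i - 2)) (1 / real (Suc m)) \<subseteq> thicken (C (i - 2)) (3 / real (Suc m0))"
          unfolding thicken_def by (intro UN_mono order_refl subset_cball)
        then show ?thesis using m0 interior_subset by blast
      qed
      then show ?thesis by (auto simp: eventually_sequentially)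
    qed simp
    have e2: "\<forall>\<^sub>F m in sequentially. \<forall>k\<in>{..<d}. (\<integral>\<^sup>+x. ennreal \<bar>conv (mollifier m) lborel (\<lambda>y. p i y * g k y) x
        - p i x * g k x\<bar> \<partial>lborel) \<le> ennreal (\<epsilon> i)"
      by (intro eventually_ball_finite ballI mollification_eventually pg \<epsilon>) simp
    have e3: "\<forall>\<^sub>F m in sequentially. \<forall>k\<in>{..<d}. \<forall>j\<in>UNIV. (\<integral>\<^sup>+x. ennreal \<bar>conv (mollifier m) lborel
        (\<lambda>y. g k y * partial_deriv j (p i) y) x - g k x * partial_deriv j (p i) x\<bar> \<partial>lborel) \<le> ennreal (\<epsilon> i)"
      by (intro eventually_ball_finite ballI mollification_eventually pdg \<epsilon>) simp_all
    from eventually_happens[OF eventually_conj[OF e1 eventually_conj[OF e2 e3]]]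
    show ?thesis unfolding Q_def by auto
  qed
  obtain m where mQ: "\<And>i. Q i (m i)" using choice[of Q] Qex by blast
  have m: "2 \<le> i \<Longrightarrow> thicken (C (i - 2)) (1 / real (Suc (m i))) \<subseteq> C (i - 1)"
    "k < d \<Longrightarrow> (\<integral>\<^sup>+x. ennreal \<bar>conv (mollifier (m i)) lborel (\<lambda>y. p i y * g k y) x - p i x * g k x\<bar> \<partial>lborel) \<le> ennreal (\<epsilon> i)"
    "k < d \<Longrightarrow> (\<integral>\<^sup>+x. ennreal \<bar>conv (mollifier (m i)) lborel (\<lambda>y. g k y * partial_deriv j (p i) y) x
        - g k x * partial_deriv j (p i) x\<bar> \<partial>lborel) \<le> ennreal (\<epsilon> i)" for i k j
    using mQ[of i] unfolding Q_def by simp_all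
  define \<rho> where "\<rho> i = (mollifier (m i) :: real ^ 'n \<Rightarrow> real)" for i
  have \<rho>: "is_mollifier (1 / real (Suc (m i))) (\<rho> i)" for i unfolding \<rho>_def by (rule mollifier)
  \<comment> \<open>By the product rule the gradient of \<open>c\<close> splits into
    \<open>a\<close>, the mollified measure \<open>p i\<close> times Dg, and \<open>b\<close>, the
    mollification of g times the gradient of \<open>p i\<close>. The unmollified versions of the
    \<open>b\<close> terms add up to 0, so the \<open>b\<close> terms contribute only a
    mollification error.\<close>
  define c where "c k i = conv (\<rho> i) lborel (\<lambda>y. p i y * g k y)" for k i
  define a where "a k j i = conv (\<rho> i) \<kappa> (\<lambda>y. p i y * h k j y)" for k j i
  define b where "b k j i = conv (\<rho> i) lborel (\<lambda>y. g k y * partial_deriv j (p i) y)" for k j i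
  have csm: "smooth (c k i)" for k i
    unfolding c_def by (rule lborel.smooth_conv(1)[OF mollifierD(1,4)[OF \<rho>] pg])
  have acont: "continuous_on UNIV (a k j i)" for k j i
    unfolding a_def by (rule \<kappa>.conv_continuous[OF mollifierD(5,4)[OF \<rho>] ph])
  have bcont: "continuous_on UNIV (b k j i)" for k j i
    unfolding b_def by (rule lborel.conv_continuous[OF mollifierD(5,4)[OF \<rho>] pdg])
  \<comment> \<open>As a function of y the product of \<open>p i y\<close> and the mollifier centred
    at x is an admissible test function, its support being compact in \<Omega>. The weak identity
    for it trades the derivative of the mollifier for the measure.\<close>
  have pdc: "partial_deriv j (c k i) x = a k j i x + b k j i x" if k: "k < d" for k j i x
  proof -
    let ?\<psi> = "\<lambda>y. p i y * \<rho> i (x - y)"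
    have rs: "smooth (\<lambda>y. \<rho> i (x - y))"
      using mollifierD(1)[OF \<rho>[of i]] C_k_reflect unfolding smooth_def by blast
    have \<psi>: "?\<psi> \<in> Cc_infinity \<Omega>" by (rule Cc_infinity_mult[OF p(1) rs])
    have pd: "partial_deriv j ?\<psi> y = p i y * (- partial_deriv j (\<rho> i) (x - y)) + partial_deriv j (p i) y * \<rho> i (x - y)" for y
      using partial_deriv_mult[OF smooth_differentiable[OF ps[of i]] smooth_differentiable[OF rs], of j y]
        partial_deriv_reflect(2)[OF smooth_differentiable[OF mollifierD(1)[OF \<rho>[of i]]], of j x y] by simp
    have i1: "integrable lborel (\<lambda>y. partial_deriv j (\<rho> i) (x - y) * (p i y * g k y))"
      by (rule lborel.conv_integrable[OF _ _ pg])
        (use smooth_continuous[OF smooth_partial_deriv[OF mollifierD(1)[OF \<rho>]]]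
          bounded_support_partial_deriv[OF mollifierD(4)[OF \<rho>]] in auto)
    have i2: "integrable lborel (\<lambda>y. \<rho> i (x - y) * (g k y * partial_deriv j (p i) y))"
      by (rule lborel.conv_integrable[OF mollifierD(5,4)[OF \<rho>] pdg])
    have "(\<integral>y. g k y * partial_deriv j ?\<psi> y \<partial>lborel)
        = (\<integral>y. \<rho> i (x - y) * (g k y * partial_deriv j (p i) y) - partial_deriv j (\<rho> i) (x - y) * (p i y * g k y) \<partial>lborel)"
      by (intro Bochner_Integration.integral_cong) (simp_all add: pd algebra_simps)
    also have "\<dots> = b k j i x - conv (partial_deriv j (\<rho> i)) lborel (\<lambda>y. p i y * g k y) x"
      unfolding b_def conv_def using i1 i2 by simp
    finally have "b k j i x - conv (partial_deriv j (\<rho> i)) lborel (\<lambda>y. p i y * g k y) x = - (\<integral>y. ?\<psi> y * h k j y \<partial>\<kappa>)"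
      using weak[OF \<psi> k, of j] by simp
    moreover have "(\<integral>y. ?\<psi> y * h k j y \<partial>\<kappa>) = a k j i x"
      unfolding a_def conv_def by (intro Bochner_Integration.integral_cong) (simp_all add: algebra_simps)
    moreover have "partial_deriv j (c k i) = conv (partial_deriv j (\<rho> i)) lborel (\<lambda>y. p i y * g k y)"
      unfolding c_def by (rule lborel.smooth_conv(2)[OF mollifierD(1,4)[OF \<rho>] pg])
    ultimately show ?thesis by simp
  qed
  have far: "p i y = 0" "partial_deriv j (p i) y = 0"
    if x: "x \<in> C n" and i: "n + 2 \<le> i" and y: "dist x y \<le> 1 / real (Suc (m i))" for n x i y j
  proof -
    have "n \<le> i - 2" "i - 1 < i" "2 \<le> i" using i by linarith+
    then have "x \<in> C (i - 2)" using x Cmono[of n "i - 2"] by blast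
    then have "y \<in> thicken (C (i - 2)) (1 / real (Suc (m i)))" using y by (auto simp: mem_thicken)
    then have "y \<in> C (i - 1)" using m(1)[OF \<open>2 \<le> i\<close>] by blast
    then show "p i y = 0" "partial_deriv j (p i) y = 0" using pz[OF _ \<open>i - 1 < i\<close>] by blast+
  qed
  have z: "c k i x = 0" "a k j i x = 0" "b k j i x = 0" if "x \<in> C n" "n + 2 \<le> i" for n x i k j
  proof -
    show "c k i x = 0" unfolding c_def by (rule lborel.conv_eq_0[OF \<rho>]) (simp add: far(1)[OF that])
    show "a k j i x = 0" unfolding a_def by (rule \<kappa>.conv_eq_0[OF \<rho>]) (simp add: far(1)[OF that])
    show "b k j i x = 0" unfolding b_def by (rule lborel.conv_eq_0[OF \<rho>]) (simp add: far(2)[OF that])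
  qed
  define v where "v k x = indicator \<Omega> x * (\<Sum>i. c k i x)" for k x
  define V where "V k j x = indicator \<Omega> x * (\<Sum>i. a k j i x + b k j i x)" for k j x
  \<comment> \<open>Piece i vanishes on \<open>C (i - 2)\<close>, so on \<open>C n\<close> only the
    indices below n + 2 contribute.\<close>
  have v_eq: "v k x = (\<Sum>i<n + 2. c k i x)" if x: "x \<in> C n" for k n x
  proof -
    have "(\<Sum>i. c k i x) = (\<Sum>i<n + 2. c k i x)" by (rule suminf_finite) (simp_all add: z(1)[OF x] not_less)
    moreover have "x \<in> \<Omega>" using C(2) x by blast
    ultimately show ?thesis by (simp add: v_def)
  qed
  have V_eq: "V k j x = (\<Sum>i<n + 2. a k j i x + b k j i x)" if x: "x \<in> C n" for k j n x
  proof -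
    have "(\<Sum>i. a k j i x + b k j i x) = (\<Sum>i<n + 2. a k j i x + b k j i x)"
      by (rule suminf_finite) (simp_all add: z(2,3)[OF x] not_less)
    moreover have "x \<in> \<Omega>" using C(2) x by blast
    ultimately show ?thesis by (simp add: V_def)
  qed
  define e where "e k i x = \<bar>c k i x - p i x * g k x\<bar>" for k i x
  define f where "f k j i x = \<bar>b k j i x - g k x * partial_deriv j (p i) x\<bar>" for k j i x
  have e0: "e k i x \<ge> 0" and f0: "f k j i x \<ge> 0" for k j i x by (simp_all add: e_def f_def)
  have cm: "c k i \<in> borel_measurable borel" for k i by (rule borel_measurable_continuous_onI[OF smooth_continuous[OF csm]])
  have am: "a k j i \<in> borel_measurable borel" for k j i by (rule borel_measurable_continuous_onI[OF acont])
  have bm: "b k j i \<in> borel_measurable borel" for k j i by (rule borel_measurable_continuous_onI[OF bcont])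
  have em: "(\<lambda>x. ennreal (e k i x)) \<in> borel_measurable lborel" for k i
    unfolding e_def using cm pm g(2) by simp
  have fm: "(\<lambda>x. ennreal (f k j i x)) \<in> borel_measurable lborel" for k j i
    unfolding f_def using bm dp(3) g(2) by simp
  have vm: "v k \<in> borel_measurable borel" for k
    unfolding v_def using cm \<Omega>b by (intro borel_measurable_times borel_measurable_indicator borel_measurable_suminf)
  have Vm: "V k j \<in> borel_measurable borel" for k j
    unfolding V_def using am bm \<Omega>b
    by (intro borel_measurable_times borel_measurable_indicator borel_measurable_suminf borel_measurable_add)
  have dL: "real d \<le> L" "real d * real CARD('n) \<le> L"
    unfolding L_def using mult_left_mono[of 1 "real CARD('n)" "real d"] by auto
  have L0: "L > 0" using L by linarith
  have \<delta>L: "0 \<le> \<delta> / L" using \<delta> L0 by (intro divide_nonneg_pos) simp_all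
  have frac_le: "r * (\<delta> / L) \<le> \<delta>" if "r \<le> L" for r
  proof -
    have "r * \<delta> \<le> L * \<delta>" by (rule mult_right_mono[OF that]) (use \<delta> in simp)
    then show ?thesis using L0 by (simp add: pos_divide_le_eq mult.commute)
  qed
  have half: "(\<Sum>i. ennreal (\<epsilon> i)) = ennreal (\<delta> / L)"
    unfolding \<epsilon>_def by (rule suminf_half_ennreal) (use \<delta> L in simp)
  have vg: "(\<integral>\<^sup>+x. ennreal (norm_vec d (\<lambda>k. v k x - g k x)) \<partial>lborel) \<le> ennreal \<delta>"
  proof -
    have "ennreal (norm_vec d (\<lambda>k. v k x - g k x)) \<le> (\<Sum>k<d. \<Sum>i. ennreal (e k i x))" for x
    proof (cases "x \<in> \<Omega>")
      case True
      then obtain n where n: "x \<in> C n" using ex by blast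
      then have "x \<in> C (Suc n)" using Cmono[of n "Suc n"] by auto
      then have s1: "(\<Sum>i<n + 2. p i x) = 1" using psum(1)[of x "Suc n"] by simp
      have eq: "v k x - g k x = (\<Sum>i<n + 2. c k i x - p i x * g k x)" for k
        unfolding v_eq[OF n] sum_subtractf sum_distrib_right[symmetric] s1 by simp
      have "\<bar>v k x - g k x\<bar> \<le> (\<Sum>i<n + 2. e k i x)" for k
        unfolding e_def eq by (rule sum_abs)
      then have "norm_vec d (\<lambda>k. v k x - g k x) \<le> (\<Sum>k<d. \<Sum>i<n + 2. e k i x)"
        by (intro order_trans[OF L2_set_le_sum_abs] sum_mono)
      then have "ennreal (norm_vec d (\<lambda>k. v k x - g k x)) \<le> ennreal (\<Sum>k<d. \<Sum>i<n + 2. e k i x)"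
        by (rule ennreal_leI)
      also have "\<dots> = (\<Sum>k<d. \<Sum>i<n + 2. ennreal (e k i x))"
        by (simp add: sum_nonneg e0)
      also have "\<dots> \<le> (\<Sum>k<d. \<Sum>i. ennreal (e k i x))"
        by (intro sum_mono sum_le_suminf) auto
      finally show ?thesis .
    qed (simp add: v_def g(3) L2_set_def)
    then have "(\<integral>\<^sup>+x. ennreal (norm_vec d (\<lambda>k. v k x - g k x)) \<partial>lborel)
        \<le> (\<integral>\<^sup>+x. (\<Sum>k<d. \<Sum>i. ennreal (e k i x)) \<partial>lborel)"
      by (intro nn_integral_mono)
    also have "\<dots> = (\<Sum>k<d. \<Sum>i. \<integral>\<^sup>+x. ennreal (e k i x) \<partial>lborel)"
      using em by (subst nn_integral_sum) (auto intro!: sum.cong nn_integral_suminf)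
    also have "\<dots> \<le> (\<Sum>k<d. \<Sum>i. ennreal (\<epsilon> i))"
      using m(2) unfolding e_def c_def \<rho>_def by (intro sum_mono suminf_le summableI) auto
    also have "\<dots> = ennreal (real d * (\<delta> / L))"
      by (subst ennreal_mult[OF _ \<delta>L]) (simp_all add: half ennreal_of_nat_eq_real_of_nat)
    also have "\<dots> \<le> ennreal \<delta>" by (rule ennreal_leI[OF frac_le[OF dL(1)]])
    finally show ?thesis .
  qed
  let ?H = "\<integral>\<^sup>+y. ennreal (frob d (\<lambda>k j. h k j y)) \<partial>\<kappa>"
  \<comment> \<open>The functions \<open>p i\<close> are nonnegative with sum 1, so the masses of
    the pieces \<open>p i\<close> times Dg add up to that of Dg. Only the \<open>b\<close> terms,
    measured against quantities whose sum is 0, cost the extra \<delta>.\<close>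
  have VH: "(\<integral>\<^sup>+x. ennreal (frob d (\<lambda>k j. V k j x)) \<partial>lborel) \<le> ?H + ennreal \<delta>"
  proof -
    let ?I = "{..<d} \<times> (UNIV :: 'n set)"
    let ?A = "\<lambda>i x. ennreal (frob d (\<lambda>k j. a k j i x))"
    let ?F = "\<lambda>x. \<Sum>q\<in>?I. \<Sum>i. ennreal (f (fst q) (snd q) i x)"
    have Am: "?A i \<in> borel_measurable lborel" for i
      using am by (intro measurable_compose[OF borel_measurable_L2_set measurable_ennreal]) auto
    have pw: "ennreal (frob d (\<lambda>k j. V k j x)) \<le> (\<Sum>i. ?A i x) + ?F x" for x
    proof (cases "x \<in> \<Omega>")
      case True
      then obtain n where n: "x \<in> C n" using ex by blast
      then have "x \<in> C (Suc n)" using Cmono[of n "Suc n"] by auto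
      then have s0: "(\<Sum>i<n + 2. partial_deriv j (p i) x) = 0" for j using psum(2)[of x "Suc n" j] by simp
      have eq: "V k j x = (\<Sum>i<n + 2. a k j i x) + (\<Sum>i<n + 2. b k j i x - g k x * partial_deriv j (p i) x)" for k j
        unfolding V_eq[OF n] sum_subtractf sum.distrib sum_distrib_left[symmetric] s0 by simp
      have "frob d (\<lambda>k j. V k j x) \<le> frob d (\<lambda>k j. \<Sum>i<n + 2. a k j i x)
          + frob d (\<lambda>k j. \<Sum>i<n + 2. b k j i x - g k x * partial_deriv j (p i) x)"
        unfolding eq by (rule L2_set_triangle_ineq)
      also have "\<dots> \<le> (\<Sum>i<n + 2. frob d (\<lambda>k j. a k j i x)) + (\<Sum>q\<in>?I. \<Sum>i<n + 2. f (fst q) (snd q) i x)"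
      proof (rule add_mono)
        show "frob d (\<lambda>k j. \<Sum>i<n + 2. a k j i x) \<le> (\<Sum>i<n + 2. frob d (\<lambda>k j. a k j i x))"
          by (rule L2_set_sum_le) simp
        show "frob d (\<lambda>k j. \<Sum>i<n + 2. b k j i x - g k x * partial_deriv j (p i) x)
            \<le> (\<Sum>q\<in>?I. \<Sum>i<n + 2. f (fst q) (snd q) i x)"
          unfolding f_def by (intro order_trans[OF L2_set_le_sum_abs] sum_mono sum_abs)
      qed
      finally have "ennreal (frob d (\<lambda>k j. V k j x))
          \<le> ennreal ((\<Sum>i<n + 2. frob d (\<lambda>k j. a k j i x)) + (\<Sum>q\<in>?I. \<Sum>i<n + 2. f (fst q) (snd q) i x))"
        by (rule ennreal_leI)
      also have "\<dots> = (\<Sum>i<n + 2. ?A i x) + (\<Sum>q\<in>?I. \<Sum>i<n + 2. ennreal (f (fst q) (snd q) i x))"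
        by (simp add: sum_nonneg f0)
      also have "\<dots> \<le> (\<Sum>i. ?A i x) + ?F x"
        by (intro add_mono sum_mono sum_le_suminf) auto
      finally show ?thesis .
    qed (simp add: V_def L2_set_def)
    have "(\<integral>\<^sup>+x. (\<Sum>i. ?A i x) \<partial>lborel) = (\<Sum>i. \<integral>\<^sup>+x. ?A i x \<partial>lborel)"
      by (rule nn_integral_suminf[OF Am])
    also have "\<dots> \<le> (\<Sum>i. \<integral>\<^sup>+y. ennreal (p i y) * ennreal (frob d (\<lambda>k j. h k j y)) \<partial>\<kappa>)"
    proof (intro suminf_le summableI)
      fix i
      have "(\<integral>\<^sup>+x. ?A i x \<partial>lborel) \<le> (\<integral>\<^sup>+y. ennreal (frob d (\<lambda>k j. p i y * h k j y)) \<partial>\<kappa>)"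
        unfolding a_def by (rule \<kappa>.nn_integral_conv_L2[OF \<rho>]) (auto intro: ph)
      also have "\<dots> = (\<integral>\<^sup>+y. ennreal (p i y) * ennreal (frob d (\<lambda>k j. h k j y)) \<partial>\<kappa>)"
        using p(2) by (intro nn_integral_cong) (simp add: L2_set_right_distrib[symmetric] ennreal_mult)
      finally show "(\<integral>\<^sup>+x. ?A i x \<partial>lborel) \<le> (\<integral>\<^sup>+y. ennreal (p i y) * ennreal (frob d (\<lambda>k j. h k j y)) \<partial>\<kappa>)" .
    qed
    also have "\<dots> = (\<integral>\<^sup>+y. (\<Sum>i. ennreal (p i y) * ennreal (frob d (\<lambda>k j. h k j y))) \<partial>\<kappa>)"
    proof (rule nn_integral_suminf[symmetric])
      have "(\<lambda>y. frob d (\<lambda>k j. h k j y)) \<in> borel_measurable \<kappa>"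
        using h by (intro borel_measurable_L2_set) auto
      then show "(\<lambda>y. ennreal (p i y) * ennreal (frob d (\<lambda>k j. h k j y))) \<in> borel_measurable \<kappa>" for i
        using pmk by simp
    qed
    also have "\<dots> = ?H"
    proof (rule nn_integral_cong)
      fix y assume "y \<in> space \<kappa>"
      then obtain n where n: "y \<in> C n" using ex spk by blast
      have "(\<Sum>i. ennreal (p i y)) = (\<Sum>i<Suc n. ennreal (p i y))"
        by (rule suminf_finite) (auto simp: pz(1)[OF n])
      also have "\<dots> = ennreal (\<Sum>i<Suc n. p i y)" by (rule sum_ennreal) (rule p(2))
      also have "\<dots> = 1" by (simp only: psum(1)[OF n] ennreal_1)
      finally show "(\<Sum>i. ennreal (p i y) * ennreal (frob d (\<lambda>k j. h k j y))) = ennreal (frob d (\<lambda>k j. h k j y))"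
        by simp
    qed
    finally have I1: "(\<integral>\<^sup>+x. (\<Sum>i. ?A i x) \<partial>lborel) \<le> ?H" .
    have "(\<integral>\<^sup>+x. ?F x \<partial>lborel) = (\<Sum>q\<in>?I. \<Sum>i. \<integral>\<^sup>+x. ennreal (f (fst q) (snd q) i x) \<partial>lborel)"
      using fm by (subst nn_integral_sum) (auto intro!: sum.cong nn_integral_suminf)
    also have "\<dots> \<le> (\<Sum>q\<in>?I. \<Sum>i. ennreal (\<epsilon> i))"
      using m(3) unfolding f_def b_def \<rho>_def by (intro sum_mono suminf_le summableI) auto
    also have "\<dots> = ennreal ((real d * real CARD('n)) * (\<delta> / L))"
      by (subst ennreal_mult[OF _ \<delta>L])
        (simp_all add: half card_cartesian_product flip: ennreal_of_nat_eq_real_of_nat of_nat_mult)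
    also have "\<dots> \<le> ennreal \<delta>" by (rule ennreal_leI[OF frac_le[OF dL(2)]])
    finally have I2: "(\<integral>\<^sup>+x. ?F x \<partial>lborel) \<le> ennreal \<delta>" .
    have "(\<integral>\<^sup>+x. ennreal (frob d (\<lambda>k j. V k j x)) \<partial>lborel) \<le> (\<integral>\<^sup>+x. (\<Sum>i. ?A i x) + ?F x \<partial>lborel)"
      by (intro nn_integral_mono pw)
    also have "\<dots> = (\<integral>\<^sup>+x. (\<Sum>i. ?A i x) \<partial>lborel) + (\<integral>\<^sup>+x. ?F x \<partial>lborel)"
      by (intro nn_integral_add borel_measurable_suminf_order borel_measurable_sum Am fm)
    also have "\<dots> \<le> ?H + ennreal \<delta>" by (rule add_mono[OF I1 I2])
    finally show ?thesis .
  qed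
  have Hfin: "?H < \<infinity>"
    using integrable_L2_set[of "{..<d} \<times> UNIV" \<kappa> "\<lambda>q. h (fst q) (snd q)"] h by (simp add: nn_integral_eq_integral)
  show thesis
  proof (rule that[of v V, OF _ _ _ _ _ vg VH])
    show "continuous_on \<Omega> (v k)" for k
    proof (rule continuous_at_imp_continuous_on, rule ballI)
      fix x assume "x \<in> \<Omega>"
      then obtain n where n: "x \<in> C n" using ex by blast
      have "continuous_on (interior (C (Suc n))) (\<lambda>x. \<Sum>i<Suc n + 2. c k i x)"
        by (intro continuous_on_sum continuous_on_subset[OF smooth_continuous[OF csm]]) auto
      moreover have "v k y = (\<Sum>i<Suc n + 2. c k i y)" if "y \<in> interior (C (Suc n))" for y
        using v_eq[of y "Suc n" k] that interior_subset by blast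
      ultimately have "continuous_on (interior (C (Suc n))) (v k)"
        by (simp cong: continuous_on_cong)
      then show "isCont (v k) x"
        using C(3) n by (auto simp: continuous_on_eq_continuous_at)
    qed
    show "v k x = 0" "V k j x = 0" if "x \<notin> \<Omega>" for k j x using that by (simp_all add: v_def V_def)
    show "integrable lborel (v k)" if k: "k < d" for k
    proof -
      have "integrable lborel (\<lambda>x. v k x - g k x)"
      proof (rule integrableI_bounded)
        show "(\<lambda>x. v k x - g k x) \<in> borel_measurable lborel" using vm g(2) by simp
        have "(\<integral>\<^sup>+x. ennreal (norm (v k x - g k x)) \<partial>lborel) \<le> (\<integral>\<^sup>+x. ennreal (norm_vec d (\<lambda>k. v k x - g k x)) \<partial>lborel)"
        proof (intro nn_integral_mono ennreal_leI)
          fix x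
          have "\<bar>v k x - g k x\<bar> \<le> L2_set (\<lambda>k. \<bar>v k x - g k x\<bar>) {..<d}"
            using member_le_L2_set[of "{..<d}" k "\<lambda>k. \<bar>v k x - g k x\<bar>"] k by simp
          then show "norm (v k x - g k x) \<le> norm_vec d (\<lambda>k. v k x - g k x)" by (simp add: L2_set_def)
        qed
        also have "\<dots> < \<infinity>" using vg ennreal_less_top le_less_trans by fastforce
        finally show "(\<integral>\<^sup>+x. ennreal (norm (v k x - g k x)) \<partial>lborel) < \<infinity>" .
      qed
      from Bochner_Integration.integrable_add[OF this g(1)[of k]] show ?thesis by simp
    qed
    show "integrable lborel (V k j)" if k: "k < d" for k j
    proof (rule integrableI_bounded)
      show "V k j \<in> borel_measurable lborel" using Vm by simp
      have "(\<integral>\<^sup>+x. ennreal (norm (V k j x)) \<partial>lborel) \<le> (\<integral>\<^sup>+x. ennreal (frob d (\<lambda>k j. V k j x)) \<partial>lborel)"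
      proof (intro nn_integral_mono ennreal_leI)
        fix x
        have "\<bar>V k j x\<bar> \<le> L2_set (\<lambda>q. \<bar>V (fst q) (snd q) x\<bar>) ({..<d} \<times> UNIV)"
          using member_le_L2_set[of "{..<d} \<times> UNIV" "(k, j)" "\<lambda>q. \<bar>V (fst q) (snd q) x\<bar>"] k by simp
        then show "norm (V k j x) \<le> frob d (\<lambda>k j. V k j x)" by (simp add: L2_set_def)
      qed
      also have "\<dots> \<le> ?H + ennreal \<delta>" by (rule VH)
      also have "\<dots> < \<infinity>" using Hfin by simp
      finally show "(\<integral>\<^sup>+x. ennreal (norm (V k j x)) \<partial>lborel) < \<infinity>" .
    qed
    fix \<phi> k j assume \<phi>: "\<phi> \<in> Cc_infinity \<Omega>" and k: "k < d"
    obtain K where K: "compact K" "K \<subseteq> \<Omega>" "\<And>x. x \<notin> K \<Longrightarrow> \<phi> x = 0"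
      using \<phi> unfolding Cc_infinity_def by auto
    obtain n where n: "K \<subseteq> C n" using C(4)[OF K(1,2)] by blast
    have d0: "partial_deriv j \<phi> x = 0" if "x \<notin> K" for x
      by (rule partial_deriv_zero_open[where S="- K" and c=0]) (use that K in \<open>auto simp: compact_imp_closed open_Compl\<close>)
    note sm = Cc_infinityD(1,2)[OF \<phi>]
    have vx: "v k x * partial_deriv j \<phi> x = (\<Sum>i<n + 2. c k i x * partial_deriv j \<phi> x)" for x
    proof (cases "x \<in> K")
      case True
      then have "x \<in> C n" using n by blast
      then show ?thesis by (simp only: v_eq sum_distrib_right)
    qed (simp add: d0)
    have Vx: "V k j x * \<phi> x = (\<Sum>i<n + 2. partial_deriv j (c k i) x * \<phi> x)" for x
    proof (cases "x \<in> K")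
      case True
      then have "x \<in> C n" using n by blast
      then show ?thesis by (simp only: V_eq pdc[OF k] sum_distrib_right)
    qed (simp add: K(3))
    have i1: "integrable lborel (\<lambda>x. c k i x * partial_deriv j \<phi> x)" for i
      by (intro integrable_bounded_support continuous_on_mult smooth_continuous csm smooth_partial_deriv sm
          bounded_support_mult_right bounded_support_partial_deriv)
    have i2: "integrable lborel (\<lambda>x. partial_deriv j (c k i) x * \<phi> x)" for i
      by (intro integrable_bounded_support continuous_on_mult smooth_continuous csm smooth_partial_deriv sm
          bounded_support_mult_right)
    have "(\<integral>x. v k x * partial_deriv j \<phi> x \<partial>lborel) = (\<Sum>i<n + 2. \<integral>x. c k i x * partial_deriv j \<phi> x \<partial>lborel)"
      unfolding vx by (rule Bochner_Integration.integral_sum) (rule i1)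
    also have "\<dots> = (\<Sum>i<n + 2. - (\<integral>x. partial_deriv j (c k i) x * \<phi> x \<partial>lborel))"
      by (intro sum.cong refl integration_by_parts_smooth csm sm)
    also have "\<dots> = - (\<integral>x. V k j x * \<phi> x \<partial>lborel)"
      unfolding Vx by (subst Bochner_Integration.integral_sum) (auto simp: i2 sum_negf)
    finally show "(\<integral>x. v k x * partial_deriv j \<phi> x \<partial>lborel) = - (\<integral>x. V k j x * \<phi> x \<partial>lborel)" .
  qed
qed

subsection \<open>Smooth functions with a sawtooth perturbation are in SBV\<close>

lemma integral_lebesgue_eq_lborel:
  fixes f :: "'a::euclidean_space \<Rightarrow> 'b::{banach, second_countable_topology}"
  assumes "f \<in> borel_measurable borel" "B \<in> sets borel"
  shows "(LINT x:B|lebesgue. f x) = (LBINT x:B. f x)"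
  unfolding set_lebesgue_integral_def
  by (rule integral_completion) (use assms in simp)

lemma borel_on_borel: "open \<Omega> \<Longrightarrow> B \<in> sets (borel_on \<Omega>) \<Longrightarrow> B \<in> sets borel \<and> B \<subseteq> \<Omega>"
  by (auto simp: sets_restrict_space)

lemma borel_onI: "B \<in> sets borel \<Longrightarrow> B \<subseteq> \<Omega> \<Longrightarrow> B \<in> sets (borel_on \<Omega>)"
  by (auto simp: sets_restrict_space image_iff intro!: bexI[of _ B])

lemma vector_measure_vecI:
  fixes \<mu> :: "'a set \<Rightarrow> real ^ 'n"
  assumes "\<And>j. vector_measure M (\<lambda>B. \<mu> B $ j)"
  shows "vector_measure M \<mu>"
  unfolding vector_measure_def
proof (intro allI impI)
  fix A :: "nat \<Rightarrow> 'a set"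
  assume A: "range A \<subseteq> sets M" "disjoint_family A"
  have "(\<lambda>k. \<mu> (A k) $ j) sums (\<mu> (\<Union>k. A k) $ j)" for j
    using vector_measure_sums[OF assms[of j], of A] A by auto
  then show "(\<lambda>k. \<mu> (A k)) sums \<mu> (\<Union>k. A k)"
    unfolding sums_def by (intro vec_tendstoI) simp
qed

lemma vec_integrable:
  fixes f :: "'n::finite \<Rightarrow> 'a \<Rightarrow> real"
  assumes "\<And>j. integrable M (f j)"
  shows "integrable M (\<lambda>x. \<chi> j. f j x)" "(\<integral>x. (\<chi> j. f j x) \<partial>M) = (\<chi> j. \<integral>x. f j x \<partial>M)"
proof -
  have eq: "(\<lambda>x. \<chi> j. f j x) = (\<lambda>x. \<Sum>j\<in>UNIV. f j x *\<^sub>R axis j 1)"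
    using basis_expansion[of "\<chi> j. f j _"] by (simp add: fun_eq_iff scalar_mult_eq_scaleR)
  show i: "integrable M (\<lambda>x. \<chi> j. f j x)" unfolding eq using assms by simp
  show "(\<integral>x. (\<chi> j. f j x) \<partial>M) = (\<chi> j. \<integral>x. f j x \<partial>M)"
    using integral_bounded_linear[OF bounded_linear_vec_nth i] by (simp add: vec_eq_iff)
qed

text \<open>The reflection in the hyperplane on which the coordinate j equals a, for telling the two
  sides of a jump apart.\<close>

definition reflect :: "'n \<Rightarrow> real \<Rightarrow> real ^ 'n \<Rightarrow> real ^ 'n" where
  "reflect j a x = x + (2 * (a - x $ j)) *\<^sub>R axis j 1"

lemma reflect_component: "reflect j a x $ i = (if i = j then 2 * a - x $ j else x $ i)"
  by (simp add: reflect_def axis_def)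

lemma dist_reflect: "dist x (reflect j (x $ j) y) = dist x y"
proof -
  have "norm (reflect j (x $ j) y - x) = norm (y - x)"
    unfolding norm_vec_def L2_set_def
    by (intro arg_cong[where f=sqrt] sum.cong refl) (auto simp: reflect_component power2_commute)
  then show ?thesis by (simp add: dist_norm norm_minus_commute)
qed

lemma borel_measurable_reflect: "reflect j a \<in> borel_measurable borel"
  unfolding reflect_def[abs_def] by measurable

lemma lborel_distr_coord_reflect:
  fixes j :: "'n::finite"
  shows "distr lborel borel (reflect j a) = lborel"
proof -
  let ?e = "axis j 1 :: real ^ 'n" and ?c = "\<lambda>b. if b = axis j 1 then - 1 else (1 :: real)"
  have e: "?e \<in> Basis" by (simp add: axis_in_Basis_iff)
  have "(2 * a) *\<^sub>R ?e + (\<Sum>b\<in>Basis. (?c b * (x \<bullet> b)) *\<^sub>R b) = reflect j a x" for x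
  proof -
    have "(\<Sum>b\<in>Basis. (?c b * (x \<bullet> b)) *\<^sub>R b)
        = (\<Sum>b\<in>Basis. (x \<bullet> b) *\<^sub>R b + (if b = ?e then (- 2 * (x \<bullet> ?e)) *\<^sub>R ?e else 0))"
    proof (rule sum.cong[OF refl])
      fix b :: "real ^ 'n"
      show "(?c b * (x \<bullet> b)) *\<^sub>R b = (x \<bullet> b) *\<^sub>R b + (if b = ?e then (- 2 * (x \<bullet> ?e)) *\<^sub>R ?e else 0)"
      proof (cases "b = ?e")
        case True
        have key: "(- 1 * t) *\<^sub>R w = t *\<^sub>R w + (- 2 * t) *\<^sub>R w" for t and w :: "real ^ 'n"
        proof -
          have "(- 1 * t) *\<^sub>R w = (t + - 2 * t) *\<^sub>R w" by simp
          also have "\<dots> = t *\<^sub>R w + (- 2 * t) *\<^sub>R w" by (rule scaleR_add_left)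
          finally show ?thesis .
        qed
        show ?thesis by (simp only: True if_True simp_thms key)
      qed simp
    qed
    also have "\<dots> = x + (- 2 * (x \<bullet> ?e)) *\<^sub>R ?e"
      by (simp only: sum.distrib euclidean_representation sum.delta[OF finite_Basis] e if_True)
    finally show ?thesis
      by (simp add: reflect_def inner_axis scaleR_left_diff_distrib algebra_simps)
  qed
  then have "lborel = density (distr lborel borel (reflect j a)) (\<lambda>_. \<Prod>b\<in>(Basis :: (real ^ 'n) set). \<bar>?c b\<bar>)"
    using lborel_affine_euclidean[of ?c "(2 * a) *\<^sub>R ?e"] by simp
  also have "(\<Prod>b\<in>(Basis :: (real ^ 'n) set). \<bar>?c b\<bar>) = 1" by (intro prod.neutral) auto
  finally show ?thesis by (simp add: density_1)
qed

lemma integral_coord_reflect: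
  fixes f :: "real ^ 'n \<Rightarrow> real"
  assumes "f \<in> borel_measurable borel"
  shows "(\<integral>x. f (reflect j a x) \<partial>lborel) = (\<integral>x. f x \<partial>lborel)"
    and "integrable lborel f \<Longrightarrow> integrable lborel (\<lambda>x. f (reflect j a x))"
proof -
  have m: "reflect j a \<in> lborel \<rightarrow>\<^sub>M borel" by (simp only: measurable_lborel2 borel_measurable_reflect)
  show "(\<integral>x. f (reflect j a x) \<partial>lborel) = (\<integral>x. f x \<partial>lborel)"
    by (rule integral_distr[OF m assms, unfolded lborel_distr_coord_reflect, symmetric])
  show "integrable lborel f \<Longrightarrow> integrable lborel (\<lambda>x. f (reflect j a x))"
    by (rule integrable_distr_eq[OF m assms, unfolded lborel_distr_coord_reflect, THEN iffD1])
qed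

lemma saw_proj: "saw n (proj n j x $ j) = 0"
proof (cases "n = 0")
  case False
  have "real n * (proj n j x $ j) = of_int \<lfloor>real n * x $ j\<rfloor>"
  proof -
    have "real n * (proj n j x $ j) = real n * x $ j - frac (real n * x $ j)"
      using False by (simp add: proj_def saw_def right_diff_distrib)
    then show ?thesis by (simp add: frac_def)
  qed
  then show ?thesis by (simp add: saw_def)
qed (simp add: saw_def)

lemma saw_jump:
  assumes n: "n > 0" and s: "saw n t = 0" and h: "\<bar>h\<bar> < 1 / real n"
  shows "saw n (t + h) = (if h < 0 then 1 / real n + h else h)"
proof (cases "h < 0")
  case True
  then show ?thesis using saw_diff[OF n, of "- h" t] h s by simp
next
  case False
  then show ?thesis using saw_add[OF n, of h t] h s by simp
qed

lemma isCont_saw: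
  assumes "saw n t \<noteq> 0"
  shows "isCont (saw n) t"
proof -
  have n: "n \<noteq> 0" using assms by (auto simp: saw_def)
  have "real n * t \<notin> \<int>" using assms n by (simp add: saw_def frac_eq_0_iff)
  then have "isCont frac (real n * t)" by (rule continuous_frac)
  moreover have "isCont (\<lambda>t. real n * t) t" by simp
  ultimately have "isCont (\<lambda>t. frac (real n * t)) t" by (rule isCont_o2[rotated])
  then show ?thesis unfolding saw_def[abs_def] using n by (intro continuous_intros) auto
qed

lemma grid_negligible: "negligible {x :: real ^ 'n. \<exists>l. saw n (x $ l) = 0}" if "n > 0"
proof -
  have "{x :: real ^ 'n. \<exists>l. saw n (x $ l) = 0} = (\<Union>l. \<Union>m::int. {x. axis l 1 \<bullet> x = of_int m / real n})"
  proof -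
    have "saw n t = 0 \<longleftrightarrow> (\<exists>m::int. t = of_int m / real n)" for t
      using \<open>n > 0\<close> by (auto simp: saw_def frac_eq_0_iff Ints_def field_simps)
    then show ?thesis by (auto simp: inner_axis')
  qed
  also have "negligible \<dots>"
  proof -
    have "negligible (\<Union>m::int. {x :: real ^ 'n. axis l 1 \<bullet> x = of_int m / real n})" for l
      by (rule negligible_countable_Union) (auto intro!: negligible_hyperplane)
    then show ?thesis by (intro negligible_Union) auto
  qed
  finally show ?thesis .
qed

lemma null_set_integral_Diff:
  fixes f :: "'a \<Rightarrow> 'b::{banach, second_countable_topology}"
  assumes f: "set_integrable M B f" and B: "B \<in> sets M" and N: "N \<in> null_sets M"
  shows "(LINT x:B - N|M. f x) = (LINT x:B|M. f x)"
  unfolding set_lebesgue_integral_def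
proof (rule integral_cong_AE)
  show "(\<lambda>x. indicator B x *\<^sub>R f x) \<in> borel_measurable M"
    using f unfolding set_integrable_def by (rule borel_measurable_integrable)
  have "set_integrable M (B - N) f" by (rule set_integrable_subset[OF f]) (use B N in auto)
  then show "(\<lambda>x. indicator (B - N) x *\<^sub>R f x) \<in> borel_measurable M"
    unfolding set_integrable_def by (rule borel_measurable_integrable)
  show "AE x in M. indicator (B - N) x *\<^sub>R f x = indicator B x *\<^sub>R f x"
    using AE_not_in[OF N] by eventually_elim (auto simp: indicator_def)
qed

section \<open>A sawtooth function and its distributional derivative\<close>

locale sawtooth_function =
  fixes \<Omega> :: "(real ^ 'n) set" and d n :: nat
    and v :: "nat \<Rightarrow> real ^ 'n \<Rightarrow> real" and V F :: "nat \<Rightarrow> 'n \<Rightarrow> real ^ 'n \<Rightarrow> real"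
  assumes open_domain: "open \<Omega>" and bounded_domain: "bounded \<Omega>" and n_pos: "n > 0"
    and v_cont: "\<And>i. continuous_on \<Omega> (v i)"
    and v_int: "\<And>i. i < d \<Longrightarrow> integrable lborel (v i)"
    and V_int: "\<And>i j. i < d \<Longrightarrow> integrable lborel (V i j)"
    and v_weak: "\<And>\<phi> i j. \<phi> \<in> Cc_infinity \<Omega> \<Longrightarrow> i < d \<Longrightarrow>
      (\<integral>x. v i x * partial_deriv j \<phi> x \<partial>lborel) = - (\<integral>x. V i j x * \<phi> x \<partial>lborel)"
    and F_smooth: "\<And>i j. smooth (F i j)" and F_supp: "\<And>i j. bounded_support (F i j)"
begin

definition u :: "real ^ 'n \<Rightarrow> nat \<Rightarrow> real" where
  "u x i = v i x + (\<Sum>l\<in>UNIV. F i l x * saw n (x $ l))"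

text \<open>The derivative of \<open>u\<close> off the hyperplanes. The sawtooth in coordinate l has
  slope 1 in direction l only, so the entry in column j receives \<open>F i j\<close> alone, besides
  the terms in which \<open>F\<close> is differentiated.\<close>

definition A :: "nat \<Rightarrow> 'n \<Rightarrow> real ^ 'n \<Rightarrow> real" where
  "A i j x = V i j x + F i j x + (\<Sum>l\<in>UNIV. saw n (x $ l) * partial_deriv j (F i l) x)"

text \<open>The value at B of the measure with density \<open>F i j\<close> against the image of
  Lebesgue measure under \<open>proj n j\<close>. Since the sawtooth jumps downwards, it enters
  \<mu> with a minus sign.\<close>

definition jump :: "nat \<Rightarrow> 'n \<Rightarrow> (real ^ 'n) set \<Rightarrow> real" where
  "jump i j B = (\<integral>y. indicator B (proj n j y) * F i j (proj n j y) \<partial>lborel)"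

definition \<mu> :: "(real ^ 'n) set \<Rightarrow> nat \<Rightarrow> real ^ 'n" where
  "\<mu> B i = (\<chi> j. (LBINT x:B. A i j x) - jump i j B)"

lemma domain_borel: "\<Omega> \<in> sets borel"
  using open_domain by simp

lemma F_cont: "continuous_on UNIV (F i j)"
  by (rule smooth_continuous[OF F_smooth])

lemma F_meas: "F i j \<in> borel_measurable borel"
  by (rule borel_measurable_continuous_onI[OF F_cont])

lemma dF_cont: "continuous_on UNIV (partial_deriv l (F i j))"
  by (rule smooth_continuous[OF smooth_partial_deriv[OF F_smooth]])

lemma saw_coord_meas: "(\<lambda>x::real ^ 'n. saw n (x $ l)) \<in> borel_measurable borel"
  by measurable

lemma saw_abs: "\<bar>saw n t\<bar> \<le> 1"
  using saw_nonneg saw_le_1 by simp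

lemma saw_weighted_int:
  assumes "continuous_on UNIV f" "bounded_support f"
  shows "integrable lborel (\<lambda>x::real ^ 'n. saw n (x $ l) * f x)"
  by (rule integrable_weighted[OF assms saw_coord_meas]) (rule saw_abs)

lemma A_int: "i < d \<Longrightarrow> integrable lborel (A i j)"
  unfolding A_def[abs_def]
  by (intro Bochner_Integration.integrable_add Bochner_Integration.integrable_sum V_int
      saw_weighted_int dF_cont bounded_support_partial_deriv F_supp integrable_bounded_support F_cont)

lemma u_int: "i < d \<Longrightarrow> integrable lborel (\<lambda>x. u x i)"
proof -
  assume i: "i < d"
  have "integrable lborel (\<lambda>x. v i x + (\<Sum>l\<in>UNIV. saw n (x $ l) * F i l x))"
    by (intro Bochner_Integration.integrable_add Bochner_Integration.integrable_sum v_int i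
        saw_weighted_int F_cont F_supp)
  then show ?thesis unfolding u_def[abs_def] by (simp add: mult.commute)
qed

lemma u_meas: "i < d \<Longrightarrow> (\<lambda>x. u x i) \<in> borel_measurable borel"
  using borel_measurable_integrable[OF u_int] by simp

lemma F_proj_int: "integrable lborel (\<lambda>y. F i j (proj n j y))"
proof -
  obtain R where R: "\<And>x. F i j x \<noteq> 0 \<Longrightarrow> norm x \<le> R" using F_supp bounded_support_def by blast
  obtain B where B: "\<And>x. \<bar>F i j x\<bar> \<le> B" using bounded_support_bounded[OF F_cont F_supp] by blast
  have "integrable lborel (\<lambda>y. 1 * F i j (proj n j y))"
    by (rule integrable_proj[OF n_pos F_meas B, where R=R and w="\<lambda>_. 1"]) (use R in force)+
  then show ?thesis by simp
qed

lemma \<mu>_component: "\<mu> B i $ j = (LBINT x:B. A i j x) - jump i j B"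
  by (simp add: \<mu>_def)

text \<open>The Boolean index selects between two reference measures on \<Omega>: Lebesgue measure,
  with density \<open>A i j\<close>, and its image under \<open>proj n j\<close>, with density minus
  \<open>F i j\<close>.\<close>

lemma \<mu>_densities:
  assumes i: "i < d"
  shows "vector_measure (borel_on \<Omega>) (\<lambda>B. \<mu> B i $ j)"
    and "\<phi> \<in> borel_measurable borel \<Longrightarrow> (\<And>x. \<bar>\<phi> x\<bar> \<le> C) \<Longrightarrow> (\<And>x. x \<notin> \<Omega> \<Longrightarrow> \<phi> x = 0) \<Longrightarrow>
      signed_integral (borel_on \<Omega>) (\<lambda>B. \<mu> B i $ j) \<phi>
        = (\<integral>x. \<phi> x * A i j x \<partial>lborel) - (\<integral>y. \<phi> (proj n j y) * F i j (proj n j y) \<partial>lborel)"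
proof -
  let ?P = "distr lborel borel (proj n j)"
  define \<kappa> where "\<kappa> b = restrict_space (if b then lborel else ?P) \<Omega>" for b
  define h where "h b = (if b then A i j else (\<lambda>x. - F i j x))" for b
  have Pm: "proj n j \<in> lborel \<rightarrow>\<^sub>M borel" by (simp only: measurable_lborel2 borel_measurable_proj)
  have s: "sets (\<kappa> b) = sets (borel_on \<Omega>)" for b
    unfolding \<kappa>_def by (rule sets_restrict_space_cong) simp
  have Om: "\<Omega> \<inter> space lborel \<in> sets lborel" "\<Omega> \<inter> space ?P \<in> sets ?P" using domain_borel by auto
  have int: "integrable (\<kappa> b) (h b)" for b
  proof (cases b)
    case True
    then show ?thesis unfolding \<kappa>_def h_def
      using integrable_mult_indicator[OF _ A_int[OF i], of \<Omega> j] domain_borel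
      by (simp add: integrable_restrict_space)
  next
    case False
    have "integrable ?P (F i j)" by (rule integrable_distr_eq[OF Pm F_meas, THEN iffD2, OF F_proj_int])
    then have "integrable ?P (\<lambda>x. indicator \<Omega> x *\<^sub>R - F i j x)"
      by (intro integrable_mult_indicator Bochner_Integration.integrable_minus) (use domain_borel in auto)
    then show ?thesis unfolding \<kappa>_def h_def using False Om(2)
      by (simp add: integrable_restrict_space)
  qed
  have LA: "(LINT x|\<kappa> True. f x * h True x) = (\<integral>x. f x * A i j x \<partial>lborel)" if "\<And>x. x \<notin> \<Omega> \<Longrightarrow> f x = 0" for f
    unfolding \<kappa>_def h_def using that
    by (simp add: integral_restrict_space domain_borel) (auto intro!: Bochner_Integration.integral_cong simp: indicator_def)
  have LF: "(LINT x|\<kappa> False. f x * h False x) = - (\<integral>y. f (proj n j y) * F i j (proj n j y) \<partial>lborel)"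
    if z: "\<And>x. x \<notin> \<Omega> \<Longrightarrow> f x = 0" and m: "f \<in> borel_measurable borel" for f
  proof -
    have "(LINT x|\<kappa> False. f x * h False x) = (\<integral>x. indicator \<Omega> x *\<^sub>R (f x * - F i j x) \<partial>?P)"
      unfolding \<kappa>_def h_def using Om(2) by (simp add: integral_restrict_space)
    also have "\<dots> = (\<integral>x. - (f x * F i j x) \<partial>?P)"
      using z by (intro Bochner_Integration.integral_cong) (auto simp: indicator_def)
    also have "\<dots> = (\<integral>y. - (f (proj n j y) * F i j (proj n j y)) \<partial>lborel)"
      by (rule integral_distr[OF Pm]) (intro borel_measurable_uminus borel_measurable_times m F_meas)
    finally show ?thesis by simp
  qed
  have eq: "\<mu> B i $ j = (\<Sum>b\<in>UNIV. LINT x:B|\<kappa> b. h b x)" if B: "B \<in> sets (borel_on \<Omega>)" for B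
  proof -
    have Bb: "B \<in> sets borel" "B \<subseteq> \<Omega>" using borel_on_borel[OF open_domain B] by auto
    then have "(LINT x:B|\<kappa> True. h True x) = (LBINT x:B. A i j x)"
      unfolding set_lebesgue_integral_def using LA[of "indicator B"] by (auto simp: indicator_def)
    moreover have "(LINT x:B|\<kappa> False. h False x) = - jump i j B"
      unfolding set_lebesgue_integral_def jump_def using LF[of "indicator B"] Bb by (auto simp: indicator_def)
    ultimately show ?thesis by (simp add: UNIV_bool \<mu>_component)
  qed
  show "vector_measure (borel_on \<Omega>) (\<lambda>B. \<mu> B i $ j)"
    by (rule signed_measure_densities(1)[where I=UNIV and \<kappa>=\<kappa> and h=h, OF finite_class.finite s int eq])
  assume \<phi>: "\<phi> \<in> borel_measurable borel" "\<And>x. \<bar>\<phi> x\<bar> \<le> C" "\<And>x. x \<notin> \<Omega> \<Longrightarrow> \<phi> x = 0"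
  have "signed_integral (borel_on \<Omega>) (\<lambda>B. \<mu> B i $ j) \<phi> = (\<Sum>b\<in>UNIV. \<integral>x. \<phi> x * h b x \<partial>\<kappa> b)"
    by (rule signed_measure_densities(2)[where I=UNIV and \<kappa>=\<kappa> and h=h, OF finite_class.finite s int eq
          borel_measurable_borel_on[OF \<phi>(1)] \<phi>(2)])
  then show "signed_integral (borel_on \<Omega>) (\<lambda>B. \<mu> B i $ j) \<phi>
      = (\<integral>x. \<phi> x * A i j x \<partial>lborel) - (\<integral>y. \<phi> (proj n j y) * F i j (proj n j y) \<partial>lborel)"
    using LA[of \<phi>, OF \<phi>(3)] LF[of \<phi>, OF \<phi>(3,1)] by (simp add: UNIV_bool)
qed

text \<open>The product rule writes \<open>F\<close> times the derivative of \<phi> as the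
  derivative of their product minus a term in which \<open>F\<close> is differentiated;
  \<open>saw_integration_by_parts\<close> treats the former.\<close>

lemma saw_part_weak:
  assumes \<phi>: "\<phi> \<in> Cc_infinity \<Omega>"
  shows "(\<integral>x. saw n (x $ l) * F i l x * partial_deriv j \<phi> x \<partial>lborel)
    = (if j = l then (\<integral>x. F i l (proj n l x) * \<phi> (proj n l x) \<partial>lborel) - (\<integral>x. F i l x * \<phi> x \<partial>lborel) else 0)
      - (\<integral>x. saw n (x $ l) * partial_deriv j (F i l) x * \<phi> x \<partial>lborel)"
proof -
  note sm = Cc_infinityD(1,2)[OF \<phi>]
  have C1: "C_k (Suc 0) (\<lambda>x. F i l x * \<phi> x)"
    using F_smooth sm(1) unfolding smooth_def by (intro C_k_mult) blast+
  have pd: "partial_deriv j (\<lambda>x. F i l x * \<phi> x) x = F i l x * partial_deriv j \<phi> x + partial_deriv j (F i l) x * \<phi> x" for x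
    by (rule partial_deriv_mult[OF smooth_differentiable[OF F_smooth] smooth_differentiable[OF sm(1)]])
  have c: "continuous_on UNIV (\<lambda>x. F i l x * partial_deriv j \<phi> x)" "continuous_on UNIV (\<lambda>x. partial_deriv j (F i l) x * \<phi> x)"
    by (intro continuous_on_mult F_cont dF_cont smooth_continuous smooth_partial_deriv sm)+
  have i1: "integrable lborel (\<lambda>x. saw n (x $ l) * (F i l x * partial_deriv j \<phi> x))"
    by (rule saw_weighted_int[OF c(1) bounded_support_mult_left[OF F_supp]])
  have i2: "integrable lborel (\<lambda>x. saw n (x $ l) * (partial_deriv j (F i l) x * \<phi> x))"
    by (rule saw_weighted_int[OF c(2) bounded_support_mult_right[OF sm(2)]])
  have "(\<integral>x. saw n (x $ l) * partial_deriv j (\<lambda>x. F i l x * \<phi> x) x \<partial>lborel)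
      = (\<integral>x. saw n (x $ l) * (F i l x * partial_deriv j \<phi> x) \<partial>lborel)
        + (\<integral>x. saw n (x $ l) * (partial_deriv j (F i l) x * \<phi> x) \<partial>lborel)"
    using i1 i2 by (simp add: pd distrib_left)
  then show ?thesis
    using saw_integration_by_parts[OF n_pos C1 bounded_support_mult_left[OF F_supp], of l j]
    by (simp add: mult.assoc split: if_splits)
qed

lemma has_distr_deriv_\<mu>: "has_distr_deriv \<Omega> d u \<mu>"
  unfolding has_distr_deriv_def
proof (intro conjI ballI allI impI)
  show "\<mu> \<in> radon_measures \<Omega> d"
    unfolding radon_measures_def using \<mu>_densities(1) by (auto intro: vector_measure_vecI)
  fix \<phi> i j assume \<phi>: "\<phi> \<in> Cc_infinity \<Omega>" and i: "i < d"
  note sm = Cc_infinityD[OF \<phi>] and dphi = Cc_infinity_partial_deriv[OF \<phi>, of j]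
  obtain B where B: "\<And>x. \<bar>\<phi> x\<bar> \<le> B" using bounded_support_bounded[OF sm(3,2)] by blast
  obtain B' where B': "\<And>x. \<bar>partial_deriv j \<phi> x\<bar> \<le> B'" using bounded_support_bounded[OF dphi(1,2)] by blast
  have d0: "partial_deriv j \<phi> x = 0" if "x \<notin> \<Omega>" for x
  proof -
    obtain K where K: "compact K" "K \<subseteq> \<Omega>" "\<And>x. x \<notin> K \<Longrightarrow> \<phi> x = 0"
      using \<phi> unfolding Cc_infinity_def by auto
    show ?thesis
      by (rule partial_deriv_zero_open[where S="- K" and c=0]) (use that K in \<open>auto simp: compact_imp_closed open_Compl\<close>)
  qed
  have iv: "integrable lborel (\<lambda>x. v i x * partial_deriv j \<phi> x)"
    by (rule integrable_mult_bounded[OF v_int[OF i], of _ B']) (use dphi(3) B' in auto)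
  have isw: "integrable lborel (\<lambda>x. saw n (x $ l) * F i l x * partial_deriv j \<phi> x)" for l
    by (rule integrable_mult_bounded[OF saw_weighted_int[OF F_cont F_supp], of _ B']) (use dphi(3) B' in auto)
  have iV: "integrable lborel (\<lambda>x. V i j x * \<phi> x)"
    by (rule integrable_mult_bounded[OF V_int[OF i], of _ B]) (use sm(4) B in auto)
  have iF: "integrable lborel (\<lambda>x. F i j x * \<phi> x)"
    by (rule integrable_mult_bounded[OF integrable_bounded_support[OF F_cont F_supp], of _ B]) (use sm(4) B in auto)
  have id: "integrable lborel (\<lambda>x. saw n (x $ l) * partial_deriv j (F i l) x * \<phi> x)" for l
    by (rule integrable_mult_bounded[OF saw_weighted_int[OF dF_cont bounded_support_partial_deriv[OF F_supp]], of _ B])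
      (use sm(4) B in auto)
  have "(LINT x:\<Omega>|lebesgue. u x i * partial_deriv j \<phi> x) = (LBINT x:\<Omega>. u x i * partial_deriv j \<phi> x)"
    by (rule integral_lebesgue_eq_lborel[OF borel_measurable_times[OF u_meas[OF i] dphi(3)] domain_borel])
  also have "\<dots> = (\<integral>x. u x i * partial_deriv j \<phi> x \<partial>lborel)"
    unfolding set_lebesgue_integral_def by (intro Bochner_Integration.integral_cong) (auto simp: indicator_def d0)
  also have "\<dots> = (\<integral>x. v i x * partial_deriv j \<phi> x + (\<Sum>l\<in>UNIV. saw n (x $ l) * F i l x * partial_deriv j \<phi> x) \<partial>lborel)"
    by (intro Bochner_Integration.integral_cong refl)
      (simp only: u_def distrib_right sum_distrib_right mult.commute[of "saw n _"])
  also have "\<dots> = (\<integral>x. v i x * partial_deriv j \<phi> x \<partial>lborel)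
      + (\<Sum>l\<in>UNIV. \<integral>x. saw n (x $ l) * F i l x * partial_deriv j \<phi> x \<partial>lborel)"
    using iv isw by simp
  also have "(\<Sum>l\<in>UNIV. \<integral>x. saw n (x $ l) * F i l x * partial_deriv j \<phi> x \<partial>lborel)
      = (\<integral>x. F i j (proj n j x) * \<phi> (proj n j x) \<partial>lborel) - (\<integral>x. F i j x * \<phi> x \<partial>lborel)
        - (\<Sum>l\<in>UNIV. \<integral>x. saw n (x $ l) * partial_deriv j (F i l) x * \<phi> x \<partial>lborel)"
    unfolding saw_part_weak[OF \<phi>] by (simp add: sum_subtractf)
  also have "(\<integral>x. v i x * partial_deriv j \<phi> x \<partial>lborel) = - (\<integral>x. V i j x * \<phi> x \<partial>lborel)"
    by (rule v_weak[OF \<phi> i])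
  finally have "(LINT x:\<Omega>|lebesgue. u x i * partial_deriv j \<phi> x)
      = - ((\<integral>x. V i j x * \<phi> x \<partial>lborel) + (\<integral>x. F i j x * \<phi> x \<partial>lborel)
        + (\<Sum>l\<in>UNIV. \<integral>x. saw n (x $ l) * partial_deriv j (F i l) x * \<phi> x \<partial>lborel)
        - (\<integral>x. F i j (proj n j x) * \<phi> (proj n j x) \<partial>lborel))" by simp
  also have "(\<integral>x. V i j x * \<phi> x \<partial>lborel) + (\<integral>x. F i j x * \<phi> x \<partial>lborel)
        + (\<Sum>l\<in>UNIV. \<integral>x. saw n (x $ l) * partial_deriv j (F i l) x * \<phi> x \<partial>lborel)
      = (\<integral>x. V i j x * \<phi> x + F i j x * \<phi> x + (\<Sum>l\<in>UNIV. saw n (x $ l) * partial_deriv j (F i l) x * \<phi> x) \<partial>lborel)"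
    using iV iF id by simp
  also have "\<dots> = (\<integral>x. \<phi> x * A i j x \<partial>lborel)"
    by (intro Bochner_Integration.integral_cong refl)
      (simp only: A_def distrib_right sum_distrib_right mult.commute[of "\<phi> _"])
  also have "(\<integral>x. \<phi> x * A i j x \<partial>lborel) - (\<integral>x. F i j (proj n j x) * \<phi> (proj n j x) \<partial>lborel)
      = signed_integral (borel_on \<Omega>) (\<lambda>B. \<mu> B i $ j) \<phi>"
    using \<mu>_densities(2)[OF i sm(4) B sm(5), of j] by (simp add: mult.commute)
  finally show "(LINT x:\<Omega>|lebesgue. u x i * partial_deriv j \<phi> x) = - signed_integral (borel_on \<Omega>) (\<lambda>B. \<mu> B i $ j) \<phi>" .
qed

lemma u_set_int: "i < d \<Longrightarrow> set_integrable lebesgue \<Omega> (\<lambda>x. u x i)"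
proof -
  assume i: "i < d"
  have "integrable lebesgue (\<lambda>x. u x i)" using u_int[OF i] u_meas[OF i] by (simp add: integrable_completion)
  then show ?thesis by (rule integrable_imp_set_integrable) (use domain_borel in simp)
qed

lemma u_BV: "u \<in> BV \<Omega> d"
  unfolding BV_def using u_set_int has_distr_deriv_\<mu> by blast

lemma D_u: "B \<in> sets (borel_on \<Omega>) \<Longrightarrow> i < d \<Longrightarrow> D \<Omega> d u B i = \<mu> B i"
  by (rule D_eq[OF open_domain has_distr_deriv_\<mu>])

text \<open>A null set that carries all the jump measures, since every value of
  \<open>proj n j\<close> has its coordinate j on the grid.\<close>

definition Z :: "(real ^ 'n) set" where
  "Z = {x \<in> \<Omega>. \<exists>l. saw n (x $ l) = 0}"

lemma Z_sets: "Z \<in> sets borel" "Z \<in> sets (borel_on \<Omega>)" "Z \<in> null_sets lebesgue"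
proof -
  have "Measurable.pred borel (\<lambda>x::real ^ 'n. saw n (x $ l) = 0)" for l
    using saw_coord_meas by measurable
  then have "(\<Union>l. {x::real ^ 'n. saw n (x $ l) = 0}) \<in> sets borel"
    by (intro sets.finite_UN) (simp_all add: pred_def)
  moreover have "(\<Union>l. {x::real ^ 'n. saw n (x $ l) = 0}) = {x. \<exists>l. saw n (x $ l) = 0}" by auto
  ultimately have "{x::real ^ 'n. \<exists>l. saw n (x $ l) = 0} \<in> sets borel" by simp
  then have "\<Omega> \<inter> {x::real ^ 'n. \<exists>l. saw n (x $ l) = 0} \<in> sets borel" using domain_borel by blast
  then show b: "Z \<in> sets borel" by (simp add: Z_def Collect_conj_eq)
  then show "Z \<in> sets (borel_on \<Omega>)" by (rule borel_onI) (auto simp: Z_def)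
  have "negligible Z" by (rule negligible_subset[OF grid_negligible[OF n_pos]]) (auto simp: Z_def)
  then show "Z \<in> null_sets lebesgue" by (simp add: negligible_iff_null_sets)
qed

text \<open>The jump measure lives where the sawtooth in coordinate j is 0 and \<open>F i j\<close>
  is not. This serves twice: off the grid for the Lebesgue decomposition, and off the discontinuity
  set for the Cantor part.\<close>

lemma jump_zero:
  assumes "\<And>x. x \<in> B \<Longrightarrow> saw n (x $ j) = 0 \<Longrightarrow> F i j x = 0"
  shows "jump i j B = 0"
proof -
  have "jump i j B = integral\<^sup>L lborel (\<lambda>y::real ^ 'n. 0)"
    unfolding jump_def using assms saw_proj by (intro Bochner_Integration.integral_cong) (auto simp: indicator_def)
  then show ?thesis by simp
qed

end

section \<open>The absolutely continuous part of the derivative\<close>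

context sawtooth_function
begin

definition G :: "real ^ 'n \<Rightarrow> nat \<Rightarrow> real ^ 'n" where
  "G x i = (\<chi> j. A i j x)"

lemma G_int: "i < d \<Longrightarrow> integrable lborel (\<lambda>x. G x i)"
  unfolding G_def by (rule vec_integrable(1)) (rule A_int)

lemma G_meas: "i < d \<Longrightarrow> (\<lambda>x. G x i) \<in> borel_measurable borel"
  using borel_measurable_integrable[OF G_int] by (simp only: measurable_lborel2)

lemma G_set_int: "i < d \<Longrightarrow> set_integrable lebesgue \<Omega> (\<lambda>x. G x i)"
proof -
  assume i: "i < d"
  have "integrable lebesgue (\<lambda>x. G x i)" 
    by (rule integrable_completion[THEN iffD2, OF borel_measurable_integrable[OF G_int[OF i]] G_int[OF i]])
  then show ?thesis by (rule integrable_imp_set_integrable) (use domain_borel in simp)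
qed

lemma density_G:
  assumes "B \<in> sets borel" "i < d"
  shows "lebesgue_density G B i = (\<chi> j. LBINT x:B. A i j x)"
proof -
  have "lebesgue_density G B i = (LBINT x:B. G x i)"
    unfolding lebesgue_density_def by (rule integral_lebesgue_eq_lborel[OF G_meas[OF assms(2)] assms(1)])
  also have "\<dots> = (\<integral>x. (\<chi> j. indicator B x * A i j x) \<partial>lborel)"
    unfolding set_lebesgue_integral_def G_def by (intro Bochner_Integration.integral_cong) (simp_all add: vec_eq_iff)
  also have "\<dots> = (\<chi> j. LBINT x:B. A i j x)"
    unfolding set_lebesgue_integral_def real_scaleR_def
    using integrable_mult_indicator[OF _ A_int[OF assms(2)], of B] assms(1) by (intro vec_integrable(2)) simp
  finally show ?thesis .
qed

lemma D_minus_density: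
  assumes "B \<in> sets (borel_on \<Omega>)" "i < d"
  shows "(D \<Omega> d u B i - lebesgue_density G B i) $ j = - jump i j B"
proof -
  have "lebesgue_density G B i = (\<chi> j. LBINT x:B. A i j x)"
    by (rule density_G[OF _ assms(2)]) (use borel_on_borel[OF open_domain assms(1)] in blast)
  then show ?thesis unfolding D_u[OF assms] by (simp add: \<mu>_component)
qed

lemma lebesgue_singular_G: "lebesgue_singular \<Omega> d (\<lambda>B i. D \<Omega> d u B i - lebesgue_density G B i)"
  unfolding lebesgue_singular_def
proof (intro bexI conjI)
  have "total_variation (borel_on \<Omega>) d (\<lambda>B i. D \<Omega> d u B i - lebesgue_density G B i) (\<Omega> - Z) \<le> 0"
    unfolding total_variation_def
  proof (rule SUP_least, clarify)
    fix X :: "nat \<Rightarrow> (real ^ 'n) set"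
    assume X: "range X \<subseteq> sets (borel_on \<Omega>)" "(\<Union>k. X k) = \<Omega> - Z"
    have "norm_mat d (\<lambda>i. D \<Omega> d u (X k) i - lebesgue_density G (X k) i) = 0" for k
    proof -
      have Xk: "X k \<in> sets (borel_on \<Omega>)" "X k \<subseteq> \<Omega> - Z" using X by auto
      have "D \<Omega> d u (X k) i - lebesgue_density G (X k) i = 0" if i: "i < d" for i
      proof -
        have "jump i j (X k) = 0" for j by (rule jump_zero) (use Xk(2) in \<open>auto simp: Z_def\<close>)
        then show ?thesis using D_minus_density[OF Xk(1) i] by (simp add: vec_eq_iff)
      qed
      then show ?thesis by (simp add: L2_set_def)
    qed
    then show "(\<Sum>k. ennreal (norm_mat d (\<lambda>i. D \<Omega> d u (X k) i - lebesgue_density G (X k) i))) \<le> 0" by simp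
  qed
  then show "total_variation (borel_on \<Omega>) d (\<lambda>B i. D \<Omega> d u B i - lebesgue_density G B i) (\<Omega> - Z) = 0" by simp
qed (use Z_sets in auto)

text \<open>Uniqueness in the Lebesgue decomposition: off the union of the two singular null sets
  both densities reproduce \<open>D \<Omega> d u\<close>, and removing a null set does not change
  the integral of a density.\<close>

lemma ac_grad_density:
  assumes B: "B \<in> sets (borel_on \<Omega>)" and i: "i < d"
  shows "lebesgue_density (ac_grad \<Omega> d u) B i = lebesgue_density G B i"
proof -
  let ?H = "ac_grad \<Omega> d u"
  have H: "(\<forall>i<d. set_integrable lebesgue \<Omega> (\<lambda>x. ?H x i)) \<and>
       lebesgue_singular \<Omega> d (\<lambda>B i. D \<Omega> d u B i - lebesgue_density ?H B i)"
    unfolding ac_grad_def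
    by (rule someI[of _ G]) (use G_set_int lebesgue_singular_G in auto)
  then obtain S where S: "S \<in> sets (borel_on \<Omega>)" "S \<in> null_sets lebesgue"
    "total_variation (borel_on \<Omega>) d (\<lambda>B i. D \<Omega> d u B i - lebesgue_density ?H B i) (\<Omega> - S) = 0"
    unfolding lebesgue_singular_def by blast
  have \<Omega>s: "\<Omega> \<in> sets (borel_on \<Omega>)" using borel_onI[OF domain_borel] by simp
  have Bb: "B \<in> sets borel" "B \<subseteq> \<Omega>" using borel_on_borel[OF open_domain B] by auto
  let ?B = "B - (S \<union> Z)"
  have B': "?B \<in> sets (borel_on \<Omega>)" by (intro sets.Diff sets.Un B S(1) Z_sets(2))
  have N: "S \<union> Z \<in> null_sets lebesgue" by (intro null_sets.Un S(2) Z_sets(3))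
  have diff: "lebesgue_density K ?B i = lebesgue_density K B i" if "set_integrable lebesgue \<Omega> (\<lambda>x. K x i)" for K
    unfolding lebesgue_density_def
    by (rule null_set_integral_Diff[OF set_integrable_subset[OF that] _ N]) (use Bb in auto)
  have "ennreal (norm_mat d (\<lambda>i. D \<Omega> d u ?B i - lebesgue_density ?H ?B i)) \<le> 0"
    unfolding S(3)[symmetric]
    by (rule norm_mat_le_total_variation[where \<mu>="\<lambda>B i. D \<Omega> d u B i - lebesgue_density ?H B i"])
      (use \<Omega>s S(1) B' Bb in auto)
  then have "norm_mat d (\<lambda>i. D \<Omega> d u ?B i - lebesgue_density ?H ?B i) = 0"
    by (simp add: order_antisym ennreal_eq_0_iff)
  then have "norm (D \<Omega> d u ?B i - lebesgue_density ?H ?B i) = 0"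
    using i by (subst (asm) L2_set_eq_0_iff) auto
  then have 1: "D \<Omega> d u ?B i = lebesgue_density ?H ?B i" by simp
  have "jump i j ?B = 0" for j by (rule jump_zero) (use Bb in \<open>auto simp: Z_def\<close>)
  then have "D \<Omega> d u ?B i = lebesgue_density G ?B i" using D_minus_density[OF B' i] by (simp add: vec_eq_iff)
  then show ?thesis using 1 diff[of ?H] diff[of G] H G_set_int i by auto
qed

subsection \<open>The discontinuity set\<close>

text \<open>At a jump of a sawtooth its coefficient tends to 0 while the sawtooth stays bounded, so
  the product is continuous; at the other points both factors are.\<close>

lemma u_isCont:
  assumes x: "x \<in> \<Omega>" and z: "\<And>j. saw n (x $ j) = 0 \<Longrightarrow> F i j x = 0"
  shows "isCont (\<lambda>y. u y i) x"
  unfolding u_def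
proof (intro continuous_add continuous_sum)
  show "isCont (v i) x" using v_cont open_domain x by (simp add: continuous_on_eq_continuous_at)
  fix l
  have Fc: "isCont (F i l) x" using F_cont by (simp add: continuous_on_eq_continuous_at)
  show "isCont (\<lambda>y. F i l y * saw n (y $ l)) x"
  proof (cases "saw n (x $ l) = 0")
    case True
    then have "F i l x = 0" by (rule z)
    then have "(F i l \<longlongrightarrow> 0) (at x)" using Fc by (simp add: isCont_def)
    moreover have "Bfun (\<lambda>y. saw n (y $ l)) (at x)"
      by (rule BfunI[of _ 1]) (simp add: saw_abs)
    ultimately have "((\<lambda>y. F i l y * saw n (y $ l)) \<longlongrightarrow> 0) (at x)"
      using bounded_bilinear.Zfun_prod_Bfun[OF bounded_bilinear_mult] by (simp add: tendsto_Zfun_iff)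
    then show ?thesis using \<open>F i l x = 0\<close> by (simp add: isCont_def)
  next
    case False
    have "isCont (\<lambda>y::real ^ 'n. y $ l) x" by simp
    then have "isCont (\<lambda>y. saw n (y $ l)) x" using isCont_saw[OF False] by (rule isCont_o2)
    then show ?thesis using Fc by (rule continuous_mult[rotated])
  qed
qed

lemma approx_limit:
  assumes x: "x \<in> \<Omega>" and z: "\<And>i j. i < d \<Longrightarrow> saw n (x $ j) = 0 \<Longrightarrow> F i j x = 0"
  shows "((\<lambda>r. (LINT y:ball x r|lebesgue. norm_vec d (\<lambda>i. u y i - u x i)) / measure lebesgue (ball x r)) \<longlongrightarrow> 0) (at_right 0)"
proof (rule tendstoI)
  fix e :: real assume e: "e > 0"
  have "((\<lambda>y. \<Sum>i<d. \<bar>u y i - u x i\<bar>) \<longlongrightarrow> (\<Sum>i<d. \<bar>u x i - u x i\<bar>)) (at x)"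
    using u_isCont[OF x] z by (intro tendsto_intros) (auto simp: isCont_def)
  then have "\<forall>\<^sub>F y in at x. (\<Sum>i<d. \<bar>u y i - u x i\<bar>) < e / 2"
    using e by (intro order_tendstoD(2)[of _ 0]) auto
  then obtain r0 where r0: "r0 > 0" "\<And>y. y \<noteq> x \<Longrightarrow> dist y x < r0 \<Longrightarrow> (\<Sum>i<d. \<bar>u y i - u x i\<bar>) < e / 2"
    unfolding eventually_at by auto
  have le: "norm_vec d (\<lambda>i. u y i - u x i) \<le> e / 2" if "dist y x < r0" for y
  proof (cases "y = x")
    case True then show ?thesis using e by (simp add: L2_set_def)
  next
    case False
    then show ?thesis using L2_set_le_sum_abs[of "\<lambda>i. u y i - u x i" "{..<d}"] r0(2)[OF False that] by simp
  qed
  have "dist ((LINT y:ball x r|lebesgue. norm_vec d (\<lambda>i. u y i - u x i)) / measure lebesgue (ball x r)) 0 < e"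
    if r: "0 < r" "r < r0" for r
  proof -
    let ?m = "measure lebesgue (ball x r)" and ?g = "\<lambda>y. indicator (ball x r) y *\<^sub>R norm_vec d (\<lambda>i. u y i - u x i)"
    have m: "?m > 0" using r(1) by (simp add: content_ball_pos)
    have "0 \<le> integral\<^sup>L lebesgue ?g" by (intro integral_nonneg_AE) auto
    moreover have "integral\<^sup>L lebesgue ?g \<le> e / 2 * ?m"
    proof (cases "integrable lebesgue ?g")
      case True
      have "integrable lebesgue (indicator (ball x r) :: real ^ 'n \<Rightarrow> real)"
        by (rule integrable_real_indicator) (use emeasure_bounded_finite[of "ball x r"] in simp_all)
      then have "integrable lebesgue (\<lambda>y. indicator (ball x r) y * (e / 2))" by (rule integrable_mult_left)
      then have "integral\<^sup>L lebesgue ?g \<le> (\<integral>y. indicator (ball x r) y * (e / 2) \<partial>lebesgue)"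
      proof (rule integral_mono[OF True])
        fix y
        show "indicator (ball x r) y *\<^sub>R norm_vec d (\<lambda>i. u y i - u x i) \<le> indicator (ball x r) y * (e / 2)"
          using le[of y] r(2) by (cases "y \<in> ball x r") (simp_all add: dist_commute)
      qed
      also have "\<dots> = ?m * (e / 2)"
        by (simp only: Bochner_Integration.integral_mult_left_zero Bochner_Integration.integral_indicator) simp
      finally show ?thesis by (simp only: mult.commute)
    next
      \<comment> \<open>Here the integral is 0 by convention, and the bound holds trivially.\<close>
      case False
      then show ?thesis using e m by (simp add: not_integrable_integral_eq)
    qed
    moreover have "e / 2 * ?m < e * ?m" using e by (intro mult_strict_right_mono m) simp
    ultimately have "0 \<le> integral\<^sup>L lebesgue ?g" "integral\<^sup>L lebesgue ?g < e * ?m" by linarith+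
    then show ?thesis using m unfolding set_lebesgue_integral_def
      by (simp only: dist_real_def diff_0_right abs_divide abs_of_nonneg abs_of_pos pos_divide_less_eq)
  qed
  then show "\<forall>\<^sub>F r in at_right 0. dist ((LINT y:ball x r|lebesgue. norm_vec d (\<lambda>i. u y i - u x i)) / measure lebesgue (ball x r)) 0 < e"
    using r0(1) unfolding eventually_at_right_field by (auto intro!: exI[of _ r0])
qed

text \<open>Reflection in the hyperplane through \<open>x\<close> orthogonal to the axis \<open>j\<close> exchanges the two sides of
  the jump and leaves the other terms unchanged up to an error that vanishes at \<open>x\<close>.\<close>

lemma reflected_difference:
  assumes x: "x \<in> \<Omega>" and s: "saw n (x $ j) = 0" and e: "e > 0"
  obtains r where "r > 0"
    "\<And>y. dist x y < r \<Longrightarrow> y $ j \<noteq> x $ j \<Longrightarrow> \<bar>u y i - u (reflect j (x $ j) y) i\<bar> \<ge> \<bar>F i j x\<bar> / real n - e"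
proof -
  let ?\<sigma> = "reflect j (x $ j)"
  obtain B where B: "B > 0" "\<And>y. \<bar>F i j y\<bar> \<le> B" using bounded_support_bounded[OF F_cont F_supp] by blast
  \<comment> \<open>All error terms in one function. The reflection fixes x, so each summand is
    continuous there and vanishes at x.\<close>
  define E where "E y = \<bar>v i y - v i (?\<sigma> y)\<bar> + (\<Sum>l\<in>UNIV. \<bar>F i l y - F i l (?\<sigma> y)\<bar>) + 2 * B * \<bar>y $ j - x $ j\<bar>
      + \<bar>F i j y - F i j x\<bar> + \<bar>F i j (?\<sigma> y) - F i j x\<bar>" for y
  have \<sigma>x: "?\<sigma> x = x" by (simp add: reflect_def)
  have \<sigma>c: "isCont ?\<sigma> x" unfolding reflect_def[abs_def] by (intro continuous_intros)
  have vc: "isCont (v i) x" using v_cont open_domain x by (simp add: continuous_on_eq_continuous_at)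
  have Fc: "isCont (F i l) x" for l using F_cont by (simp add: continuous_on_eq_continuous_at)
  have v\<sigma>: "isCont (\<lambda>y. v i (?\<sigma> y)) x" using isCont_o2[OF \<sigma>c, of "v i"] vc by (simp add: \<sigma>x)
  have F\<sigma>: "isCont (\<lambda>y. F i l (?\<sigma> y)) x" for l using isCont_o2[OF \<sigma>c, of "F i l"] Fc by (simp add: \<sigma>x)
  have jc: "isCont (\<lambda>y::real ^ 'n. y $ j) x" by simp
  have "isCont E x"
    unfolding E_def by (intro continuous_intros vc v\<sigma> Fc F\<sigma> jc)
  then have "(E \<longlongrightarrow> 0) (at x)" by (simp add: isCont_def E_def \<sigma>x)
  then have "\<forall>\<^sub>F y in at x. E y < e" using e by (rule order_tendstoD)
  then obtain r where r: "r > 0" "\<And>y. y \<noteq> x \<Longrightarrow> dist y x < r \<Longrightarrow> E y < e"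
    unfolding eventually_at by auto
  have "\<bar>u y i - u (?\<sigma> y) i\<bar> \<ge> \<bar>F i j x\<bar> / real n - e" if y: "dist x y < min r (1 / real n)" "y $ j \<noteq> x $ j" for y
  proof -
    define t where "t = y $ j - x $ j"
    have "\<bar>t\<bar> \<le> norm (y - x)" unfolding t_def using component_le_norm_cart[of "y - x" j] by simp
    then have t: "t \<noteq> 0" "\<bar>t\<bar> < 1 / real n" using y by (simp_all add: t_def dist_norm norm_minus_commute)
    have s1: "saw n (y $ j) = (if t < 0 then 1 / real n + t else t)"
      using saw_jump[OF n_pos s t(2)] by (simp add: t_def)
    have s2: "saw n (?\<sigma> y $ j) = (if t > 0 then 1 / real n - t else - t)"
      using saw_jump[OF n_pos s, of "- t"] t(2) by (simp add: reflect_component t_def algebra_simps)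
    define P where "P = F i j y * saw n (y $ j) - F i j (?\<sigma> y) * saw n (?\<sigma> y $ j)"
    define R where "R = v i y - v i (?\<sigma> y) + (\<Sum>l\<in>UNIV - {j}. (F i l y - F i l (?\<sigma> y)) * saw n (y $ l))"
    have "u y i - u (?\<sigma> y) i = v i y - v i (?\<sigma> y) + (\<Sum>l\<in>UNIV. F i l y * saw n (y $ l) - F i l (?\<sigma> y) * saw n (?\<sigma> y $ l))"
      by (simp add: u_def sum_subtractf)
    also have "(\<Sum>l\<in>UNIV. F i l y * saw n (y $ l) - F i l (?\<sigma> y) * saw n (?\<sigma> y $ l))
        = P + (\<Sum>l\<in>UNIV - {j}. F i l y * saw n (y $ l) - F i l (?\<sigma> y) * saw n (?\<sigma> y $ l))"
      unfolding P_def by (rule sum.remove) auto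
    also have "(\<Sum>l\<in>UNIV - {j}. F i l y * saw n (y $ l) - F i l (?\<sigma> y) * saw n (?\<sigma> y $ l))
        = (\<Sum>l\<in>UNIV - {j}. (F i l y - F i l (?\<sigma> y)) * saw n (y $ l))"
      by (intro sum.cong refl) (simp add: reflect_component left_diff_distrib)
    finally have ueq: "u y i - u (?\<sigma> y) i = R + P" by (simp add: R_def)
    have "\<bar>\<Sum>l\<in>UNIV - {j}. (F i l y - F i l (?\<sigma> y)) * saw n (y $ l)\<bar> \<le> (\<Sum>l\<in>UNIV - {j}. \<bar>F i l y - F i l (?\<sigma> y)\<bar>)"
    proof (rule order_trans[OF sum_abs], rule sum_mono)
      fix l show "\<bar>(F i l y - F i l (?\<sigma> y)) * saw n (y $ l)\<bar> \<le> \<bar>F i l y - F i l (?\<sigma> y)\<bar>"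
        unfolding abs_mult using mult_left_mono[OF saw_abs, of "\<bar>F i l y - F i l (?\<sigma> y)\<bar>" "y $ l"] by simp
    qed
    also have "\<dots> \<le> (\<Sum>l\<in>UNIV. \<bar>F i l y - F i l (?\<sigma> y)\<bar>)" by (rule sum_mono2) auto
    finally have Rle: "\<bar>R\<bar> \<le> \<bar>v i y - v i (?\<sigma> y)\<bar> + (\<Sum>l\<in>UNIV. \<bar>F i l y - F i l (?\<sigma> y)\<bar>)"
      unfolding R_def by linarith
    have n1: "1 / real n \<le> 1" using n_pos by simp
    have small: "\<bar>(a - F i j x) / real n\<bar> \<le> \<bar>a - F i j x\<bar>" for a
      using mult_left_mono[OF n1, of "\<bar>a - F i j x\<bar>"] by (simp add: abs_divide)
    have Bt: "\<bar>F i j y * t + F i j (?\<sigma> y) * t\<bar> \<le> 2 * B * \<bar>t\<bar>"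
    proof -
      have "\<bar>F i j y * t + F i j (?\<sigma> y) * t\<bar> \<le> \<bar>F i j y\<bar> * \<bar>t\<bar> + \<bar>F i j (?\<sigma> y)\<bar> * \<bar>t\<bar>"
        using abs_triangle_ineq[of "F i j y * t" "F i j (?\<sigma> y) * t"] by (simp add: abs_mult)
      also have "\<dots> \<le> B * \<bar>t\<bar> + B * \<bar>t\<bar>" by (intro add_mono mult_right_mono B(2)) auto
      finally show ?thesis by simp
    qed
    \<comment> \<open>On whichever side of the hyperplane y lies, one of the two sawtooth values is
      the distance to it and the other is 1 / n minus that distance. So \<open>P\<close> is, up to
      sign and small terms, the jump \<open>F i j x / n\<close>.\<close>
    have Pge: "\<bar>P\<bar> \<ge> \<bar>F i j x\<bar> / real n - (2 * B * \<bar>t\<bar> + \<bar>F i j y - F i j x\<bar> + \<bar>F i j (?\<sigma> y) - F i j x\<bar>)"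
    proof (cases "t > 0")
      case True
      then have "P = - (F i j x / real n) + (F i j y * t + F i j (?\<sigma> y) * t) - (F i j (?\<sigma> y) - F i j x) / real n"
        unfolding P_def s1 s2 by (simp add: algebra_simps diff_divide_distrib)
      moreover have "\<bar>F i j x / real n\<bar> = \<bar>F i j x\<bar> / real n" by simp
      ultimately show ?thesis using Bt small[of "F i j (?\<sigma> y)"] by linarith
    next
      case False
      then have "P = F i j x / real n + (F i j y * t + F i j (?\<sigma> y) * t) + (F i j y - F i j x) / real n"
        unfolding P_def s1 s2 using t(1) by (simp add: algebra_simps diff_divide_distrib)
      moreover have "\<bar>F i j x / real n\<bar> = \<bar>F i j x\<bar> / real n" by simp
      ultimately show ?thesis using Bt small[of "F i j y"] by linarith
    qed
    have "E y < e" using r(2)[of y] y by (auto simp: dist_commute)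
    moreover have "E y = \<bar>v i y - v i (?\<sigma> y)\<bar> + (\<Sum>l\<in>UNIV. \<bar>F i l y - F i l (?\<sigma> y)\<bar>) + 2 * B * \<bar>t\<bar>
      + \<bar>F i j y - F i j x\<bar> + \<bar>F i j (?\<sigma> y) - F i j x\<bar>" by (simp add: E_def t_def)
    ultimately show ?thesis unfolding ueq using Rle Pge by linarith
  qed
  moreover have "min r (1 / real n) > 0" using r(1) n_pos by simp
  ultimately show thesis using that by blast
qed

text \<open>Reflection preserves the ball and Lebesgue measure, so the mean distance of
  \<open>u\<close> to any z is the same for \<open>u\<close> composed with the reflection. If it
  were small, then \<open>u\<close> and its reflected copy would be close on average, which
  contradicts \<open>reflected_difference\<close>.\<close>

lemma no_approx_limit:
  assumes x: "x \<in> \<Omega>" and s: "saw n (x $ j) = 0" and i: "i < d" and F: "F i j x \<noteq> 0"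
  shows "\<not> ((\<lambda>r. (LINT y:ball x r|lebesgue. norm_vec d (\<lambda>i. u y i - z i)) / measure lebesgue (ball x r)) \<longlongrightarrow> 0) (at_right 0)"
proof
  let ?avg = "\<lambda>r. (LINT y:ball x r|lebesgue. norm_vec d (\<lambda>i. u y i - z i)) / measure lebesgue (ball x r)"
  let ?\<sigma> = "reflect j (x $ j)"
  assume lim: "(?avg \<longlongrightarrow> 0) (at_right 0)"
  \<comment> \<open>Half the jump: with error c allowed, values at mirrored points remain at least c
    apart, and the mean distance to z is at least c / 2.\<close>
  define c where "c = \<bar>F i j x\<bar> / real n / 2"
  have c: "c > 0" using F n_pos by (simp add: c_def)
  obtain r0 where r0: "r0 > 0" "\<And>y. dist x y < r0 \<Longrightarrow> y $ j \<noteq> x $ j \<Longrightarrow> \<bar>u y i - u (?\<sigma> y) i\<bar> \<ge> \<bar>F i j x\<bar> / real n - c"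
    using reflected_difference[OF x s c, of i] by blast
  have "\<forall>\<^sub>F r in at_right 0. ?avg r < c / 2" using lim c by (intro order_tendstoD) auto
  moreover have "\<forall>\<^sub>F r in at_right 0. r < r0" using r0(1) eventually_at_right_less by (auto simp: eventually_at_right_field)
  moreover have "\<forall>\<^sub>F r in at_right (0::real). r > 0" by (simp add: eventually_at_right_less)
  ultimately have "\<forall>\<^sub>F r in at_right 0. ?avg r < c / 2 \<and> r < r0 \<and> r > 0" by eventually_elim auto
  then obtain r where r: "?avg r < c / 2" "r < r0" "r > 0"
    using eventually_happens'[OF trivial_limit_at_right_real] by blast
  let ?b = "indicator (ball x r) :: real ^ 'n \<Rightarrow> real"
  let ?N = "\<lambda>y. norm_vec d (\<lambda>i. u y i - z i)" and ?m = "measure lborel (ball x r)"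
  have m: "?m > 0" using r(3) by (simp add: content_ball_pos)
  have ball: "ball x r \<in> sets lborel" by simp
  have bi: "integrable lborel (\<lambda>y. ?b y * a)" for a :: real
    using emeasure_bounded_finite[of "ball x r"] by (simp add: emeasure_lborel_ball_finite)
  have ui: "integrable lborel (\<lambda>y. ?b y * (u y k - z k))" if "k < d" for k
    using integrable_mult_indicator[OF ball u_int[OF that]] bi[of "z k"] by (simp add: right_diff_distrib)
  have Nm: "?N \<in> borel_measurable borel"
    by (rule borel_measurable_L2_set) (use u_meas in auto)
  have Ni: "integrable lborel (\<lambda>y. ?b y * ?N y)"
  proof -
    have "integrable lborel (\<lambda>y. norm_vec d (\<lambda>i. ?b y * (u y i - z i)))"
      by (rule integrable_L2_set) (use ui in auto)
    then show ?thesis by (simp add: L2_set_right_distrib)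
  qed
  define f where "f y = ?b y * \<bar>u y i - z i\<bar>" for y
  have fi: "integrable lborel f"
    using integrable_abs[OF ui[OF i]] unfolding f_def[abs_def] by (simp add: abs_mult)
  have fm: "f \<in> borel_measurable borel" using borel_measurable_integrable[OF fi] by simp
  have f\<sigma>: "integrable lborel (\<lambda>y. f (?\<sigma> y))" "(\<integral>y. f (?\<sigma> y) \<partial>lborel) = (\<integral>y. f y \<partial>lborel)"
    using integral_coord_reflect[OF fm] fi by auto
  have "c * ?m = (\<integral>y. ?b y * c \<partial>lborel)" by (simp add: mult.commute)
  also have "\<dots> \<le> (\<integral>y. f y + f (?\<sigma> y) \<partial>lborel)"
  proof (rule integral_mono_AE)
    have "negligible {y::real ^ 'n. axis j 1 \<bullet> y = x $ j}" by (rule negligible_hyperplane) auto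
    then have "{y::real ^ 'n. axis j 1 \<bullet> y = x $ j} \<in> null_sets lborel"
      using closed_hyperplane[of "axis j 1" "x $ j"]
      by (subst null_sets_completion_iff[symmetric]) (simp_all add: negligible_iff_null_sets)
    then have "AE y in lborel. y \<notin> {y::real ^ 'n. axis j 1 \<bullet> y = x $ j}" by (rule AE_not_in)
    then have "AE y::real ^ 'n in lborel. \<not> axis j 1 \<bullet> y = x $ j" by simp
    then show "AE y in lborel. ?b y * c \<le> f y + f (?\<sigma> y)"
    proof eventually_elim
      fix y :: "real ^ 'n" assume ny: "\<not> axis j 1 \<bullet> y = x $ j"
      have "?b (?\<sigma> y) = ?b y" by (simp add: indicator_def dist_reflect)
      moreover have "c \<le> \<bar>u y i - z i\<bar> + \<bar>u (?\<sigma> y) i - z i\<bar>" if "y \<in> ball x r"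
      proof -
        have "dist x y < r0" using that r(2) by simp
        moreover have "y $ j \<noteq> x $ j" using ny by (simp add: inner_axis')
        ultimately have "\<bar>F i j x\<bar> / real n - c \<le> \<bar>u y i - u (?\<sigma> y) i\<bar>" by (rule r0(2))
        moreover have "\<bar>F i j x\<bar> / real n = c + c" by (simp add: c_def)
        ultimately show ?thesis by linarith
      qed
      ultimately show "?b y * c \<le> f y + f (?\<sigma> y)"
        unfolding f_def by (cases "y \<in> ball x r") simp_all
    qed
  qed (use bi fi f\<sigma> in auto)
  also have "\<dots> = 2 * (\<integral>y. f y \<partial>lborel)" using fi f\<sigma> by simp
  also have "(\<integral>y. f y \<partial>lborel) \<le> (\<integral>y. ?b y * ?N y \<partial>lborel)"
  proof (rule integral_mono[OF fi Ni])
    fix y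
    have "\<bar>u y i - z i\<bar> \<le> L2_set (\<lambda>k. \<bar>u y k - z k\<bar>) {..<d}"
      using member_le_L2_set[of "{..<d}" i "\<lambda>k. \<bar>u y k - z k\<bar>"] i by simp
    also have "\<dots> = ?N y" by (simp add: L2_set_def)
    finally show "f y \<le> ?b y * ?N y" by (simp add: f_def mult_left_mono)
  qed
  also have "(\<integral>y. ?b y * ?N y \<partial>lborel) = (LINT y:ball x r|lebesgue. ?N y)"
    using integral_lebesgue_eq_lborel[OF Nm, of "ball x r"] by (simp add: set_lebesgue_integral_def)
  finally have "c * ?m \<le> 2 * (LINT y:ball x r|lebesgue. ?N y)" by simp
  then have "c / 2 \<le> ?avg r" using m by (simp add: field_simps)
  then show False using r(1) by simp
qed

lemma approx_discont_u:
  "approx_discont \<Omega> d u = {x \<in> \<Omega>. \<exists>j. saw n (x $ j) = 0 \<and> (\<exists>i<d. F i j x \<noteq> 0)}"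
proof (rule set_eqI)
  fix x
  show "x \<in> approx_discont \<Omega> d u \<longleftrightarrow> x \<in> {x \<in> \<Omega>. \<exists>j. saw n (x $ j) = 0 \<and> (\<exists>i<d. F i j x \<noteq> 0)}"
  proof (cases "x \<in> \<Omega> \<and> (\<exists>j. saw n (x $ j) = 0 \<and> (\<exists>i<d. F i j x \<noteq> 0))")
    case True
    then show ?thesis unfolding approx_discont_def using no_approx_limit by blast
  next
    case False
    then show ?thesis unfolding approx_discont_def using approx_limit by blast
  qed
qed

lemma approx_discont_borel: "approx_discont \<Omega> d u \<in> sets borel"
proof -
  have "Measurable.pred borel (\<lambda>x. saw n (x $ j) = 0 \<and> F i j x \<noteq> 0)" for i j
    using saw_coord_meas F_meas by measurable
  then have b: "{x. saw n (x $ j) = 0 \<and> F i j x \<noteq> 0} \<in> sets borel" for i j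
    by (simp only: pred_def space_borel UNIV_I simp_thms)
  have "approx_discont \<Omega> d u = \<Omega> \<inter> (\<Union>j. \<Union>i\<in>{..<d}. {x. saw n (x $ j) = 0 \<and> F i j x \<noteq> 0})"
    unfolding approx_discont_u by auto
  also have "\<dots> \<in> sets borel" by (intro sets.Int domain_borel sets.finite_UN b finite_class.finite finite_lessThan)
  finally show ?thesis .
qed

text \<open>Outside the discontinuity set every point of the grid has vanishing \<open>F\<close> in
  the columns concerned, so no jump mass remains there and the derivative reduces to its
  density.\<close>

theorem u_SBV: "u \<in> SBV \<Omega> d"
  unfolding SBV_def
proof (rule CollectI, intro conjI u_BV ballI allI impI)
  fix B i assume B: "B \<in> sets (borel_on \<Omega>)" and i: "i < d"
  let ?B = "B - approx_discont \<Omega> d u"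
  have Bb: "B \<in> sets borel" "B \<subseteq> \<Omega>" using borel_on_borel[OF open_domain B] by auto
  have B': "?B \<in> sets (borel_on \<Omega>)" by (rule borel_onI) (use Bb approx_discont_borel in auto)
  have "jump i j ?B = 0" for j
    by (rule jump_zero) (use Bb i in \<open>auto simp: approx_discont_u\<close>)
  then have "D \<Omega> d u ?B i - lebesgue_density G ?B i = 0"
    using D_minus_density[OF B' i] by (simp add: vec_eq_iff)
  then show "D_cantor \<Omega> d u B i = 0"
    unfolding D_cantor_def D_sing_def ac_grad_density[OF B' i] .
qed

lemma ac_grad_component:
  assumes "B \<in> sets (borel_on \<Omega>)" "i < d"
  shows "lebesgue_density (ac_grad \<Omega> d u) B i $ j = (LBINT x:B. A i j x)"
  using ac_grad_density[OF assms] density_G[of B i] borel_on_borel[OF open_domain assms(1)] assms(2) by simp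

end

section \<open>Frobenius norms and the mass of the derivative\<close>

lemma frob_add_le: "frob d (\<lambda>i j. a i j + b i j) \<le> frob d a + frob d b"
  for a b :: "nat \<Rightarrow> 'n::finite \<Rightarrow> real"
  by (rule L2_set_triangle_ineq)

lemma frob_diff_le: "frob d (\<lambda>i j. a i j - b i j) \<le> frob d a + frob d b"
  for a b :: "nat \<Rightarrow> 'n::finite \<Rightarrow> real"
  using frob_add_le[of a "\<lambda>i j. - b i j" d] by (simp add: L2_set_def)

text \<open>Column j belongs to the hyperplanes orthogonal to the axis j, so the columns of the jump
  part come from different measures. Splitting by columns costs a factor that involves N but not
  d.\<close>

lemma frob_le_sum_columns:
  fixes b :: "nat \<Rightarrow> 'n::finite \<Rightarrow> real"
  shows "frob d b \<le> (\<Sum>j\<in>UNIV. norm_vec d (\<lambda>i. b i j))"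
proof -
  let ?f = "\<lambda>j k. if snd k = j then b (fst k) j else 0"
  have "frob d b = L2_set (\<lambda>k. \<Sum>j\<in>UNIV. ?f j k) ({..<d} \<times> UNIV)"
    by simp
  also have "\<dots> \<le> (\<Sum>j\<in>UNIV. L2_set (?f j) ({..<d} \<times> UNIV))" by (rule L2_set_sum_le) simp
  also have "\<dots> = (\<Sum>j\<in>UNIV. norm_vec d (\<lambda>i. b i j))"
  proof (intro sum.cong refl)
    fix j
    have "(\<Sum>k\<in>{..<d} \<times> UNIV. (?f j k)\<^sup>2) = (\<Sum>i<d. \<Sum>l\<in>UNIV. if l = j then (b i j)\<^sup>2 else 0)"
      unfolding sum.cartesian_product by (intro sum.cong) auto
    then show "L2_set (?f j) ({..<d} \<times> UNIV) = norm_vec d (\<lambda>i. b i j)" by (simp add: L2_set_def)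
  qed
  finally show ?thesis .
qed

lemma norm_vec_le_frob: "norm_vec d (\<lambda>i. b i j) \<le> frob d b" for b :: "nat \<Rightarrow> 'n::finite \<Rightarrow> real"
proof -
  have "(\<Sum>i<d. (b i j)\<^sup>2) \<le> (\<Sum>i<d. \<Sum>l\<in>UNIV. (b i l)\<^sup>2)"
    by (intro sum_mono member_le_sum) auto
  then show ?thesis by (simp add: L2_set_def sum.cartesian_product split_beta)
qed

lemma frob_le_sum_abs: "frob d b \<le> (\<Sum>i<d. \<Sum>j\<in>UNIV. \<bar>b i j\<bar>)" for b :: "nat \<Rightarrow> 'n::finite \<Rightarrow> real"
  using L2_set_le_sum_abs[of "\<lambda>k. b (fst k) (snd k)" "{..<d} \<times> UNIV"] by (simp add: sum.cartesian_product split_beta)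

lemma abs_le_frob: "i < d \<Longrightarrow> \<bar>b i j\<bar> \<le> frob d b" for b :: "nat \<Rightarrow> 'n::finite \<Rightarrow> real"
  using member_le_L2_set[of "{..<d} \<times> UNIV" "(i, j)" "\<lambda>k. \<bar>b (fst k) (snd k)\<bar>"]
  by (simp add: L2_set_def)

text \<open>The preimages of disjoint pieces under each \<open>p t\<close> are disjoint, so the
  weights on them add up to at most the full integral. Each summand may live on its own image of the
  common measure L.\<close>

lemma total_variation_le_densities:
  fixes \<mu> :: "'a set \<Rightarrow> nat \<Rightarrow> real ^ 'n" and p :: "'t \<Rightarrow> 'b \<Rightarrow> 'a" and w :: "'t \<Rightarrow> 'b \<Rightarrow> ennreal"
  assumes T: "finite T" and M: "\<And>B. B \<in> sets M \<Longrightarrow> B \<in> sets M'"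
    and p: "\<And>t. t \<in> T \<Longrightarrow> p t \<in> L \<rightarrow>\<^sub>M M'" and w: "\<And>t. t \<in> T \<Longrightarrow> w t \<in> borel_measurable L"
    and le: "\<And>B. B \<in> sets M \<Longrightarrow> ennreal (norm_mat d (\<mu> B)) \<le> (\<Sum>t\<in>T. \<integral>\<^sup>+x. indicator B (p t x) * w t x \<partial>L)"
  shows "total_variation M d \<mu> E \<le> (\<Sum>t\<in>T. \<integral>\<^sup>+x. w t x \<partial>L)"
  unfolding total_variation_def
proof (rule SUP_least, clarify)
  fix X :: "nat \<Rightarrow> 'a set"
  assume X: "range X \<subseteq> sets M" "disjoint_family X"
  have m: "(\<lambda>x. indicator (X k) (p t x) * w t x :: ennreal) \<in> borel_measurable L" if "t \<in> T" for k t
  proof -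
    have "X k \<in> sets M'" using X(1) by (intro M) auto
    then have "(\<lambda>x. indicator (X k) (p t x) :: ennreal) \<in> borel_measurable L"
      by (intro measurable_compose[OF p[OF that] borel_measurable_indicator])
    then show ?thesis by (intro borel_measurable_times_ennreal w[OF that])
  qed
  have "(\<Sum>k. ennreal (norm_mat d (\<mu> (X k)))) \<le> (\<Sum>k. \<Sum>t\<in>T. \<integral>\<^sup>+x. indicator (X k) (p t x) * w t x \<partial>L)"
    by (intro suminf_le le summableI) (use X(1) in auto)
  also have "\<dots> = (\<Sum>t\<in>T. \<Sum>k. \<integral>\<^sup>+x. indicator (X k) (p t x) * w t x \<partial>L)"
    by (rule suminf_sum) (rule summableI)
  also have "\<dots> = (\<Sum>t\<in>T. \<integral>\<^sup>+x. (\<Sum>k. indicator (X k) (p t x) * w t x) \<partial>L)"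
    by (intro sum.cong refl nn_integral_suminf[symmetric] m)
  also have "\<dots> \<le> (\<Sum>t\<in>T. \<integral>\<^sup>+x. w t x \<partial>L)"
  proof (intro sum_mono nn_integral_mono)
    fix t x
    have "(\<Sum>k. indicator (X k) (p t x) * w t x) = indicator (\<Union>k. X k) (p t x) * w t x"
      by (simp only: ennreal_suminf_multc suminf_indicator[OF X(2)])
    also have "\<dots> \<le> w t x" by (simp add: indicator_def)
    finally show "(\<Sum>k. indicator (X k) (p t x) * w t x) \<le> w t x" .
  qed
  finally show "(\<Sum>k. ennreal (norm_mat d (\<mu> (X k)))) \<le> (\<Sum>t\<in>T. \<integral>\<^sup>+x. w t x \<partial>L)" .
qed

lemma nn_integral_L2_set_eq:
  fixes f :: "'k \<Rightarrow> 'a \<Rightarrow> real"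
  assumes "finite I" "\<And>k. k \<in> I \<Longrightarrow> integrable M (f k)"
  shows "(\<integral>\<^sup>+x. ennreal (L2_set (\<lambda>k. f k x) I) \<partial>M) = ennreal (\<integral>x. L2_set (\<lambda>k. f k x) I \<partial>M)"
  by (rule nn_integral_eq_integral[OF integrable_L2_set[OF assms]]) simp_all

lemma ennreal_L2_set_integral_le:
  fixes f :: "'k \<Rightarrow> 'a \<Rightarrow> real"
  assumes "finite I" "\<And>k. k \<in> I \<Longrightarrow> integrable M (f k)"
  shows "ennreal (L2_set (\<lambda>k. \<integral>x. f k x \<partial>M) I) \<le> (\<integral>\<^sup>+x. ennreal (L2_set (\<lambda>k. f k x) I) \<partial>M)"
  using ennreal_leI[OF L2_set_integral_le[of I M f]] nn_integral_L2_set_eq[of I M f] assms by simp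

lemma L2_set_indicator: "L2_set (\<lambda>k. indicator B y * f k) I = indicator B y * L2_set f I"
  by (simp add: indicator_def L2_set_def)

lemma integrable_frob:
  fixes H :: "nat \<Rightarrow> 'n::finite \<Rightarrow> 'a \<Rightarrow> real"
  assumes "\<And>i j. i < d \<Longrightarrow> integrable M (H i j)"
  shows "integrable M (\<lambda>x. frob d (\<lambda>i j. H i j x))"
  by (rule integrable_L2_set[of _ _ "\<lambda>k. H (fst k) (snd k)"]) (use assms in auto)

lemma nn_integral_frob_eq:
  fixes H :: "nat \<Rightarrow> 'n::finite \<Rightarrow> 'a \<Rightarrow> real"
  assumes "\<And>i j. i < d \<Longrightarrow> integrable M (H i j)"
  shows "(\<integral>\<^sup>+x. ennreal (frob d (\<lambda>i j. H i j x)) \<partial>M) = ennreal (\<integral>x. frob d (\<lambda>i j. H i j x) \<partial>M)"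
  by (rule nn_integral_eq_integral[OF integrable_frob[OF assms]]) simp_all

context sawtooth_function
begin

lemma measure_norm_D_u:
  "measure_norm \<Omega> d (D \<Omega> d u) \<le> (\<integral>\<^sup>+x. ennreal (frob d (\<lambda>i j. A i j x)) \<partial>lborel)
    + (\<Sum>j\<in>UNIV. \<integral>\<^sup>+y. ennreal (norm_vec d (\<lambda>i. F i j (proj n j y))) \<partial>lborel)"
proof -
  \<comment> \<open>\<open>None\<close> stands for the absolutely continuous part, carried by the
    identity, and \<open>Some j\<close> for the jumps across the hyperplanes orthogonal to the axis
    j.\<close>
  define p where "p t = (case t of None \<Rightarrow> (\<lambda>x. x) | Some j \<Rightarrow> proj n j)" for t :: "'n option"
  define w where "w t y = (case t of None \<Rightarrow> ennreal (frob d (\<lambda>i j. A i j y))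
    | Some j \<Rightarrow> ennreal (norm_vec d (\<lambda>i. F i j (proj n j y))))" for t y
  have U: "(\<Sum>t\<in>(UNIV :: 'n option set). f t) = f None + (\<Sum>j\<in>UNIV. f (Some j))" for f :: "'n option \<Rightarrow> ennreal"
    by (simp add: UNIV_option_conv sum.reindex)
  have "measure_norm \<Omega> d (D \<Omega> d u) = total_variation (borel_on \<Omega>) d \<mu> \<Omega>"
    unfolding measure_norm_def by (rule total_variation_cong) (rule D_u)
  also have "\<dots> \<le> (\<Sum>t\<in>UNIV. \<integral>\<^sup>+x. w t x \<partial>lborel)"
  proof (rule total_variation_le_densities[where p=p and M'=borel])
    show "B \<in> sets borel" if "B \<in> sets (borel_on \<Omega>)" for B using borel_on_borel[OF open_domain that] by simp
    show "p t \<in> lborel \<rightarrow>\<^sub>M borel" for t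
    proof (cases t)
      case None then show ?thesis by (simp add: p_def)
    next
      case (Some j) then show ?thesis
        unfolding p_def option.case by (simp only: option.case measurable_lborel2 borel_measurable_proj)
    qed
    show "w t \<in> borel_measurable lborel" for t
    proof (cases t)
      case None
      have "(\<lambda>x. frob d (\<lambda>i j. A i j x)) \<in> borel_measurable lborel"
        by (rule borel_measurable_integrable[OF integrable_frob[OF A_int]])
      then show ?thesis unfolding w_def[abs_def] None option.case by (rule measurable_compose[OF _ measurable_ennreal])
    next
      case (Some j)
      have "(\<lambda>y. norm_vec d (\<lambda>i. F i j (proj n j y))) \<in> borel_measurable lborel"
        by (rule borel_measurable_integrable[OF integrable_L2_set]) (simp_all add: F_proj_int)
      then show ?thesis unfolding w_def[abs_def] Some option.case by (rule measurable_compose[OF _ measurable_ennreal])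
    qed
    fix B assume B: "B \<in> sets (borel_on \<Omega>)"
    have Bb: "B \<in> sets lborel" using borel_on_borel[OF open_domain B] by simp
    have Pm: "proj n j \<in> lborel \<rightarrow>\<^sub>M borel" for j by (simp only: measurable_lborel2 borel_measurable_proj)
    have iA: "integrable lborel (\<lambda>x. indicator B x * A i j x)" if "i < d" for i j
      using integrable_mult_indicator[OF Bb A_int[OF that]] by simp
    have iF: "integrable lborel (\<lambda>y. indicator B (proj n j y) * F i j (proj n j y))" for i j
    proof -
      have "(\<lambda>y. indicator B (proj n j y) :: real) \<in> borel_measurable lborel"
        by (intro measurable_compose[OF Pm] borel_measurable_indicator) (use Bb in simp)
      then have "integrable lborel (\<lambda>y. F i j (proj n j y) * indicator B (proj n j y))"
        by (rule integrable_mult_bounded[OF F_proj_int, of _ 1]) (simp add: indicator_def)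
      then show ?thesis by (simp only: mult.commute)
    qed
    have "ennreal (norm_mat d (\<mu> B)) = ennreal (frob d (\<lambda>i j. (LBINT x:B. A i j x) - jump i j B))"
      by (simp only: norm_mat_eq_frob \<mu>_component)
    also have "\<dots> \<le> ennreal (frob d (\<lambda>i j. LBINT x:B. A i j x) + frob d (\<lambda>i j. jump i j B))"
      by (intro ennreal_leI frob_diff_le)
    also have "\<dots> \<le> ennreal (frob d (\<lambda>i j. LBINT x:B. A i j x) + (\<Sum>j\<in>UNIV. norm_vec d (\<lambda>i. jump i j B)))"
      by (intro ennreal_leI add_left_mono frob_le_sum_columns)
    also have "\<dots> = ennreal (frob d (\<lambda>i j. LBINT x:B. A i j x)) + (\<Sum>j\<in>UNIV. ennreal (norm_vec d (\<lambda>i. jump i j B)))"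
      by (simp add: sum_nonneg ennreal_plus)
    also have "\<dots> \<le> (\<integral>\<^sup>+x. indicator B x * ennreal (frob d (\<lambda>i j. A i j x)) \<partial>lborel)
        + (\<Sum>j\<in>UNIV. \<integral>\<^sup>+y. indicator B (proj n j y) * ennreal (norm_vec d (\<lambda>i. F i j (proj n j y))) \<partial>lborel)"
    proof (intro add_mono sum_mono)
      have "ennreal (frob d (\<lambda>i j. LBINT x:B. A i j x))
          \<le> (\<integral>\<^sup>+x. ennreal (frob d (\<lambda>i j. indicator B x * A i j x)) \<partial>lborel)"
        unfolding set_lebesgue_integral_def real_scaleR_def
        by (rule ennreal_L2_set_integral_le) (auto intro: iA)
      also have "\<dots> = (\<integral>\<^sup>+x. indicator B x * ennreal (frob d (\<lambda>i j. A i j x)) \<partial>lborel)"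
        unfolding L2_set_indicator
        by (intro nn_integral_cong) (simp add: indicator_def)
      finally show "ennreal (frob d (\<lambda>i j. LBINT x:B. A i j x))
          \<le> (\<integral>\<^sup>+x. indicator B x * ennreal (frob d (\<lambda>i j. A i j x)) \<partial>lborel)" .
      fix j
      have "ennreal (norm_vec d (\<lambda>i. jump i j B))
          \<le> (\<integral>\<^sup>+y. ennreal (norm_vec d (\<lambda>i. indicator B (proj n j y) * F i j (proj n j y))) \<partial>lborel)"
        unfolding jump_def by (rule ennreal_L2_set_integral_le) (simp_all only: iF finite_lessThan)
      also have "\<dots> = (\<integral>\<^sup>+y. indicator B (proj n j y) * ennreal (norm_vec d (\<lambda>i. F i j (proj n j y))) \<partial>lborel)"
        unfolding L2_set_indicator by (intro nn_integral_cong) (simp add: indicator_def)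
      finally show "ennreal (norm_vec d (\<lambda>i. jump i j B))
          \<le> (\<integral>\<^sup>+y. indicator B (proj n j y) * ennreal (norm_vec d (\<lambda>i. F i j (proj n j y))) \<partial>lborel)" .
    qed
    also have "\<dots> = (\<Sum>t\<in>UNIV. \<integral>\<^sup>+x. indicator B (p t x) * w t x \<partial>lborel)"
      unfolding U p_def w_def option.case ..
    finally show "ennreal (norm_mat d (\<mu> B)) \<le> (\<Sum>t\<in>UNIV. \<integral>\<^sup>+x. indicator B (p t x) * w t x \<partial>lborel)" .
  qed simp
  also have "\<dots> = (\<integral>\<^sup>+x. ennreal (frob d (\<lambda>i j. A i j x)) \<partial>lborel)
    + (\<Sum>j\<in>UNIV. \<integral>\<^sup>+y. ennreal (norm_vec d (\<lambda>i. F i j (proj n j y))) \<partial>lborel)"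
    unfolding U w_def option.case ..
  finally show ?thesis .
qed

end

lemma saw_abs_le: "n > 0 \<Longrightarrow> \<bar>saw n t\<bar> \<le> 1 / real n"
  using saw_less[of n t] saw_nonneg[of n t] by simp

lemma abs_sum_saw_le:
  assumes "n > 0"
  shows "\<bar>\<Sum>l\<in>UNIV. f l * saw n (x $ l)\<bar> \<le> (\<Sum>l\<in>UNIV. \<bar>f l\<bar>) / real n"
proof -
  have "\<bar>\<Sum>l\<in>UNIV. f l * saw n (x $ l)\<bar> \<le> (\<Sum>l\<in>UNIV. \<bar>f l * saw n (x $ l)\<bar>)" by (rule sum_abs)
  also have "\<dots> \<le> (\<Sum>l\<in>UNIV. \<bar>f l\<bar> / real n)"
  proof (rule sum_mono)
    fix l show "\<bar>f l * saw n (x $ l)\<bar> \<le> \<bar>f l\<bar> / real n"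
      using mult_left_mono[OF saw_abs_le[OF assms, of "x $ l"], of "\<bar>f l\<bar>"] by (simp add: abs_mult)
  qed
  finally show ?thesis by (simp add: sum_divide_distrib)
qed

lemma integral_le_of_nn_integral_le:
  fixes f :: "'a \<Rightarrow> real"
  assumes "integrable M f" "\<And>x. f x \<ge> 0" "(\<integral>\<^sup>+x. ennreal (f x) \<partial>M) \<le> ennreal c" "c \<ge> 0"
  shows "(\<integral>x. f x \<partial>M) \<le> c"
  using assms(3,4) nn_integral_eq_integral[OF assms(1)] assms(2) by simp

lemma bounded_support_norm_vec:
  fixes F :: "nat \<Rightarrow> real ^ 'n \<Rightarrow> real"
  assumes "\<And>i. bounded_support (F i)"
  shows "bounded_support (\<lambda>x. norm_vec d (\<lambda>i. F i x))"
proof -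
  have "\<exists>R. \<forall>x. F i x \<noteq> 0 \<longrightarrow> norm x \<le> R" for i using assms unfolding bounded_support_def by blast
  then obtain R where R: "\<And>i x. F i x \<noteq> 0 \<Longrightarrow> norm x \<le> R i" by metis
  have "norm x \<le> (\<Sum>i<d. \<bar>R i\<bar>)" if nz: "norm_vec d (\<lambda>i. F i x) \<noteq> 0" for x
  proof -
    obtain i where i: "i < d" "F i x \<noteq> 0" using nz by (subst (asm) L2_set_eq_0_iff) auto
    have "norm x \<le> \<bar>R i\<bar>" using R[OF i(2)] by simp
    also have "\<dots> \<le> (\<Sum>i<d. \<bar>R i\<bar>)" using i(1) by (intro member_le_sum) auto
    finally show ?thesis .
  qed
  then show ?thesis unfolding bounded_support_def by blast
qed

text \<open>The constants arise as follows. The L1 norm of \<open>V\<close> is at most a + \<delta>,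
  that of W at most b, so that of \<open>F\<close> is at most a + b + \<delta>. Hence the gradient
  \<open>A\<close> costs at most 2 a + b + 3 \<delta>, the last \<delta> being due to the sawtooth
  terms, and each of the N jump parts at most a + b + 2 \<delta>, the extra \<delta> being the error
  of the Riemann sum.\<close>

theorem sawtooth_approximation:
  fixes \<Omega> :: "(real ^ 'n) set" and g :: "nat \<Rightarrow> real ^ 'n \<Rightarrow> real" and W :: "nat \<Rightarrow> 'n \<Rightarrow> real ^ 'n \<Rightarrow> real"
  assumes \<Omega>: "open \<Omega>" "bounded \<Omega>" and \<delta>: "\<delta> > 0"
    and \<kappa>: "finite_measure \<kappa>" "sets \<kappa> = sets (borel_on \<Omega>)" and h: "\<And>k j. integrable \<kappa> (h k j)"
    and g: "\<And>k. integrable lborel (g k)" "\<And>k. g k \<in> borel_measurable borel" "\<And>k x. x \<notin> \<Omega> \<Longrightarrow> g k x = 0"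
    and weak: "\<And>\<phi> k j. \<phi> \<in> Cc_infinity \<Omega> \<Longrightarrow> k < d \<Longrightarrow>
      (\<integral>x. g k x * partial_deriv j \<phi> x \<partial>lborel) = - (\<integral>y. \<phi> y * h k j y \<partial>\<kappa>)"
    and W: "\<And>i j. integrable lborel (W i j)" "\<And>i j x. x \<notin> \<Omega> \<Longrightarrow> W i j x = 0"
    and ab: "(\<integral>\<^sup>+y. ennreal (frob d (\<lambda>k j. h k j y)) \<partial>\<kappa>) \<le> ennreal a"
      "(\<integral>\<^sup>+x. ennreal (frob d (\<lambda>i j. W i j x)) \<partial>lborel) \<le> ennreal b" "a \<ge> 0" "b \<ge> 0"
  obtains u A where "u \<in> SBV \<Omega> d" "\<And>i. i < d \<Longrightarrow> integrable lborel (\<lambda>x. u x i)"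
    "(\<integral>\<^sup>+x. ennreal (norm_vec d (\<lambda>i. u x i - g i x)) \<partial>lborel) \<le> ennreal (2 * \<delta>)"
    "measure_norm \<Omega> d (D \<Omega> d u) \<le> ennreal ((real CARD('n) + 2) * (a + b) + (2 * real CARD('n) + 3) * \<delta>)"
    "\<And>i j. i < d \<Longrightarrow> integrable lborel (A i j)"
    "\<And>B i j. B \<in> sets (borel_on \<Omega>) \<Longrightarrow> i < d \<Longrightarrow> lebesgue_density (ac_grad \<Omega> d u) B i $ j = (LBINT x:B. A i j x)"
    "\<And>i j. i < d \<Longrightarrow> (\<integral>x. \<bar>A i j x - W i j x\<bar> \<partial>lborel) \<le> 2 * \<delta>"
proof -
  obtain v V where v: "\<And>k. continuous_on \<Omega> (v k)" "\<And>k. k < d \<Longrightarrow> integrable lborel (v k)"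
    and V: "\<And>k j. k < d \<Longrightarrow> integrable lborel (V k j)" "\<And>k j x. x \<notin> \<Omega> \<Longrightarrow> V k j x = 0"
    and vg: "(\<integral>\<^sup>+x. ennreal (norm_vec d (\<lambda>k. v k x - g k x)) \<partial>lborel) \<le> ennreal \<delta>"
    and Vh: "(\<integral>\<^sup>+x. ennreal (frob d (\<lambda>k j. V k j x)) \<partial>lborel)
      \<le> (\<integral>\<^sup>+y. ennreal (frob d (\<lambda>k j. h k j y)) \<partial>\<kappa>) + ennreal \<delta>"
    and vV: "\<And>\<phi> k j. \<phi> \<in> Cc_infinity \<Omega> \<Longrightarrow> k < d \<Longrightarrow>
      (\<integral>x. v k x * partial_deriv j \<phi> x \<partial>lborel) = - (\<integral>x. V k j x * \<phi> x \<partial>lborel)"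
    by (rule Meyers_Serrin_measure[where d=d and g=g and h=h, OF \<Omega>(1) \<delta> \<kappa> h g weak];
      (assumption | (rule that; assumption)))
  have d0: "0 \<le> \<delta>" using \<delta> by simp
  have Va: "(\<integral>x. frob d (\<lambda>i j. V i j x) \<partial>lborel) \<le> a + \<delta>"
  proof (rule integral_le_of_nn_integral_le[OF integrable_frob[OF V(1)]])
    have "(\<integral>\<^sup>+x. ennreal (frob d (\<lambda>k j. V k j x)) \<partial>lborel) \<le> ennreal a + ennreal \<delta>"
      by (rule order_trans[OF Vh add_right_mono[OF ab(1)]])
    then show "(\<integral>\<^sup>+x. ennreal (frob d (\<lambda>k j. V k j x)) \<partial>lborel) \<le> ennreal (a + \<delta>)"
      by (simp only: ennreal_plus[OF ab(3) d0])
  qed (use ab \<delta> in simp_all)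
  have Wb: "(\<integral>x. frob d (\<lambda>i j. W i j x) \<partial>lborel) \<le> b"
    by (rule integral_le_of_nn_integral_le[OF integrable_frob[OF W(1)] _ ab(2,4)]) simp
  \<comment> \<open>The gradient that is missing in \<open>v\<close>; setting it to 0 for rows
    beyond d makes it integrable for all indices.\<close>
  define F0 where "F0 i j x = (if i < d then W i j x - V i j x else 0)" for i j x
  have F0i: "integrable lborel (F0 i j)" for i j
    unfolding F0_def[abs_def] using W(1) V(1) by (cases "i < d") simp_all
  have F0b: "(\<integral>x. frob d (\<lambda>i j. F0 i j x) \<partial>lborel) \<le> a + b + \<delta>"
  proof -
    have "(\<integral>x. frob d (\<lambda>i j. F0 i j x) \<partial>lborel) \<le> (\<integral>x. frob d (\<lambda>i j. W i j x) + frob d (\<lambda>i j. V i j x) \<partial>lborel)"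
    proof (rule integral_mono[OF integrable_frob[OF F0i]])
      show "integrable lborel (\<lambda>x. frob d (\<lambda>i j. W i j x) + frob d (\<lambda>i j. V i j x))"
        by (rule Bochner_Integration.integrable_add[OF integrable_frob[OF W(1)] integrable_frob[OF V(1)]])
      fix x
      have "frob d (\<lambda>i j. F0 i j x) = frob d (\<lambda>i j. W i j x - V i j x)"
        by (rule L2_set_cong) (auto simp: F0_def)
      then show "frob d (\<lambda>i j. F0 i j x) \<le> frob d (\<lambda>i j. W i j x) + frob d (\<lambda>i j. V i j x)"
        using frob_diff_le[of "\<lambda>i j. W i j x" "\<lambda>i j. V i j x" d] by simp
    qed
    also have "\<dots> = (\<integral>x. frob d (\<lambda>i j. W i j x) \<partial>lborel) + (\<integral>x. frob d (\<lambda>i j. V i j x) \<partial>lborel)"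
      by (rule Bochner_Integration.integral_add[OF integrable_frob[OF W(1)] integrable_frob[OF V(1)]])
    finally show ?thesis using Va Wb by linarith
  qed
  have "\<forall>\<^sub>F m in sequentially. \<forall>k\<in>{..<d} \<times> UNIV.
      (\<integral>\<^sup>+x. ennreal \<bar>conv (mollifier m) lborel (F0 (fst k) (snd k)) x - F0 (fst k) (snd k) x\<bar> \<partial>lborel) \<le> ennreal \<delta>"
    by (intro eventually_ball_finite ballI mollification_eventually F0i \<delta>) simp
  then obtain m where m: "\<And>i j. i < d \<Longrightarrow>
      (\<integral>\<^sup>+x. ennreal \<bar>conv (mollifier m) lborel (F0 i j) x - F0 i j x\<bar> \<partial>lborel) \<le> ennreal \<delta>"
    by (auto dest!: eventually_happens)
  define F where "F i j = conv (mollifier m) lborel (F0 i j)" for i j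
  note mol = mollifierD[OF mollifier[of m]]
  have Fs: "smooth (F i j)" for i j
    unfolding F_def by (rule lborel.smooth_conv(1)[OF mol(1,4) F0i])
  have Fb: "bounded_support (F i j)" for i j
  proof -
    obtain R where R: "\<And>x. x \<in> \<Omega> \<Longrightarrow> norm x \<le> R" using \<Omega>(2) unfolding bounded_iff by blast
    have "norm x \<le> R + 1" if "F i j x \<noteq> 0" for x
    proof (rule ccontr)
      assume nx: "\<not> norm x \<le> R + 1"
      have "F0 i j y = 0" if y: "dist x y \<le> 1 / real (Suc m)" for y
      proof -
        have "1 / real (Suc m) \<le> 1" by simp
        moreover have "norm x \<le> norm y + dist x y" using norm_triangle_sub[of x y] by (simp add: dist_norm)
        ultimately have "y \<notin> \<Omega>" using R[of y] nx y by linarith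
        then show ?thesis using W(2) V(2) by (simp add: F0_def)
      qed
      then have "F i j x = 0" unfolding F_def by (intro lborel.conv_eq_0[OF mollifier]) simp
      then show False using that by simp
    qed
    then show ?thesis unfolding bounded_support_def by blast
  qed
  note Fc = smooth_continuous[OF Fs] and dFc = smooth_continuous[OF smooth_partial_deriv[OF Fs]]
  have Fi: "integrable lborel (F i j)" for i j by (rule integrable_bounded_support[OF Fc Fb])
  have dFi: "integrable lborel (partial_deriv l (F i j))" for i j l
    by (rule integrable_bounded_support[OF dFc bounded_support_partial_deriv[OF Fb]])
  have Fint: "(\<integral>x. frob d (\<lambda>i j. F i j x) \<partial>lborel) \<le> a + b + \<delta>"
  proof (rule integral_le_of_nn_integral_le[OF integrable_frob[OF Fi]])
    have "(\<integral>\<^sup>+x. ennreal (frob d (\<lambda>i j. F i j x)) \<partial>lborel) \<le> (\<integral>\<^sup>+x. ennreal (frob d (\<lambda>i j. F0 i j x)) \<partial>lborel)"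
      unfolding F_def by (rule lborel.nn_integral_conv_L2[OF mollifier]) (simp_all add: F0i)
    also have "\<dots> = ennreal (\<integral>x. frob d (\<lambda>i j. F0 i j x) \<partial>lborel)" by (rule nn_integral_frob_eq[OF F0i])
    also have "\<dots> \<le> ennreal (a + b + \<delta>)" by (rule ennreal_leI[OF F0b])
    finally show "(\<integral>\<^sup>+x. ennreal (frob d (\<lambda>i j. F i j x)) \<partial>lborel) \<le> ennreal (a + b + \<delta>)" .
  qed (use ab \<delta> in simp_all)
  \<comment> \<open>One L1 majorant for \<open>F\<close> and all its first derivatives. It involves
    d and the mollifier, but only H / n is ever used, and n is chosen after H.\<close>
  define H where "H x = (\<Sum>i<d. \<Sum>l\<in>UNIV. \<bar>F i l x\<bar>) + (\<Sum>i<d. \<Sum>j\<in>UNIV. \<Sum>l\<in>UNIV. \<bar>partial_deriv j (F i l) x\<bar>)" for x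
  have Hi: "integrable lborel H"
    unfolding H_def[abs_def] by (intro Bochner_Integration.integrable_add Bochner_Integration.integrable_sum integrable_abs Fi dFi)
  have H0: "0 \<le> H x" for x unfolding H_def by (intro add_nonneg_nonneg sum_nonneg abs_ge_zero)
  let ?nF = "\<lambda>j x. norm_vec d (\<lambda>i. F i j x)"
  have nFc: "continuous_on UNIV (?nF j)" for j
    unfolding L2_set_def by (intro continuous_intros Fc)
  have "(\<lambda>k. (\<integral>x. H x \<partial>lborel) / real (Suc k)) \<longlonglongrightarrow> 0"
    using LIMSEQ_Suc[OF lim_const_over_n] by simp
  then have e1: "\<forall>\<^sub>F k in sequentially. (\<integral>x. H x \<partial>lborel) / real (Suc k) < \<delta>" using \<delta> by (rule order_tendstoD)
  have e2: "\<forall>\<^sub>F k in sequentially. \<forall>j\<in>UNIV. (\<integral>x. ?nF j (proj (Suc k) j x) \<partial>lborel) < (\<integral>x. ?nF j x \<partial>lborel) + \<delta>"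
  proof (intro eventually_ball_finite ballI)
    fix j
    show "\<forall>\<^sub>F k in sequentially. (\<integral>x. ?nF j (proj (Suc k) j x) \<partial>lborel) < (\<integral>x. ?nF j x \<partial>lborel) + \<delta>"
      by (rule order_tendstoD(2)[OF integral_proj_tendsto[OF nFc bounded_support_norm_vec[OF Fb]]]) (use \<delta> in simp)
  qed simp
  obtain k where k: "(\<integral>x. H x \<partial>lborel) / real (Suc k) < \<delta>"
      "\<And>j. (\<integral>x. ?nF j (proj (Suc k) j x) \<partial>lborel) < (\<integral>x. ?nF j x \<partial>lborel) + \<delta>"
    using eventually_happens'[OF sequentially_bot eventually_conj[OF e1 e2]] by blast
  define n where "n = Suc k"
  have n: "n > 0" by (simp add: n_def)
  have Hn: "integrable lborel (\<lambda>x. H x / real n)" "(\<integral>x. H x / real n \<partial>lborel) \<le> \<delta>"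
    using Hi k(1) by (simp_all add: n_def)
  interpret S: sawtooth_function \<Omega> d n v V F
    by (rule sawtooth_function.intro) (fact \<Omega> n v V(1) vV Fs Fb)+
  \<comment> \<open>The part of the gradient in which the sawtooth is not differentiated; it is of
    order 1 / n.\<close>
  define P where "P i j x = (\<Sum>l\<in>UNIV. saw n (x $ l) * partial_deriv j (F i l) x)" for i j x
  have A_eq: "S.A i j x = V i j x + F i j x + P i j x" for i j x by (simp add: S.A_def P_def)
  have Pabs: "\<bar>P i j x\<bar> \<le> (\<Sum>l\<in>UNIV. \<bar>partial_deriv j (F i l) x\<bar>) / real n" for i j x
    using abs_sum_saw_le[OF n, of "\<lambda>l. partial_deriv j (F i l) x" x] by (simp add: P_def mult.commute)
  have Psum: "(\<Sum>i<d. \<Sum>j\<in>UNIV. \<bar>P i j x\<bar>) \<le> H x / real n" for x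
  proof -
    have "(\<Sum>i<d. \<Sum>j\<in>UNIV. \<bar>P i j x\<bar>) \<le> (\<Sum>i<d. \<Sum>j\<in>UNIV. (\<Sum>l\<in>UNIV. \<bar>partial_deriv j (F i l) x\<bar>) / real n)"
      by (intro sum_mono Pabs)
    also have "\<dots> = (\<Sum>i<d. \<Sum>j\<in>UNIV. \<Sum>l\<in>UNIV. \<bar>partial_deriv j (F i l) x\<bar>) / real n"
      by (simp only: sum_divide_distrib)
    also have "\<dots> \<le> H x / real n"
      by (intro divide_right_mono) (simp_all add: H_def sum_nonneg)
    finally show ?thesis .
  qed
  have Pfrob: "frob d (\<lambda>i j. P i j x) \<le> H x / real n" for x
    by (rule order_trans[OF frob_le_sum_abs Psum])
  have P1: "\<bar>P i j x\<bar> \<le> H x / real n" if "i < d" for i j x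
    by (rule order_trans[OF abs_le_frob[OF that, of "\<lambda>i j. P i j x"] Pfrob])
  show thesis
  proof (rule that[of S.u S.A])
    show "S.u \<in> SBV \<Omega> d" by (rule S.u_SBV)
    show "integrable lborel (\<lambda>x. S.u x i)" if "i < d" for i by (rule S.u_int[OF that])
    show "integrable lborel (S.A i j)" if "i < d" for i j by (rule S.A_int[OF that])
    show "lebesgue_density (ac_grad \<Omega> d S.u) B i $ j = (LBINT x:B. S.A i j x)"
      if "B \<in> sets (borel_on \<Omega>)" "i < d" for B i j by (rule S.ac_grad_component[OF that])
    show "(\<integral>\<^sup>+x. ennreal (norm_vec d (\<lambda>i. S.u x i - g i x)) \<partial>lborel) \<le> ennreal (2 * \<delta>)"
    proof -
      have le: "norm_vec d (\<lambda>i. S.u x i - g i x) \<le> norm_vec d (\<lambda>i. v i x - g i x) + H x / real n" for x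
      proof -
        have "norm_vec d (\<lambda>i. S.u x i - g i x)
            = norm_vec d (\<lambda>i. (v i x - g i x) + (\<Sum>l\<in>UNIV. F i l x * saw n (x $ l)))"
          by (rule L2_set_cong) (simp_all add: S.u_def)
        also have "\<dots> \<le> norm_vec d (\<lambda>i. v i x - g i x) + norm_vec d (\<lambda>i. \<Sum>l\<in>UNIV. F i l x * saw n (x $ l))"
          by (rule L2_set_triangle_ineq)
        also have "norm_vec d (\<lambda>i. \<Sum>l\<in>UNIV. F i l x * saw n (x $ l)) \<le> (\<Sum>i<d. \<bar>\<Sum>l\<in>UNIV. F i l x * saw n (x $ l)\<bar>)"
          by (rule L2_set_le_sum_abs)
        also have "\<dots> \<le> (\<Sum>i<d. (\<Sum>l\<in>UNIV. \<bar>F i l x\<bar>) / real n)" by (intro sum_mono abs_sum_saw_le n)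
        also have "\<dots> = (\<Sum>i<d. \<Sum>l\<in>UNIV. \<bar>F i l x\<bar>) / real n" by (simp only: sum_divide_distrib)
        also have "\<dots> \<le> H x / real n" by (intro divide_right_mono) (simp_all add: H_def sum_nonneg)
        finally show ?thesis by simp
      qed
      have "(\<integral>\<^sup>+x. ennreal (norm_vec d (\<lambda>i. S.u x i - g i x)) \<partial>lborel)
          \<le> (\<integral>\<^sup>+x. ennreal (norm_vec d (\<lambda>i. v i x - g i x)) + ennreal (H x / real n) \<partial>lborel)"
        by (rule nn_integral_mono) (simp add: ennreal_leI[OF le] H0 flip: ennreal_plus)
      also have "\<dots> = (\<integral>\<^sup>+x. ennreal (norm_vec d (\<lambda>i. v i x - g i x)) \<partial>lborel) + (\<integral>\<^sup>+x. ennreal (H x / real n) \<partial>lborel)"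
      proof (rule nn_integral_add)
        have "integrable lborel (\<lambda>x. norm_vec d (\<lambda>i. v i x - g i x))"
          by (rule integrable_L2_set) (use v(2) g(1) in auto)
        from measurable_compose[OF borel_measurable_integrable[OF this] measurable_ennreal]
        show "(\<lambda>x. ennreal (norm_vec d (\<lambda>i. v i x - g i x))) \<in> borel_measurable lborel" .
        from measurable_compose[OF borel_measurable_integrable[OF Hn(1)] measurable_ennreal]
        show "(\<lambda>x. ennreal (H x / real n)) \<in> borel_measurable lborel" .
      qed
      also have "\<dots> \<le> ennreal \<delta> + ennreal \<delta>"
      proof (rule add_mono[OF vg])
        show "(\<integral>\<^sup>+x. ennreal (H x / real n) \<partial>lborel) \<le> ennreal \<delta>"
          using nn_integral_eq_integral[OF Hn(1)] H0 Hn(2) by (simp add: ennreal_leI)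
      qed
      also have "\<dots> = ennreal (2 * \<delta>)" using \<delta> by (simp flip: ennreal_plus)
      finally show ?thesis .
    qed
    show "(\<integral>x. \<bar>S.A i j x - W i j x\<bar> \<partial>lborel) \<le> 2 * \<delta>" if i: "i < d" for i j
    proof -
      have iF: "integrable lborel (\<lambda>x. \<bar>F i j x - F0 i j x\<bar>)"
        by (intro integrable_abs Bochner_Integration.integrable_diff Fi F0i)
      have "(\<integral>x. \<bar>S.A i j x - W i j x\<bar> \<partial>lborel) \<le> (\<integral>x. \<bar>F i j x - F0 i j x\<bar> + H x / real n \<partial>lborel)"
      proof (rule integral_mono)
        show "integrable lborel (\<lambda>x. \<bar>S.A i j x - W i j x\<bar>)"
          by (intro integrable_abs Bochner_Integration.integrable_diff S.A_int i W)
        show "integrable lborel (\<lambda>x. \<bar>F i j x - F0 i j x\<bar> + H x / real n)"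
          by (rule Bochner_Integration.integrable_add[OF iF Hn(1)])
        fix x
        \<comment> \<open>\<open>V\<close> cancels because \<open>F0\<close> is W minus
          \<open>V\<close>, which leaves the mollification error and the term of order 1 /
          n.\<close>
        have "S.A i j x - W i j x = (F i j x - F0 i j x) + P i j x" using i by (simp add: A_eq F0_def)
        then show "\<bar>S.A i j x - W i j x\<bar> \<le> \<bar>F i j x - F0 i j x\<bar> + H x / real n" using P1[OF i, of j x] by linarith
      qed
      also have "\<dots> = (\<integral>x. \<bar>F i j x - F0 i j x\<bar> \<partial>lborel) + (\<integral>x. H x / real n \<partial>lborel)"
        by (rule Bochner_Integration.integral_add[OF iF Hn(1)])
      also have "(\<integral>x. \<bar>F i j x - F0 i j x\<bar> \<partial>lborel) \<le> \<delta>"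
        by (rule integral_le_of_nn_integral_le[OF iF _ _ d0]) (use m[OF i, of j] in \<open>simp_all add: F_def\<close>)
      finally show ?thesis using Hn(2) by linarith
    qed
    show "measure_norm \<Omega> d (D \<Omega> d S.u)
        \<le> ennreal ((real CARD('n) + 2) * (a + b) + (2 * real CARD('n) + 3) * \<delta>)"
    proof -
      have iVF: "integrable lborel (\<lambda>x. frob d (\<lambda>i j. V i j x) + frob d (\<lambda>i j. F i j x))"
        by (rule Bochner_Integration.integrable_add[OF integrable_frob[OF V(1)] integrable_frob[OF Fi]])
      have "(\<integral>x. frob d (\<lambda>i j. S.A i j x) \<partial>lborel)
          \<le> (\<integral>x. frob d (\<lambda>i j. V i j x) + frob d (\<lambda>i j. F i j x) + H x / real n \<partial>lborel)"
      proof (rule integral_mono[OF integrable_frob[OF S.A_int] Bochner_Integration.integrable_add[OF iVF Hn(1)]])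
        fix x
        have "frob d (\<lambda>i j. S.A i j x) \<le> frob d (\<lambda>i j. V i j x + F i j x) + frob d (\<lambda>i j. P i j x)"
          unfolding A_eq by (rule frob_add_le)
        then show "frob d (\<lambda>i j. S.A i j x) \<le> frob d (\<lambda>i j. V i j x) + frob d (\<lambda>i j. F i j x) + H x / real n"
          using frob_add_le[of "\<lambda>i j. V i j x" "\<lambda>i j. F i j x" d] Pfrob[of x] by linarith
      qed
      also have "\<dots> = (\<integral>x. frob d (\<lambda>i j. V i j x) + frob d (\<lambda>i j. F i j x) \<partial>lborel) + (\<integral>x. H x / real n \<partial>lborel)"
        by (rule Bochner_Integration.integral_add[OF iVF Hn(1)])
      also have "(\<integral>x. frob d (\<lambda>i j. V i j x) + frob d (\<lambda>i j. F i j x) \<partial>lborel)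
          = (\<integral>x. frob d (\<lambda>i j. V i j x) \<partial>lborel) + (\<integral>x. frob d (\<lambda>i j. F i j x) \<partial>lborel)"
        by (rule Bochner_Integration.integral_add[OF integrable_frob[OF V(1)] integrable_frob[OF Fi]])
      finally have A: "(\<integral>x. frob d (\<lambda>i j. S.A i j x) \<partial>lborel) \<le> 2 * a + b + 3 * \<delta>"
        using Va Fint Hn(2) by linarith
      have J: "(\<integral>y. norm_vec d (\<lambda>i. F i j (proj n j y)) \<partial>lborel) \<le> a + b + 2 * \<delta>" for j
      proof -
        have "(\<integral>x. ?nF j x \<partial>lborel) \<le> (\<integral>x. frob d (\<lambda>i j. F i j x) \<partial>lborel)"
        proof (rule integral_mono[OF integrable_L2_set integrable_frob[OF Fi]])
          show "?nF j x \<le> frob d (\<lambda>i j. F i j x)" for x by (rule norm_vec_le_frob)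
        qed (simp_all add: Fi)
        then show ?thesis using Fint k(2)[of j] unfolding n_def by linarith
      qed
      have "measure_norm \<Omega> d (D \<Omega> d S.u) \<le> (\<integral>\<^sup>+x. ennreal (frob d (\<lambda>i j. S.A i j x)) \<partial>lborel)
          + (\<Sum>j\<in>UNIV. \<integral>\<^sup>+y. ennreal (norm_vec d (\<lambda>i. F i j (proj n j y))) \<partial>lborel)"
        by (rule S.measure_norm_D_u)
      also have "\<dots> \<le> ennreal (2 * a + b + 3 * \<delta>) + (\<Sum>j\<in>(UNIV :: 'n set). ennreal (a + b + 2 * \<delta>))"
      proof (intro add_mono sum_mono)
        have "(\<integral>\<^sup>+x. ennreal (frob d (\<lambda>i j. S.A i j x)) \<partial>lborel) = ennreal (\<integral>x. frob d (\<lambda>i j. S.A i j x) \<partial>lborel)"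
          by (rule nn_integral_frob_eq[OF S.A_int])
        also have "\<dots> \<le> ennreal (2 * a + b + 3 * \<delta>)" by (rule ennreal_leI[OF A])
        finally show "(\<integral>\<^sup>+x. ennreal (frob d (\<lambda>i j. S.A i j x)) \<partial>lborel) \<le> ennreal (2 * a + b + 3 * \<delta>)" .
        fix j
        have "(\<integral>\<^sup>+y. ennreal (norm_vec d (\<lambda>i. F i j (proj n j y))) \<partial>lborel)
            = ennreal (\<integral>y. norm_vec d (\<lambda>i. F i j (proj n j y)) \<partial>lborel)"
          by (rule nn_integral_L2_set_eq) (simp_all only: S.F_proj_int finite_lessThan)
        also have "\<dots> \<le> ennreal (a + b + 2 * \<delta>)" by (rule ennreal_leI[OF J])
        finally show "(\<integral>\<^sup>+y. ennreal (norm_vec d (\<lambda>i. F i j (proj n j y))) \<partial>lborel) \<le> ennreal (a + b + 2 * \<delta>)" .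
      qed
      also have "\<dots> = ennreal ((2 * a + b + 3 * \<delta>) + real CARD('n) * (a + b + 2 * \<delta>))"
      proof -
        have "(\<Sum>j\<in>(UNIV :: 'n set). ennreal (a + b + 2 * \<delta>)) = ennreal (\<Sum>j\<in>(UNIV :: 'n set). a + b + 2 * \<delta>)"
          by (rule sum_ennreal) (use ab \<delta> in simp)
        also have "(\<Sum>j\<in>(UNIV :: 'n set). a + b + 2 * \<delta>) = real CARD('n) * (a + b + 2 * \<delta>)" by simp
        finally show ?thesis using ab \<delta> by (simp only: ennreal_plus mult_nonneg_nonneg of_nat_0_le_iff add_nonneg_nonneg)
      qed
      \<comment> \<open>The coefficient 2 a + b is rounded up to 2 (a + b).\<close>
      also have "\<dots> \<le> ennreal ((real CARD('n) + 2) * (a + b) + (2 * real CARD('n) + 3) * \<delta>)"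
        by (rule ennreal_leI) (use ab(4) in \<open>simp add: algebra_simps\<close>)
      finally show ?thesis .
    qed
  qed
qed

text \<open>The tolerance is going to be proportional to the norm of (g, G), which may be 0. In that
  case the function u = 0 serves, obtained from the same locale with vanishing data: g vanishes
  almost everywhere, and W has integral 0 because b = 0.\<close>

lemma sawtooth_approximation_nonneg:
  fixes \<Omega> :: "(real ^ 'n) set" and g :: "nat \<Rightarrow> real ^ 'n \<Rightarrow> real" and W :: "nat \<Rightarrow> 'n \<Rightarrow> real ^ 'n \<Rightarrow> real"
  assumes \<Omega>: "open \<Omega>" "bounded \<Omega>" and \<delta>: "\<delta> \<ge> 0"
    and \<kappa>: "finite_measure \<kappa>" "sets \<kappa> = sets (borel_on \<Omega>)" and h: "\<And>k j. integrable \<kappa> (h k j)"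
    and g: "\<And>k. integrable lborel (g k)" "\<And>k. g k \<in> borel_measurable borel" "\<And>k x. x \<notin> \<Omega> \<Longrightarrow> g k x = 0"
    and weak: "\<And>\<phi> k j. \<phi> \<in> Cc_infinity \<Omega> \<Longrightarrow> k < d \<Longrightarrow>
      (\<integral>x. g k x * partial_deriv j \<phi> x \<partial>lborel) = - (\<integral>y. \<phi> y * h k j y \<partial>\<kappa>)"
    and W: "\<And>i j. integrable lborel (W i j)" "\<And>i j x. x \<notin> \<Omega> \<Longrightarrow> W i j x = 0"
    and ab: "(\<integral>\<^sup>+y. ennreal (frob d (\<lambda>k j. h k j y)) \<partial>\<kappa>) \<le> ennreal a"
      "(\<integral>\<^sup>+x. ennreal (frob d (\<lambda>i j. W i j x)) \<partial>lborel) \<le> ennreal b" "a \<ge> 0" "b \<ge> 0"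
    and zero: "\<delta> = 0 \<Longrightarrow> b = 0" "\<delta> = 0 \<Longrightarrow> (\<integral>\<^sup>+x. ennreal (norm_vec d (\<lambda>i. g i x)) \<partial>lborel) = 0"
  shows "\<exists>u A. u \<in> SBV \<Omega> d \<and> (\<forall>i<d. integrable lborel (\<lambda>x. u x i)) \<and>
    (\<integral>\<^sup>+x. ennreal (norm_vec d (\<lambda>i. u x i - g i x)) \<partial>lborel) \<le> ennreal (2 * \<delta>) \<and>
    measure_norm \<Omega> d (D \<Omega> d u) \<le> ennreal ((real CARD('n) + 2) * (a + b) + (2 * real CARD('n) + 3) * \<delta>) \<and>
    (\<forall>i<d. \<forall>j. integrable lborel (A i j) \<and> (\<integral>x. \<bar>A i j x - W i j x\<bar> \<partial>lborel) \<le> 2 * \<delta>) \<and>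
    (\<forall>B\<in>sets (borel_on \<Omega>). \<forall>i<d. \<forall>j. lebesgue_density (ac_grad \<Omega> d u) B i $ j = (LBINT x:B. A i j x))"
proof (cases "\<delta> = 0")
  case False
  then have "\<delta> > 0" using \<delta> by simp
  show ?thesis
  proof (rule sawtooth_approximation[where d=d and g=g and h=h and W=W, OF \<Omega> \<open>\<delta> > 0\<close> \<kappa> h g weak W ab])
    fix u :: "real ^ 'n \<Rightarrow> nat \<Rightarrow> real" and A :: "nat \<Rightarrow> 'n \<Rightarrow> real ^ 'n \<Rightarrow> real"
    assume p: "u \<in> SBV \<Omega> d" "\<And>i. i < d \<Longrightarrow> integrable lborel (\<lambda>x. u x i)"
      "(\<integral>\<^sup>+x. ennreal (norm_vec d (\<lambda>i. u x i - g i x)) \<partial>lborel) \<le> ennreal (2 * \<delta>)"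
      "measure_norm \<Omega> d (D \<Omega> d u) \<le> ennreal ((real CARD('n) + 2) * (a + b) + (2 * real CARD('n) + 3) * \<delta>)"
      "\<And>i j. i < d \<Longrightarrow> integrable lborel (A i j)"
      "\<And>B i j. B \<in> sets (borel_on \<Omega>) \<Longrightarrow> i < d \<Longrightarrow> lebesgue_density (ac_grad \<Omega> d u) B i $ j = (LBINT x:B. A i j x)"
      "\<And>i j. i < d \<Longrightarrow> (\<integral>x. \<bar>A i j x - W i j x\<bar> \<partial>lborel) \<le> 2 * \<delta>"
    show ?thesis by (intro exI[of _ u] exI[of _ A] conjI ballI allI impI p)
  qed assumption+
next
  case True
  interpret S: sawtooth_function \<Omega> d "Suc 0" "\<lambda>i x. 0" "\<lambda>i j x. 0" "\<lambda>i j x. 0"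
    by unfold_locales (simp_all add: \<Omega> smooth_def C_k_const bounded_support_def)
  have u: "S.u = (\<lambda>x i. 0)" by (simp add: S.u_def fun_eq_iff)
  have A: "S.A i j = (\<lambda>x. 0)" for i j by (simp add: S.A_def fun_eq_iff)
  have "measure_norm \<Omega> d (D \<Omega> d S.u) \<le> 0" using S.measure_norm_D_u by (simp add: A L2_set_def)
  then have M: "measure_norm \<Omega> d (D \<Omega> d S.u)
      \<le> ennreal ((real CARD('n) + 2) * (a + b) + (2 * real CARD('n) + 3) * \<delta>)" by simp
  have W0: "(\<integral>x. \<bar>S.A i j x - W i j x\<bar> \<partial>lborel) \<le> 2 * \<delta>" if i: "i < d" for i j
  proof -
    have "(\<integral>x. \<bar>S.A i j x - W i j x\<bar> \<partial>lborel) \<le> (\<integral>x. frob d (\<lambda>i j. W i j x) \<partial>lborel)"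
      by (rule integral_mono[OF integrable_abs integrable_frob[OF W(1)]])
        (simp_all add: A W(1) abs_le_frob[OF i, of "\<lambda>i j. W i j _"])
    also have "\<dots> \<le> b"
      by (rule integral_le_of_nn_integral_le[OF integrable_frob[OF W(1)] _ ab(2,4)]) simp
    finally show ?thesis using zero(1) True by simp
  qed
  have g0: "(\<integral>\<^sup>+x. ennreal (norm_vec d (\<lambda>i. S.u x i - g i x)) \<partial>lborel) \<le> ennreal (2 * \<delta>)"
    using zero(2)[OF True] by (simp add: u L2_set_def)
  show ?thesis
    by (intro exI[of _ S.u] exI[of _ S.A] conjI ballI allI impI S.u_SBV S.u_int g0 M S.A_int W0 S.ac_grad_component)
qed

section \<open>Representing the given function and measure by densities\<close>

lemma radon_measure_polar:
  fixes \<mu> :: "(real ^ 'n) set \<Rightarrow> nat \<Rightarrow> real ^ 'n"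
  assumes "\<mu> \<in> radon_measures \<Omega> d"
  obtains \<kappa> h where "finite_measure \<kappa>" "sets \<kappa> = sets (borel_on \<Omega>)" "\<And>i j. integrable \<kappa> (h i j)"
    "\<And>i j \<phi> C. i < d \<Longrightarrow> \<phi> \<in> borel_measurable borel \<Longrightarrow> \<forall>x. \<bar>\<phi> x\<bar> \<le> C \<Longrightarrow>
      signed_integral (borel_on \<Omega>) (\<lambda>B. \<mu> B i $ j) \<phi> = (\<integral>y. \<phi> y * h i j y \<partial>\<kappa>)"
    "(\<integral>\<^sup>+x. ennreal (frob d (\<lambda>i j. h i j x)) \<partial>\<kappa>) \<le> measure_norm \<Omega> d \<mu>"
proof (rule polar_decomposition)
  show "vector_measure (borel_on \<Omega>) (\<lambda>B. \<mu> B i)" if "i < d" for i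
    using assms that by (simp add: radon_measures_def)
  fix \<kappa> :: "(real ^ 'n) measure" and h :: "nat \<Rightarrow> 'n \<Rightarrow> real ^ 'n \<Rightarrow> real"
  assume p: "finite_measure \<kappa>" "sets \<kappa> = sets (borel_on \<Omega>)" "\<And>i j. integrable \<kappa> (h i j)"
    and eq: "\<And>i j B. i < d \<Longrightarrow> B \<in> sets (borel_on \<Omega>) \<Longrightarrow> \<mu> B i $ j = (LINT x:B|\<kappa>. h i j x)"
    and le: "(\<integral>\<^sup>+x. ennreal (frob d (\<lambda>i j. h i j x)) \<partial>\<kappa>) \<le> total_variation (borel_on \<Omega>) d \<mu> (space (borel_on \<Omega>))"
  show thesis
  proof (rule that[OF p])
    fix i j C and \<phi> :: "real ^ 'n \<Rightarrow> real" assume a: "i < d" "\<phi> \<in> borel_measurable borel" "\<forall>x. \<bar>\<phi> x\<bar> \<le> C"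
    have "signed_integral (borel_on \<Omega>) (\<lambda>B. \<mu> B i $ j) \<phi> = (\<Sum>_\<in>{()}. \<integral>y. \<phi> y * h i j y \<partial>\<kappa>)"
      by (rule signed_measure_densities(2)[where I="{()}" and \<kappa>="\<lambda>_. \<kappa>" and h="\<lambda>_. h i j",
            OF _ p(2,3) _ borel_measurable_borel_on[OF a(2)] a(3)[rule_format]]) (simp_all add: eq[OF a(1)])
    then show "signed_integral (borel_on \<Omega>) (\<lambda>B. \<mu> B i $ j) \<phi> = (\<integral>y. \<phi> y * h i j y \<partial>\<kappa>)" by simp
  next
    show "(\<integral>\<^sup>+x. ennreal (frob d (\<lambda>i j. h i j x)) \<partial>\<kappa>) \<le> measure_norm \<Omega> d \<mu>"
      using le by (simp add: measure_norm_def space_restrict_space)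
  qed
qed

lemma measure_norm_finite: "\<mu> \<in> radon_measures \<Omega> d \<Longrightarrow> measure_norm \<Omega> d \<mu> < \<infinity>"
  using total_variation_finite[of d "borel_on \<Omega>" \<mu>]
  by (simp add: measure_norm_def radon_measures_def space_restrict_space)

text \<open>Supplies the common bound on the values of the measures that
  \<open>weak_star_measuresI\<close> asks for.\<close>

lemma abs_component_le_measure_norm:
  fixes \<mu> :: "(real ^ 'n) set \<Rightarrow> nat \<Rightarrow> real ^ 'n"
  assumes \<Omega>: "open \<Omega>" and K: "measure_norm \<Omega> d \<mu> \<le> ennreal K" "K \<ge> 0"
    and B: "B \<in> sets (borel_on \<Omega>)" and i: "i < d"
  shows "\<bar>\<mu> B i $ j\<bar> \<le> K"
proof -
  have Bs: "B \<subseteq> \<Omega>" using borel_on_borel[OF \<Omega> B] by simp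
  have "\<Omega> \<in> sets (borel_on \<Omega>)" by (rule borel_onI) (use \<Omega> in auto)
  then have "ennreal (norm_mat d (\<mu> B)) \<le> ennreal K"
    using norm_mat_le_total_variation[OF _ B Bs, of \<mu> d] K(1) unfolding measure_norm_def by (meson order_trans)
  then have "norm_mat d (\<mu> B) \<le> K" using K(2) by simp
  moreover have "\<bar>\<mu> B i $ j\<bar> \<le> norm (\<mu> B i)" by (rule component_le_norm_cart)
  moreover have "norm (\<mu> B i) \<le> norm_mat d (\<mu> B)" using i by (intro member_le_L2_set) auto
  ultimately show ?thesis by linarith
qed

lemma L1_norm_representative:
  fixes f :: "real ^ 'n \<Rightarrow> nat \<Rightarrow> real"
  assumes f': "\<And>i. i < d \<Longrightarrow> integrable lborel (f' i)" "\<And>i x. i < d \<Longrightarrow> x \<notin> \<Omega> \<Longrightarrow> f' i x = 0"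
    and ae: "\<And>i. i < d \<Longrightarrow> AE x in lebesgue. x \<in> \<Omega> \<longrightarrow> f' i x = f x i"
  shows "L1_norm \<Omega> d f = (\<integral>\<^sup>+x. ennreal (norm_vec d (\<lambda>i. f' i x)) \<partial>lborel)"
proof -
  have "AE x in lebesgue. \<forall>i\<in>{..<d}. x \<in> \<Omega> \<longrightarrow> f' i x = f x i"
    by (rule AE_finite_allI) (use ae in auto)
  then have "L1_norm \<Omega> d f = (\<integral>\<^sup>+x. ennreal (norm_vec d (\<lambda>i. f' i x)) \<partial>lebesgue)"
    unfolding L1_norm_def
  proof (intro nn_integral_cong_AE, eventually_elim)
    fix x assume x: "\<forall>i\<in>{..<d}. x \<in> \<Omega> \<longrightarrow> f' i x = f x i"
    show "ennreal (norm_vec d (f x)) * indicator \<Omega> x = ennreal (norm_vec d (\<lambda>i. f' i x))"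
    proof (cases "x \<in> \<Omega>")
      case True
      have "norm_vec d (f x) = norm_vec d (\<lambda>i. f' i x)" by (rule L2_set_cong) (use x True in auto)
      then show ?thesis using True by simp
    next
      case False
      have "norm_vec d (\<lambda>i. f' i x) = norm_vec d (\<lambda>i. 0)" by (rule L2_set_cong) (use f'(2) False in auto)
      then show ?thesis using False by (simp add: L2_set_def)
    qed
  qed
  also have "\<dots> = (\<integral>\<^sup>+x. ennreal (norm_vec d (\<lambda>i. f' i x)) \<partial>lborel)"
    by (rule nn_integral_completion)
  finally show ?thesis .
qed

lemma density_measure:
  fixes f :: "real ^ 'n \<Rightarrow> real"
  assumes \<Omega>: "open \<Omega>" and f: "integrable lborel f"
    and eq: "\<And>B. B \<in> sets (borel_on \<Omega>) \<Longrightarrow> \<nu> B = (LBINT x:B. f x)"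
  shows "vector_measure (borel_on \<Omega>) \<nu>"
    and "\<phi> \<in> borel_measurable borel \<Longrightarrow> (\<And>x. \<bar>\<phi> x\<bar> \<le> C) \<Longrightarrow> (\<And>x. x \<notin> \<Omega> \<Longrightarrow> \<phi> x = 0) \<Longrightarrow>
      signed_integral (borel_on \<Omega>) \<nu> \<phi> = (\<integral>x. \<phi> x * f x \<partial>lborel)"
proof -
  let ?\<kappa> = "restrict_space lborel \<Omega> :: (real ^ 'n) measure"
  have \<Omega>b: "\<Omega> \<in> sets borel" using \<Omega> by simp
  have s: "sets ?\<kappa> = sets (borel_on \<Omega>)" by (rule sets_restrict_space_cong) simp
  have int: "integrable ?\<kappa> f"
    using integrable_mult_indicator[OF _ f, of \<Omega>] \<Omega>b by (simp add: integrable_restrict_space)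
  have L: "(LINT x|?\<kappa>. k x * f x) = (\<integral>x. k x * f x \<partial>lborel)" if "\<And>x. x \<notin> \<Omega> \<Longrightarrow> k x = 0" for k
    using that by (simp add: integral_restrict_space \<Omega>b)
      (auto intro!: Bochner_Integration.integral_cong simp: indicator_def)
  have eq': "\<nu> B = (\<Sum>_\<in>{()}. LINT x:B|?\<kappa>. f x)" if B: "B \<in> sets (borel_on \<Omega>)" for B
  proof -
    have "(LINT x|?\<kappa>. indicator B x * f x) = (\<integral>x. indicator B x * f x \<partial>lborel)"
      by (rule L) (use borel_on_borel[OF \<Omega> B] in \<open>auto simp: indicator_def\<close>)
    then show ?thesis by (simp add: eq[OF B] set_lebesgue_integral_def)
  qed
  show "vector_measure (borel_on \<Omega>) \<nu>"
    by (rule signed_measure_densities(1)[where I="{()}" and \<kappa>="\<lambda>_. ?\<kappa>" and h="\<lambda>_. f", OF _ s int eq']) simp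
  assume \<phi>: "\<phi> \<in> borel_measurable borel" "\<And>x. \<bar>\<phi> x\<bar> \<le> C" "\<And>x. x \<notin> \<Omega> \<Longrightarrow> \<phi> x = 0"
  have "signed_integral (borel_on \<Omega>) \<nu> \<phi> = (\<Sum>_\<in>{()}. \<integral>x. \<phi> x * f x \<partial>?\<kappa>)"
    by (rule signed_measure_densities(2)[where I="{()}" and \<kappa>="\<lambda>_. ?\<kappa>" and h="\<lambda>_. f", OF _ s int eq'
          borel_measurable_borel_on[OF \<phi>(1)] \<phi>(2)]) simp
  then show "signed_integral (borel_on \<Omega>) \<nu> \<phi> = (\<integral>x. \<phi> x * f x \<partial>lborel)" using L[of \<phi>, OF \<phi>(3)] by simp
qed

text \<open>A mollified measure converges in general only when tested. Fubini's theorem moves the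
  mollifier to \<psi>, where uniform continuity makes the convergence uniform, and the density h is
  integrable.\<close>

lemma mollified_measure_tendsto:
  fixes \<psi> :: "real ^ 'n \<Rightarrow> real"
  assumes \<kappa>: "euclidean_measure \<kappa>" "integrable \<kappa> h" and \<psi>: "continuous_on UNIV \<psi>" "bounded_support \<psi>"
    and space: "(\<lambda>y. \<psi> y) \<in> borel_measurable \<kappa>"
  shows "(\<lambda>m. \<integral>x. \<psi> x * conv (mollifier m) \<kappa> h x \<partial>lborel) \<longlonglongrightarrow> (\<integral>y. \<psi> y * h y \<partial>\<kappa>)"
proof (rule LIMSEQ_I)
  interpret euclidean_measure \<kappa> by (rule \<kappa>(1))
  fix r :: real assume r: "r > 0"
  let ?H = "\<integral>y. \<bar>h y\<bar> \<partial>\<kappa>"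
  have H: "?H \<ge> 0" by (intro integral_nonneg_AE) auto
  define e where "e = r / (?H + 1)"
  have e: "e > 0" using r H unfolding e_def by (intro divide_pos_pos) linarith+
  obtain s where s: "s > 0" "\<And>x y. norm (x - y) < s \<Longrightarrow> \<bar>\<psi> x - \<psi> y\<bar> < e"
    using bounded_support_uniformly_continuous[OF \<psi> e] by blast
  obtain C where C: "\<And>x. \<bar>\<psi> x\<bar> \<le> C" using bounded_support_bounded[OF \<psi>] by blast
  have \<psi>m: "\<psi> \<in> borel_measurable borel" by (rule borel_measurable_continuous_onI[OF \<psi>(1)])
  obtain M where M: "1 / real (Suc M) < s" using nat_approx_posE[OF s(1)] by blast
  have "norm ((\<integral>x. \<psi> x * conv (mollifier m) \<kappa> h x \<partial>lborel) - (\<integral>y. \<psi> y * h y \<partial>\<kappa>)) < r" if m: "m \<ge> M" for m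
  proof -
    let ?\<psi> = "\<lambda>y. \<integral>x. \<psi> x * mollifier m (x - y) \<partial>lborel"
    note [measurable] = mollifierD(6)[OF mollifier[of m]] \<psi>m
    have ms: "1 / real (Suc m) < s"
      using M m by (intro le_less_trans[OF _ M] divide_left_mono) auto
    have close: "\<bar>?\<psi> y - \<psi> y\<bar> \<le> e" for y
    proof (rule mollified_value_close(2)[OF mollifier \<psi>m])
      fix x assume "dist y x \<le> 1 / real (Suc m)"
      then have "norm (x - y) < s" using ms by (simp add: dist_norm norm_minus_commute)
      then show "\<bar>\<psi> x - \<psi> y\<bar> \<le> e" using s(2) by (simp add: less_imp_le)
    qed
    have "(\<lambda>y. ?\<psi> y) \<in> borel_measurable borel" by measurable
    then have \<psi>'m: "(\<lambda>y. ?\<psi> y) \<in> borel_measurable \<kappa>" by (rule measurable_compose[OF id_measurable])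
    have b: "\<bar>?\<psi> y\<bar> \<le> C + e" for y using close[of y] C[of y] by linarith
    have i1: "integrable \<kappa> (\<lambda>y. ?\<psi> y * h y)"
      using integrable_mult_bounded[OF \<kappa>(2) \<psi>'m, of "C + e"] b by (simp add: mult.commute)
    have i2: "integrable \<kappa> (\<lambda>y. \<psi> y * h y)"
      using integrable_mult_bounded[OF \<kappa>(2) space, of C] C by (simp add: mult.commute)
    have "(\<integral>x. \<psi> x * conv (mollifier m) \<kappa> h x \<partial>lborel) - (\<integral>y. \<psi> y * h y \<partial>\<kappa>) = (\<integral>y. ?\<psi> y * h y - \<psi> y * h y \<partial>\<kappa>)"
      unfolding integral_mult_conv[OF mollifier \<kappa>(2) \<psi>m C] by (rule Bochner_Integration.integral_diff[OF i1 i2, symmetric])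
    also have "norm \<dots> \<le> (\<integral>y. e * \<bar>h y\<bar> \<partial>\<kappa>)"
    proof (rule Bochner_Integration.integral_norm_bound_integral)
      show "integrable \<kappa> (\<lambda>y. ?\<psi> y * h y - \<psi> y * h y)" by (rule Bochner_Integration.integrable_diff[OF i1 i2])
      show "integrable \<kappa> (\<lambda>y. e * \<bar>h y\<bar>)" using \<kappa>(2) by simp
      show "norm (?\<psi> y * h y - \<psi> y * h y) \<le> e * \<bar>h y\<bar>" for y
        using mult_right_mono[OF close[of y], of "\<bar>h y\<bar>"] by (simp add: left_diff_distrib[symmetric] abs_mult)
    qed
    also have "\<dots> = e * ?H" by simp
    also have "\<dots> < e * (?H + 1)" using e by simp
    also have "\<dots> = r"
    proof -
      have "r / (t + 1) * (t + 1) = r" if "t \<ge> 0" for t :: real using that by simp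
      from this[OF H] show ?thesis unfolding e_def .
    qed
    finally show ?thesis .
  qed
  then show "\<exists>no. \<forall>m\<ge>no. norm ((\<integral>x. \<psi> x * conv (mollifier m) \<kappa> h x \<partial>lborel) - (\<integral>y. \<psi> y * h y \<partial>\<kappa>)) < r" by blast
qed

text \<open>\<open>u\<close> is not assumed to vanish outside \<Omega>. Cutting it off there can
  only decrease the distance to \<open>g'\<close>, which is 0 outside.\<close>

lemma L1_norm_diff_le:
  fixes g :: "real ^ 'n \<Rightarrow> nat \<Rightarrow> real"
  assumes \<Omega>: "\<Omega> \<in> sets borel"
    and u: "\<And>i. i < d \<Longrightarrow> integrable lborel (\<lambda>x. u x i)"
    and g': "\<And>i. integrable lborel (g' i)" "\<And>i x. x \<notin> \<Omega> \<Longrightarrow> g' i x = 0"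
      "\<And>i. i < d \<Longrightarrow> AE x in lebesgue. x \<in> \<Omega> \<longrightarrow> g' i x = g x i"
  shows "L1_norm \<Omega> d (\<lambda>x i. u x i - g x i) \<le> (\<integral>\<^sup>+x. ennreal (norm_vec d (\<lambda>i. u x i - g' i x)) \<partial>lborel)"
    and "L1_norm \<Omega> d u \<le> L1_norm \<Omega> d g + (\<integral>\<^sup>+x. ennreal (norm_vec d (\<lambda>i. u x i - g' i x)) \<partial>lborel)"
proof -
  have iu: "integrable lborel (\<lambda>x. indicator \<Omega> x * u x i)" if "i < d" for i
    using integrable_mult_indicator[OF _ u[OF that], of \<Omega>] \<Omega> by simp
  have "L1_norm \<Omega> d (\<lambda>x i. u x i - g x i)
      = (\<integral>\<^sup>+x. ennreal (norm_vec d (\<lambda>i. indicator \<Omega> x * u x i - g' i x)) \<partial>lborel)"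
  proof (rule L1_norm_representative)
    fix i assume i: "i < d"
    show "integrable lborel (\<lambda>x. indicator \<Omega> x * u x i - g' i x)"
      by (rule Bochner_Integration.integrable_diff[OF iu[OF i] g'(1)])
    show "AE x in lebesgue. x \<in> \<Omega> \<longrightarrow> indicator \<Omega> x * u x i - g' i x = u x i - g x i"
      using g'(3)[OF i] by eventually_elim simp
  qed (simp add: g'(2))
  also have "\<dots> \<le> (\<integral>\<^sup>+x. ennreal (norm_vec d (\<lambda>i. u x i - g' i x)) \<partial>lborel)"
  proof (intro nn_integral_mono ennreal_leI)
    fix x
    show "norm_vec d (\<lambda>i. indicator \<Omega> x * u x i - g' i x) \<le> norm_vec d (\<lambda>i. u x i - g' i x)"
      by (cases "x \<in> \<Omega>") (simp_all add: g'(2) L2_set_def sum_nonneg)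
  qed
  finally show "L1_norm \<Omega> d (\<lambda>x i. u x i - g x i) \<le> (\<integral>\<^sup>+x. ennreal (norm_vec d (\<lambda>i. u x i - g' i x)) \<partial>lborel)" .
  have "L1_norm \<Omega> d u = (\<integral>\<^sup>+x. ennreal (norm_vec d (\<lambda>i. indicator \<Omega> x * u x i)) \<partial>lborel)"
    by (rule L1_norm_representative) (simp_all add: iu)
  also have "\<dots> \<le> (\<integral>\<^sup>+x. ennreal (norm_vec d (\<lambda>i. g' i x)) + ennreal (norm_vec d (\<lambda>i. u x i - g' i x)) \<partial>lborel)"
  proof (rule nn_integral_mono)
    fix x
    have "norm_vec d (\<lambda>i. indicator \<Omega> x * u x i) \<le> norm_vec d (\<lambda>i. g' i x + (u x i - g' i x))"
      by (cases "x \<in> \<Omega>") (simp_all add: L2_set_def sum_nonneg)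
    also have "\<dots> \<le> norm_vec d (\<lambda>i. g' i x) + norm_vec d (\<lambda>i. u x i - g' i x)" by (rule L2_set_triangle_ineq)
    finally show "ennreal (norm_vec d (\<lambda>i. indicator \<Omega> x * u x i))
        \<le> ennreal (norm_vec d (\<lambda>i. g' i x)) + ennreal (norm_vec d (\<lambda>i. u x i - g' i x))"
      by (simp add: ennreal_leI flip: ennreal_plus)
  qed
  also have "\<dots> = (\<integral>\<^sup>+x. ennreal (norm_vec d (\<lambda>i. g' i x)) \<partial>lborel)
      + (\<integral>\<^sup>+x. ennreal (norm_vec d (\<lambda>i. u x i - g' i x)) \<partial>lborel)"
  proof (rule nn_integral_add)
    have "integrable lborel (\<lambda>x. norm_vec d (\<lambda>i. g' i x))"
      by (rule integrable_L2_set) (simp_all add: g'(1))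
    from measurable_compose[OF borel_measurable_integrable[OF this] measurable_ennreal]
    show "(\<lambda>x. ennreal (norm_vec d (\<lambda>i. g' i x))) \<in> borel_measurable lborel" .
    have "integrable lborel (\<lambda>x. norm_vec d (\<lambda>i. u x i - g' i x))"
      by (rule integrable_L2_set) (auto intro!: Bochner_Integration.integrable_diff g'(1) u)
    from measurable_compose[OF borel_measurable_integrable[OF this] measurable_ennreal]
    show "(\<lambda>x. ennreal (norm_vec d (\<lambda>i. u x i - g' i x))) \<in> borel_measurable lborel" .
  qed
  also have "(\<integral>\<^sup>+x. ennreal (norm_vec d (\<lambda>i. g' i x)) \<partial>lborel) = L1_norm \<Omega> d g"
    by (rule L1_norm_representative[symmetric]) (simp_all add: g')
  finally show "L1_norm \<Omega> d u \<le> L1_norm \<Omega> d g + (\<integral>\<^sup>+x. ennreal (norm_vec d (\<lambda>i. u x i - g' i x)) \<partial>lborel)" .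
qed

lemma abs_integral_mult_diff_le:
  fixes f f' \<psi> :: "'a::euclidean_space \<Rightarrow> real"
  assumes f: "integrable M f" "integrable M f'" and \<psi>: "\<psi> \<in> borel_measurable M" "\<And>x. \<bar>\<psi> x\<bar> \<le> C"
    and e: "(\<integral>x. \<bar>f x - f' x\<bar> \<partial>M) \<le> e" and C: "C \<ge> 0"
  shows "\<bar>(\<integral>x. f x * \<psi> x \<partial>M) - (\<integral>x. f' x * \<psi> x \<partial>M)\<bar> \<le> C * e"
proof -
  have i: "integrable M (\<lambda>x. f x * \<psi> x)" "integrable M (\<lambda>x. f' x * \<psi> x)"
    by (rule integrable_mult_bounded[OF f(1) \<psi>(1), of C], use \<psi>(2) in simp)
      (rule integrable_mult_bounded[OF f(2) \<psi>(1), of C], use \<psi>(2) in simp)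
  have "(\<integral>x. f x * \<psi> x \<partial>M) - (\<integral>x. f' x * \<psi> x \<partial>M) = (\<integral>x. f x * \<psi> x - f' x * \<psi> x \<partial>M)"
    by (rule Bochner_Integration.integral_diff[OF i, symmetric])
  also have "norm \<dots> \<le> (\<integral>x. C * \<bar>f x - f' x\<bar> \<partial>M)"
  proof (rule Bochner_Integration.integral_norm_bound_integral)
    show "integrable M (\<lambda>x. f x * \<psi> x - f' x * \<psi> x)" by (rule Bochner_Integration.integrable_diff[OF i])
    show "integrable M (\<lambda>x. C * \<bar>f x - f' x\<bar>)"
      by (intro integrable_mult_right integrable_abs Bochner_Integration.integrable_diff f)
    show "norm (f x * \<psi> x - f' x * \<psi> x) \<le> C * \<bar>f x - f' x\<bar>" for x
      unfolding real_norm_def left_diff_distrib[symmetric] abs_mult mult.commute[of C]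
      by (rule mult_left_mono[OF \<psi>(2)]) simp
  qed
  also have "\<dots> = C * (\<integral>x. \<bar>f x - f' x\<bar> \<partial>M)" by simp
  also have "\<dots> \<le> C * e" by (rule mult_left_mono[OF e C])
  finally show ?thesis by simp
qed

lemma tendsto_of_abs_diff_le:
  fixes x :: "nat \<Rightarrow> real"
  assumes "\<And>n. \<bar>x n - y n\<bar> \<le> C * \<delta> n" "\<delta> \<longlonglongrightarrow> 0" "y \<longlonglongrightarrow> l"
  shows "x \<longlonglongrightarrow> l"
proof -
  have "(\<lambda>n. C * \<delta> n) \<longlonglongrightarrow> 0" using tendsto_mult_left[OF assms(2), of C] by simp
  then have "(\<lambda>n. x n - y n) \<longlonglongrightarrow> 0"
    by (rule Lim_null_comparison[rotated]) (use assms(1) in simp)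
  from tendsto_add[OF this assms(3)] show ?thesis by simp
qed

section \<open>The approximating sequence and the two constants\<close>

theorem sawtooth_sequence:
  fixes \<Omega> :: "(real ^ 'n) set"
  assumes \<Omega>: "open \<Omega>" "bounded \<Omega>" and g: "g \<in> BV \<Omega> d" and G: "G \<in> radon_measures \<Omega> d"
  shows "\<exists>u. (\<forall>n. u n \<in> SBV \<Omega> d) \<and> weak_star_BV \<Omega> d u g \<and>
    weak_star_measures \<Omega> d (\<lambda>n. lebesgue_density (ac_grad \<Omega> d (u n))) G \<and>
    (\<forall>n. measure_norm \<Omega> d (D \<Omega> d (u n)) \<le> ennreal (real CARD('n) + 3) * mSD_norm \<Omega> d (g, G)) \<and>
    (\<forall>n. BV_norm \<Omega> d (u n) \<le> ennreal (real CARD('n) + 5) * mSD_norm \<Omega> d (g, G))"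
proof -
  let ?N = "real CARD('n)"
  have \<Omega>b: "\<Omega> \<in> sets borel" using \<Omega>(1) by simp
  have Dg: "D \<Omega> d g \<in> radon_measures \<Omega> d"
    and Dg_weak: "\<And>\<phi> i j. \<phi> \<in> Cc_infinity \<Omega> \<Longrightarrow> i < d \<Longrightarrow>
      (LINT x:\<Omega>|lebesgue. g x i * partial_deriv j \<phi> x) = - signed_integral (borel_on \<Omega>) (\<lambda>B. D \<Omega> d g B i $ j) \<phi>"
    using has_distr_deriv_D[OF g] unfolding has_distr_deriv_def by blast+
  obtain \<kappa> h where \<kappa>: "finite_measure \<kappa>" "sets \<kappa> = sets (borel_on \<Omega>)" and h: "\<And>i j. integrable \<kappa> (h i j)"
    and h_int: "\<And>i j \<phi> C. i < d \<Longrightarrow> \<phi> \<in> borel_measurable borel \<Longrightarrow> \<forall>x. \<bar>\<phi> x\<bar> \<le> C \<Longrightarrow>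
      signed_integral (borel_on \<Omega>) (\<lambda>B. D \<Omega> d g B i $ j) \<phi> = (\<integral>y. \<phi> y * h i j y \<partial>\<kappa>)"
    and h_le: "(\<integral>\<^sup>+x. ennreal (frob d (\<lambda>i j. h i j x)) \<partial>\<kappa>) \<le> measure_norm \<Omega> d (D \<Omega> d g)"
    by (rule radon_measure_polar[OF Dg]) (rule that; assumption)
  obtain \<kappa>' h' where \<kappa>': "finite_measure \<kappa>'" "sets \<kappa>' = sets (borel_on \<Omega>)" and h': "\<And>i j. integrable \<kappa>' (h' i j)"
    and h'_int: "\<And>i j \<phi> C. i < d \<Longrightarrow> \<phi> \<in> borel_measurable borel \<Longrightarrow> \<forall>x. \<bar>\<phi> x\<bar> \<le> C \<Longrightarrow>
      signed_integral (borel_on \<Omega>) (\<lambda>B. G B i $ j) \<phi> = (\<integral>y. \<phi> y * h' i j y \<partial>\<kappa>')"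
    and h'_le: "(\<integral>\<^sup>+x. ennreal (frob d (\<lambda>i j. h' i j x)) \<partial>\<kappa>') \<le> measure_norm \<Omega> d G"
    by (rule radon_measure_polar[OF G]) (rule that; assumption)
  have "\<forall>i. \<exists>f. f \<in> borel_measurable borel \<and> integrable lborel f \<and> (\<forall>x. x \<notin> \<Omega> \<longrightarrow> f x = 0) \<and>
    (i < d \<longrightarrow> (AE x in lebesgue. x \<in> \<Omega> \<longrightarrow> f x = g x i) \<and>
      (\<forall>k\<in>borel_measurable borel. (LINT x:\<Omega>|lebesgue. g x i * k x) = (\<integral>x. f x * k x \<partial>lborel)))"
  proof
    fix i
    show "\<exists>f. f \<in> borel_measurable borel \<and> integrable lborel f \<and> (\<forall>x. x \<notin> \<Omega> \<longrightarrow> f x = 0) \<and>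
      (i < d \<longrightarrow> (AE x in lebesgue. x \<in> \<Omega> \<longrightarrow> f x = g x i) \<and>
        (\<forall>k\<in>borel_measurable borel. (LINT x:\<Omega>|lebesgue. g x i * k x) = (\<integral>x. f x * k x \<partial>lborel)))"
    proof (cases "i < d")
      case True
      then have "set_integrable lebesgue \<Omega> (\<lambda>x. g x i)" using g by (simp add: BV_def)
      then show ?thesis
      proof (rule lebesgue_borel_representative[OF _ \<Omega>b])
        fix f assume f: "f \<in> borel_measurable borel" "integrable lborel f" "\<And>x. x \<notin> \<Omega> \<Longrightarrow> f x = 0"
          "AE x in lebesgue. x \<in> \<Omega> \<longrightarrow> f x = g x i"
          "\<And>k. k \<in> borel_measurable borel \<Longrightarrow> (LINT x:\<Omega>|lebesgue. g x i * k x) = (\<integral>x. f x * k x \<partial>lborel)"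
        show ?thesis by (intro exI[of _ f] conjI allI impI ballI f)
      qed
    next
      case False
      then show ?thesis by (intro exI[of _ "\<lambda>x. 0"]) simp
    qed
  qed
  from choice[OF this] obtain g' where g'0: "\<forall>i. g' i \<in> borel_measurable borel \<and> integrable lborel (g' i) \<and>
    (\<forall>x. x \<notin> \<Omega> \<longrightarrow> g' i x = 0) \<and> (i < d \<longrightarrow> (AE x in lebesgue. x \<in> \<Omega> \<longrightarrow> g' i x = g x i) \<and>
      (\<forall>k\<in>borel_measurable borel. (LINT x:\<Omega>|lebesgue. g x i * k x) = (\<integral>x. g' i x * k x \<partial>lborel)))" ..
  have g': "\<And>i. integrable lborel (g' i)" "\<And>i. g' i \<in> borel_measurable borel" "\<And>i x. x \<notin> \<Omega> \<Longrightarrow> g' i x = 0"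
    and g'_ae: "\<And>i. i < d \<Longrightarrow> AE x in lebesgue. x \<in> \<Omega> \<longrightarrow> g' i x = g x i"
    and g'_int: "\<And>i k. i < d \<Longrightarrow> k \<in> borel_measurable borel \<Longrightarrow>
      (LINT x:\<Omega>|lebesgue. g x i * k x) = (\<integral>x. g' i x * k x \<partial>lborel)"
    using g'0 by blast+
  have weak: "(\<integral>x. g' i x * partial_deriv j \<phi> x \<partial>lborel) = - (\<integral>y. \<phi> y * h i j y \<partial>\<kappa>)"
    if \<phi>: "\<phi> \<in> Cc_infinity \<Omega>" and i: "i < d" for \<phi> i j
  proof -
    note c = Cc_infinityD[OF \<phi>]
    obtain C where C: "\<And>x. \<bar>\<phi> x\<bar> \<le> C" using bounded_support_bounded[OF c(3,2)] by blast
    have "(\<integral>x. g' i x * partial_deriv j \<phi> x \<partial>lborel) = (LINT x:\<Omega>|lebesgue. g x i * partial_deriv j \<phi> x)"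
      by (rule g'_int[OF i Cc_infinity_partial_deriv(3)[OF \<phi>], symmetric])
    also have "\<dots> = - signed_integral (borel_on \<Omega>) (\<lambda>B. D \<Omega> d g B i $ j) \<phi>" by (rule Dg_weak[OF \<phi> i])
    also have "\<dots> = - (\<integral>y. \<phi> y * h i j y \<partial>\<kappa>)" by (simp only: h_int[OF i c(4) allI[OF C]])
    finally show ?thesis .
  qed
  have L1g: "L1_norm \<Omega> d g = (\<integral>\<^sup>+x. ennreal (norm_vec d (\<lambda>i. g' i x)) \<partial>lborel)"
    by (rule L1_norm_representative) (simp_all add: g' g'_ae)
  define l where "l = (\<integral>x. norm_vec d (\<lambda>i. g' i x) \<partial>lborel)"
  have l: "L1_norm \<Omega> d g = ennreal l" "l \<ge> 0"
    unfolding L1g l_def by (rule nn_integral_L2_set_eq, simp_all add: g')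
  define a where "a = enn2real (measure_norm \<Omega> d (D \<Omega> d g))"
  define b where "b = enn2real (measure_norm \<Omega> d G)"
  have a: "measure_norm \<Omega> d (D \<Omega> d g) = ennreal a" "a \<ge> 0"
    using measure_norm_finite[OF Dg] by (simp_all add: a_def less_top)
  have b: "measure_norm \<Omega> d G = ennreal b" "b \<ge> 0"
    using measure_norm_finite[OF G] by (simp_all add: b_def less_top)
  define m where "m = l + a + b"
  have m: "mSD_norm \<Omega> d (g, G) = ennreal m" "m \<ge> 0"
    using l a b by (simp_all add: mSD_norm_def BV_norm_def m_def)
  \<comment> \<open>The coefficient of the tolerance in the mass bound. Dividing the norm m by it
    keeps the total error at most m for every n, and the further factor 1 / (n + 1) drives the
    tolerance to 0.\<close>
  define c where "c = 2 * ?N + 3"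
  have c: "c \<ge> 3" by (simp add: c_def)
  define \<delta> where "\<delta> n = m / c / real (Suc n)" for n
  have \<delta>0: "\<delta> n \<ge> 0" for n using m(2) c by (simp add: \<delta>_def)
  have c\<delta>: "c * \<delta> n \<le> m" for n
  proof -
    have "c * \<delta> n = m / real (Suc n)" using c by (simp add: \<delta>_def)
    also have "\<dots> \<le> m / 1" using m(2) by (intro divide_left_mono) auto
    finally show ?thesis by simp
  qed
  have \<delta>2: "2 * \<delta> n \<le> m" for n
    using mult_right_mono[OF c \<delta>0[of n]] c\<delta>[of n] \<delta>0[of n] by linarith
  have \<delta>lim: "\<delta> \<longlonglongrightarrow> 0"
    unfolding \<delta>_def[abs_def] by (rule LIMSEQ_Suc[OF lim_const_over_n])
  have \<delta>eq: "m = 0" if "\<delta> n = 0" for n using that c by (simp add: \<delta>_def)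
  have em: "euclidean_measure \<kappa>'" by (rule euclidean_measure_borel_on[OF \<kappa>'])
  \<comment> \<open>The mollification of \<open>G\<close> spreads beyond \<Omega>. Cutting it off
    does not increase its mass and is invisible to test functions supported in \<Omega>.\<close>
  define W where "W n i j x = indicator \<Omega> x * conv (mollifier n) \<kappa>' (h' i j) x" for n i j x
  have conv_i: "integrable lborel (conv (mollifier n) \<kappa>' (h' i j))" for n i j
    by (rule euclidean_measure.integrable_conv[OF em mollifier h'])
  have W: "integrable lborel (W n i j)" "x \<notin> \<Omega> \<Longrightarrow> W n i j x = 0" for n i j x
    unfolding W_def[abs_def] using integrable_mult_indicator[OF _ conv_i, of \<Omega>] \<Omega>b by simp_all
  have W_le: "(\<integral>\<^sup>+x. ennreal (frob d (\<lambda>i j. W n i j x)) \<partial>lborel) \<le> ennreal b" for n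
  proof -
    have "(\<integral>\<^sup>+x. ennreal (frob d (\<lambda>i j. W n i j x)) \<partial>lborel)
        \<le> (\<integral>\<^sup>+x. ennreal (frob d (\<lambda>i j. conv (mollifier n) \<kappa>' (h' i j) x)) \<partial>lborel)"
    proof (intro nn_integral_mono ennreal_leI)
      fix x
      show "frob d (\<lambda>i j. W n i j x) \<le> frob d (\<lambda>i j. conv (mollifier n) \<kappa>' (h' i j) x)"
        by (cases "x \<in> \<Omega>") (simp_all add: W_def L2_set_def sum_nonneg)
    qed
    also have "\<dots> \<le> (\<integral>\<^sup>+y. ennreal (frob d (\<lambda>i j. h' i j y)) \<partial>\<kappa>')"
      by (rule euclidean_measure.nn_integral_conv_L2[OF em mollifier]) (simp_all add: h')
    finally show ?thesis using h'_le b(1) by simp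
  qed
  define Q where "Q n u A \<longleftrightarrow> u \<in> SBV \<Omega> d \<and> (\<forall>i<d. integrable lborel (\<lambda>x. u x i)) \<and>
    (\<integral>\<^sup>+x. ennreal (norm_vec d (\<lambda>i. u x i - g' i x)) \<partial>lborel) \<le> ennreal (2 * \<delta> n) \<and>
    measure_norm \<Omega> d (D \<Omega> d u) \<le> ennreal ((?N + 2) * (a + b) + (2 * ?N + 3) * \<delta> n) \<and>
    (\<forall>i<d. \<forall>j. integrable lborel (A i j) \<and> (\<integral>x. \<bar>A i j x - W n i j x\<bar> \<partial>lborel) \<le> 2 * \<delta> n) \<and>
    (\<forall>B\<in>sets (borel_on \<Omega>). \<forall>i<d. \<forall>j. lebesgue_density (ac_grad \<Omega> d u) B i $ j = (LBINT x:B. A i j x))" for n u A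
  have "\<forall>n. \<exists>p. Q n (fst p) (snd p)"
  proof
    fix n
    have "\<exists>u A. Q n u A"
      unfolding Q_def
    proof (rule sawtooth_approximation_nonneg[where g=g' and h=h and \<kappa>=\<kappa> and W="W n" and a=a and b=b, OF \<Omega> \<delta>0 \<kappa> h g' weak W])
      show "(\<integral>\<^sup>+y. ennreal (frob d (\<lambda>k j. h k j y)) \<partial>\<kappa>) \<le> ennreal a" using h_le a(1) by simp
      show "b = 0" if "\<delta> n = 0" using \<delta>eq[OF that] l a b by (simp add: m_def)
      show "(\<integral>\<^sup>+x. ennreal (norm_vec d (\<lambda>i. g' i x)) \<partial>lborel) = 0" if "\<delta> n = 0"
      proof -
        have "l = 0" using \<delta>eq[OF that] l(2) a(2) b(2) by (simp add: m_def)
        then show ?thesis using l(1) unfolding L1g by simp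
      qed
    qed (use W_le a b in auto)
    then show "\<exists>p. Q n (fst p) (snd p)" by auto
  qed
  from choice[OF this] obtain p where p: "\<forall>n. Q n (fst (p n)) (snd (p n))" ..
  define u where "u n = fst (p n)" for n
  define A where "A n = snd (p n)" for n
  have Q: "Q n (u n) (A n)" for n using p by (simp add: u_def A_def)
  have uSBV: "u n \<in> SBV \<Omega> d" and u_int: "i < d \<Longrightarrow> integrable lborel (\<lambda>x. u n x i)"
    and u_g: "(\<integral>\<^sup>+x. ennreal (norm_vec d (\<lambda>i. u n x i - g' i x)) \<partial>lborel) \<le> ennreal (2 * \<delta> n)"
    and Du: "measure_norm \<Omega> d (D \<Omega> d (u n)) \<le> ennreal ((?N + 2) * (a + b) + (2 * ?N + 3) * \<delta> n)"
    and A_int: "i < d \<Longrightarrow> integrable lborel (A n i j)"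
    and A_W: "i < d \<Longrightarrow> (\<integral>x. \<bar>A n i j x - W n i j x\<bar> \<partial>lborel) \<le> 2 * \<delta> n"
    and density: "B \<in> sets (borel_on \<Omega>) \<Longrightarrow> i < d \<Longrightarrow>
      lebesgue_density (ac_grad \<Omega> d (u n)) B i $ j = (LBINT x:B. A n i j x)" for n i j B
    using Q[of n] unfolding Q_def by blast+
  have uBV: "u n \<in> BV \<Omega> d" for n using uSBV unfolding SBV_def by blast
  \<comment> \<open>As a + b is at most m, the main term is at most (N + 2) m, and the error
    contributes at most one more m.\<close>
  have Du_le: "measure_norm \<Omega> d (D \<Omega> d (u n)) \<le> ennreal ((?N + 3) * m)" for n
  proof (rule order_trans[OF Du ennreal_leI])
    have "(?N + 2) * (a + b) \<le> (?N + 2) * m" using l(2) by (intro mult_left_mono) (simp_all add: m_def)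
    then show "(?N + 2) * (a + b) + (2 * ?N + 3) * \<delta> n \<le> (?N + 3) * m"
      using c\<delta>[of n] by (simp add: c_def algebra_simps)
  qed
  have K: "0 \<le> (?N + 3) * m" using m(2) by simp
  \<comment> \<open>Bounds the values of the gradient measures: mass at most b for \<open>W\<close>,
    and L1 distance at most twice the tolerance from it.\<close>
  have bK: "b + 2 * \<delta> n \<le> (?N + 3) * m" for n
  proof -
    have "b + 2 * \<delta> n \<le> 2 * m" using \<delta>2[of n] l(2) a(2) by (simp add: m_def)
    also have "\<dots> \<le> (?N + 3) * m" using m(2) by (intro mult_right_mono) auto
    finally show ?thesis .
  qed
  have u_g_abs: "(\<integral>x. \<bar>u n x i - g' i x\<bar> \<partial>lborel) \<le> 2 * \<delta> n" if i: "i < d" for n i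
  proof -
    have ii: "integrable lborel (\<lambda>x. u n x i - g' i x)" if "i < d" for i
      by (rule Bochner_Integration.integrable_diff[OF u_int[OF that] g'(1)])
    have iL: "integrable lborel (\<lambda>x. norm_vec d (\<lambda>i. u n x i - g' i x))"
      by (rule integrable_L2_set) (auto intro: ii)
    have "(\<integral>x. \<bar>u n x i - g' i x\<bar> \<partial>lborel) \<le> (\<integral>x. norm_vec d (\<lambda>i. u n x i - g' i x) \<partial>lborel)"
    proof (rule integral_mono[OF integrable_abs[OF ii[OF i]] iL])
      fix x
      show "\<bar>u n x i - g' i x\<bar> \<le> norm_vec d (\<lambda>i. u n x i - g' i x)"
        using member_le_L2_set[of "{..<d}" i "\<lambda>i. \<bar>u n x i - g' i x\<bar>"] i by (simp add: L2_set_def)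
    qed
    also have "\<dots> \<le> 2 * \<delta> n"
      by (rule integral_le_of_nn_integral_le[OF iL _ u_g]) (simp_all add: \<delta>0)
    finally show ?thesis .
  qed
  have Du_radon: "D \<Omega> d (u n) \<in> radon_measures \<Omega> d"
    and Du_weak: "\<And>\<phi> i j. \<phi> \<in> Cc_infinity \<Omega> \<Longrightarrow> i < d \<Longrightarrow>
      (LINT x:\<Omega>|lebesgue. u n x i * partial_deriv j \<phi> x) = - signed_integral (borel_on \<Omega>) (\<lambda>B. D \<Omega> d (u n) B i $ j) \<phi>" for n
    using has_distr_deriv_D[OF uBV[of n]] unfolding has_distr_deriv_def by blast+
  \<comment> \<open>On smooth test functions the convergence of the derivatives is the L1
    convergence of the functions, with the derivative moved to the test function; the uniform mass
    bound does the rest.\<close>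
  have 1: "weak_star_measures \<Omega> d (\<lambda>n. D \<Omega> d (u n)) (D \<Omega> d g)"
  proof (rule weak_star_measuresI[OF \<Omega>(1) Du_radon Dg, where K="(?N + 3) * m"])
    fix B i j assume B: "B \<in> sets (borel_on \<Omega>)" and i: "i < d"
    show "\<bar>D \<Omega> d (u n) B i $ j\<bar> \<le> (?N + 3) * m" for n
      by (rule abs_component_le_measure_norm[OF \<Omega>(1) Du_le K B i])
    have "\<bar>D \<Omega> d g B i $ j\<bar> \<le> a"
      by (rule abs_component_le_measure_norm[OF \<Omega>(1) _ a(2) B i]) (simp add: a(1))
    also have "\<dots> \<le> 1 * m" using l(2) b(2) by (simp add: m_def)
    also have "\<dots> \<le> (?N + 3) * m" using m(2) by (intro mult_right_mono) auto
    finally show "\<bar>D \<Omega> d g B i $ j\<bar> \<le> (?N + 3) * m" .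
  next
    fix \<psi> i j assume \<psi>: "\<psi> \<in> Cc_infinity \<Omega>" and i: "i < d"
    note d\<psi> = Cc_infinity_partial_deriv[OF \<psi>, of j]
    obtain C where C: "\<And>x. \<bar>partial_deriv j \<psi> x\<bar> \<le> C" using bounded_support_bounded[OF d\<psi>(1,2)] by blast
    have C0: "C \<ge> 0" using C[of 0] by linarith
    let ?k = "\<lambda>x. indicator \<Omega> x * partial_deriv j \<psi> x"
    have km: "?k \<in> borel_measurable borel"
      by (intro borel_measurable_times borel_measurable_indicator \<Omega>b d\<psi>(3))
    have kC: "\<bar>?k x\<bar> \<le> C" for x using C[of x] C0 by (simp add: indicator_def)
    have s: "signed_integral (borel_on \<Omega>) (\<lambda>B. D \<Omega> d (u n) B i $ j) \<psi> = - (\<integral>x. u n x i * ?k x \<partial>lborel)" for n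
    proof -
      have um: "(\<lambda>x. u n x i) \<in> borel_measurable borel"
        using borel_measurable_integrable[OF u_int[OF i]] by (simp only: measurable_lborel2)
      have "- signed_integral (borel_on \<Omega>) (\<lambda>B. D \<Omega> d (u n) B i $ j) \<psi> = (LBINT x:\<Omega>. u n x i * partial_deriv j \<psi> x)"
        unfolding Du_weak[OF \<psi> i, symmetric]
        by (rule integral_lebesgue_eq_lborel[OF borel_measurable_times[OF um d\<psi>(3)] \<Omega>b])
      also have "\<dots> = (\<integral>x. u n x i * ?k x \<partial>lborel)"
        unfolding set_lebesgue_integral_def by (simp only: real_scaleR_def mult.left_commute)
      finally show ?thesis by simp
    qed
    have sg: "signed_integral (borel_on \<Omega>) (\<lambda>B. D \<Omega> d g B i $ j) \<psi> = - (\<integral>x. g' i x * ?k x \<partial>lborel)"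
    proof -
      have "- signed_integral (borel_on \<Omega>) (\<lambda>B. D \<Omega> d g B i $ j) \<psi> = (\<integral>x. g' i x * partial_deriv j \<psi> x \<partial>lborel)"
        unfolding Dg_weak[OF \<psi> i, symmetric] by (rule g'_int[OF i d\<psi>(3)])
      also have "\<dots> = (\<integral>x. g' i x * ?k x \<partial>lborel)"
        by (rule Bochner_Integration.integral_cong) (use g'(3) in \<open>auto simp: indicator_def\<close>)
      finally show ?thesis by simp
    qed
    have kml: "?k \<in> borel_measurable lborel" using km by (simp only: measurable_lborel2)
    have "(\<lambda>n. \<integral>x. u n x i * ?k x \<partial>lborel) \<longlonglongrightarrow> (\<integral>x. g' i x * ?k x \<partial>lborel)"
    proof (rule tendsto_of_abs_diff_le[where C="2 * C" and \<delta>=\<delta> and y="\<lambda>_. \<integral>x. g' i x * ?k x \<partial>lborel"])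
      show "\<bar>(\<integral>x. u n x i * ?k x \<partial>lborel) - (\<integral>x. g' i x * ?k x \<partial>lborel)\<bar> \<le> 2 * C * \<delta> n" for n
        using abs_integral_mult_diff_le[OF u_int[OF i] g'(1) kml kC u_g_abs[OF i] C0] by (simp add: mult.commute mult.left_commute)
    qed (simp_all add: \<delta>lim)
    then show "(\<lambda>n. signed_integral (borel_on \<Omega>) (\<lambda>B. D \<Omega> d (u n) B i $ j) \<psi>)
        \<longlonglongrightarrow> signed_integral (borel_on \<Omega>) (\<lambda>B. D \<Omega> d g B i $ j) \<psi>"
      unfolding s sg by (rule tendsto_minus)
  qed
  \<comment> \<open>The densities \<open>A n\<close> differ from \<open>W n\<close> by a null
    sequence in L1, and \<open>W n\<close> is a mollification of \<open>G\<close>.\<close>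
  have 2: "weak_star_measures \<Omega> d (\<lambda>n. lebesgue_density (ac_grad \<Omega> d (u n))) G"
  proof (rule weak_star_measuresI[OF \<Omega>(1) _ G, where K="(?N + 3) * m"])
    show "lebesgue_density (ac_grad \<Omega> d (u n)) \<in> radon_measures \<Omega> d" for n
      unfolding radon_measures_def
    proof (rule CollectI, intro allI impI vector_measure_vecI)
      fix i j assume i: "i < d"
      show "vector_measure (borel_on \<Omega>) (\<lambda>B. lebesgue_density (ac_grad \<Omega> d (u n)) B i $ j)"
        by (rule density_measure(1)[OF \<Omega>(1) A_int[OF i, of n j] density[OF _ i]])
    qed
  next
    fix B i j assume B: "B \<in> sets (borel_on \<Omega>)" and i: "i < d"
    have W_abs: "(\<integral>x. \<bar>W n i j x\<bar> \<partial>lborel) \<le> b" for n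
    proof -
      have "(\<integral>x. \<bar>W n i j x\<bar> \<partial>lborel) \<le> (\<integral>x. frob d (\<lambda>i j. W n i j x) \<partial>lborel)"
        by (rule integral_mono[OF integrable_abs[OF W(1)] integrable_frob[OF W(1)]]) (rule abs_le_frob[OF i])
      also have "\<dots> \<le> b"
        by (rule integral_le_of_nn_integral_le[OF integrable_frob[OF W(1)] _ W_le b(2)]) simp
      finally show ?thesis .
    qed
    show "\<bar>lebesgue_density (ac_grad \<Omega> d (u n)) B i $ j\<bar> \<le> (?N + 3) * m" for n
    proof -
      have iA: "integrable lborel (\<lambda>x. \<bar>A n i j x - W n i j x\<bar>)"
        by (intro integrable_abs Bochner_Integration.integrable_diff A_int i W)
      have Bb: "B \<in> sets lborel" using borel_on_borel[OF \<Omega>(1) B] by simp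
      have "\<bar>LBINT x:B. A n i j x\<bar> \<le> (\<integral>x. \<bar>A n i j x - W n i j x\<bar> + \<bar>W n i j x\<bar> \<partial>lborel)"
        unfolding set_lebesgue_integral_def real_norm_def[symmetric]
      proof (rule Bochner_Integration.integral_norm_bound_integral)
        show "integrable lborel (\<lambda>x. indicator B x *\<^sub>R A n i j x)"
          by (rule integrable_mult_indicator[OF Bb A_int[OF i]])
        show "integrable lborel (\<lambda>x. norm (A n i j x - W n i j x) + norm (W n i j x))"
          unfolding real_norm_def by (rule Bochner_Integration.integrable_add[OF iA integrable_abs[OF W(1)]])
        show "norm (indicator B x *\<^sub>R A n i j x) \<le> norm (A n i j x - W n i j x) + norm (W n i j x)" for x
          using abs_triangle_ineq[of "A n i j x - W n i j x" "W n i j x"] by (simp add: indicator_def)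
      qed
      also have "\<dots> = (\<integral>x. \<bar>A n i j x - W n i j x\<bar> \<partial>lborel) + (\<integral>x. \<bar>W n i j x\<bar> \<partial>lborel)"
        by (rule Bochner_Integration.integral_add[OF iA integrable_abs[OF W(1)]])
      finally show ?thesis using A_W[OF i, of n j] W_abs[of n] bK[of n] unfolding density[OF B i] by linarith
    qed
    have "\<bar>G B i $ j\<bar> \<le> b"
      by (rule abs_component_le_measure_norm[OF \<Omega>(1) _ b(2) B i]) (simp add: b(1))
    then show "\<bar>G B i $ j\<bar> \<le> (?N + 3) * m" using bK[of 0] \<delta>0[of 0] by linarith
  next
    fix \<psi> i j assume \<psi>: "\<psi> \<in> Cc_infinity \<Omega>" and i: "i < d"
    note c\<psi> = Cc_infinityD[OF \<psi>]
    obtain C where C: "\<And>x. \<bar>\<psi> x\<bar> \<le> C" using bounded_support_bounded[OF c\<psi>(3,2)] by blast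
    have C0: "C \<ge> 0" using C[of 0] by linarith
    have \<psi>l: "\<psi> \<in> borel_measurable lborel" using c\<psi>(4) by (simp only: measurable_lborel2)
    have s: "signed_integral (borel_on \<Omega>) (\<lambda>B. lebesgue_density (ac_grad \<Omega> d (u n)) B i $ j) \<psi>
        = (\<integral>x. A n i j x * \<psi> x \<partial>lborel)" for n
      unfolding mult.commute[of "A n i j _"]
      by (rule density_measure(2)[OF \<Omega>(1) A_int[OF i] density[OF _ i] c\<psi>(4) C c\<psi>(5)])
    have sG: "signed_integral (borel_on \<Omega>) (\<lambda>B. G B i $ j) \<psi> = (\<integral>y. \<psi> y * h' i j y \<partial>\<kappa>')"
      by (rule h'_int[OF i c\<psi>(4) allI[OF C]])
    have \<psi>\<kappa>: "\<psi> \<in> borel_measurable \<kappa>'"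
      using borel_measurable_borel_on[OF c\<psi>(4), of \<Omega>] \<kappa>'(2) by (simp cong: measurable_cong_sets)
    have W\<psi>: "(\<integral>x. W n i j x * \<psi> x \<partial>lborel) = (\<integral>x. \<psi> x * conv (mollifier n) \<kappa>' (h' i j) x \<partial>lborel)" for n
      by (rule Bochner_Integration.integral_cong) (use c\<psi>(5) in \<open>auto simp: W_def indicator_def\<close>)
    have "(\<lambda>n. \<integral>x. A n i j x * \<psi> x \<partial>lborel) \<longlonglongrightarrow> (\<integral>y. \<psi> y * h' i j y \<partial>\<kappa>')"
    proof (rule tendsto_of_abs_diff_le[where C="2 * C" and \<delta>=\<delta> and y="\<lambda>n. \<integral>x. W n i j x * \<psi> x \<partial>lborel"])
      show "\<bar>(\<integral>x. A n i j x * \<psi> x \<partial>lborel) - (\<integral>x. W n i j x * \<psi> x \<partial>lborel)\<bar> \<le> 2 * C * \<delta> n" for n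
        using abs_integral_mult_diff_le[OF A_int[OF i] W(1) \<psi>l C A_W[OF i] C0] by (simp add: mult.commute mult.left_commute)
      show "(\<lambda>n. \<integral>x. W n i j x * \<psi> x \<partial>lborel) \<longlonglongrightarrow> (\<integral>y. \<psi> y * h' i j y \<partial>\<kappa>')"
        unfolding W\<psi> by (rule mollified_measure_tendsto[OF em h' c\<psi>(3,2) \<psi>\<kappa>])
    qed (rule \<delta>lim)
    then show "(\<lambda>n. signed_integral (borel_on \<Omega>) (\<lambda>B. lebesgue_density (ac_grad \<Omega> d (u n)) B i $ j) \<psi>)
        \<longlonglongrightarrow> signed_integral (borel_on \<Omega>) (\<lambda>B. G B i $ j) \<psi>"
      unfolding s sG .
  qed
  note L1 = L1_norm_diff_le[OF \<Omega>b u_int g'(1,3) g'_ae]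
  have 3: "(\<lambda>n. L1_norm \<Omega> d (\<lambda>x i. u n x i - g x i)) \<longlonglongrightarrow> 0"
  proof (rule tendsto_sandwich[OF _ _ tendsto_const])
    show "\<forall>\<^sub>F n in sequentially. L1_norm \<Omega> d (\<lambda>x i. u n x i - g x i) \<le> ennreal (2 * \<delta> n)"
      by (intro always_eventually allI) (rule order_trans[OF L1(1) u_g])
    have "(\<lambda>n. 2 * \<delta> n) \<longlonglongrightarrow> 0" using tendsto_mult_left[OF \<delta>lim, of 2] by simp
    then show "(\<lambda>n. ennreal (2 * \<delta> n)) \<longlonglongrightarrow> 0" using tendsto_ennrealI by fastforce
  qed simp
  have 4: "measure_norm \<Omega> d (D \<Omega> d (u n)) \<le> ennreal (?N + 3) * mSD_norm \<Omega> d (g, G)" for n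
    using Du_le[of n] m by (simp add: ennreal_mult)
  \<comment> \<open>The L1 norm is at most l plus twice the tolerance, hence at most 2 m; together
    with N + 3 from the derivative this gives N + 5.\<close>
  have 5: "BV_norm \<Omega> d (u n) \<le> ennreal (?N + 5) * mSD_norm \<Omega> d (g, G)" for n
  proof -
    have "L1_norm \<Omega> d (u n) \<le> ennreal l + ennreal (2 * \<delta> n)"
      by (rule order_trans[OF L1(2) add_mono[OF eq_refl[OF l(1)] u_g]])
    also have "\<dots> = ennreal (l + 2 * \<delta> n)" using l(2) \<delta>0[of n] by simp
    also have "\<dots> \<le> ennreal (2 * m)" using \<delta>2[of n] a(2) b(2) by (intro ennreal_leI) (simp add: m_def)
    finally have "BV_norm \<Omega> d (u n) \<le> ennreal (2 * m) + ennreal ((?N + 3) * m)"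
      unfolding BV_norm_def by (rule add_mono[OF _ Du_le])
    also have "\<dots> = ennreal (2 * m + (?N + 3) * m)" by (rule ennreal_plus[symmetric]) (use m(2) K in simp_all)
    also have "2 * m + (?N + 3) * m = (?N + 5) * m" by (simp add: algebra_simps)
    also have "ennreal ((?N + 5) * m) = ennreal (?N + 5) * mSD_norm \<Omega> d (g, G)"
      unfolding m(1) by (rule ennreal_mult) (use m(2) in simp_all)
    finally show ?thesis .
  qed
  show ?thesis
    by (intro exI[of _ u] conjI allI uSBV 2 4 5) (simp add: weak_star_BV_def 1 3)
qed

theorem theorem2p3:
  "\<exists>C1::real. C1 > 0 \<and>
    (\<forall>\<Omega> :: (real ^ 'n) set. bounded \<Omega> \<and> open \<Omega> \<and> lipschitz_boundary \<Omega> \<longrightarrow>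
      (\<exists>C2::real. C2 > 0 \<and>
        (\<forall>d\<ge>1. \<forall>(g, G) \<in> mSD \<Omega> d.
          \<exists>u :: nat \<Rightarrow> real ^ 'n \<Rightarrow> nat \<Rightarrow> real.
            (\<forall>n. u n \<in> SBV \<Omega> d) \<and>
            weak_star_BV \<Omega> d u g \<and>
            weak_star_measures \<Omega> d (\<lambda>n. lebesgue_density (ac_grad \<Omega> d (u n))) G \<and>
            (\<forall>n. measure_norm \<Omega> d (D \<Omega> d (u n)) \<le> ennreal C1 * mSD_norm \<Omega> d (g, G)) \<and>
            (\<forall>n. BV_norm \<Omega> d (u n) \<le> ennreal C2 * mSD_norm \<Omega> d (g, G)))))"
proof (rule exI[of _ "real CARD('n) + 3"], intro exI[of _ "real CARD('n) + 5"] conjI allI impI ballI)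
  fix \<Omega> :: "(real ^ 'n) set" and d :: nat and gG :: "(real ^ 'n \<Rightarrow> nat \<Rightarrow> real) \<times> ((real ^ 'n) set \<Rightarrow> nat \<Rightarrow> real ^ 'n)"
  assume \<Omega>: "bounded \<Omega> \<and> open \<Omega> \<and> lipschitz_boundary \<Omega>" and gG: "gG \<in> mSD \<Omega> d"
  obtain g G where eq: "gG = (g, G)" by (cases gG)
  have "g \<in> BV \<Omega> d" "G \<in> radon_measures \<Omega> d" using gG by (simp_all add: eq mSD_def)
  with \<Omega> show "case gG of (g, G) \<Rightarrow> \<exists>u :: nat \<Rightarrow> real ^ 'n \<Rightarrow> nat \<Rightarrow> real.
            (\<forall>n. u n \<in> SBV \<Omega> d) \<and>
            weak_star_BV \<Omega> d u g \<and>
            weak_star_measures \<Omega> d (\<lambda>n. lebesgue_density (ac_grad \<Omega> d (u n))) G \<and>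
            (\<forall>n. measure_norm \<Omega> d (D \<Omega> d (u n)) \<le> ennreal (real CARD('n) + 3) * mSD_norm \<Omega> d (g, G)) \<and>
            (\<forall>n. BV_norm \<Omega> d (u n) \<le> ennreal (real CARD('n) + 5) * mSD_norm \<Omega> d (g, G))"
    unfolding eq prod.case by (intro sawtooth_sequence) simp_all
qed simp_all

end
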